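(* Let $k$ be a field and let $q,d$ be integers with $2\le q\le d$. Put $n=2d-q+2$ and $f=2(d-q+1)$. Let $C(n,f)$ be a cyclic polytope with $n$ vertices in $\mathbb R^f$, and let $\Delta$ be the Alexander dual of the boundary complex of $C(n,f)$. Then $k[\Delta]$ is a $d$-dimensional Buchsbaum Stanley--Reisner ring with minimal multiplicity of type $q$. In particular, for integers $c,d,q,h$ with $c\ge1$, $h\ge0$, $2\le q\le d$ and $h_{c,d,q}:=\frac{(c+q-2)\cdots(c+1)c}{d(d-1)\cdots(d-q+2)}=1$, the following are equivalent: (i) there exists a Buchsbaum Stanley--Reisner ring $A=k[\Delta']$ with $q$-linear resolution such that $\dim A=d$, $\operatorname{codim}A=c$ and $\dim_kH^{q-1}_{\mathfrak m}(A)=h$; (ii) $0\le h\le h_{c,d,q}$.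
   Context: A simplicial complex $\Delta$ on $V=\{x_1,\dots,x_n\}$ is a collection of subsets of $V$ closed under taking subsets and containing every singleton $\{x_i\}$. $S=k[x_1,\dots,x_n]$ (standard grading), $I_\Delta$ is generated by the square-free monomials $x_{i_1}\cdots x_{i_r}$ with $\{x_{i_1},\dots,x_{i_r}\}\notin\Delta$, $k[\Delta]=S/I_\Delta$ is the Stanley--Reisner ring and $\mathfrak m$ its homogeneous maximal ideal. If $d=\dim k[\Delta]=\dim\Delta+1$, then $\operatorname{codim}k[\Delta]=n-d$. The multiplicity $e(k[\Delta])$ equals the number of $(d-1)$-dimensional faces of $\Delta$. $k[\Delta]$ is Buchsbaum if $\Delta$ is pure and $\widetilde H_i(\operatorname{link}_\Delta F;k)=0$ for every nonempty face $F$ and every $i<\dim\operatorname{link}_\Delta F$. For $A=S/I$, $\beta_{i,j}(A)=\dim_k\operatorname{Tor}_i^S(A,k)_j$, $\operatorname{reg}A=\max\{j-i:\beta_{i,j}(A)\ne0\}$ and $\operatorname{indeg}A=\min\{j: I_j\neq0\}$. $A$ has $q$-linear resolution if $\operatorname{reg}A=\operatorname{indeg}A-1=q-1$. A $d$-dimensional Buchsbaum Stanley--Reisner ring $A$ with $\operatorname{codim}A=c$ and $\operatorname{indeg}A=q$ has minimal multiplicity of type $q$ if $e(A)=\frac{c+d}{d}\binom{c+q-2}{q-2}$. For $n\ge f+1$, a cyclic polytope $C(n,f)$ is the convex hull of $n$ distinct points on the moment curve $t\mapsto(t,t^2,\dots,t^f)$ in $\mathbb R^f$; it is a simplicial $f$-polytope,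 and its boundary complex is the simplicial complex on its $n$ vertices whose faces are the vertex sets of its proper faces. The Alexander dual of a complex $\Gamma$ on $V$ is $\Gamma^*=\{F\subseteq V:V\setminus F\notin\Gamma\}$. *)

theory Defs
  imports
    "HOL-Analysis.Analysis"
    "HOL-Analysis.Finite_Function_Topology"
    "HOL-Library.Poly_Mapping"
    "HOL-Library.Extended_Nat"
    "HOL-Algebra.QuotRing"
begin

section \<open>Simplicial complexes\<close>

text \<open>The vertex set \<open>V = {x\<^sub>1, \<dots>, x\<^sub>n}\<close> is rendered as \<open>{1..n}\<close>.\<close>

definition simplicial_complex_on :: "nat \<Rightarrow> nat set set \<Rightarrow> bool" where
  "simplicial_complex_on n \<Delta> \<longleftrightarrow>
     \<Delta> \<subseteq> Pow {1..n} \<and> (\<forall>F\<in>\<Delta>. \<forall>G. G \<subseteq> F \<longrightarrow> G \<in> \<Delta>) \<and> (\<forall>i\<in>{1..n}. {i} \<in> \<Delta>)"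

definition complex_dim :: "nat set set \<Rightarrow> int" where
  "complex_dim \<Delta> = int (Max (card ` \<Delta>)) - 1"

definition facets :: "nat set set \<Rightarrow> nat set set" where
  "facets \<Delta> = {F \<in> \<Delta>. \<forall>G\<in>\<Delta>. F \<subseteq> G \<longrightarrow> F = G}"

definition pure_complex :: "nat set set \<Rightarrow> bool" where
  "pure_complex \<Delta> \<longleftrightarrow> (\<forall>F\<in>facets \<Delta>. \<forall>G\<in>facets \<Delta>. card F = card G)"

definition link :: "nat set set \<Rightarrow> nat set \<Rightarrow> nat set set" where
  "link \<Delta> F = {G. G \<inter> F = {} \<and> G \<union> F \<in> \<Delta>}"

definition alexander_dual :: "nat \<Rightarrow> nat set set \<Rightarrow> nat set set" where
  "alexander_dual n \<Gamma> = {F. F \<subseteq> {1..n} \<and> {1..n} - F \<notin> \<Gamma>}"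

text \<open>Augmented oriented simplicial chains with coefficients in \<open>'k\<close>; the empty face spans
  degree \<open>-1\<close>. Faces are oriented by the order of \<open>nat\<close>.\<close>

definition chains :: "nat set set \<Rightarrow> int \<Rightarrow> (nat set \<Rightarrow>\<^sub>0 'k::field) set" where
  "chains \<Delta> i = {c. \<forall>F\<in>Poly_Mapping.keys c. F \<in> \<Delta> \<and> int (card F) = i + 1}"

definition boundary_map :: "(nat set \<Rightarrow>\<^sub>0 'k::field) \<Rightarrow> (nat set \<Rightarrow>\<^sub>0 'k)" where
  "boundary_map c = (\<Sum>F\<in>Poly_Mapping.keys c. \<Sum>v\<in>F.
     Poly_Mapping.single (F - {v}) ((-1) ^ card {u\<in>F. u < v} * Poly_Mapping.lookup c F))"

definition reduced_homology_vanishes :: "'k::field itself \<Rightarrow> nat set set \<Rightarrow> int \<Rightarrow> bool" where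
  "reduced_homology_vanishes _ \<Delta> i \<longleftrightarrow>
     (\<forall>z \<in> (chains \<Delta> i :: (nat set \<Rightarrow>\<^sub>0 'k) set). boundary_map z = 0 \<longrightarrow>
        (\<exists>w \<in> chains \<Delta> (i + 1). z = boundary_map w))"

definition buchsbaum :: "'k::field itself \<Rightarrow> nat set set \<Rightarrow> bool" where
  "buchsbaum K \<Delta> \<longleftrightarrow> pure_complex \<Delta> \<and>
     (\<forall>F\<in>\<Delta>. F \<noteq> {} \<longrightarrow>
        (\<forall>i. i < complex_dim (link \<Delta> F) \<longrightarrow> reduced_homology_vanishes K (link \<Delta> F) i))"

section \<open>Polynomial rings and Stanley--Reisner rings\<close>

type_synonym 'k mpoly = "(nat \<Rightarrow>\<^sub>0 nat) \<Rightarrow>\<^sub>0 'k"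

definition poly_ring :: "nat \<Rightarrow> 'k::field mpoly ring" where
  "poly_ring n =
     \<lparr>carrier = {p. \<forall>m\<in>Poly_Mapping.keys p. Poly_Mapping.keys m \<subseteq> {1..n}},
      mult = (*), one = 1, zero = 0, add = (+)\<rparr>"

definition var :: "nat \<Rightarrow> 'k::field mpoly" where
  "var i = Poly_Mapping.single (Poly_Mapping.single i 1) 1"

definition maximal_ideal :: "nat \<Rightarrow> 'k::field mpoly set" where
  "maximal_ideal n = genideal (poly_ring n) (var ` {1..n})"

definition sr_ideal :: "nat \<Rightarrow> nat set set \<Rightarrow> 'k::field mpoly set" where
  "sr_ideal n \<Delta> = genideal (poly_ring n) {\<Prod>i\<in>F. var i | F. F \<subseteq> {1..n} \<and> F \<notin> \<Delta>}"

definition sr_ring :: "nat \<Rightarrow> nat set set \<Rightarrow> 'k::field mpoly set ring" where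
  "sr_ring n \<Delta> = poly_ring n Quot sr_ideal n \<Delta>"

definition krull_dim :: "('a, 'b) ring_scheme \<Rightarrow> enat" where
  "krull_dim R = Sup {enat l | l. \<exists>P :: nat \<Rightarrow> 'a set.
     (\<forall>i\<le>l. primeideal (P i) R) \<and> (\<forall>i<l. P i \<subset> P (Suc i))}"

definition sr_dim :: "'k::field itself \<Rightarrow> nat \<Rightarrow> nat set set \<Rightarrow> enat" where
  "sr_dim _ n \<Delta> = krull_dim (sr_ring n \<Delta> :: 'k mpoly set ring)"

definition sr_codim :: "'k::field itself \<Rightarrow> nat \<Rightarrow> nat set set \<Rightarrow> enat" where
  "sr_codim K n \<Delta> = krull_dim (poly_ring n :: 'k mpoly ring) - sr_dim K n \<Delta>"

definition mdeg :: "(nat \<Rightarrow>\<^sub>0 nat) \<Rightarrow> nat" where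
  "mdeg m = (\<Sum>i\<in>Poly_Mapping.keys m. Poly_Mapping.lookup m i)"

definition hom_component :: "nat \<Rightarrow> nat \<Rightarrow> 'k::field mpoly set" where
  "hom_component n j = {p \<in> carrier (poly_ring n). \<forall>m\<in>Poly_Mapping.keys p. mdeg m = j}"

definition initial_degree :: "nat \<Rightarrow> 'k::field mpoly set \<Rightarrow> nat" where
  "initial_degree n I = (LEAST j. I \<inter> hom_component n j \<noteq> {0})"

text \<open>\<open>dim\<^sub>k (Z / (Z \<inter> B)) = h\<close> for subspaces \<open>Z\<close>, \<open>B\<close>: some finite \<open>X \<subseteq> Z\<close> with
  \<open>h\<close> elements maps to a basis of the quotient. This is a relation, so it is false
  (rather than true with \<open>h = 0\<close>) for infinite-dimensional quotients.\<close>

definition has_quot_dim ::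
    "('k::field \<Rightarrow> 'v::ab_group_add \<Rightarrow> 'v) \<Rightarrow> 'v set \<Rightarrow> 'v set \<Rightarrow> nat \<Rightarrow> bool" where
  "has_quot_dim scl Z B h \<longleftrightarrow> (\<exists>X. X \<subseteq> Z \<and> finite X \<and> card X = h \<and>
     (\<forall>z\<in>Z. \<exists>!a. (\<forall>x. x \<notin> X \<longrightarrow> a x = 0) \<and> z - (\<Sum>x\<in>X. scl (a x) x) \<in> B))"

definition hilbert_function :: "nat \<Rightarrow> 'k::field mpoly set \<Rightarrow> nat \<Rightarrow> nat" where
  "hilbert_function n I j = (THE h.
     has_quot_dim (\<lambda>c p. Poly_Mapping.single 0 c * p) (hom_component n j) (I \<inter> hom_component n j) h)"

text \<open>The multiplicity \<open>e(A) = lim d! \<cdot> dim\<^sub>k (A/\<mm>\<^sup>t) / t\<^sup>d\<close> of \<open>A = S/I\<close>, \<open>d = dim A\<close>; as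
  \<open>A\<close> is standard graded, \<open>dim\<^sub>k (A/\<mm>\<^sup>t)\<close> is the sum of its Hilbert function below \<open>t\<close>.\<close>

definition multiplicity_of :: "nat \<Rightarrow> 'k::field mpoly set \<Rightarrow> real" where
  "multiplicity_of n I = (let d = the_enat (krull_dim (poly_ring n Quot I)) in
     lim (\<lambda>t. fact d * real (\<Sum>j<t. hilbert_function n I j) / real t ^ d))"

definition minimal_multiplicity :: "'k::field itself \<Rightarrow> nat \<Rightarrow> nat set set \<Rightarrow> nat \<Rightarrow> bool" where
  "minimal_multiplicity K n \<Delta> q \<longleftrightarrow>
     simplicial_complex_on n \<Delta> \<and> buchsbaum K \<Delta> \<and>
     initial_degree n (sr_ideal n \<Delta> :: 'k mpoly set) = q \<and>
     (\<exists>c d. sr_dim K n \<Delta> = enat d \<and> sr_codim K n \<Delta> = enat c \<and>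
        multiplicity_of n (sr_ideal n \<Delta> :: 'k mpoly set) =
          (real c + real d) / real d * real ((c + q - 2) choose (q - 2)))"

section \<open>Graded Betti numbers and regularity\<close>

text \<open>A graded free module over \<open>S = poly_ring n\<close> with basis \<open>B \<subseteq> nat\<close> consists of the finitely
  supported families \<open>nat \<Rightarrow>\<^sub>0 S\<close> with support in \<open>B\<close>; the basis element \<open>b\<close> sits in degree \<open>e b\<close>.\<close>

definition free_module :: "nat \<Rightarrow> nat set \<Rightarrow> (nat \<Rightarrow>\<^sub>0 'k::field mpoly) set" where
  "free_module n B = {x. Poly_Mapping.keys x \<subseteq> B \<and>
     (\<forall>b. Poly_Mapping.lookup x b \<in> carrier (poly_ring n))}"

definition free_component ::
    "nat \<Rightarrow> nat set \<Rightarrow> (nat \<Rightarrow> nat) \<Rightarrow> nat \<Rightarrow> (nat \<Rightarrow>\<^sub>0 'k::field mpoly) set" where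
  "free_component n B e j = {x \<in> free_module n B. \<forall>b\<in>Poly_Mapping.keys x.
     \<forall>m\<in>Poly_Mapping.keys (Poly_Mapping.lookup x b). mdeg m + e b = j}"

definition lin_ext ::
    "(nat \<Rightarrow> (nat \<Rightarrow>\<^sub>0 'k::field mpoly)) \<Rightarrow> (nat \<Rightarrow>\<^sub>0 'k mpoly) \<Rightarrow> (nat \<Rightarrow>\<^sub>0 'k mpoly)" where
  "lin_ext D x =
     (\<Sum>b\<in>Poly_Mapping.keys x. Poly_Mapping.map ((*) (Poly_Mapping.lookup x b)) (D b))"

text \<open>A graded free resolution \<open>\<dots> \<rightarrow> F\<^sub>2 \<rightarrow> F\<^sub>1 \<rightarrow> F\<^sub>0 = S \<rightarrow> S/J \<rightarrow> 0\<close>: \<open>F\<^sub>i\<close> has basis \<open>B i\<close> with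
  degrees \<open>e i\<close>, and \<open>D i b \<in> F\<^bsub>i-1\<^esub>\<close> is the image of the basis element \<open>b\<close> of \<open>F\<^sub>i\<close>, \<open>i > 0\<close>
  (\<open>D 0\<close> is irrelevant).\<close>

definition graded_free_resolution ::
    "nat \<Rightarrow> 'k::field mpoly set \<Rightarrow> (nat \<Rightarrow> nat set) \<Rightarrow> (nat \<Rightarrow> nat \<Rightarrow> nat) \<Rightarrow>
     (nat \<Rightarrow> nat \<Rightarrow> (nat \<Rightarrow>\<^sub>0 'k mpoly)) \<Rightarrow> bool" where
  "graded_free_resolution n J B e D \<longleftrightarrow>
     B 0 = {0} \<and> e 0 0 = 0 \<and>
     (\<forall>i. \<forall>b\<in>B (Suc i). D (Suc i) b \<in> free_component n (B i) (e i) (e (Suc i) b)) \<and>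
     (\<lambda>x. Poly_Mapping.lookup (lin_ext (D 1) x) 0) ` free_module n (B 1) = J \<and>
     (\<forall>i\<ge>1. {x \<in> free_module n (B i). lin_ext (D i) x = 0} =
              lin_ext (D (Suc i)) ` free_module n (B (Suc i)))"

text \<open>\<open>dim\<^sub>k Tor\<^sub>i\<^sup>S(S/I, S/J)\<^sub>j\<close> is the dimension of the degree \<open>j\<close> part of the \<open>i\<close>-th homology of
  \<open>S/I \<otimes>\<^sub>S F = F/IF\<close>, where \<open>F\<close> is a graded free resolution of \<open>S/J\<close>. The value does not depend
  on \<open>F\<close>.\<close>

definition tor_dim ::
    "nat \<Rightarrow> 'k::field mpoly set \<Rightarrow> 'k mpoly set \<Rightarrow> nat \<Rightarrow> nat \<Rightarrow> nat" where
  "tor_dim n I J i j = (THE h. \<exists>B e D. graded_free_resolution n J B e D \<and>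
     has_quot_dim (\<lambda>c. Poly_Mapping.map ((*) (Poly_Mapping.single 0 c)))
       {x \<in> free_component n (B i) (e i) j.
          i = 0 \<or> (\<forall>b. Poly_Mapping.lookup (lin_ext (D i) x) b \<in> I)}
       {x \<in> free_component n (B i) (e i) j.
          \<exists>y\<in>free_module n (B (Suc i)).
            \<forall>b. Poly_Mapping.lookup (x - lin_ext (D (Suc i)) y) b \<in> I}
       h)"

text \<open>\<open>\<beta>\<^bsub>i,j\<^esub>(S/I)\<close>, with \<open>k = S/\<mm>\<close>.\<close>

definition betti :: "nat \<Rightarrow> 'k::field mpoly set \<Rightarrow> nat \<Rightarrow> nat \<Rightarrow> nat" where
  "betti n I i j = tor_dim n I (maximal_ideal n) i j"

definition regularity :: "nat \<Rightarrow> 'k::field mpoly set \<Rightarrow> int" where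
  "regularity n I = Max {int j - int i | i j. betti n I i j \<noteq> 0}"

definition linear_resolution :: "nat \<Rightarrow> 'k::field mpoly set \<Rightarrow> nat \<Rightarrow> bool" where
  "linear_resolution n I q \<longleftrightarrow>
     regularity n I = int (initial_degree n I) - 1 \<and> int (initial_degree n I) - 1 = int q - 1"

section \<open>Local cohomology\<close>

text \<open>\<open>H\<^sup>i\<^sub>\<mm>(S/I)\<close> is the \<open>i\<close>-th cohomology of the Cech complex on \<open>x\<^sub>1, \<dots>, x\<^sub>n\<close>, with
  \<open>C\<^sup>i = \<Oplus> (S/I)\<^bsub>x\<^sub>T\<^esub>\<close> over \<open>T \<subseteq> {1..n}\<close>, \<open>|T| = i\<close>, where \<open>x\<^sub>T\<close> is the product of the \<open>x\<^sub>i\<close>,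
  \<open>i \<in> T\<close>. The localizations of \<open>S\<close> are taken inside the Laurent polynomials, and
  \<open>(S/I)\<^bsub>x\<^sub>T\<^esub> = S\<^bsub>x\<^sub>T\<^esub> / I S\<^bsub>x\<^sub>T\<^esub>\<close>.\<close>

type_synonym 'k laurent = "(nat \<Rightarrow>\<^sub>0 int) \<Rightarrow>\<^sub>0 'k"

definition to_laurent :: "'k::field mpoly \<Rightarrow> 'k laurent" where
  "to_laurent p = (\<Sum>m\<in>Poly_Mapping.keys p.
     Poly_Mapping.single (Poly_Mapping.map int m) (Poly_Mapping.lookup p m))"

definition localize :: "nat set \<Rightarrow> 'k::field mpoly set \<Rightarrow> 'k laurent set" where
  "localize T M = {g. \<exists>r. to_laurent ((\<Prod>i\<in>T. var i) ^ r) * g \<in> to_laurent ` M}"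

text \<open>Lifts to \<open>\<Oplus> S\<^bsub>x\<^sub>T\<^esub>\<close>, \<open>|T| = i\<close>, of \<open>i\<close>-cochains. The degree is an integer so that
  \<open>C\<^bsup>-1\<^esup> = 0\<close>.\<close>

definition cech_cochains :: "nat \<Rightarrow> int \<Rightarrow> (nat set \<Rightarrow>\<^sub>0 'k::field laurent) set" where
  "cech_cochains n i = {z. \<forall>T\<in>Poly_Mapping.keys z. T \<subseteq> {1..n} \<and> int (card T) = i \<and>
     Poly_Mapping.lookup z T \<in> localize T (carrier (poly_ring n))}"

definition cech_null :: "nat \<Rightarrow> 'k::field mpoly set \<Rightarrow> (nat set \<Rightarrow>\<^sub>0 'k laurent) set" where
  "cech_null n I = {z. \<forall>T\<in>Poly_Mapping.keys z. T \<subseteq> {1..n} \<and>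
     Poly_Mapping.lookup z T \<in> localize T I}"

definition cech_diff ::
    "nat \<Rightarrow> (nat set \<Rightarrow>\<^sub>0 'k::field laurent) \<Rightarrow> (nat set \<Rightarrow>\<^sub>0 'k laurent)" where
  "cech_diff n z = (\<Sum>T\<in>Pow {1..n}. Poly_Mapping.single T
     (\<Sum>a\<in>T. (-1) ^ card {b\<in>T. b < a} * Poly_Mapping.lookup z (T - {a})))"

definition has_local_cohomology_dim ::
    "nat \<Rightarrow> 'k::field mpoly set \<Rightarrow> nat \<Rightarrow> nat \<Rightarrow> bool" where
  "has_local_cohomology_dim n I i h \<longleftrightarrow>
     has_quot_dim (\<lambda>c. Poly_Mapping.map ((*) (Poly_Mapping.single 0 c)))
       {z \<in> cech_cochains n (int i). cech_diff n z \<in> cech_null n I}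
       {z \<in> cech_cochains n (int i).
          \<exists>w\<in>cech_cochains n (int i - 1). z - cech_diff n w \<in> cech_null n I}
       h"

section \<open>Cyclic polytopes\<close>

text \<open>Since \<open>f\<close> depends on the other parameters, \<open>\<real>\<^sup>f\<close> is realised as the vectors supported in
  \<open>{1..f}\<close> inside the real vector space \<open>nat \<Rightarrow>\<^sub>0 real\<close> of finitely supported sequences.\<close>

definition moment_curve :: "nat \<Rightarrow> real \<Rightarrow> (nat \<Rightarrow>\<^sub>0 real)" where
  "moment_curve f s = (\<Sum>j=1..f. Poly_Mapping.single j (s ^ j))"

definition cyclic_polytope :: "nat \<Rightarrow> nat \<Rightarrow> (nat \<Rightarrow> real) \<Rightarrow> (nat \<Rightarrow>\<^sub>0 real) set" where
  "cyclic_polytope n f t = convex hull ((\<lambda>i. moment_curve f (t i)) ` {1..n})"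

text \<open>The vertex with parameter \<open>t i\<close> carries the label \<open>i\<close>.\<close>

definition cyclic_boundary_complex :: "nat \<Rightarrow> nat \<Rightarrow> (nat \<Rightarrow> real) \<Rightarrow> nat set set" where
  "cyclic_boundary_complex n f t =
     {F. \<exists>T. T face_of cyclic_polytope n f t \<and> T \<noteq> cyclic_polytope n f t \<and>
             F = {i \<in> {1..n}. moment_curve f (t i) extreme_point_of T}}"

definition h_bound :: "nat \<Rightarrow> nat \<Rightarrow> nat \<Rightarrow> real" where
  "h_bound c d q = (\<Prod>j=0..q-2. real c + real j) / (\<Prod>j=0..q-2. real d - real j)"

end

theory Submission
imports Defs "HOL-Library.Function_Algebras" "HOL-Library.Nat_Bijection"
	"HOL-Computational_Algebra.Polynomial"
begin

text \<open>
Put \<open>m = d - q + 1\<close>. By Gale evenness a vertex set lies in a proper face of \<open>C(n, 2m)\<close> iff it contains no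
\<open>m + 1\<close> points that are pairwise non-adjacent in the cyclic order. Hence the faces of the dual are the sets
whose complement contains such a configuration; its links and induced subcomplexes are the analogous
complexes for a linear order, whose homology vanishes by induction on the last vertex.

Betti numbers come from the Koszul complex, one fine degree at a time: only square-free degrees \<open>W\<close> matter,
and there complementation in \<open>W\<close> turns the Koszul complex into the cochain complex of the complex induced on \<open>W\<close>.
Likewise the Cech complex in fine degree \<open>a\<close> computes the cohomology of a link, so that in the Buchsbaum case
only degree \<open>0\<close> contributes.

For the bound, linearity and the Buchsbaum property leave at most one nonzero cohomology group in every
link. Summing the Euler characteristics of the links against a polynomial weight that vanishes on the
large faces bounds \<open>h\<close>, and another weight counts the facets.
\<close>

text \<open>The statement speaks of rings, but every quantity in it is decided by finite sets.
  Multiplicity, Betti numbers and local cohomology are defined by a limit, by a unique value over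
  all graded resolutions and by a Cech complex, and each needs one bridge to faces. Regularity only
  asks which Betti numbers vanish, so Hochster's formula is needed only as a vanishing criterion.
  The weights are the binomials of \<open>|G| - k\<close> over \<open>q - 1\<close>: summed with
  signs over \<open>G\<close> inside \<open>F\<close> they form a \<open>|F|\<close>-fold finite
  difference, which kills every \<open>F\<close> with more than \<open>q - 1\<close> vertices. All
  smaller sets are faces, so the total depends on \<open>n\<close> alone. With
  \<open>k = d - q + 2\<close> only sizes up to \<open>d - q + 1\<close> are weighted, which gives
  an inequality; with \<open>k = d - q + 1\<close> only facets and the empty face contribute, which
  gives an equation. For the cyclic dual the equation is read backwards: facets are counted directly
  and \<open>h = 1\<close> results. The condition \<open>h_{c,d,q} = 1\<close> means
  \<open>c + q - 2 = d\<close>; then the bound reads \<open>h <= 1\<close>, and the codimension of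
  the cyclic dual is exactly \<open>c\<close>. A second complex supplies
  \<open>h = 0\<close>.\<close>

abbreviation (input) "lookup \<equiv> Poly_Mapping.lookup"
abbreviation (input) "keys \<equiv> Poly_Mapping.keys"
abbreviation (input) iff_ascii (infixr "<->" 25) where "P <-> Q \<equiv> P = (Q :: bool)"
abbreviation (input) subset_ascii (infix "<:" 50) where "A <: B \<equiv> A \<subseteq> B"
abbreviation (input) "single \<equiv> Poly_Mapping.single"

section \<open>Linear algebra over a field\<close>

text \<open>Gaussian elimination by induction on the equations \<open>Y\<close>: an unknown
  \<open>x0\<close> with nonzero coefficient in \<open>y0\<close> is solved for and substituted into
  the others, which costs one equation and one unknown.\<close>

lemma homogeneous_system_nontrivial_solution:
fixes a :: "'x => 'y => 'k::field"
assumes "finite Y" "finite X" "card Y < card X"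
shows "EX c. (EX x:X. c x ~= 0) & (ALL y:Y. (SUM x:X. c x * a x y) = 0)"
using assms
proof (induction Y arbitrary: X a rule: finite_induct)
case empty
hence "X ~= {}" by auto
thus ?case by (intro exI[of _ "%_. 1"]) auto
next
case (insert y0 Y)
show ?case
proof (cases "ALL x:X. a x y0 = 0")
	case True
	have "card Y < card X" using insert by simp
	from insert.IH[OF insert.prems(1) this, of a]
	obtain c where "EX x:X. c x ~= 0" "ALL y:Y. (SUM x:X. c x * a x y) = 0" by blast
	with True show ?thesis by (intro exI[of _ c]) auto
next
	case False
	then obtain x0 where x0: "x0 : X" "a x0 y0 ~= 0" by blast
	let ?X = "X - {x0}"
	let ?a = "%x y. a x y - a x y0 / a x0 y0 * a x0 y"
	have card: "card Y < card ?X" using insert x0 by simp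
	have fin: "finite ?X" using insert by simp
	from insert.IH[OF fin card, of ?a]
	obtain c where c: "EX x:?X. c x ~= 0" "!!y. y : Y ==> (SUM x:?X. c x * ?a x y) = 0" by blast
	define c' where "c' x = (if x = x0 then - (SUM x:?X. c x * a x y0) / a x0 y0 else c x)" for x
	have split: "(SUM x:X. c' x * a x y) = c' x0 * a x0 y + (SUM x:?X. c x * a x y)" for y
	proof -
		have "(SUM x:X. c' x * a x y) = c' x0 * a x0 y + (SUM x:?X. c' x * a x y)"
			using insert.prems x0 by (simp add: sum.remove)
		also have "(SUM x:?X. c' x * a x y) = (SUM x:?X. c x * a x y)"
			by (intro sum.cong) (auto simp: c'_def)
		finally show ?thesis .
	qed
	have "(SUM x:X. c' x * a x y) = 0" if "y : insert y0 Y" for y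
	proof (cases "y = y0")
		case True
		with x0 show ?thesis unfolding split by (simp add: c'_def)
	next
		case False
		with that have "(SUM x:?X. c x * ?a x y) = 0" using c by simp
		hence "(SUM x:?X. c x * a x y) = (SUM x:?X. c x * a x y0) / a x0 y0 * a x0 y"
			by (simp add: right_diff_distrib sum_subtractf sum_divide_distrib sum_distrib_right mult.assoc)
		thus ?thesis unfolding split by (simp add: c'_def)
	qed
	moreover have "EX x:X. c' x ~= 0" using c(1) by (auto simp: c'_def)
	ultimately show ?thesis by blast
qed
qed

text \<open>The annihilator of the kernel of a matrix is its row space. This transposes exactness
  and is what carries vanishing between homology and cohomology without dual spaces.\<close>

lemma row_space_if_vanishes_on_kernel:
fixes N :: "'p => 'q => 'k::field"
assumes "finite P" "finite Q"
	and "!!x. (!!p. p : P ==> (SUM q:Q. N p q * x q) = 0) ==> (SUM q:Q. g q * x q) = 0"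
shows "EX y. ALL q:Q. g q = (SUM p:P. y p * N p q)"
using assms
proof (induction P arbitrary: g rule: finite_induct)
case empty
have "g q = 0" if "q : Q" for q
	using empty.prems(2)[of "%r. if r = q then 1 else 0"] that empty.prems(1)
	by (simp add: if_distrib[of "%x. _ * x"] cong: if_cong)
thus ?case by simp
next
case (insert r P)
have upd: "(SUM p:insert r P. (y(r := c)) p * N p q) = c * N r q + (SUM p:P. y p * N p q)" for y c q
proof -
	have "(SUM p:P. (y(r := c)) p * N p q) = (SUM p:P. y p * N p q)"
		using insert.hyps by (intro sum.cong) auto
	thus ?thesis using insert.hyps by simp
qed
show ?case
proof (cases "ALL x. (ALL p:P. (SUM q:Q. N p q * x q) = 0) --> (SUM q:Q. g q * x q) = 0")
	case True
	then obtain y where y: "ALL q:Q. g q = (SUM p:P. y p * N p q)"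
		using insert.IH[OF insert.prems(1), of g] by blast
	show ?thesis by (intro exI[of _ "y(r := 0)"]) (use y upd[of y 0] in simp)
next
	case False
	then obtain x0 where x0: "!!p. p : P ==> (SUM q:Q. N p q * x0 q) = 0"
		and gx0: "(SUM q:Q. g q * x0 q) ~= 0" by blast
	have r0: "(SUM q:Q. N r q * x0 q) ~= 0" (is "?r0 ~= 0")
		using insert.prems(2)[of x0] x0 gx0 by auto
	\<comment> \<open>\<open>c\<close> makes \<open>g - c * N r\<close> vanish at \<open>x0\<close>.
	  Any vector killed by the rows in \<open>P\<close> becomes killed by row \<open>r\<close> too
	  after subtracting a multiple of \<open>x0\<close>, so this difference vanishes on the whole
	  kernel of \<open>P\<close>.\<close>
	define c where "c = (SUM q:Q. g q * x0 q) / ?r0"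
	have "(SUM q:Q. (g q - c * N r q) * x q) = 0" if x: "!!p. p : P ==> (SUM q:Q. N p q * x q) = 0" for x
	proof -
		define t where "t = (SUM q:Q. N r q * x q) / ?r0"
		have lin: "(SUM q:Q. f q * (x q - t * x0 q)) = (SUM q:Q. f q * x q) - t * (SUM q:Q. f q * x0 q)" for f
			by (simp add: right_diff_distrib sum_subtractf sum_distrib_left mult.left_commute)
		have "(SUM q:Q. g q * (x q - t * x0 q)) = 0"
		proof (rule insert.prems(2))
			fix p assume "p : insert r P"
			thus "(SUM q:Q. N p q * (x q - t * x0 q)) = 0"
				unfolding lin using x x0 r0 by (auto simp: t_def)
		qed
		hence "(SUM q:Q. g q * x q) = c * (SUM q:Q. N r q * x q)"
			unfolding lin by (simp add: t_def c_def)
		thus ?thesis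
			by (simp add: left_diff_distrib sum_subtractf sum_distrib_left mult.assoc)
	qed
	then obtain y where y: "ALL q:Q. g q - c * N r q = (SUM p:P. y p * N p q)"
		using insert.IH[OF insert.prems(1), of "%q. g q - c * N r q"] by blast
	show ?thesis
	proof (intro exI[of _ "y(r := c)"] ballI)
		fix q assume "q : Q"
		with y have "g q = c * N r q + (SUM p:P. y p * N p q)" by (metis add.commute diff_eq_eq)
		thus "g q = (SUM p:insert r P. (y(r := c)) p * N p q)" using upd[of y c q] by simp
	qed
qed
qed

section \<open>Dimensions of quotients of subspaces\<close>

context vector_space
begin

text \<open>The unique coefficient function in \<open>has_quot_dim\<close> is split into
  independence modulo \<open>B\<close> and generation modulo \<open>B\<close>, the form in which all
  later bases are supplied.\<close>

lemma has_quot_dimI: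
assumes B: "subspace B" and X: "X <: Z" "finite X" "card X = h"
	and indep: "!!c. (SUM x:X. scale (c x) x) : B ==> (ALL x:X. c x = 0)"
	and spans: "!!z. z : Z ==> EX c. z - (SUM x:X. scale (c x) x) : B"
shows "has_quot_dim scale Z B h"
unfolding has_quot_dim_def
proof (intro exI[of _ X] conjI ballI X)
fix z assume "z : Z"
then obtain c where c: "z - (SUM x:X. scale (c x) x) : B" using spans by blast
show "\<exists>!a. (ALL x. x ~: X --> a x = 0) & z - (SUM x:X. scale (a x) x) : B"
proof (rule ex1I[of _ "%x. if x : X then c x else 0"])
	have "(SUM x:X. scale (if x : X then c x else 0) x) = (SUM x:X. scale (c x) x)"
		by (intro sum.cong) auto
	with c show "(ALL x. x ~: X --> (if x : X then c x else 0) = 0) &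
		z - (SUM x:X. scale (if x : X then c x else 0) x) : B" by simp
next
	fix a assume a: "(ALL x. x ~: X --> a x = 0) & z - (SUM x:X. scale (a x) x) : B"
	have "(z - (SUM x:X. scale (a x) x)) - (z - (SUM x:X. scale (c x) x)) : B"
		by (rule subspace_diff[OF B _ c]) (use a in simp)
	hence "(SUM x:X. scale (c x - a x) x) : B"
		by (simp add: scale_left_diff_distrib sum_subtractf)
	hence *: "ALL x:X. c x - a x = 0" by (rule indep)
	show "a = (%x. if x : X then c x else 0)"
	proof
		fix x show "a x = (if x : X then c x else 0)"
			using * a by (cases "x : X") simp_all
	qed
qed
qed

lemma has_quot_dimE:
assumes "has_quot_dim scale Z B h" "subspace Z" "subspace B"
obtains X where "X <: Z" "finite X" "card X = h"
	"!!c. (SUM x:X. scale (c x) x) : B ==> (ALL x:X. c x = 0)"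
	"!!z. z : Z ==> EX c. z - (SUM x:X. scale (c x) x) : B"
proof -
define R where "R X z a <-> (ALL x. x ~: X --> a x = 0) & z - (SUM x:X. scale (a x) x) : B" for X z a
from assms(1) have "EX X. X <: Z & finite X & card X = h & (ALL z:Z. \<exists>!a. R X z a)"
	unfolding has_quot_dim_def R_def .
then obtain X where X: "X <: Z" "finite X" "card X = h" and u: "ALL z:Z. \<exists>!a. R X z a"
	by (elim exE conjE)
have ex: "EX a. R X z a" if "z : Z" for z using bspec[OF u that] by (rule ex1_implies_ex)
have uniq: "a = b" if "z : Z" "R X z a" "R X z b" for z a b
	using bspec[OF u that(1)] that(2,3) by (auto elim: ex1E)
have "ALL x:X. c x = 0" if c: "(SUM x:X. scale (c x) x) : B" for c
proof -
	\<comment> \<open>A relation modulo \<open>B\<close> is a second representation of the vector 0,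
	  next to the zero coefficients; the sign appears because \<open>R\<close> subtracts the
	  sum.\<close>
	define a where "a x = (if x : X then - c x else 0)" for x
	have "(SUM x:X. scale (a x) x) = - (SUM x:X. scale (c x) x)"
		unfolding sum_negf[symmetric] by (intro sum.cong) (auto simp: a_def)
	with c have "R X 0 a" by (simp add: R_def a_def)
	moreover have "R X 0 (%_. 0)" using assms(3) by (simp add: R_def subspace_0)
	moreover have "0 : Z" using assms(2) by (rule subspace_0)
	ultimately have "a = (%_. 0)" using uniq by blast
	show ?thesis
	proof
		fix x assume "x : X"
		thus "c x = 0" using fun_cong[OF \<open>a = (\<lambda>_. 0)\<close>, of x] by (simp add: a_def)
	qed
qed
moreover have "EX c. z - (SUM x:X. scale (c x) x) : B" if "z : Z" for z
	using ex[OF that] unfolding R_def by blast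
ultimately show ?thesis by (rule that[OF X])
qed

text \<open>A largest subset of \<open>Z\<close> independent modulo \<open>B\<close> is a basis. It
  exists because more than \<open>card Y\<close> vectors in the span of \<open>Y\<close> admit a
  nontrivial relation, by the elimination lemma.\<close>

lemma quot_dim_exists:
assumes Z: "subspace Z" and B: "subspace B" and Y: "finite Y"
	and span: "!!z. z : Z ==> EX c. z = (SUM y:Y. scale (c y) y)"
shows "EX h. has_quot_dim scale Z B h"
proof -
define P where "P X <-> finite X & X <: Z & (ALL c. (SUM x:X. scale (c x) x) : B --> (ALL x:X. c x = 0))" for X
have bound: "card X <= card Y" if PX: "P X" for X
proof (rule ccontr)
	assume neg: "~ card X <= card Y"
	from PX have "X <: Z" by (simp add: P_def)
	hence "ALL x:X. EX c. x = (SUM y:Y. scale (c y) y)" using span by blast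
	then obtain a where "ALL x:X. x = (SUM y:Y. scale (a x y) y)" by (rule bchoice[THEN exE])
	hence a: "!!x. x : X ==> x = (SUM y:Y. scale (a x y) y)" by blast
	have "finite X" "card Y < card X" using PX neg by (simp_all add: P_def)
	then obtain c where c: "EX x:X. c x ~= 0" "ALL y:Y. (SUM x:X. c x * a x y) = 0"
		using homogeneous_system_nontrivial_solution[OF Y, of X a] by blast
	have "(SUM x:X. scale (c x) x) = (SUM x:X. SUM y:Y. scale (c x * a x y) y)"
	proof (intro sum.cong refl)
		fix x assume "x : X"
		hence "scale (c x) x = scale (c x) (SUM y:Y. scale (a x y) y)"
			by (intro arg_cong[of _ _ "scale (c x)"] a)
		also have "... = (SUM y:Y. scale (c x * a x y) y)" by (simp add: scale_sum_right)
		finally show "scale (c x) x = (SUM y:Y. scale (c x * a x y) y)" .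
	qed
	also have "... = (SUM y:Y. scale (SUM x:X. c x * a x y) y)"
		by (subst sum.swap) (simp add: scale_sum_left)
	also have "... = 0" using c by simp
	finally have "(SUM x:X. scale (c x) x) : B" using B by (simp add: subspace_0)
	thus False using PX c(1) unfolding P_def by blast
qed
have "P {}" by (simp add: P_def)
moreover have "ALL X. P X --> card X < Suc (card Y)" using bound by (simp add: less_Suc_eq_le)
ultimately have "EX X. P X & (ALL X'. P X' --> card X' <= card X)"
	by (rule Lattices_Big.ex_has_greatest_nat)
then obtain X where X: "P X" and max: "!!X'. P X' ==> card X' <= card X" by blast
have "has_quot_dim scale Z B (card X)"
proof (rule has_quot_dimI[OF B, of X])
	show "X <: Z" "finite X" "card X = card X" using X by (simp_all add: P_def)
	show "ALL x:X. c x = 0" if "(SUM x:X. scale (c x) x) : B" for c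
		using X that unfolding P_def by blast
	fix z assume z: "z : Z"
	show "EX c. z - (SUM x:X. scale (c x) x) : B"
	proof (rule ccontr)
		assume "~ ?thesis"
		hence neg: "z - (SUM x:X. scale (c x) x) ~: B" for c by simp
		have fX: "finite X" and XZ: "X <: Z" using X by (simp_all add: P_def)
		have zX: "z ~: X"
		proof
			assume "z : X"
			hence "(SUM x:X. scale ((if x = z then 1 else 0)) x) = z"
				using fX by (simp add: if_distrib[of "%c. scale c _"] cong: if_cong)
			hence "z - (SUM x:X. scale ((if x = z then 1 else 0)) x) : B"
				using B by (simp add: subspace_0)
			thus False using neg[of "%x. if x = z then 1 else 0"] by contradiction
		qed
		have "P (insert z X)"
			unfolding P_def
		proof (intro conjI allI impI)
			show "finite (insert z X)" "insert z X <: Z" using fX XZ z by simp_all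
			fix c assume "(SUM x:insert z X. scale (c x) x) : B"
			hence s: "scale (c z) z + (SUM x:X. scale (c x) x) : B" using fX zX by simp
			have cz: "c z = 0"
			proof (rule ccontr)
				assume "c z ~= 0"
				have "scale (1 / c z) (scale (c z) z + (SUM x:X. scale (c x) x)) : B"
					using s B by (rule subspace_scale[rotated])
				moreover have "scale (1 / c z) (scale (c z) z + (SUM x:X. scale (c x) x)) =
						z - (SUM x:X. scale (- c x / c z) x)"
					using \<open>c z \<noteq> 0\<close> by (simp add: scale_right_distrib scale_sum_right sum_negf)
				ultimately have "z - (SUM x:X. scale (- c x / c z) x) : B" by simp
				thus False using neg[of "%x. - c x / c z"] by contradiction
			qed
			with s have "(SUM x:X. scale (c x) x) : B" by simp
			with X have "ALL x:X. c x = 0" unfolding P_def by blast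
			with cz show "ALL x:insert z X. c x = 0" by blast
		qed
		hence "card (insert z X) <= card X" by (rule max)
		thus False using fX zX by simp
	qed
qed
thus ?thesis by blast
qed

text \<open>A basis of \<open>Z\<close> modulo \<open>B\<close> and a basis of \<open>B\<close>
  modulo \<open>A\<close> are disjoint, and their union is a basis of \<open>Z\<close> modulo
  \<open>A\<close>.\<close>

lemma quot_dim_add:
assumes "has_quot_dim scale Z B h" "has_quot_dim scale B A h'"
	and Z: "subspace Z" and B: "subspace B" and A: "subspace A" and "A <: B" "B <: Z"
shows "has_quot_dim scale Z A (h + h')"
proof -
obtain X where X: "X <: Z" "finite X" "card X = h"
	"!!c. (SUM x:X. scale (c x) x) : B ==> (ALL x:X. c x = 0)"
	"!!z. z : Z ==> EX c. z - (SUM x:X. scale (c x) x) : B"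
	by (rule has_quot_dimE[OF assms(1) Z B]) blast
obtain Y where Y: "Y <: B" "finite Y" "card Y = h'"
	"!!c. (SUM x:Y. scale (c x) x) : A ==> (ALL x:Y. c x = 0)"
	"!!z. z : B ==> EX c. z - (SUM x:Y. scale (c x) x) : A"
	by (rule has_quot_dimE[OF assms(2) B A]) blast
have sumB: "(SUM x:Y. scale (c x) x) : B" for c
	using Y(1) B by (intro subspace_sum subspace_scale) auto
have disj: "X Int Y = {}"
proof (rule ccontr)
	assume "X Int Y ~= {}"
	then obtain x where x: "x : X" "x : Y" by auto
	have "(SUM y:X. scale (if y = x then 1 else 0) y) = x"
		using x X(2) by (simp add: if_distrib[of "%c. scale c _"] cong: if_cong)
	hence "(SUM y:X. scale (if y = x then 1 else 0) y) : B" using x Y(1) by auto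
	from X(4)[OF this] x(1) show False by auto
qed
show ?thesis
proof (rule has_quot_dimI[OF A, of "X Un Y"])
	show "X Un Y <: Z" "finite (X Un Y)" "card (X Un Y) = h + h'"
		using X Y disj assms by (auto simp: card_Un_disjoint)
	fix c assume "(SUM x:X Un Y. scale (c x) x) : A"
	hence s: "(SUM x:X. scale (c x) x) + (SUM x:Y. scale (c x) x) : A"
		using X Y disj by (simp add: sum.union_disjoint)
	hence "(SUM x:X. scale (c x) x) + (SUM x:Y. scale (c x) x) - (SUM x:Y. scale (c x) x) : B"
		using assms sumB subspace_diff[OF B] by blast
	hence "ALL x:X. c x = 0" using X(4) by simp
	moreover from this s have "ALL x:Y. c x = 0" using Y(4) by simp
	ultimately show "ALL x:X Un Y. c x = 0" by blast
next
	fix z assume "z : Z"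
	then obtain c where c: "z - (SUM x:X. scale (c x) x) : B" using X(5) by blast
	then obtain d where d: "z - (SUM x:X. scale (c x) x) - (SUM x:Y. scale (d x) x) : A" using Y(5) by blast
	have "(SUM x:X Un Y. scale (if x : X then c x else d x) x) =
		 (SUM x:X. scale (c x) x) + (SUM x:Y. scale (d x) x)"
		using X Y disj
		by (subst sum.union_disjoint) (auto intro!: arg_cong2[of _ _ _ _ "(+)"] sum.cong)
	with d show "EX c. z - (SUM x:X Un Y. scale (c x) x) : A"
		by (intro exI[of _ "%x. if x : X then c x else d x"]) (simp add: diff_diff_eq)
qed
qed

lemma quot_dim_0_iff:
assumes "has_quot_dim scale Z B h" "subspace Z" "subspace B"
shows "h = 0 <-> Z <: B"
proof -
obtain X where X: "X <: Z" "finite X" "card X = h"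
	"!!c. (SUM x:X. scale (c x) x) : B ==> (ALL x:X. c x = 0)"
	"!!z. z : Z ==> EX c. z - (SUM x:X. scale (c x) x) : B"
	by (rule has_quot_dimE[OF assms]) blast
show ?thesis
proof
	assume "h = 0"
	thus "Z <: B" using X by auto
next
	assume "Z <: B"
	hence "(SUM x:X. scale 1 x) : B" using X(1) by (intro subspace_sum[OF assms(3)]) auto
	hence "ALL x:X. (1::'a) = 0" by (rule X(4)[of "%_. 1"])
	thus "h = 0" using X by auto
qed
qed

end

text \<open>Injectivity is expressed through formal combinations of images, so that \<open>L\<close>
  may be an arbitrary function. \<open>quot_dim_image\<close> uses this freedom for a section of a
  linear map chosen point by point.\<close>

lemma (in vector_space_pair) quot_dim_le:
assumes d1: "has_quot_dim s1 Z B h" and d2: "has_quot_dim s2 Z' B' h'"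
	and Z: "vs1.subspace Z" and B: "vs1.subspace B"
	and Z': "vs2.subspace Z'" and B': "vs2.subspace B'"
	and maps: "!!x. x : Z ==> L x : Z'"
	and inj: "!!X c. finite X ==> X <: Z ==> (SUM x:X. s2 (c x) (L x)) : B' ==> (SUM x:X. s1 (c x) x) : B"
shows "h <= h'"
proof (rule ccontr)
assume "~ h <= h'"
obtain X where X: "X <: Z" "finite X" "card X = h"
	"!!c. (SUM x:X. s1 (c x) x) : B ==> (ALL x:X. c x = 0)"
	"!!z. z : Z ==> EX c. z - (SUM x:X. s1 (c x) x) : B"
	by (rule vs1.has_quot_dimE[OF d1 Z B]) blast
obtain Y where Y: "Y <: Z'" "finite Y" "card Y = h'"
	"!!c. (SUM x:Y. s2 (c x) x) : B' ==> (ALL x:Y. c x = 0)"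
	"!!z. z : Z' ==> EX c. z - (SUM x:Y. s2 (c x) x) : B'"
	by (rule vs2.has_quot_dimE[OF d2 Z' B']) blast
have "ALL x:X. EX c. L x - (SUM y:Y. s2 (c y) y) : B'" using Y(5) maps X(1) by blast
then obtain a where a: "!!x. x : X ==> L x - (SUM y:Y. s2 (a x y) y) : B'" by metis
obtain c where c: "EX x:X. c x ~= 0" "ALL y:Y. (SUM x:X. c x * a x y) = 0"
	using homogeneous_system_nontrivial_solution[of Y X a] \<open>\<not> h \<le> h'\<close> X Y by auto
have "(SUM x:X. s2 (c x) (L x - (SUM y:Y. s2 (a x y) y))) : B'"
	using a B' by (intro vs2.subspace_sum vs2.subspace_scale) auto
also have "(SUM x:X. s2 (c x) (L x - (SUM y:Y. s2 (a x y) y))) =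
		(SUM x:X. s2 (c x) (L x)) - (SUM x:X. SUM y:Y. s2 (c x * a x y) y)"
	by (simp add: vs2.scale_right_diff_distrib sum_subtractf vs2.scale_sum_right)
also have "(SUM x:X. SUM y:Y. s2 (c x * a x y) y) = (SUM y:Y. s2 (SUM x:X. c x * a x y) y)"
	by (subst sum.swap) (simp add: vs2.scale_sum_left)
also have "... = 0" using c by simp
finally have "(SUM x:X. s2 (c x) (L x)) : B'" by simp
hence "(SUM x:X. s1 (c x) x) : B" using inj X by blast
thus False using X(4) c(1) by blast
qed

lemma (in vector_space) quot_dim_unique:
assumes "has_quot_dim scale Z B h" "has_quot_dim scale Z B h'" "subspace Z" "subspace B"
shows "h = h'"
proof -
interpret vector_space_pair scale scale ..
have "h <= h'" by (rule quot_dim_le[OF assms(1,2,3,4,3,4), of "%x. x"])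
moreover have "h' <= h" by (rule quot_dim_le[OF assms(2,1,3,4,3,4), of "%x. x"])
ultimately show ?thesis by simp
qed

text \<open>Rank and nullity: the quotient by the kernel and the image have the same dimension, by
  comparing \<open>f\<close> in one direction and \<open>inv_into C f\<close> in the other.\<close>

lemma (in vector_space_pair) quot_dim_image:
assumes d: "has_quot_dim s1 C {x:C. f x = 0} h" and C: "vs1.subspace C" and f: "Vector_Spaces.linear s1 s2 f"
	and d': "has_quot_dim s2 (f ` C) {0} h'"
shows "h = h'"
proof -
interpret f: Vector_Spaces.linear s1 s2 f by (fact f)
interpret rev: vector_space_pair s2 s1 ..
have K: "vs1.subspace {x:C. f x = 0}"
	using C by (auto simp: vs1.subspace_def f.add f.scale)
have fC: "vs2.subspace (f ` C)" using C by (rule f.subspace_image)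
have "h <= h'"
proof (rule quot_dim_le[OF d d' C K fC])
	fix X c assume "finite X" "X <: C" "(SUM x:X. s2 (c x) (f x)) : {0}"
	thus "(SUM x:X. s1 (c x) x) : {x:C. f x = 0}"
		using C by (auto simp: f.sum f.scale intro!: vs1.subspace_sum vs1.subspace_scale)
qed (auto simp: vs2.subspace_def)
moreover have "h' <= h"
proof (rule rev.quot_dim_le[OF d' d fC _ C K])
	show "inv_into C f y : C" if "y : f ` C" for y using that by (rule inv_into_into)
	fix Y c assume Y: "finite Y" "Y <: f ` C" "(SUM y:Y. s1 (c y) (inv_into C f y)) : {x:C. f x = 0}"
	have "(SUM y:Y. s2 (c y) y) = f (SUM y:Y. s1 (c y) (inv_into C f y))"
		unfolding f.sum using Y(2) by (intro sum.cong refl) (simp add: f.scale f_inv_into_f subset_iff)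
	with Y(3) show "(SUM y:Y. s2 (c y) y) : {0}" by simp
qed (auto simp: vs2.subspace_def)
ultimately show ?thesis by simp
qed

section \<open>Simplicial homology with set-indexed chains\<close>

definition osign :: "nat => nat set => 'k::field" where
"osign u T = (-1) ^ card {x:T. x < u}"

text \<open>The boundary is written as the coefficient at \<open>T\<close>, hence as a sum over the
  vertices that can be added to \<open>T\<close>. This is why an ambient finite \<open>V\<close> has
  to be named, whereas \<open>cobd\<close> finds its vertices inside \<open>T\<close>.\<close>

definition bd :: "nat set => (nat set => 'k::field) => nat set => 'k" where
"bd V g T = (SUM u:V - T. osign u T * g (insert u T))"

definition cobd :: "(nat set => 'k::field) => nat set => 'k" where
"cobd g T = (SUM u:T. osign u T * g (T - {u}))"

definition supp_on :: "nat set set => nat => (nat set => 'k::field) => bool" where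
"supp_on L p g <-> (ALL T. g T ~= 0 --> T : L & card T = p)"

text \<open>The index \<open>p\<close> is the number of vertices, so this is the vanishing of \<open>H\<^bsub>p-1\<^esub>\<close>.\<close>

definition hvan :: "'k::field itself => nat set => nat set set => nat => bool" where
"hvan _ V L p <-> (\<forall>g::nat set => 'k. supp_on L p g --> (ALL T. bd V g T = 0) -->
	 (EX y. supp_on L (Suc p) y & (ALL T. g T = bd V y T)))"

text \<open>Both equations are imposed on faces only, since \<open>cobd\<close> of a cochain on
  \<open>L\<close> may be nonzero off \<open>L\<close>. Writing \<open>Suc (card T) = p\<close>
  leaves no nonzero \<open>y\<close> for \<open>p = 0\<close>.\<close>

definition cvan :: "'k::field itself => nat set set => nat => bool" where
"cvan _ L p <-> (\<forall>g::nat set => 'k. supp_on L p g --> (ALL T:L. cobd g T = 0) -->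
	 (EX y. (ALL T. y T ~= 0 --> T : L & Suc (card T) = p) & (ALL T:L. g T = cobd y T)))"

definition down_closed :: "nat set set => bool" where
"down_closed L <-> (ALL F:L. ALL G. G <: F --> G : L)"

lemma down_closedD: "down_closed L ==> F : L ==> G <: F ==> G : L"
unfolding down_closed_def by blast

lemma supp_onD: "supp_on L p g ==> g T ~= 0 ==> T : L & card T = p"
unfolding supp_on_def by blast

lemma hvanD:
fixes g :: "nat set => 'k::field"
assumes "hvan TYPE('k) V L p" "supp_on L p g" "!!T. bd V g T = 0"
shows "EX y. supp_on L (Suc p) y & (ALL T. g T = bd V y T)"
using assms by (simp add: hvan_def)

lemma osign_square [simp]: "osign u T * osign u T = (1::'k::field)"
by (simp add: osign_def flip: power_mult_distrib)

lemma osign_square_left [simp]: "osign u T * (osign u T * x) = (x::'k::field)"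
by (simp flip: mult.assoc)

lemma osign_nonzero [simp]: "osign u T ~= (0::'k::field)"
by (simp add: osign_def)

lemma osign_empty [simp]: "osign u {} = 1" by (simp add: osign_def)

lemma osign_insert_self [simp]: "osign u (insert u T) = osign u T"
unfolding osign_def by (rule arg_cong[of _ _ "%S. (-1) ^ card S"]) auto

lemma osign_remove_self [simp]: "osign u (T - {u}) = osign u T"
unfolding osign_def by (rule arg_cong[of _ _ "%S. (-1) ^ card S"]) auto

lemma osign_insert:
assumes "finite T" "v ~: T"
shows "osign u (insert v T) = (if v < u then - osign u T else osign u T :: 'k::field)"
proof (cases "v < u")
case True
hence "{x:insert v T. x < u} = insert v {x:T. x < u}" by auto
with True assms show ?thesis by (simp add: osign_def)
next
case False
hence "{x:insert v T. x < u} = {x:T. x < u}" by auto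
with False show ?thesis by (simp add: osign_def)
qed

text \<open>The one sign rule behind both homotopy formulas below: adding \<open>v\<close> and
  removing \<open>u\<close> in either order gives opposite signs.\<close>

lemma osign_anticommute:
assumes "finite T" "u : T" "v ~: T"
shows "osign v T * osign u (insert v T) = - (osign u T * osign v (T - {u}) :: 'k::field)"
proof -
define S where "S = T - {u}"
have T: "T = insert u S" "finite S" "u ~: S" "v ~: S" "u ~= v" using assms by (auto simp: S_def)
show ?thesis
proof (cases "u < v")
	case True
	thus ?thesis using T(2-5) unfolding T(1) 
		by (simp add: osign_insert insert_commute[of v u] mult.commute)
next
	case False
	hence "v < u" using T(5) by simp
	thus ?thesis using T(2-5) unfolding T(1)
		by (simp add: osign_insert insert_commute[of v u] mult.commute)
qed
qed

section \<open>Exterior multiplication and contraction by a vertex as homotopies\<close>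

definition wedge :: "nat => (nat set => 'k::field) => nat set => 'k" where
"wedge u g T = (if u : T then osign u T * g (T - {u}) else 0)"

definition contract :: "nat => (nat set => 'k::field) => nat set => 'k" where
"contract u g T = (if u : T then 0 else osign u T * g (insert u T))"

text \<open>The Cartan formula: \<open>bd\<close> after \<open>wedge u\<close> plus
  \<open>wedge u\<close> after \<open>bd\<close> is the identity. In the terms where a vertex other
  than \<open>u\<close> is added the signs cancel by \<open>osign_anticommute\<close>; adding
  \<open>u\<close> itself leaves \<open>g T\<close>.\<close>

lemma bd_wedge:
fixes g :: "nat set => 'k::field"
assumes V: "finite V" "u : V" "T <: V"
shows "bd V (wedge u g) T = g T - wedge u (bd V g) T"
proof (cases "u : T")
case False
hence "bd V (wedge u g) T = (SUM v:V - T. if v = u then osign v T * wedge u g (insert v T) else 0)"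
	unfolding bd_def by (intro sum.cong) (auto simp: wedge_def)
also have "... = g T" using V False by (simp add: wedge_def)
finally show ?thesis using False by (simp add: wedge_def)
next
case True
have fT: "finite T" using V finite_subset by blast
have "wedge u (bd V g) T = osign u T * (SUM v:insert u (V - T). osign v (T - {u}) * g (insert v (T - {u})))"
proof -
	have "V - (T - {u}) = insert u (V - T)" using V True by auto
	thus ?thesis using True by (simp add: wedge_def bd_def)
qed
also have "... = g T + (SUM v:V - T. osign u T * osign v (T - {u}) * g (insert v (T - {u})))"
	using V True by (simp add: insert_absorb distrib_left sum_distrib_left mult.assoc)
also have "(SUM v:V - T. osign u T * osign v (T - {u}) * g (insert v (T - {u}))) =
	- (SUM v:V - T. osign v T * wedge u g (insert v T))"
	unfolding sum_negf[symmetric]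
proof (intro sum.cong refl)
	fix v assume v: "v : V - T"
	hence "insert v (T - {u}) = insert v T - {u}" using True by auto
	thus "osign u T * osign v (T - {u}) * g (insert v (T - {u})) = - (osign v T * wedge u g (insert v T))"
		using osign_anticommute[OF fT True, of v, where 'k='k] v True
		by (simp add: wedge_def) (metis minus_mult_left mult.assoc minus_minus)
qed
finally show ?thesis unfolding bd_def[of V "wedge u g"] by simp
qed

lemma cobd_contract:
fixes g :: "nat set => 'k::field"
assumes fT: "finite T"
shows "cobd (contract u g) T = g T - contract u (cobd g) T"
proof (cases "u : T")
case True
hence "cobd (contract u g) T = (SUM v:T. if v = u then osign v T * contract u g (T - {v}) else 0)"
	unfolding cobd_def by (intro sum.cong) (auto simp: contract_def)
also have "... = g T" using fT True by (simp add: contract_def insert_absorb)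
finally show ?thesis using True by (simp add: contract_def)
next
case False
have "contract u (cobd g) T = g T + (SUM v:T. osign u T * osign v (insert u T) * g (insert u T - {v}))"
	using False fT by (simp add: contract_def cobd_def distrib_left sum_distrib_left mult.assoc)
also have "(SUM v:T. osign u T * osign v (insert u T) * g (insert u T - {v})) =
	- (SUM v:T. osign v T * contract u g (T - {v}))"
	unfolding sum_negf[symmetric]
proof (intro sum.cong refl)
	fix v assume v: "v : T"
	hence "insert u T - {v} = insert u (T - {v})" using False by auto
	thus "osign u T * osign v (insert u T) * g (insert u T - {v}) = - (osign v T * contract u g (T - {v}))"
		using osign_anticommute[OF fT v, of u, where 'k='k] v False
		by (simp add: contract_def mult.assoc)
qed
finally show ?thesis unfolding cobd_def[of "contract u g"] by simp
qed

text \<open>Two uses of \<open>cobd_contract\<close> show that contracting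
  \<open>cobd (cobd g)\<close> by \<open>u\<close> equals \<open>cobd (cobd (contract u g))\<close>
  on \<open>T - {u}\<close>, which is zero by induction on the size. No double sum over pairs of
  vertices is required.\<close>

lemma cobd_cobd:
fixes g :: "nat set => 'k::field"
assumes "finite T"
shows "cobd (cobd g) T = 0"
using assms
proof (induction "card T" arbitrary: T g)
case 0
thus ?case by (simp add: cobd_def)
next
case (Suc k)
then obtain u where u: "u : T" by fastforce
let ?S = "T - {u}"
have S: "finite ?S" "k = card ?S" using Suc u by auto
have fin: "!!v. finite (?S - {v})" using S by auto
have eq: "cobd (cobd g) S' - contract u (cobd (cobd (cobd g))) S' = cobd (cobd g) S'
	 - contract u (cobd (cobd (cobd g))) S'" for S' ..
have "contract u (cobd (cobd g)) ?S = cobd g ?S - cobd (contract u (cobd g)) ?S"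
	using cobd_contract[OF S(1), of u "cobd g"] by simp
also have "cobd (contract u (cobd g)) ?S = cobd (%T. g T - cobd (contract u g) T) ?S"
	unfolding cobd_def[of _ ?S] using cobd_contract[OF fin, of u g] by simp
also have "... = cobd g ?S - cobd (cobd (contract u g)) ?S"
	unfolding cobd_def[of _ ?S] by (simp add: right_diff_distrib sum_subtractf)
also have "cobd (cobd (contract u g)) ?S = 0" using Suc(1)[OF S(2,1)] .
finally show ?case using u by (simp add: contract_def insert_absorb)
qed

lemma bd_outside:
assumes "supp_on L p g" "down_closed L" "T ~: L"
shows "bd V g T = (0::'k::field)"
unfolding bd_def
proof (intro sum.neutral ballI)
fix u show "osign u T * g (insert u T) = 0"
	using assms supp_onD[OF assms(1), of "insert u T"] down_closedD[of L "insert u T" T] by auto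
qed

lemma card_insert_mem:
assumes "finite T" "u : T" shows "card T = Suc (card (T - {u}))"
using assms by (metis card_Suc_Diff1)

text \<open>A cone argument in a single degree: \<open>wedge u\<close> has to stay inside
  \<open>L\<close> only on faces with \<open>p\<close> vertices. This covers truncated complexes,
  which are cones merely below their top dimension.\<close>

lemma hvanI_contracting:
assumes V: "finite V" "L <: Pow V" "u : V" "down_closed L"
	and ins: "!!T. T : L ==> card T = p ==> insert u T : L"
shows "hvan TYPE('k::field) V L p"
unfolding hvan_def
proof (intro allI impI)
fix g :: "nat set => 'k" assume g: "supp_on L p g" "ALL T. bd V g T = 0"
have w: "supp_on L (Suc p) (wedge u g)"
	unfolding supp_on_def
proof (intro allI impI)
	fix T assume "wedge u g T ~= 0"
	hence u: "u : T" "g (T - {u}) ~= 0" by (simp_all add: wedge_def split: if_splits)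
	have *: "T - {u} : L" "card (T - {u}) = p" using supp_onD[OF g(1) u(2)] by simp_all
	have "T - {u} <: V" using *(1) V(2) by (rule PowD[OF subsetD, rotated])
	hence "finite (T - {u})" using V(1) by (rule finite_subset)
	hence "finite T" by simp
	have "card T = Suc p" by (rule trans[OF card_insert_mem[OF \<open>finite T\<close> u(1)] arg_cong[where f = Suc, OF *(2)]])
	thus "T : L & card T = Suc p" using ins[OF *] u by (simp add: insert_absorb)
qed
have "g T = bd V (wedge u g) T" for T
proof (cases "T <: V")
	case True
	thus ?thesis unfolding bd_wedge[OF V(1,3) True, of g] using g(2) by (simp add: wedge_def)
next
	case False
	hence T: "T ~: L" using V by auto
	hence "g T = 0" using supp_onD[OF g(1), of T] by blast
	with bd_outside[OF w V(4) T] show ?thesis by simp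
qed
with w show "EX y. supp_on L (Suc p) y & (ALL T. g T = bd V y T)" by (intro exI[of _ "wedge u g"]) simp
qed

lemma hvan_no_faces:
assumes "!!T. T : L ==> card T ~= p"
shows "hvan TYPE('k::field) V L p"
unfolding hvan_def
proof (intro allI impI)
fix g :: "nat set => 'k" assume "supp_on L p g"
hence "g T = 0" for T using assms[of T] supp_onD[of L p g T] by blast
thus "EX y. supp_on L (Suc p) y & (ALL T. g T = bd V y T)"
	by (intro exI[of _ "%_. 0"]) (simp add: supp_on_def bd_def)
qed

section \<open>The exact sequence of deletion and link of a vertex\<close>

definition del :: "nat set set => nat => nat set set" where
"del L u = {T:L. u ~: T}"

lemma link_singleton: "link L {u} = {T. u ~: T & insert u T : L}"
by (auto simp: link_def)

lemma chain_decomposition: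
assumes "u : V" "finite V"
shows "z T = (if u : T then 0 else z T) + wedge u (contract u z) (T::nat set)"
by (simp add: wedge_def contract_def insert_absorb)

lemma bd_add: "bd V (%T. f T + g T) T = bd V f T + bd V g T"
by (simp add: bd_def distrib_left sum.distrib)

lemma bd_diff: "bd V (%T. f T - g T) T = bd V f T - bd V g T"
by (simp add: bd_def right_diff_distrib sum_subtractf)

lemma bd_uminus: "bd V (%T. - g T) T = - bd V g T"
by (simp add: bd_def sum_negf)

lemma bd_contract:
fixes z :: "nat set => 'k::field"
assumes V: "finite V" "u : V" "T <: V" and uT: "u ~: T"
shows "bd V (contract u z) T = - contract u (bd V z) T"
	and "bd V (%T. if u : T then 0 else z T) T = bd V z T - contract u z T"
proof -
let ?A = "%T. if u : T then 0 else z T"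
have dec: "bd V z S = bd V ?A S + bd V (wedge u (contract u z)) S" for S
proof -
	have "(%T. ?A T + wedge u (contract u z) T) = z"
		by (intro ext) (rule chain_decomposition[OF V(2,1), symmetric])
	thus ?thesis using bd_add[of V ?A "wedge u (contract u z)" S] by simp
qed
have "bd V z (insert u T) = bd V ?A (insert u T) + (0 - wedge u (bd V (contract u z)) (insert u T))"
	using V by (subst dec, subst bd_wedge) (auto simp: contract_def)
moreover have "bd V ?A (insert u T) = 0" by (simp add: bd_def)
ultimately have "bd V z (insert u T) = - (osign u T * bd V (contract u z) T)"
	using uT by (simp add: wedge_def)
thus "bd V (contract u z) T = - contract u (bd V z) T"
	using uT by (simp add: contract_def)
show "bd V ?A T = bd V z T - contract u z T"
	using V uT by (subst dec, subst bd_wedge) (auto simp: wedge_def)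
qed

lemma supp_on_contract:
assumes z: "supp_on L (Suc p) z" and fin: "!!T. T : L ==> finite T"
shows "supp_on (link L {u}) p (contract u z)"
unfolding supp_on_def
proof (intro allI impI)
fix T assume "contract u z T ~= 0"
hence *: "u ~: T" "z (insert u T) ~= 0" by (simp_all add: contract_def split: if_splits)
have **: "insert u T : L" "card (insert u T) = Suc p" using supp_onD[OF z *(2)] by simp_all
have "finite T" using fin[OF **(1)] by simp
with * ** show "T : link L {u} & card T = p" by (simp add: link_singleton)
qed

lemma supp_on_wedge:
assumes z: "supp_on (link L {u}) p z" and fin: "!!T. T : L ==> finite T"
shows "supp_on L (Suc p) (wedge u z)"
unfolding supp_on_def
proof (intro allI impI)
fix T assume "wedge u z T ~= 0"
hence *: "u : T" "z (T - {u}) ~= 0" by (simp_all add: wedge_def split: if_splits)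
have **: "T - {u} : link L {u}" "card (T - {u}) = p" using supp_onD[OF z *(2)] by simp_all
have TL: "T : L" using * ** by (simp add: link_singleton insert_absorb)
moreover have "card T = Suc p"
	by (rule trans[OF card_insert_mem[OF fin[OF TL] *(1)] arg_cong[where f = Suc, OF **(2)]])
ultimately show "T : L & card T = Suc p" ..
qed

locale complex_vertex =
fixes V :: "nat set" and L :: "nat set set" and u :: nat
assumes finV: "finite V" and LV: "L <: Pow V" and uV: "u : V" and down: "down_closed L"
begin

lemma fin: "T : L ==> finite T"
using finV LV by (meson PowD finite_subset subsetD)

lemma link_del: "T : link L {u} ==> T : del L u"
using down by (auto simp: link_singleton del_def down_closed_def)

lemma down_del: "down_closed (del L u)"
using down by (auto simp: down_closed_def del_def)

lemma down_link: "down_closed (link L {u})"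
unfolding down_closed_def link_singleton
proof (intro ballI allI impI)
fix F G assume "F : {T. u ~: T & insert u T : L}" "G <: F"
thus "G : {T. u ~: T & insert u T : L}"
	using down_closedD[OF down, of "insert u F" "insert u G"] by auto
qed

text \<open>Exactness of homology of the deletion, of \<open>L\<close>, of the link: a cycle is
  split as \<open>?A + wedge u ?B\<close>, the link part is filled first and the remainder is a
  cycle in the deletion.\<close>

lemma hvan_from_del_link:
assumes d: "hvan TYPE('k::field) V (del L u) (Suc p)" and l: "hvan TYPE('k) V (link L {u}) p"
shows "hvan TYPE('k) V L (Suc p)"
unfolding hvan_def
proof (intro allI impI)
fix z :: "nat set => 'k" assume z: "supp_on L (Suc p) z" "ALL T. bd V z T = 0"
let ?A = "%T. if u : T then 0 else z T" and ?B = "contract u z"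
have sB: "supp_on (link L {u}) p ?B" using z(1) fin by (rule supp_on_contract)
have bdB: "bd V ?B T = 0" for T
proof (cases "T : link L {u}")
	case True
	hence "u ~: T" "T <: V" using LV link_del by (auto simp: del_def)
	thus ?thesis using bd_contract(1)[OF finV uV, of T z] z(2) by (simp add: contract_def)
next
	case False
	thus ?thesis using bd_outside[OF sB down_link] by blast
qed
obtain W where W: "supp_on (link L {u}) (Suc p) W" "!!T. ?B T = bd V W T"
	using hvanD[OF l sB bdB] by auto
have Wu: "u : T ==> W T = 0" for T using supp_onD[OF W(1), of T] by (auto simp: link_singleton)
\<comment> \<open>Replacing \<open>wedge u ?B\<close> by the filling \<open>W\<close> changes the
  cycle by a boundary: \<open>wedge u W\<close> has boundary \<open>W - wedge u ?B\<close>. What is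
  left avoids \<open>u\<close>.\<close>
have sAW: "supp_on (del L u) (Suc p) (%T. ?A T + W T)"
	unfolding supp_on_def
proof (intro allI impI)
	fix T assume "?A T + W T ~= 0"
	hence "u ~: T & z T ~= 0 \<or> W T ~= 0" by (auto split: if_splits)
	thus "T : del L u & card T = Suc p"
		using supp_onD[OF z(1), of T] supp_onD[OF W(1), of T] link_del[of T] by (auto simp: del_def)
qed
have bdAW: "bd V (%T. ?A T + W T) T = 0" for T
proof (cases "T : del L u")
	case True
	hence "u ~: T" "T <: V" using LV by (auto simp: del_def)
	thus ?thesis using bd_contract(2)[OF finV uV, of T z] z(2) W(2)[of T]
		by (simp add: bd_add)
next
	case False
	thus ?thesis using bd_outside[OF sAW down_del] by blast
qed
obtain Y where Y: "supp_on (del L u) (Suc (Suc p)) Y" "!!T. ?A T + W T = bd V Y T"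
	using hvanD[OF d sAW bdAW] by auto
have sY: "supp_on L (Suc (Suc p)) Y" using Y(1) by (auto simp: supp_on_def del_def)
have sW: "supp_on L (Suc (Suc p)) (wedge u W)" using W(1) fin by (rule supp_on_wedge)
show "EX y. supp_on L (Suc (Suc p)) y & (ALL T. z T = bd V y T)"
proof (intro exI[of _ "%T. Y T - wedge u W T"] conjI allI)
	show s: "supp_on L (Suc (Suc p)) (%T. Y T - wedge u W T)"
		unfolding supp_on_def
	proof (intro allI impI)
		fix T assume "Y T - wedge u W T ~= 0"
		hence "Y T ~= 0 \<or> wedge u W T ~= 0" by auto
		thus "T : L & card T = Suc (Suc p)" using supp_onD[OF sY, of T] supp_onD[OF sW, of T] by blast
	qed
	fix T show "z T = bd V (%T. Y T - wedge u W T) T"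
	proof (cases "T : L")
		case True
		hence TV: "T <: V" using LV by auto
		have "bd V (%T. Y T - wedge u W T) T = ?A T + W T - (W T - wedge u (bd V W) T)"
			using Y(2)[of T] bd_wedge[OF finV uV TV, of W] by (simp add: bd_diff)
		also have "wedge u (bd V W) T = wedge u ?B T" using W(2) by (simp add: wedge_def)
		finally show ?thesis using chain_decomposition[OF uV finV, of z T] by simp
	next
		case False
		thus ?thesis using bd_outside[OF s down] supp_onD[OF z(1), of T] by auto
	qed
qed
qed

text \<open>The next stretch of the same sequence, from \<open>L\<close> through the link to the
  deletion. It is how linearity will be passed on to links.\<close>

lemma hvan_link_from_del:
assumes w: "hvan TYPE('k::field) V L (Suc p)" and d: "hvan TYPE('k) V (del L u) p"
shows "hvan TYPE('k) V (link L {u}) p"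
unfolding hvan_def
proof (intro allI impI)
fix B :: "nat set => 'k" assume B: "supp_on (link L {u}) p B" "ALL T. bd V B T = 0"
have Bu: "u : T ==> B T = 0" for T using supp_onD[OF B(1), of T] by (auto simp: link_singleton)
have sBd: "supp_on (del L u) p B" unfolding supp_on_def
	using supp_onD[OF B(1)] link_del by simp
obtain A where A: "supp_on (del L u) (Suc p) A" "!!T. B T = bd V A T"
	using hvanD[OF d sBd] B(2) by auto
have sA: "supp_on L (Suc p) A" using A(1) by (auto simp: supp_on_def del_def)
have sB: "supp_on L (Suc p) (wedge u B)" using B(1) fin by (rule supp_on_wedge)
\<comment> \<open>Both terms have boundary \<open>B\<close>: the first by \<open>bd_wedge\<close> as
  \<open>B\<close> is a cycle, the second by the choice of \<open>A\<close>. Contracting a filling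
  of this cycle by \<open>u\<close> then recovers a filling of \<open>B\<close>, up to sign.\<close>
let ?z = "%T. wedge u B T - A T"
have sz: "supp_on L (Suc p) ?z"
	unfolding supp_on_def
proof (intro allI impI)
	fix T assume "?z T ~= 0"
	hence "A T ~= 0 \<or> wedge u B T ~= 0" by auto
	thus "T : L & card T = Suc p" using supp_onD[OF sA, of T] supp_onD[OF sB, of T] by blast
qed
have bdz: "bd V ?z T = 0" for T
proof (cases "T : L")
	case True
	hence TV: "T <: V" using LV by auto
	have "wedge u (bd V B) T = 0" using B(2) by (simp add: wedge_def)
	thus ?thesis using A(2)[of T] bd_wedge[OF finV uV TV, of B] by (simp add: bd_diff)
next
	case False
	thus ?thesis using bd_outside[OF sz down] by blast
qed
obtain C where C: "supp_on L (Suc (Suc p)) C" "!!T. ?z T = bd V C T"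
	using hvanD[OF w sz bdz] by auto
have sC: "supp_on (link L {u}) (Suc p) (contract u C)" using C(1) fin by (rule supp_on_contract)
show "EX y. supp_on (link L {u}) (Suc p) y & (ALL T. B T = bd V y T)"
proof (intro exI[of _ "%T. - contract u C T"] conjI allI)
	show s: "supp_on (link L {u}) (Suc p) (%T. - contract u C T)"
		using sC by (simp add: supp_on_def)
	fix T show "B T = bd V (%T. - contract u C T) T"
	proof (cases "T : link L {u}")
		case True
		hence *: "u ~: T" "T <: V" using LV link_del by (auto simp: del_def)
		have "A (insert u T) = 0" using supp_onD[OF A(1), of "insert u T"] by (auto simp: del_def)
		hence "contract u (bd V C) T = B T"
			using C(2)[of "insert u T"] * by (simp add: contract_def wedge_def flip: C(2))
		thus ?thesis using bd_contract(1)[OF finV uV *(2,1), of C] by (simp add: bd_uminus)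
	next
		case False
		thus ?thesis using bd_outside[OF s down_link] supp_onD[OF B(1), of T] by auto
	qed
qed
qed

end

text \<open>The lower end of the sequence: chains with \<open>p = 0\<close> live on the empty face,
  which survives the deletion.\<close>

lemma hvan_0_from_del:
assumes "hvan TYPE('k::field) V (del L u) 0" "!!T. T : L ==> finite T"
shows "hvan TYPE('k) V L 0"
unfolding hvan_def
proof (intro allI impI)
fix z :: "nat set => 'k" assume z: "supp_on L 0 z" "ALL T. bd V z T = 0"
have "supp_on (del L u) 0 z"
	unfolding supp_on_def
proof (intro allI impI)
	fix T assume "z T ~= 0"
	hence "T : L" "card T = 0" using supp_onD[OF z(1), of T] by auto
	thus "T : del L u & card T = 0" using assms(2) by (auto simp: del_def)
qed
from hvanD[OF assms(1) this] z(2) obtain y where "supp_on (del L u) (Suc 0) y" "ALL T. z T = bd V y T" by auto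
thus "EX y. supp_on L (Suc 0) y & (ALL T. z T = bd V y T)"
	by (intro exI[of _ y]) (auto simp: supp_on_def del_def)
qed

subsection \<open>Duality between homology and cohomology\<close>

text \<open>A single matrix for \<open>bd\<close>, whose transpose is the matrix of
  \<open>cobd\<close>; \<open>the_elem (T' - T)\<close> is the added vertex. It puts both operators
  into the shape of \<open>row_space_if_vanishes_on_kernel\<close>.\<close>

definition incidence :: "nat set => nat set => 'k::field" where
"incidence T T' = (if T <: T' & card T' = Suc (card T) then osign (the_elem (T' - T)) T else 0)"

lemma incidence_insert:
assumes "finite T" "u ~: T"
shows "incidence T (insert u T) = (osign u T :: 'k::field)"
proof -
have "insert u T - T = {u}" using assms by auto
thus ?thesis using assms by (auto simp: incidence_def)
qed

lemma incidence_nonzero: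
assumes "incidence T T' ~= (0::'k::field)" "finite T'"
obtains u where "u ~: T" "T' = insert u T"
proof -
have *: "T <: T'" "card T' = Suc (card T)" using assms by (auto simp: incidence_def split: if_splits)
hence "card (T' - T) = 1" using assms(2) by (simp add: card_Diff_subset finite_subset)
then obtain u where "T' - T = {u}" by (auto simp: card_1_singleton_iff)
thus ?thesis using * by (intro that[of u]) auto
qed

lemma bd_eq_incidence:
fixes g :: "nat set => 'k::field"
assumes V: "finite V" "L <: Pow V" "T <: V" and g: "supp_on L (Suc (card T)) g"
shows "bd V g T = (SUM T':{T':L. card T' = Suc (card T)}. incidence T T' * g T')"
proof -
have fT: "finite T" using V finite_subset by blast
have finL: "finite L" using V by (meson finite_Pow_iff finite_subset)
have inj: "inj_on (%u. insert u T) (V - T)" by (auto simp: inj_on_def)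
have "bd V g T = (SUM u:V - T. incidence T (insert u T) * g (insert u T))"
	unfolding bd_def using fT by (intro sum.cong) (auto simp: incidence_insert)
also have "... = (SUM T':(%u. insert u T) ` (V - T). incidence T T' * g T')"
	using inj by (simp add: sum.reindex)
also have "... = (SUM T':{T':L. card T' = Suc (card T)}. incidence T T' * g T')"
proof (rule sum.mono_neutral_cong)
	show "finite {T':L. card T' = Suc (card T)}" using finL by simp
	show "finite ((%u. insert u T) ` (V - T))" using V by simp
	show "incidence T T' * g T' = 0" if T': "T' : {T':L. card T' = Suc (card T)} - (%u. insert u T) ` (V - T)" for T'
	proof (rule ccontr)
		assume "incidence T T' * g T' ~= 0"
		hence i: "incidence T T' ~= (0::'k)" by auto
		have "T' <: V" using T' V by auto
		hence "finite T'" using V(1) by (rule finite_subset)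
		with i obtain u where "u ~: T" "T' = insert u T" by (rule incidence_nonzero)
		hence "T' : (%u. insert u T) ` (V - T)" using \<open>T' \<subseteq> V\<close> by blast
		thus False using T' by blast
	qed
	show "incidence T T' * g T' = 0" if "T' : (%u. insert u T) ` (V - T) - {T':L. card T' = Suc (card T)}" for T'
	proof (rule ccontr)
		assume "incidence T T' * g T' ~= 0"
		hence "g T' ~= 0" by auto
		thus False using supp_onD[OF g, of T'] that by blast
	qed
qed simp
finally show ?thesis .
qed

lemma cobd_eq_incidence:
fixes y :: "nat set => 'k::field"
assumes L: "finite L" "down_closed L" and T': "T' : L" "finite T'"
shows "cobd y T' = (SUM T:{T:L. Suc (card T) = card T'}. incidence T T' * y T)"
proof -
have inj: "inj_on (%u. T' - {u}) T'" by (auto simp: inj_on_def)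
have "cobd y T' = (SUM u:T'. incidence (T' - {u}) T' * y (T' - {u}))"
	unfolding cobd_def
proof (intro sum.cong refl)
	fix u assume "u : T'"
	hence "incidence (T' - {u}) T' = (osign u T' :: 'k)"
		using incidence_insert[of "T' - {u}" u, where 'k='k] T' by (simp add: insert_absorb)
	thus "osign u T' * y (T' - {u}) = incidence (T' - {u}) T' * y (T' - {u})" by simp
qed
also have "... = (SUM T:(%u. T' - {u}) ` T'. incidence T T' * y T)"
	using inj by (simp add: sum.reindex)
also have "... = (SUM T:{T:L. Suc (card T) = card T'}. incidence T T' * y T)"
proof (rule sum.mono_neutral_left)
	show "finite {T:L. Suc (card T) = card T'}" using L by simp
	show "(%u. T' - {u}) ` T' <: {T:L. Suc (card T) = card T'}"
	proof
		fix T assume "T : (%u. T' - {u}) ` T'"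
		then obtain u where u: "u : T'" "T = T' - {u}" by blast
		have "T : L" using u down_closedD[OF L(2) T'(1)] by auto
		moreover have "card T' = Suc (card T)" unfolding u(2) by (rule card_insert_mem[OF T'(2) u(1)])
		ultimately show "T : {T:L. Suc (card T) = card T'}" by simp
	qed
	show "ALL T:{T:L. Suc (card T) = card T'} - (%u. T' - {u}) ` T'. incidence T T' * y T = 0"
	proof
		fix T assume T: "T : {T:L. Suc (card T) = card T'} - (%u. T' - {u}) ` T'"
		show "incidence T T' * y T = 0"
		proof (rule ccontr)
			assume "incidence T T' * y T ~= 0"
			hence "incidence T T' ~= (0::'k)" by auto
			then obtain u where u: "u ~: T" "T' = insert u T" using T'(2) by (rule incidence_nonzero)
			hence "T = T' - {u}" "u : T'" by auto
			thus False using T by blast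
		qed
	qed
qed
finally show ?thesis .
qed

text \<open>Over a field exactness at \<open>Q\<close> of the maps between \<open>R\<close>,
  \<open>Q\<close> and \<open>P\<close> is preserved by transposition.\<close>

lemma hvan_imp_cvan:
assumes V: "finite V" "L <: Pow V" "down_closed L" and h: "hvan TYPE('k::field) V L p"
shows "cvan TYPE('k) L p"
unfolding cvan_def
proof (intro allI impI)
fix g :: "nat set => 'k" assume g: "supp_on L p g" "ALL T:L. cobd g T = 0"
define P Q R where "P = {T:L. Suc (card T) = p}" and "Q = {T:L. card T = p}"
	and "R = {T:L. card T = Suc p}"
have finL: "finite L" using V by (meson finite_Pow_iff finite_subset)
have finT: "finite T" if "T : L" for T using that V by (meson PowD finite_subset subsetD)
have fin: "finite P" "finite Q" "finite R" using finL by (auto simp: P_def Q_def R_def)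
\<comment> \<open>As a functional the cocycle \<open>g\<close> kills every cycle: a cycle is a
  boundary \<open>bd y\<close>, and pairing \<open>g\<close> with \<open>bd y\<close> is pairing
  \<open>cobd g\<close> with \<open>y\<close>. So \<open>g\<close> lies in the row space of the
  incidence matrix, that is, \<open>g\<close> is a coboundary.\<close>
have *: "(SUM q:Q. g q * x q) = 0" if x: "!!T. T : P ==> (SUM q:Q. incidence T q * x q) = 0" for x
proof -
	define x' where "x' T = (if T : Q then x T else 0)" for T
	have sx: "supp_on L p x'" by (auto simp: supp_on_def x'_def Q_def)
	have xx: "(SUM q:Q. f q * x' q) = (SUM q:Q. f q * x q)" for f
		by (intro sum.cong) (auto simp: x'_def)
	have bdx: "bd V x' T = 0" for T
	proof (cases "T : P")
		case True
		hence T: "T <: V" "p = Suc (card T)" using V by (auto simp: P_def)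
		have "bd V x' T = (SUM q:Q. incidence T q * x' q)"
			using bd_eq_incidence[OF V(1,2) T(1), of x'] sx unfolding Q_def T(2) by simp
		also have "... = 0" unfolding xx using x[OF True] .
		finally show ?thesis .
	next
		case False
		show ?thesis
			unfolding bd_def
		proof (intro sum.neutral ballI)
			fix u assume u: "u : V - T"
			have "x' (insert u T) = 0"
			proof (rule ccontr)
				assume "x' (insert u T) ~= 0"
				hence i: "insert u T : L" "card (insert u T) = p" using supp_onD[OF sx, of "insert u T"] by auto
				hence "finite T" using finT[OF i(1)] by simp
				hence "T : P" using i u down_closedD[OF V(3) i(1), of T] by (auto simp: P_def)
				thus False using False by simp
			qed
			thus "osign u T * x' (insert u T) = 0" by simp
		qed
	qed
	obtain y where y: "supp_on L (Suc p) y" "!!T. x' T = bd V y T"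
		using hvanD[OF h sx bdx] by auto
	have "(SUM q:Q. g q * x' q) = (SUM q:Q. SUM r:R. y r * (incidence q r * g q))"
	proof (intro sum.cong refl)
		fix q assume q: "q : Q"
		hence qV: "q <: V" "card q = p" using V by (auto simp: Q_def)
		have "x' q = (SUM r:R. incidence q r * y r)"
			using bd_eq_incidence[OF V(1,2) qV(1), of y] y unfolding R_def qV(2) by simp
		thus "g q * x' q = (SUM r:R. y r * (incidence q r * g q))"
			by (simp add: sum_distrib_left mult_ac)
	qed
	also have "... = (SUM r:R. y r * (SUM q:Q. incidence q r * g q))"
		by (subst sum.swap) (simp add: sum_distrib_left)
	also have "... = 0"
	proof (intro sum.neutral ballI)
		fix r assume "r : R"
		hence r: "r : L" "card r = Suc p" by (auto simp: R_def)
		have "cobd g r = (SUM q:Q. incidence q r * g q)"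
			using cobd_eq_incidence[OF finL V(3) r(1) finT[OF r(1)], of g] unfolding Q_def r(2) by simp
		thus "y r * (SUM q:Q. incidence q r * g q) = 0" using g(2) r by simp
	qed
	finally show ?thesis unfolding xx .
qed
obtain y where y: "ALL q:Q. g q = (SUM T:P. y T * incidence T q)"
	using row_space_if_vanishes_on_kernel[OF fin(1,2), of incidence g, OF *] by auto
define y' where "y' T = (if T : P then y T else 0)" for T
show "EX y. (ALL T. y T ~= 0 --> T : L & Suc (card T) = p) & (ALL T:L. g T = cobd y T)"
proof (intro exI[of _ y'] conjI allI impI ballI)
	show "T : L" "Suc (card T) = p" if "y' T ~= 0" for T using that by (auto simp: y'_def P_def split: if_splits)
	fix T assume T: "T : L"
	have c: "cobd y' T = (SUM S:{S:L. Suc (card S) = card T}. incidence S T * y' S)"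
		by (rule cobd_eq_incidence[OF finL V(3) T finT[OF T]])
	show "g T = cobd y' T"
	proof (cases "card T = p")
		case True
		hence "g T = (SUM S:P. y S * incidence S T)" using y T by (simp add: Q_def)
		also have "... = (SUM S:P. incidence S T * y' S)" by (intro sum.cong) (auto simp: y'_def)
		finally show ?thesis unfolding c True P_def .
	next
		case False
		hence "g T = 0" using supp_onD[OF g(1), of T] by auto
		moreover have "cobd y' T = 0" unfolding c
			by (intro sum.neutral ballI) (use False in "auto simp: y'_def P_def")
		ultimately show ?thesis by simp
	qed
qed
qed

lemma cvan_imp_hvan:
assumes V: "finite V" "L <: Pow V" "down_closed L" and h: "cvan TYPE('k::field) L p"
shows "hvan TYPE('k) V L p"
unfolding hvan_def
proof (intro allI impI)
fix g :: "nat set => 'k" assume g: "supp_on L p g" "ALL T. bd V g T = 0"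
define P Q R where "P = {T:L. Suc (card T) = p}" and "Q = {T:L. card T = p}"
	and "R = {T:L. card T = Suc p}"
have finL: "finite L" using V by (meson finite_Pow_iff finite_subset)
have finT: "finite T" if "T : L" for T using that V by (meson PowD finite_subset subsetD)
have fin: "finite P" "finite Q" "finite R" using finL by (auto simp: P_def Q_def R_def)
have *: "(SUM q:Q. g q * x q) = 0" if x: "!!r. r : R ==> (SUM q:Q. incidence q r * x q) = 0" for x
proof -
	define x' where "x' T = (if T : Q then x T else 0)" for T
	have sx: "supp_on L p x'" by (auto simp: supp_on_def x'_def Q_def)
	have xx: "(SUM q:Q. f q * x' q) = (SUM q:Q. f q * x q)" for f
		by (intro sum.cong) (auto simp: x'_def)
	have cx: "ALL T:L. cobd x' T = 0"
	proof
		fix T assume T: "T : L"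
		have c: "cobd x' T = (SUM S:{S:L. Suc (card S) = card T}. incidence S T * x' S)"
			by (rule cobd_eq_incidence[OF finL V(3) T finT[OF T]])
		show "cobd x' T = 0"
		proof (cases "card T = Suc p")
			case True
			hence "T : R" using T by (simp add: R_def)
			thus ?thesis unfolding c True using x[of T] xx[of "%q. incidence q T"] by (simp add: Q_def)
		next
			case False
			thus ?thesis unfolding c
				by (intro sum.neutral ballI) (auto simp: x'_def Q_def)
		qed
	qed
	from h sx cx have "EX y. (ALL T. y T ~= 0 --> T : L & Suc (card T) = p) & (ALL T:L. x' T = cobd y T)"
		unfolding cvan_def by (elim allE[of _ x'] impE) simp_all
	then obtain y where y: "ALL T. y T ~= 0 --> T : L & Suc (card T) = p" "ALL T:L. x' T = cobd y T"
		by (elim exE conjE)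
	have "(SUM q:Q. g q * x' q) = (SUM q:Q. SUM r:P. y r * (incidence r q * g q))"
	proof (intro sum.cong refl)
		fix q assume q: "q : Q"
		hence qV: "q : L" "card q = p" by (auto simp: Q_def)
		have "x' q = (SUM r:P. incidence r q * y r)"
			using cobd_eq_incidence[OF finL V(3) qV(1) finT[OF qV(1)], of y] y(2) qV unfolding P_def by simp
		thus "g q * x' q = (SUM r:P. y r * (incidence r q * g q))"
			by (simp add: sum_distrib_left mult_ac)
	qed
	also have "... = (SUM r:P. y r * (SUM q:Q. incidence r q * g q))"
		by (subst sum.swap) (simp add: sum_distrib_left)
	also have "... = 0"
	proof (intro sum.neutral ballI)
		fix r assume "r : P"
		hence r: "r <: V" "p = Suc (card r)" using V by (auto simp: P_def)
		have "bd V g r = (SUM q:Q. incidence r q * g q)"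
			using bd_eq_incidence[OF V(1,2) r(1), of g] g(1) unfolding Q_def r(2) by simp
		thus "y r * (SUM q:Q. incidence r q * g q) = 0" using g(2) by simp
	qed
	finally show ?thesis unfolding xx .
qed
obtain y where y: "ALL q:Q. g q = (SUM r:R. y r * incidence q r)"
	using row_space_if_vanishes_on_kernel[OF fin(3,2), of "%r q. incidence q r" g, OF *] by auto
define y' where "y' T = (if T : R then y T else 0)" for T
have sy: "supp_on L (Suc p) y'" by (auto simp: supp_on_def y'_def R_def)
show "EX y. supp_on L (Suc p) y & (ALL T. g T = bd V y T)"
proof (intro exI[of _ y'] conjI allI sy)
	fix T show "g T = bd V y' T"
	proof (cases "T : L")
		case False
		thus ?thesis using supp_onD[OF g(1), of T] bd_outside[OF sy V(3), of T V] by auto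
	next
		case T: True
		hence TV: "T <: V" using V by auto
		show ?thesis
		proof (cases "card T = p")
			case True
			hence "g T = (SUM S:R. y S * incidence T S)" using y T by (simp add: Q_def)
			also have "... = (SUM S:R. incidence T S * y' S)" by (intro sum.cong) (auto simp: y'_def)
			finally show ?thesis using bd_eq_incidence[OF V(1,2) TV, of y'] sy unfolding R_def True by simp
		next
			case False
			hence "g T = 0" using supp_onD[OF g(1), of T] by auto
			moreover have "bd V y' T = 0"
				unfolding bd_def
			proof (intro sum.neutral ballI)
				fix u assume "u : V - T"
				hence "card (insert u T) ~= Suc p" using False finT[OF T] by simp
				thus "osign u T * y' (insert u T) = 0" by (simp add: y'_def R_def)
			qed
			ultimately show ?thesis by simp
		qed
	qed
qed
qed

section \<open>From finitely supported chains to functions on sets\<close>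

lemma lookup_boundary_map:
fixes c :: "nat set \<Rightarrow>\<^sub>0 'k::field"
assumes V: "finite V" "keys c <: Pow V"
shows "lookup (boundary_map c) T = bd V (lookup c) T"
proof -
let ?K = "keys c" and ?c = "lookup c"
have "lookup (boundary_map c) T =
	(SUM F:?K. SUM v:F. if F - {v} = T then osign v F * ?c F else 0)"
	unfolding boundary_map_def osign_def
	by (simp add: lookup_sum lookup_single when_def)
also have "... = (SUM F:?K. SUM u:V - T. if F = insert u T then osign u T * ?c F else 0)"
proof (rule sum.cong[OF refl])
	fix F assume "F : ?K"
	hence F: "F <: V" using V by auto
	hence fF: "finite F" using V(1) by (rule finite_subset)
	have set: "{v:F. F - {v} = T} = {u:V - T. F = insert u T}"
	proof (intro Collect_cong iffI conjI; elim conjE)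
		fix v assume "v : F" "F - {v} = T"
		thus "v : V - T" "F = insert v T" using F by blast+
	next
		fix v assume "v : V - T" "F = insert v T"
		thus "v : F" "F - {v} = T" by blast+
	qed
	have "(SUM v:F. if F - {v} = T then osign v F * ?c F else 0) = (\<Sum>v | v : F & F - {v} = T. osign v F * ?c F)"
		using fF by (simp add: sum.inter_filter)
	also have "... = (\<Sum>v | v : V - T & F = insert v T. osign v T * ?c F)"
		unfolding set by (intro sum.cong) auto
	also have "... = (SUM u:V - T. if F = insert u T then osign u T * ?c F else 0)"
		using V by (subst sum.inter_filter) auto
	finally show "(SUM v:F. if F - {v} = T then osign v F * ?c F else 0) =
		(SUM u:V - T. if F = insert u T then osign u T * ?c F else 0)" .
qed
also have "... = (SUM u:V - T. SUM F:?K. if F = insert u T then osign u T * ?c F else 0)"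
	by (rule sum.swap)
also have "... = bd V ?c T"
	unfolding bd_def
proof (intro sum.cong refl)
	fix u
	have "(SUM F:?K. if F = insert u T then osign u T * ?c F else 0) =
		(if insert u T : ?K then osign u T * ?c (insert u T) else 0)"
		by simp
	thus "(SUM F:?K. if F = insert u T then osign u T * ?c F else 0) = osign u T * ?c (insert u T)"
		by (simp add: in_keys_iff)
qed
finally show ?thesis .
qed

text \<open>The shift by one comes from counting vertices instead of dimensions, so the empty face
  sits at \<open>p = 0\<close>. Functions supported on the finite \<open>L\<close> and finitely
  supported chains correspond to each other.\<close>

lemma reduced_homology_vanishes_iff:
assumes V: "finite V" "L <: Pow V" and i: "i = int p - 1"
shows "reduced_homology_vanishes TYPE('k::field) L i <-> hvan TYPE('k) V L p"
proof -
have finL: "finite L" using V by (meson finite_Pow_iff finite_subset)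
have ch: "c : chains L (int m - 1) <-> supp_on L m (lookup c)" for c :: "nat set \<Rightarrow>\<^sub>0 'k" and m
	unfolding chains_def supp_on_def Ball_def in_keys_iff by simp
have keys: "keys c <: Pow V" if "supp_on L m (lookup c)" for c :: "nat set \<Rightarrow>\<^sub>0 'k" and m
	using supp_onD[OF that] V(2) unfolding in_keys_iff[symmetric] by blast
have lift: "EX c. lookup c = g" if "supp_on L m g" for g :: "nat set => 'k" and m
proof -
	have "{x. g x ~= 0} <: L" using supp_onD[OF that] by blast
	hence "finite {x. g x ~= 0}" using finL finite_subset by blast
	thus ?thesis by (intro exI[of _ "Abs_poly_mapping g"]) simp
qed
have i1: "i + 1 = int (Suc p) - 1" using i by simp
show ?thesis
proof
	assume r: "reduced_homology_vanishes TYPE('k) L i"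
	show "hvan TYPE('k) V L p"
		unfolding hvan_def
	proof (intro allI impI)
		fix g :: "nat set => 'k" assume g: "supp_on L p g" "ALL T. bd V g T = 0"
		obtain c where c: "lookup c = g" using lift[OF g(1)] by blast
		have cc: "c : chains L i" using g ch c i by simp
		have "boundary_map c = 0"
			using lookup_boundary_map[OF V(1) keys[of p c]] g c by (intro poly_mapping_eqI) simp
		with r cc obtain w where w: "w : chains L (i + 1)" "c = boundary_map w"
			unfolding reduced_homology_vanishes_def by blast
		have sw: "supp_on L (Suc p) (lookup w)" using w(1) unfolding i1 ch .
		have "g T = bd V (lookup w) T" for T
			using lookup_boundary_map[OF V(1) keys[OF sw], of T] w(2) c by simp
		with sw show "EX y. supp_on L (Suc p) y & (ALL T. g T = bd V y T)"
			by (intro exI[of _ "lookup w"]) simp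
	qed
next
	assume r: "hvan TYPE('k) V L p"
	show "reduced_homology_vanishes TYPE('k) L i"
		unfolding reduced_homology_vanishes_def
	proof (intro ballI impI)
		fix z :: "nat set \<Rightarrow>\<^sub>0 'k" assume z: "z : chains L i" "boundary_map z = 0"
		have sz: "supp_on L p (lookup z)" using z ch i by simp
		have "bd V (lookup z) T = 0" for T
			using lookup_boundary_map[OF V(1) keys[OF sz], of T] z(2) by simp
		then obtain y where y: "supp_on L (Suc p) y" "ALL T. lookup z T = bd V y T"
			using hvanD[OF r sz] by auto
		obtain w where w: "lookup w = y" using lift[OF y(1)] by blast
		have "w : chains L (i + 1)" unfolding i1 ch using w y by simp
		moreover have "z = boundary_map w"
			using lookup_boundary_map[OF V(1) keys[of "Suc p" w]] y w by (intro poly_mapping_eqI) simp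
		ultimately show "EX w:chains L (i + 1). z = boundary_map w" by blast
	qed
qed
qed

subsection \<open>Euler characteristics\<close>

lemma sum_fun_apply: "sum f A x = (SUM a:A. f a x)"
by (induction A rule: infinite_finite_induct) auto

lemma vector_space_fun: "vector_space (%(c::'k::field) (f::'x => 'k) x. c * f x)"
by unfold_locales (auto simp: algebra_simps fun_eq_iff)

definition cocycles :: "nat set set => nat => (nat set => 'k::field) set" where
"cocycles L p = {g. supp_on L p g & (ALL T:L. cobd g T = 0)}"

text \<open>Cutting off at \<open>L\<close> makes the coboundary a linear map from cochains on
  \<open>L\<close> to cochains on \<open>L\<close>, so that kernel and image dimensions can be
  compared.\<close>

definition cobd_on :: "nat set set => (nat set => 'k::field) => nat set => 'k" where
"cobd_on L g T = (if T : L then cobd g T else 0)"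

definition cobs :: "nat set set => nat => (nat set => 'k::field) set" where
"cobs L p = {cobd_on L y | y. ALL T. y T ~= 0 --> T : L & Suc (card T) = p}"

abbreviation (input) fscale :: "'k::field => ('x => 'k) => 'x => 'k" where
"fscale \<equiv> %c f x. c * f x"

lemma cvan_iff: "cvan TYPE('k::field) L p <-> (cocycles L p :: (nat set => 'k) set) <: cobs L p"
proof
assume c: "cvan TYPE('k) L p"
show "(cocycles L p :: (nat set => 'k) set) <: cobs L p"
proof
	fix g :: "nat set => 'k" assume "g : cocycles L p"
	hence g: "supp_on L p g" "ALL T:L. cobd g T = 0" by (auto simp: cocycles_def)
	with c have "EX y. (ALL T. y T ~= 0 --> T : L & Suc (card T) = p) & (ALL T:L. g T = cobd y T)"
		unfolding cvan_def by (elim allE[of _ g] impE) simp_all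
	then obtain y where y: "ALL T. y T ~= 0 --> T : L & Suc (card T) = p" "ALL T:L. g T = cobd y T"
		by (elim exE conjE)
	have "g = cobd_on L y"
	proof
		fix T show "g T = cobd_on L y T"
			using y(2) supp_onD[OF g(1), of T] by (cases "T : L") (auto simp: cobd_on_def)
	qed
	thus "g : cobs L p" unfolding cobs_def using y(1) by (intro CollectI exI[of _ y]) simp
qed
next
assume c: "(cocycles L p :: (nat set => 'k) set) <: cobs L p"
show "cvan TYPE('k) L p"
	unfolding cvan_def
proof (intro allI impI)
	fix g :: "nat set => 'k" assume "supp_on L p g" "ALL T:L. cobd g T = 0"
	hence "g : cobs L p" using c by (auto simp: cocycles_def)
	then obtain y where "ALL T. y T ~= 0 --> T : L & Suc (card T) = p" "g = cobd_on L y"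
		unfolding cobs_def by (elim CollectE exE conjE)
	thus "EX y. (ALL T. y T ~= 0 --> T : L & Suc (card T) = p) & (ALL T:L. g T = cobd y T)"
		by (intro exI[of _ y]) (simp add: cobd_on_def)
qed
qed

lemma cobd_add: "cobd (%T. f T + g T) T = cobd f T + cobd g T"
by (simp add: cobd_def distrib_left sum.distrib)

lemma cobd_scale: "cobd (%T. c * f T) T = c * cobd f T"
by (simp add: cobd_def sum_distrib_left mult_ac)

lemma cobd_zero: "cobd (%_. 0) T = 0"
by (simp add: cobd_def)

locale finite_complex =
fixes L :: "nat set set"
assumes finL: "finite L" and downL: "down_closed L" and fin_face: "!!T. T : L ==> finite T"
begin

definition cochain :: "nat => (nat set => 'k::field) set" where
"cochain p = {g. supp_on L p g}"

lemma fs: "vector_space (fscale :: 'k::field => (nat set => 'k) => _)" by (rule vector_space_fun)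

lemma sub_cochain: "module.subspace fscale (cochain p :: (nat set => 'k::field) set)"
proof -
interpret vector_space "fscale :: 'k => (nat set => 'k) => _" by (rule fs)
show ?thesis
proof (rule subspaceI)
	show "0 : (cochain p :: (nat set => 'k) set)" by (simp add: cochain_def supp_on_def)
	fix f g :: "nat set => 'k" assume "f : cochain p" "g : cochain p"
	hence s: "supp_on L p f" "supp_on L p g" by (auto simp: cochain_def)
	have "supp_on L p (f + g)" unfolding supp_on_def
	proof (intro allI impI)
		fix T assume "(f + g) T ~= 0"
		hence "f T ~= 0 \<or> g T ~= 0" by auto
		thus "T : L & card T = p" using supp_onD[OF s(1), of T] supp_onD[OF s(2), of T] by blast
	qed
	thus "f + g : cochain p" by (simp add: cochain_def)
next
	fix c :: 'k and f :: "nat set => 'k" assume "f : cochain p"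
	thus "(%x. c * f x) : cochain p" by (simp add: cochain_def supp_on_def)
qed
qed

lemma linear_cobd_on: "Vector_Spaces.linear (fscale :: 'k::field => (nat set => 'k) => _) fscale (cobd_on L)"
proof -
show ?thesis
	unfolding Vector_Spaces.linear_iff
proof (intro conjI allI fs)
	fix f g :: "nat set => 'k" show "cobd_on L (f + g) = cobd_on L f + cobd_on L g"
		using cobd_add[of f g] by (auto simp: cobd_on_def plus_fun_def)
next
	fix c :: 'k and f :: "nat set => 'k" show "cobd_on L (%x. c * f x) = (%x. c * cobd_on L f x)"
		using cobd_scale[of c f] by (auto simp: cobd_on_def)
qed
qed

lemma cobs_Suc: "cobs L (Suc p) = cobd_on L ` cochain p"
by (auto simp: cobs_def cochain_def supp_on_def)

lemma cobs_0: "cobs L 0 = {0 :: nat set => 'k::field}"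
proof
show "cobs L 0 <: {0 :: nat set => 'k}"
proof
	fix g :: "nat set => 'k" assume "g : cobs L 0"
	then obtain y :: "nat set => 'k" where y: "ALL T. y T = 0" "g = cobd_on L y"
		unfolding cobs_def by auto
	thus "g : {0}" by (auto simp: cobd_on_def cobd_def fun_eq_iff)
qed
show "{0 :: nat set => 'k} <: cobs L 0"
	unfolding cobs_def by (auto intro!: exI[of _ "%_. 0"] simp: cobd_on_def cobd_def fun_eq_iff)
qed

lemma sub_cobs: "module.subspace fscale (cobs L p :: (nat set => 'k::field) set)"
proof (cases p)
case 0
interpret vector_space "fscale :: 'k => (nat set => 'k) => _" by (rule fs)
show ?thesis unfolding 0 cobs_0 by (rule subspace_single_0)
next
case (Suc m)
interpret l: Vector_Spaces.linear "fscale :: 'k => (nat set => 'k) => _" fscale "cobd_on L" by (rule linear_cobd_on)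
show ?thesis unfolding Suc cobs_Suc by (rule l.subspace_image[OF sub_cochain])
qed

lemma cocycles_eq: "cocycles L p = {g:cochain p. cobd_on L g = (0 :: nat set => 'k::field)}"
by (auto simp: cocycles_def cochain_def cobd_on_def fun_eq_iff)

lemma sub_cocycles: "module.subspace fscale (cocycles L p :: (nat set => 'k::field) set)"
proof -
interpret l: Vector_Spaces.linear "fscale :: 'k => (nat set => 'k) => _" fscale "cobd_on L" by (rule linear_cobd_on)
show ?thesis unfolding cocycles_eq
	using sub_cochain[of p, where 'k='k] by (auto simp: l.vs1.subspace_def l.add l.scale)
qed

lemma cobs_subset: "cobs L p <: (cocycles L p :: (nat set => 'k::field) set)"
proof
fix g :: "nat set => 'k" assume "g : cobs L p"
then obtain y :: "nat set => 'k" where y: "ALL T. y T ~= 0 --> T : L & Suc (card T) = p" "g = cobd_on L y"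
	unfolding cobs_def by (elim CollectE exE conjE)
have "cobd g T = 0" if T: "T : L" for T
proof -
	have "cobd g T = cobd (cobd y) T"
		unfolding cobd_def[of g T] cobd_def[of "cobd y" T]
	proof (intro sum.cong refl)
		fix u assume "u : T"
		have "T - {u} : L" using down_closedD[OF downL T] by auto
		thus "osign u T * g (T - {u}) = osign u T * cobd y (T - {u})" by (simp add: y(2) cobd_on_def)
	qed
	thus ?thesis using cobd_cobd[OF fin_face[OF T]] by simp
qed
moreover have "supp_on L p g" unfolding supp_on_def
proof (intro allI impI)
	fix T assume "g T ~= 0"
	hence T: "T : L" "cobd y T ~= 0" by (auto simp: y(2) cobd_on_def split: if_splits)
	then obtain u where "u : T" "osign u T * y (T - {u}) ~= 0"
		unfolding cobd_def by (metis (mono_tags, lifting) sum.neutral)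
	hence u: "u : T" "Suc (card (T - {u})) = p" using y(1) by auto
	thus "T : L & card T = p" using T card_insert_mem[OF fin_face[OF T(1)] u(1)] by metis
qed
ultimately show "g : cocycles L p" by (simp add: cocycles_def)
qed

definition unit_fun :: "nat set => nat set => 'k::field" where
"unit_fun S = (%T. if T = S then 1 else 0)"

lemma unit_fun_apply: "unit_fun S T = (if T = S then 1 else 0)"
by (simp add: unit_fun_def)

lemma inj_unit_fun: "inj_on (unit_fun :: nat set => nat set => 'k::field) A"
proof (rule inj_onI)
fix S T assume "(unit_fun S :: nat set => 'k) = unit_fun T"
hence "(unit_fun S S :: 'k) = unit_fun T S" by (rule fun_cong)
thus "S = T" by (simp add: unit_fun_def split: if_splits)
qed

lemma unit_fun_sum:
fixes c :: "(nat set => 'k) => 'k::field"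
assumes "finite A"
shows "(SUM x:unit_fun ` A. (%T. c x * x T)) = (%T. if T : A then c (unit_fun T) else 0)"
proof
fix T
have "(SUM x:unit_fun ` A. (%T. c x * x T)) T = (SUM x:unit_fun ` A. c x * x T)"
	by (rule sum_fun_apply)
also have "... = (SUM S:A. c (unit_fun S) * (if T = S then 1 else 0))"
	by (subst sum.reindex[OF inj_unit_fun]) (simp add: unit_fun_apply)
also have "... = (if T : A then c (unit_fun T) else 0)"
	using assms by (simp add: if_distrib[of "%x. _ * x"] cong: if_cong)
finally show "(SUM x:unit_fun ` A. (%T. c x * x T)) T = ..." .
qed

abbreviation "faces p \<equiv> {T:L. card T = p}"

lemma cochain_span:
fixes z :: "nat set => 'k::field"
assumes "z : cochain p"
shows "EX c. z = (SUM x:unit_fun ` faces p. fscale (c x) x)"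
proof (intro exI ext)
let ?c = "%x. z (inv_into (faces p) unit_fun x)"
fix T show "z T = (SUM x:unit_fun ` faces p. fscale (?c x) x) T"
	using assms finL supp_onD[of L p z T]
	by (subst unit_fun_sum) (auto simp: cochain_def inv_into_f_f[OF inj_unit_fun])
qed

lemma dim_cochain: "has_quot_dim fscale (cochain p :: (nat set => 'k::field) set) {0} (card (faces p))"
proof -
interpret vector_space "fscale :: 'k => (nat set => 'k) => _" by (rule fs)
have fin: "finite (faces p)" using finL by simp
show ?thesis
proof (rule has_quot_dimI[of "{0}" "unit_fun ` faces p"])
	show "unit_fun ` faces p <: (cochain p :: (nat set => 'k) set)"
		by (auto simp: cochain_def supp_on_def unit_fun_def split: if_splits)
	show "card (unit_fun ` faces p :: (nat set => 'k) set) = card (faces p)" by (rule card_image[OF inj_unit_fun])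
	fix c :: "(nat set => 'k) => 'k" assume "(SUM x:unit_fun ` faces p. fscale (c x) x) : {0}"
	hence e: "(%T. if T : faces p then c (unit_fun T) else 0) = 0" unfolding unit_fun_sum[OF fin] by simp
	show "ALL x:unit_fun ` faces p. c x = 0"
	proof
		fix x :: "nat set => 'k" assume "x : unit_fun ` faces p"
		then obtain T where "T : faces p" "x = unit_fun T" by blast
		thus "c x = 0" using fun_cong[OF e, of T] by simp
	qed
next
	fix z :: "nat set => 'k" assume "z : cochain p"
	from cochain_span[OF this] show "EX c. z - (SUM x:unit_fun ` faces p. fscale (c x) x) : {0}" by simp
qed (use fin in "auto simp: subspace_single_0")
qed

lemma dim_exists:
assumes "module.subspace fscale (Z :: (nat set => 'k::field) set)" "module.subspace fscale B" "Z <: cochain p"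
shows "EX h. has_quot_dim fscale Z B h"
proof -
interpret vector_space "fscale :: 'k => (nat set => 'k) => _" by (rule fs)
show ?thesis
	by (rule quot_dim_exists[OF assms(1,2), of "unit_fun ` faces p"])
		(use finL assms(3) cochain_span in auto)
qed

lemma cohomology_dim_exists:
"EX h. has_quot_dim fscale (cocycles L p :: (nat set => 'k::field) set) (cobs L p) h"
by (rule dim_exists[OF sub_cocycles sub_cobs, of _ p]) (auto simp: cocycles_eq)

text \<open>The filtration of all cochains by cocycles and coboundaries; the top quotient is
  isomorphic to the coboundaries one degree higher, whence \<open>r'\<close>.\<close>

lemma euler_step:
assumes h: "has_quot_dim fscale (cocycles L p :: (nat set => 'k::field) set) (cobs L p) h"
	and r: "has_quot_dim fscale (cobs L p :: (nat set => 'k) set) {0} r"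
	and r': "has_quot_dim fscale (cobs L (Suc p) :: (nat set => 'k) set) {0} r'"
shows "card (faces p) = r' + h + r"
proof -
interpret vector_space_pair "fscale :: 'k => (nat set => 'k) => _" "fscale :: 'k => (nat set => 'k) => _"
	by (intro vector_space_pair.intro fs)
obtain s where s: "has_quot_dim fscale (cochain p :: (nat set => 'k) set) (cocycles L p) s"
	using dim_exists[OF sub_cochain sub_cocycles order_refl] by blast
have "s = r'"
	by (rule quot_dim_image[OF s[unfolded cocycles_eq] sub_cochain linear_cobd_on r'[unfolded cobs_Suc]])
have z: "vs1.subspace {0}" by (rule vs1.subspace_single_0)
have "{0} <: (cobs L p :: (nat set => 'k) set)"
	using vs1.subspace_0[OF sub_cobs] by simp
hence hr: "has_quot_dim fscale (cocycles L p :: (nat set => 'k) set) {0} (h + r)"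
	by (rule vs1.quot_dim_add[OF h r sub_cocycles sub_cobs z _ cobs_subset])
have "{0} <: (cocycles L p :: (nat set => 'k) set)"
	using vs1.subspace_0[OF sub_cocycles] by simp
hence "has_quot_dim fscale (cochain p :: (nat set => 'k) set) {0} (s + (h + r))"
	by (rule vs1.quot_dim_add[OF s hr sub_cochain sub_cocycles z]) (auto simp: cocycles_eq)
hence "card (faces p) = s + (h + r)"
	by (rule vs1.quot_dim_unique[OF dim_cochain _ sub_cochain z])
with \<open>s = r'\<close> show ?thesis by simp
qed

theorem euler_single:
assumes van: "!!p. p ~= p0 ==> cvan TYPE('k::field) L p"
	and h: "has_quot_dim fscale (cocycles L p0 :: (nat set => 'k) set) (cobs L p0) h"
shows "(SUM T:L. (-1) ^ card T) = ((-1) ^ p0 * int h :: int)"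
proof -
interpret vector_space "fscale :: 'k => (nat set => 'k) => _" by (rule fs)
have z: "subspace {0}" by (rule subspace_single_0)
have "EX r. has_quot_dim fscale (cobs L p :: (nat set => 'k) set) {0} r" for p
	by (rule dim_exists[OF sub_cobs z, of _ p]) (use cobs_subset cocycles_eq in blast)
then obtain r where r: "!!p. has_quot_dim fscale (cobs L p :: (nat set => 'k) set) {0} (r p)" by metis
define H where "H p = (if p = p0 then h else 0)" for p
have H: "has_quot_dim fscale (cocycles L p :: (nat set => 'k) set) (cobs L p) (H p)" for p
proof (cases "p = p0")
	case True with h show ?thesis by (simp add: H_def)
next
	case False
	obtain k where k: "has_quot_dim fscale (cocycles L p :: (nat set => 'k) set) (cobs L p) k"
		using cohomology_dim_exists by blast
	have "k = 0" using van[OF False] unfolding cvan_iff quot_dim_0_iff[OF k sub_cocycles sub_cobs] .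
	with k False show ?thesis by (simp add: H_def)
qed
have step: "card (faces p) = r (Suc p) + H p + r p" for p by (rule euler_step[OF H r r])
have r0: "r 0 = 0"
	using quot_dim_0_iff[OF r[of 0] sub_cobs z] cobs_0[where 'k='k] by simp
\<comment> \<open>No face has \<open>N\<close> vertices, so \<open>step\<close> forces
  \<open>r N = 0\<close>, and the telescoping sum of ranks closes without a remainder. Including
  \<open>p0\<close> keeps the exceptional degree inside the range.\<close>
define N where "N = Suc (Max (insert p0 (card ` L)))"
have N: "p0 < N" "!!T. T : L ==> card T < N"
	using finL by (auto simp: N_def less_Suc_eq_le)
have rN: "r N = 0"
proof -
	have "faces N = {}" using N(2) by force
	hence "card (faces N) = 0" by (simp only: card.empty)
	thus ?thesis using step[of N] by linarith
qed
have "(\<Sum>p<m. (-1) ^ p * int (card (faces p))) = (\<Sum>p<m. (-1) ^ p * int (H p)) - (-1) ^ m * int (r m)" for m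
	by (induction m) (auto simp: r0 step algebra_simps)
hence e: "(\<Sum>p<N. (-1) ^ p * int (card (faces p))) = (\<Sum>p<N. (-1) ^ p * int (H p))" using rN by simp
have "(\<Sum>p<N. (-1) ^ p * int (H p)) = (-1) ^ p0 * int h"
proof -
	have "(\<Sum>p<N. (-1) ^ p * int (H p)) = (\<Sum>p<N. if p = p0 then (-1) ^ p * int h else 0)"
		by (intro sum.cong) (auto simp: H_def)
	thus ?thesis using N(1) by simp
qed
moreover have "(SUM T:L. (-1) ^ card T) = (\<Sum>p<N. (-1) ^ p * int (card (faces p)))"
proof -
	have "(SUM T:L. (-1) ^ card T) = (SUM p:{..<N}. \<Sum>T | T : L & card T = p. (-1) ^ card T :: int)"
		by (rule sum.group[symmetric]) (use finL N in auto)
	also have "... = (\<Sum>p<N. (-1) ^ p * int (card (faces p)))"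
		by (intro sum.cong) auto
	finally show ?thesis .
qed
ultimately show ?thesis using e by simp
qed

end

section \<open>Counting faces through the Euler characteristics of links\<close>

text \<open>The left side is the \<open>card F\<close>-fold forward difference at \<open>x\<close>
  of the polynomial that takes \<open>y\<close> to \<open>y gchoose j\<close>. Each new element of
  \<open>F\<close> takes one difference and lowers the index by one, until nothing is left.\<close>

lemma alternating_gbinomial_sum:
fixes x :: real
assumes "finite F"
shows "(SUM G:Pow F. (-1) ^ card (F - G) * ((x + real (card G)) gchoose j)) =
	(if card F <= j then x gchoose (j - card F) else 0)"
using assms
proof (induction F arbitrary: x rule: finite_induct)
case empty
thus ?case by simp
next
case (insert a F)
let ?S = "%x. SUM G:Pow F. (-1) ^ card (F - G) * ((x + real (card G)) gchoose j)"
have disj: "Pow F Int insert a ` Pow F = {}" using insert by auto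
have inj: "inj_on (insert a) (Pow F)"
proof (rule inj_onI)
	fix x y assume "x : Pow F" "y : Pow F" "insert a x = insert a y"
	thus "x = y" using insert.hyps(2) insert_ident[of a x y] by blast
qed
have "(SUM G:Pow (insert a F). (-1) ^ card (insert a F - G) * ((x + real (card G)) gchoose j)) =
	(SUM G:Pow F. (-1) ^ card (insert a F - G) * ((x + real (card G)) gchoose j)) +
	(SUM G:Pow F. (-1) ^ card (insert a F - insert a G) * ((x + real (card (insert a G))) gchoose j))"
	unfolding Pow_insert using insert disj inj by (simp add: sum.union_disjoint sum.reindex)
also have "(SUM G:Pow F. (-1) ^ card (insert a F - G) * ((x + real (card G)) gchoose j)) = - ?S x"
	unfolding sum_negf[symmetric]
proof (intro sum.cong refl)
	fix G assume G: "G : Pow F"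
	hence "insert a F - G = insert a (F - G)" "a ~: F - G" using insert by auto
	thus "(-1) ^ card (insert a F - G) * ((x + real (card G)) gchoose j) =
		 - ((-1) ^ card (F - G) * ((x + real (card G)) gchoose j))" using insert by simp
qed
also have "(SUM G:Pow F. (-1) ^ card (insert a F - insert a G) * ((x + real (card (insert a G))) gchoose j)) = ?S (x + 1)"
proof (intro sum.cong refl)
	fix G assume G: "G : Pow F"
	hence "insert a F - insert a G = F - G" "a ~: G" "finite G" using insert finite_subset by auto
	thus "(-1) ^ card (insert a F - insert a G) * ((x + real (card (insert a G))) gchoose j) =
		 (-1) ^ card (F - G) * ((x + 1 + real (card G)) gchoose j)" by (simp add: add_ac)
qed
also have "- ?S x + ?S (x + 1) = (if card (insert a F) <= j then x gchoose (j - card (insert a F)) else 0)"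
proof (cases "card F < j")
	case True
	then obtain m where m: "j - card F = Suc m" "j - Suc (card F) = m" by (metis Suc_diff_Suc)
	show ?thesis using True insert by (simp add: insert.IH m gbinomial_Suc_Suc)
next
	case False
	thus ?thesis using insert by (simp add: insert.IH)
qed
finally show ?case .
qed

text \<open>The empty face counts with sign \<open>+1\<close>, so this is the negative of the usual
  reduced Euler characteristic; it matches the vertex-counting index \<open>p\<close>.\<close>

definition euler_char :: "nat set set => int" where
"euler_char L = (SUM T:L. (-1) ^ card T)"

text \<open>Double counting of pairs of a face \<open>G\<close> inside a face \<open>F\<close>: for
  fixed \<open>F\<close> the sum over \<open>G\<close> is a finite difference, which leaves only
  faces with at most \<open>j\<close> vertices.\<close>

lemma sum_euler_char_links:
fixes k :: real
assumes V: "finite V" "Dl <: Pow V" and down: "down_closed Dl"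
	and skeleton: "!!G. G <: V ==> card G <= j ==> G : Dl"
shows "(SUM G:Dl. real_of_int (euler_char (link Dl G)) * ((real (card G) - k) gchoose j)) =
	(real (card V) - k) gchoose j"
proof -
let ?phi = "%G::nat set. (- k + real (card G)) gchoose j"
have fin: "finite Dl" using V by (meson finite_Pow_iff finite_subset)
have finF: "finite F" if "F : Dl" for F using that V by (meson PowD finite_subset subsetD)
have link: "euler_char (link Dl G) = (\<Sum>F | F : Dl & G <: F. (-1) ^ card (F - G))" if "G : Dl" for G
	unfolding euler_char_def
	by (rule sum.reindex_bij_witness[of _ "%F. F - G" "%T. T Un G"])
		(auto simp: link_def Un_Diff Diff_triv Un_absorb2 Un_commute)
have "(SUM G:Dl. real_of_int (euler_char (link Dl G)) * ((real (card G) - k) gchoose j)) =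
	(SUM G:Dl. \<Sum>F | F : Dl & G <: F. (-1) ^ card (F - G) * ?phi G)"
	by (intro sum.cong) (auto simp: link sum_distrib_right)
also have "... = (SUM G:Dl. SUM F:Dl. if G <: F then (-1) ^ card (F - G) * ?phi G else 0)"
	by (rule sum.cong[OF refl]) (rule sum.inter_filter[OF fin])
also have "... = (SUM F:Dl. SUM G:Dl. if G <: F then (-1) ^ card (F - G) * ?phi G else 0)"
	by (rule sum.swap)
also have "... = (SUM F:Dl. SUM G:Pow F. (-1) ^ card (F - G) * ?phi G)"
proof (rule sum.cong[OF refl])
	fix F assume F: "F : Dl"
	hence "{G:Dl. G <: F} = Pow F" using down_closedD[OF down] by auto
	thus "(SUM G:Dl. if G <: F then (-1) ^ card (F - G) * ?phi G else 0) = (SUM G:Pow F. (-1) ^ card (F - G) * ?phi G)"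
		using fin by (simp add: sum.inter_filter[symmetric])
qed
also have "... = (SUM F:Dl. if card F <= j then (- k) gchoose (j - card F) else 0)"
	by (intro sum.cong refl alternating_gbinomial_sum finF)
also have "... = (\<Sum>F | F : Dl & card F <= j. (- k) gchoose (j - card F))"
	using fin by (simp add: sum.inter_filter)
\<comment> \<open>The surviving faces are all small subsets of \<open>V\<close>, so the complex
  disappears from the sum and Vandermonde's identity evaluates it.\<close>
also have "{F. F : Dl & card F <= j} = {F. F <: V & card F <= j}"
	using V skeleton by auto
also have "(\<Sum>F | F <: V & card F <= j. (- k) gchoose (j - card F)) =
	 (\<Sum>i\<le>j. \<Sum>F | F : {F. F <: V & card F <= j} & card F = i. (- k) gchoose (j - card F))"
	by (rule sum.group[symmetric]) (use V in auto)
also have "... = (\<Sum>i\<le>j. (real (card V) gchoose i) * ((- k) gchoose (j - i)))"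
proof (intro sum.cong refl)
	fix i assume i: "i : {..j}"
	hence "{F. F : {F. F <: V & card F <= j} & card F = i} = {F. F <: V & card F = i}" by auto
	thus "(\<Sum>F | F : {F. F <: V & card F <= j} & card F = i. (- k) gchoose (j - card F)) =
		(real (card V) gchoose i) * ((- k) gchoose (j - i))"
		using V by (simp add: n_subsets binomial_gbinomial)
qed
also have "... = (real (card V) + (- k)) gchoose j"
	using gbinomial_Vandermonde[of "real (card V)" "- k" j] by (simp add: atMost_atLeast0)
finally show ?thesis by simp
qed

section \<open>Face numbers of Buchsbaum complexes with linear resolution\<close>

lemma down_closed_link:
assumes "down_closed Dl" shows "down_closed (link Dl F)"
unfolding down_closed_def
proof (intro ballI allI impI)
fix A B assume "A : link Dl F" "B <: A"
hence "A Int F = {}" "A Un F : Dl" "B Un F <: A Un F" by (auto simp: link_def)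
moreover from this have "B Un F : Dl" using down_closedD[OF assms] by blast
ultimately show "B : link Dl F" using \<open>B \<subseteq> A\<close> by (auto simp: link_def)
qed

text \<open>The combinatorial content of the ring-theoretic hypotheses: \<open>buchs\<close> is the
  vanishing of link homology, \<open>linear\<close> is a linear resolution read through Hochster's
  formula on induced subcomplexes, and \<open>skeleton\<close> says that generators of the ideal
  have degree at least \<open>q\<close>.\<close>

locale linear_buchsbaum =
fixes K :: "'k::field itself" and V :: "nat set" and Dl :: "nat set set" and d q :: nat
assumes V: "finite V" "V ~= {}" "Dl <: Pow V" and down: "down_closed Dl"
	and q: "2 <= q" "q <= d"
	and dim: "!!F. F : Dl ==> card F <= d"
	and buchs: "!!F p. F : Dl ==> F ~= {} ==> p < d - card F ==> hvan TYPE('k) V (link Dl F) p"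
	and linear: "!!W p. W <: V ==> q <= p ==> hvan TYPE('k) V {F:Dl. F <: W} p"
	and skeleton: "!!G. G <: V ==> card G <= q - 1 ==> G : Dl"
begin

text \<open>Linearity is inherited by links, one vertex \<open>v\<close> at a time: deleting
  \<open>v\<close> from the link in \<open>W\<close> gives the link in \<open>W - {v}\<close>, so
  the exact sequence bounds the link of the larger face by degrees \<open>p\<close> and
  \<open>Suc p\<close>. The induction therefore runs over all \<open>W\<close> at once.\<close>

lemma hvan_link_linear:
assumes "finite F" "F <: W" "W <: V" "q <= p"
shows "hvan TYPE('k) V (link {G:Dl. G <: W} F) p"
using assms
proof (induction F arbitrary: W p rule: finite_induct)
case empty
have "link {G:Dl. G <: W} {} = {G:Dl. G <: W}" by (auto simp: link_def)
thus ?case using linear empty by simp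
next
case (insert v F)
let ?L = "link {G:Dl. G <: W} F"
interpret complex_vertex V ?L v
proof
	show "finite V" "?L <: Pow V" "v : V" using V insert by (auto simp: link_def)
	have "down_closed {G:Dl. G <: W}" using down by (auto simp: down_closed_def)
	thus "down_closed ?L" by (rule down_closed_link)
qed
have "del ?L v = link {G:Dl. G <: W - {v}} F"
	using insert by (auto simp: del_def link_def)
moreover have "F <: W - {v}" "W - {v} <: V" using insert by auto
ultimately have "hvan TYPE('k) V (del ?L v) p" using insert.IH[of "W - {v}" p] insert.prems(3) by simp
moreover have "hvan TYPE('k) V ?L (Suc p)" using insert by simp
ultimately have "hvan TYPE('k) V (link ?L {v}) p" by (rule hvan_link_from_del[rotated])
moreover have "link ?L {v} = link {G:Dl. G <: W} (insert v F)"
	using insert by (auto simp: link_def)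
ultimately show ?case by simp
qed

lemma link_complex:
shows "link Dl F <: Pow V" "down_closed (link Dl F)" "finite_complex (link Dl F)"
proof -
show s: "link Dl F <: Pow V" using V by (auto simp: link_def)
show dl: "down_closed (link Dl F)" using down by (rule down_closed_link)
show "finite_complex (link Dl F)"
proof
	show "finite (link Dl F)" using s V by (meson finite_Pow_iff finite_subset)
	show "finite T" if "T : link Dl F" for T using that s V by (meson PowD finite_subset subsetD)
qed (rule dl)
qed

lemma cvan_link:
assumes F: "F : Dl" "F ~= {}" and p: "p < d - card F \<or> q <= p"
shows "cvan TYPE('k) (link Dl F) p"
proof -
have "hvan TYPE('k) V (link Dl F) p"
proof (cases "q <= p")
	case True
	have "{G:Dl. G <: V} = Dl" using V by auto
	thus ?thesis using hvan_link_linear[of F V p] True F V finite_subset[of F V] by auto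
next
	case False
	thus ?thesis using buchs[OF F] p by simp
qed
thus ?thesis by (rule hvan_imp_cvan[OF V(1) link_complex(1,2)])
qed

text \<open>Linearity settles the degrees from \<open>q\<close> on. Below \<open>q - 1\<close> the
  complex contains every set with one more vertex, so any vertex serves as the apex of a
  cone.\<close>

lemma cvan_complex:
assumes "p ~= q - 1"
shows "cvan TYPE('k) Dl p"
proof -
have "hvan TYPE('k) V Dl p"
proof (cases "q <= p")
	case True
	have "{G:Dl. G <: V} = Dl" using V by auto
	thus ?thesis using linear[of V p] True by simp
next
	case False
	obtain u where u: "u : V" using V by auto
	show ?thesis
	proof (rule hvanI_contracting[OF V(1,3) u down])
		fix T assume "T : Dl" "card T = p"
		thus "insert u T : Dl" using False assms V u
			by (intro skeleton) (auto intro!: order_trans[OF card_insert_le_m1])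
	qed
qed
thus ?thesis by (rule hvan_imp_cvan[OF V(1,3) down])
qed

text \<open>In the link of \<open>F\<close> the Buchsbaum condition covers
  \<open>p < d - card F\<close> and linearity covers \<open>q <= p\<close>. These ranges meet when
  \<open>card F <= d - q\<close>; for \<open>card F = d - q + 1\<close> they miss only
  \<open>p = q - 1\<close>, which fixes the sign; for \<open>card F = d\<close> the link is
  \<open>{{}}\<close>.\<close>

lemma euler_char_links:
shows "F : Dl ==> F ~= {} ==> card F <= d - q ==> euler_char (link Dl F) = 0"
	and "F : Dl ==> card F = d - q + 1 ==> 0 <= (-1) ^ (q - 1) * euler_char (link Dl F)"
	and "F : Dl ==> card F = d ==> euler_char (link Dl F) = 1"
proof -
assume F: "F : Dl" "F ~= {}" "card F <= d - q"
interpret finite_complex "link Dl F" by (rule link_complex(3))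
have c: "cvan TYPE('k) (link Dl F) p" for p by (rule cvan_link[OF F(1,2)]) (use F q in linarith)
obtain h where h: "has_quot_dim fscale (cocycles (link Dl F) 0 :: (nat set => 'k) set) (cobs (link Dl F) 0) h"
	using cohomology_dim_exists by blast
have "h = 0"
	using c[of 0] unfolding cvan_iff vector_space.quot_dim_0_iff[OF fs h sub_cocycles sub_cobs] .
thus "euler_char (link Dl F) = 0"
	unfolding euler_char_def using euler_single[OF c h] by simp
next
assume F: "F : Dl" "card F = d - q + 1"
interpret finite_complex "link Dl F" by (rule link_complex(3))
have F0: "F ~= {}" using F by auto
have c: "cvan TYPE('k) (link Dl F) p" if "p ~= q - 1" for p
	by (rule cvan_link[OF F(1) F0]) (use F q that in linarith)
obtain h where h: "has_quot_dim fscale (cocycles (link Dl F) (q - 1) :: (nat set => 'k) set) (cobs (link Dl F) (q - 1)) h"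
	using cohomology_dim_exists by blast
have "euler_char (link Dl F) = (-1) ^ (q - 1) * int h"
	unfolding euler_char_def by (rule euler_single[OF c h])
thus "0 <= (-1) ^ (q - 1) * euler_char (link Dl F)"
	by (cases "even (q - 1)") auto
next
assume F: "F : Dl" "card F = d"
have "link Dl F = {{}}"
proof
	show "link Dl F <: {{}}"
	proof
		fix G assume "G : link Dl F"
		hence G: "G Int F = {}" "G Un F : Dl" by (auto simp: link_def)
		have fin: "finite (G Un F)" using G(2) V by (meson PowD finite_subset subsetD)
		hence "card G + card F <= d" using dim[OF G(2)] G(1) by (simp add: card_Un_disjoint)
		hence "card G = 0" using F by simp
		thus "G : {{}}" using fin by simp
	qed
qed (use F in "auto simp: link_def")
thus "euler_char (link Dl F) = 1" by (simp add: euler_char_def)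
qed

context
fixes h :: nat
assumes h: "has_quot_dim fscale (cocycles Dl (q - 1) :: (nat set => 'k) set) (cobs Dl (q - 1)) h"
begin

lemma euler_char_complex: "euler_char (link Dl {}) = (-1) ^ (q - 1) * int h"
proof -
have l: "link Dl {} = Dl" by (auto simp: link_def)
interpret finite_complex Dl using link_complex(3)[of "{}"] unfolding l .
show ?thesis unfolding l euler_char_def by (rule euler_single[OF cvan_complex h])
qed

lemma empty_face: "{} : Dl" using skeleton[of "{}"] by simp

lemma gbinomial_minus: "(- real k) gchoose j = (-1) ^ j * real ((k + j - 1) choose j)" if "1 <= k"
using that gbinomial_minus[of "real k" j] by (simp add: binomial_gbinomial of_nat_diff add_ac)

lemma finite_faces: "finite Dl" using V by (meson finite_Pow_iff finite_subset)

text \<open>The weights \<open>(|G| - k) gchoose (q - 1)\<close> vanish at all large faces.\<close>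

lemma weighted_euler_sum:
assumes "1 <= k" "k <= card V"
shows "real h * real ((k + q - 2) choose (q - 1)) +
	(SUM G:Dl - {{}}. real_of_int (euler_char (link Dl G)) * ((real (card G) - real k) gchoose (q - 1))) =
	real ((card V - k) choose (q - 1))"
proof -
have "(SUM G:Dl. real_of_int (euler_char (link Dl G)) * ((real (card G) - real k) gchoose (q - 1))) =
	(real (card V) - real k) gchoose (q - 1)"
	by (rule sum_euler_char_links[OF V(1,3) down skeleton])
moreover have "(real (card V) - real k) gchoose (q - 1) = real ((card V - k) choose (q - 1))"
	using assms by (simp add: binomial_gbinomial of_nat_diff)
moreover have "real_of_int (euler_char (link Dl {})) * ((real (card ({}::nat set)) - real k) gchoose (q - 1)) =
	 real h * real ((k + q - 2) choose (q - 1))"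
proof -
	\<comment> \<open>At the empty face the weight is a binomial of a negative number. Its sign
	  \<open>(-1) ^ (q - 1)\<close> cancels the sign of the Euler characteristic, so \<open>h\<close>
	  enters with a positive coefficient.\<close>
	have e: "k + (q - 1) - 1 = k + q - 2" using q by simp
	have "(real (card ({}::nat set)) - real k) gchoose (q - 1) = (-1) ^ (q - 1) * real ((k + q - 2) choose (q - 1))"
		using gbinomial_minus[OF assms(1), of "q - 1"] unfolding e by simp
	thus ?thesis unfolding euler_char_complex by (simp flip: power_mult_distrib mult.assoc)
qed
ultimately show ?thesis
	using sum.remove[OF finite_faces empty_face, of "%G. real_of_int (euler_char (link Dl G)) * ((real (card G) - real k) gchoose (q - 1))"]
	by linarith
qed

text \<open>With \<open>k = d - q + 2\<close> the weight vanishes for sizes from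
  \<open>d - q + 2\<close> to \<open>d\<close>, the Euler characteristic vanishes for nonempty faces
  up to \<open>d - q\<close>, and at \<open>d - q + 1\<close> both carry the sign
  \<open>(-1) ^ (q - 1)\<close>. Dropping these nonnegative terms leaves the bound.\<close>

theorem homology_bound:
assumes "card V = c + d" "1 <= c"
shows "h * (d choose (q - 1)) <= (c + q - 2) choose (q - 1)"
proof -
let ?k = "d - q + 2"
have e: "?k + q - 2 = d" "card V - ?k = c + q - 2" using q assms by auto
have "0 <= (SUM G:Dl - {{}}. real_of_int (euler_char (link Dl G)) * ((real (card G) - real ?k) gchoose (q - 1)))"
proof (rule sum_nonneg)
	fix G assume "G : Dl - {{}}"
	hence G: "G : Dl" "G ~= {}" by auto
	consider "card G <= d - q" | "card G = d - q + 1" | "?k <= card G" by linarith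
	thus "0 <= real_of_int (euler_char (link Dl G)) * ((real (card G) - real ?k) gchoose (q - 1))"
	proof cases
		case 1
		thus ?thesis using euler_char_links(1)[OF G] by simp
	next
		case 2
		have "real (card G) - real ?k = - real (Suc 0)" using 2 by simp
		hence "(real (card G) - real ?k) gchoose (q - 1) = (-1) ^ (q - 1)"
			using gbinomial_minus[of "Suc 0" "q - 1"] by (simp only:) simp
		moreover have "0 <= real_of_int ((-1) ^ (q - 1) * euler_char (link Dl G))"
			using euler_char_links(2)[OF G(1) 2] by (simp only: of_int_0_le_iff)
		ultimately show ?thesis by (simp add: mult.commute)
	next
		case 3
		have "real (card G) - real ?k = real (card G - ?k)" using 3 by (simp add: of_nat_diff)
		moreover have "card G - ?k < q - 1" using dim[OF G(1)] q by linarith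
		ultimately have "(real (card G) - real ?k) gchoose (q - 1) = 0"
			by (metis binomial_eq_0 binomial_gbinomial of_nat_0)
		thus ?thesis by simp
	qed
qed
moreover have "?k <= card V" using assms q by simp
ultimately have "real h * real (d choose (q - 1)) <= real ((c + q - 2) choose (q - 1))"
	using weighted_euler_sum[of ?k] unfolding e by simp
thus ?thesis by (simp flip: of_nat_mult)
qed

text \<open>With \<open>k = d - q + 1\<close> the weight vanishes for sizes from
  \<open>d - q + 1\<close> to \<open>d - 1\<close> and equals 1 at size \<open>d\<close>, so exactly
  the faces with \<open>d\<close> vertices and the empty face remain.\<close>

theorem facet_count:
assumes "card V = c + d"
shows "h * ((d - 1) choose (q - 1)) + card {F:Dl. card F = d} = (c + q - 1) choose (q - 1)"
proof -
let ?k = "d - q + 1"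
have e: "?k + q - 2 = d - 1" "card V - ?k = c + q - 1" using q assms by auto
have "(SUM G:Dl - {{}}. real_of_int (euler_char (link Dl G)) * ((real (card G) - real ?k) gchoose (q - 1))) =
	(SUM G:Dl - {{}}. if card G = d then 1 else 0)"
proof (intro sum.cong refl)
	fix G assume "G : Dl - {{}}"
	hence G: "G : Dl" "G ~= {}" by auto
	show "real_of_int (euler_char (link Dl G)) * ((real (card G) - real ?k) gchoose (q - 1)) =
		(if card G = d then 1 else 0)"
	proof (cases "card G <= d - q")
		case True
		thus ?thesis using euler_char_links(1)[OF G] q by auto
	next
		case False
		hence r: "real (card G) - real ?k = real (card G - ?k)" by (simp add: of_nat_diff)
		show ?thesis
		proof (cases "card G = d")
			case True
			hence "card G - ?k = q - 1" using q by simp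
			thus ?thesis unfolding r using euler_char_links(3)[OF G(1) True] True
				by (simp flip: binomial_gbinomial)
		next
			case False
			hence "card G - ?k < q - 1" using dim[OF G(1)] q by linarith
			hence "real (card G - ?k) gchoose (q - 1) = 0"
				by (metis binomial_eq_0 binomial_gbinomial of_nat_0)
			thus ?thesis unfolding r using False by simp
		qed
	qed
qed
also have "... = real (card {G:Dl - {{}}. card G = d})"
	using finite_faces by (simp add: sum.If_cases Int_def)
also have "{G:Dl - {{}}. card G = d} = {F:Dl. card F = d}" using q by auto
finally have "real h * real ((d - 1) choose (q - 1)) + real (card {F:Dl. card F = d}) = real ((c + q - 1) choose (q - 1))"
	using weighted_euler_sum[of ?k] assms q unfolding e by simp
thus ?thesis by (simp flip: of_nat_mult of_nat_add)
qed

end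

end

section \<open>Krull dimension of Stanley--Reisner rings\<close>

subsection \<open>Chains of primes in quotients\<close>

definition prime_chain :: "('a, 'b) ring_scheme => nat => (nat => 'a set) => bool" where
"prime_chain R l P <-> (\<forall>i\<le>l. primeideal (P i) R) & (\<forall>i<l. P i \<subset> P (Suc i))"

lemma krull_dim_eqI:
assumes "!!l P. prime_chain R l P ==> l <= d" "prime_chain R d P"
shows "krull_dim R = enat d"
unfolding krull_dim_def
proof (rule antisym)
show "Sup {enat l |l. EX P. (\<forall>i\<le>l. primeideal (P i) R) & (\<forall>i<l. P i \<subset> P (Suc i))} <= enat d"
	by (rule Sup_least) (use assms(1) in "auto simp: prime_chain_def")
show "enat d <= Sup {enat l |l. EX P. (\<forall>i\<le>l. primeideal (P i) R) & (\<forall>i<l. P i \<subset> P (Suc i))}"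
	by (rule Sup_upper) (use assms(2) in "auto simp: prime_chain_def")
qed

context cring
begin

lemma coset_mem_image_iff:
assumes I: "ideal I R" and J: "ideal J R" "I <: J" and x: "x : carrier R"
shows "I +> x : (+>) I ` J <-> x : J"
proof
interpret I: ideal I R by (fact I)
interpret J: ideal J R by (fact J)
assume "I +> x : (+>) I ` J"
then obtain p where p: "p : J" "I +> x = I +> p" by blast
have "x : I +> p" using I.a_rcos_self[OF x] p(2) by simp
then obtain h where "h : I" "x = h \<oplus> p" by (auto simp: a_r_coset_def')
thus "x : J" using J(2) p(1) J.a_closed by blast
qed auto

lemma quot_carrierE:
assumes "X : carrier (R Quot I)"
obtains x where "x : carrier R" "X = I +> x"
using assms by (auto simp: FactRing_def A_RCOSETS_def')

lemma coset_in_quot_carrier: "x : carrier R ==> I +> x : carrier (R Quot I)"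
by (auto simp: FactRing_def A_RCOSETS_def')

lemma primeideal_coset_image:
assumes I: "ideal I R" and P: "primeideal P R" "I <: P"
shows "primeideal ((+>) I ` P) (R Quot I)"
proof -
interpret I: ideal I R by (fact I)
interpret P: primeideal P R by (fact P(1))
have hom: "(+>) I : ring_hom R (R Quot I)" by (rule I.rcos_ring_hom)
note iff = coset_mem_image_iff[OF I P.is_ideal P(2)]
show ?thesis
proof (rule primeidealI)
	show "ideal ((+>) I ` P) (R Quot I)" by (rule ring_ideal_imp_quot_ideal[OF I P.is_ideal])
	show "cring (R Quot I)" using I.quotient_is_cring is_cring by blast
	obtain x where x: "x : carrier R" "x ~: P" using P.I_notcarr P.a_subset by blast
	hence "I +> x ~: (+>) I ` P" using iff by blast
	thus "carrier (R Quot I) ~= (+>) I ` P" using coset_in_quot_carrier[OF x(1)] by blast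
next
	fix a b assume a: "a : carrier (R Quot I)" and b: "b : carrier (R Quot I)"
		and ab: "a \<otimes>\<^bsub>R Quot I\<^esub> b : (+>) I ` P"
	obtain x where x: "x : carrier R" "a = I +> x" using a by (rule quot_carrierE)
	obtain y where y: "y : carrier R" "b = I +> y" using b by (rule quot_carrierE)
	have "I +> (x \<otimes> y) : (+>) I ` P" using ab ring_hom_mult[OF hom x(1) y(1)] x y by simp
	hence "x \<otimes> y : P" using iff[of "x \<otimes> y"] x y by simp
	hence "x : P \<or> y : P" using P.I_prime x y by blast
	thus "a : (+>) I ` P \<or> b : (+>) I ` P" using x y by blast
qed
qed

lemma primeideal_coset_vimage:
assumes I: "ideal I R" and Q: "primeideal Q (R Quot I)"
shows "primeideal {r:carrier R. I +> r : Q} R" (is "primeideal ?P R")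
proof -
interpret I: ideal I R by (fact I)
interpret Q: primeideal Q "R Quot I" by (fact Q)
interpret h: ring_hom_ring R "R Quot I" "(+>) I" by (rule I.rcos_ring_hom_ring)
show ?thesis
proof (rule primeidealI)
	show "ideal ?P R" by (rule h.ideal_vimage[OF Q.is_ideal])
	show "cring R" by (rule is_cring)
	show "carrier R ~= ?P"
	proof
		assume e: "carrier R = ?P"
		have "carrier (R Quot I) <: Q"
		proof
			fix X assume "X : carrier (R Quot I)"
			then obtain x where "x : carrier R" "X = I +> x" by (rule quot_carrierE)
			thus "X : Q" using e by blast
		qed
		thus False using Q.I_notcarr Q.a_subset by blast
	qed
next
	fix a b assume a: "a : carrier R" and b: "b : carrier R" and "a \<otimes> b : ?P"
	hence "(I +> a) \<otimes>\<^bsub>R Quot I\<^esub> (I +> b) : Q" by simp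
	hence "I +> a : Q \<or> I +> b : Q"
		using Q.I_prime coset_in_quot_carrier[OF a] coset_in_quot_carrier[OF b] by blast
	thus "a : ?P \<or> b : ?P" using a b by blast
qed
qed

text \<open>Preimages under the quotient map; inclusions stay strict because every coset has a
  representative.\<close>

lemma prime_chain_quot_imp:
assumes I: "ideal I R" and c: "prime_chain (R Quot I) l Q"
shows "EX P. prime_chain R l P & (\<forall>i\<le>l. I <: P i)"
proof -
interpret I: ideal I R by (fact I)
define P where "P i = {r:carrier R. I +> r : Q i}" for i
have prime: "primeideal (Q i) (R Quot I)" if "i <= l" for i using c that by (simp add: prime_chain_def)
have "primeideal (P i) R" if "i <= l" for i
	unfolding P_def by (rule primeideal_coset_vimage[OF I prime[OF that]])
moreover have "P i \<subset> P (Suc i)" if i: "i < l" for i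
proof -
	have s: "Q i \<subset> Q (Suc i)" using c i by (simp add: prime_chain_def)
	then obtain X where X: "X : Q (Suc i)" "X ~: Q i" by blast
	interpret Q: primeideal "Q (Suc i)" "R Quot I" using prime[of "Suc i"] i by simp
	have "X : carrier (R Quot I)" using X Q.a_subset by blast
	then obtain x where "x : carrier R" "X = I +> x" by (rule quot_carrierE)
	hence "x : P (Suc i)" "x ~: P i" using X by (auto simp: P_def)
	thus ?thesis using s by (auto simp: P_def)
qed
moreover have "I <: P i" if i: "i <= l" for i
proof
	interpret Q: primeideal "Q i" "R Quot I" using prime[OF i] .
	fix x assume x: "x : I"
	have "I +> x = I" by (rule I.a_rcos_const[OF x])
	moreover have "I : Q i"
		using additive_subgroup.zero_closed[OF ideal.axioms(1)[OF Q.is_ideal]] by (simp add: FactRing_def)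
	ultimately show "x : P i" using x I.a_subset by (auto simp: P_def)
qed
ultimately show ?thesis by (intro exI[of _ P]) (simp add: prime_chain_def)
qed

lemma prime_chain_imp_quot:
assumes I: "ideal I R" and c: "prime_chain R l P" and sub: "!!i. i <= l ==> I <: P i"
shows "prime_chain (R Quot I) l (%i. (+>) I ` P i)"
unfolding prime_chain_def
proof (intro conjI allI impI)
have prime: "primeideal (P i) R" if "i <= l" for i using c that by (simp add: prime_chain_def)
show "primeideal ((+>) I ` P i) (R Quot I)" if "i <= l" for i
	by (rule primeideal_coset_image[OF I prime[OF that] sub[OF that]])
show "(+>) I ` P i \<subset> (+>) I ` P (Suc i)" if i: "i < l" for i
proof -
	have s: "P i \<subset> P (Suc i)" using c i by (simp add: prime_chain_def)
	then obtain x where x: "x : P (Suc i)" "x ~: P i" by blast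
	interpret Pi: primeideal "P i" R using prime[of i] i by simp
	interpret Ps: primeideal "P (Suc i)" R using prime[of "Suc i"] i by simp
	have "x : carrier R" using x Ps.a_subset by blast
	hence "I +> x ~: (+>) I ` P i"
		using coset_mem_image_iff[OF I Pi.is_ideal sub[of i]] i x by simp
	thus ?thesis using s x by blast
qed
qed

end

subsection \<open>The polynomial ring and its monomial ideals\<close>

lemma lookup_single_0_mult:
"lookup (single 0 c * p) m = c * (lookup p m :: 'k::field)"
by (simp add: mult_map_scale_conv_mult[symmetric] Poly_Mapping.map.rep_eq when_def)

lemma carrier_poly_ring: "p : carrier (poly_ring n) <-> (ALL m:keys p. keys m <: {1..n})"
by (simp add: poly_ring_def)

lemma poly_ring_simps [simp]:
"x \<otimes>\<^bsub>poly_ring n\<^esub> y = x * y" "x \<oplus>\<^bsub>poly_ring n\<^esub> y = x + y" "\<one>\<^bsub>poly_ring n\<^esub> = 1" "\<zero>\<^bsub>poly_ring n\<^esub> = 0"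
by (simp_all add: poly_ring_def)

lemma keys_add_nat: "keys (a + b :: 'x \<Rightarrow>\<^sub>0 nat) = keys a Un keys b"
by (auto simp: in_keys_iff lookup_add)

lemma keys_uminus_eq: "keys (- p) = keys (p :: 'x \<Rightarrow>\<^sub>0 'b::ab_group_add)"
by (auto simp: in_keys_iff)

lemma keys_multE:
assumes "m : keys (p * q)"
obtains a b where "a : keys p" "b : keys q" "m = a + b"
using assms keys_mult[of p q] by blast

lemma poly_ring_closed:
shows "p : carrier (poly_ring n) ==> q : carrier (poly_ring n) ==> p + q : carrier (poly_ring n)"
	and "p : carrier (poly_ring n) ==> q : carrier (poly_ring n) ==> p * q : carrier (poly_ring n)"
	and "p : carrier (poly_ring n) ==> - p : carrier (poly_ring n)"
	and "0 : carrier (poly_ring n)" "1 : carrier (poly_ring n)"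
	and "single 0 c : carrier (poly_ring n)"
proof -
show "p * q : carrier (poly_ring n)" if "p : carrier (poly_ring n)" "q : carrier (poly_ring n)"
	unfolding carrier_poly_ring
proof
	fix m assume "m : keys (p * q)"
	then obtain a b where "a : keys p" "b : keys q" "m = a + b" by (rule keys_multE)
	thus "keys m <: {1..n}" using that by (simp add: carrier_poly_ring keys_add_nat)
qed
show "p + q : carrier (poly_ring n)" if "p : carrier (poly_ring n)" "q : carrier (poly_ring n)"
	using that keys_add[of p q] unfolding carrier_poly_ring by blast
qed (auto simp: carrier_poly_ring keys_uminus_eq)

lemma carrier_poly_ring_sum:
assumes "!!x. x : A ==> f x : carrier (poly_ring n)"
shows "sum f A : carrier (poly_ring n)"
using assms by (induction A rule: infinite_finite_induct) (auto intro: poly_ring_closed)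

lemma carrier_poly_ring_power:
assumes "p : carrier (poly_ring n)" shows "p ^ k : carrier (poly_ring n)"
using assms by (induction k) (auto intro: poly_ring_closed)

lemma cring_poly_ring: "cring (poly_ring n :: 'k::field mpoly ring)"
proof (rule cringI)
show "abelian_group (poly_ring n :: 'k mpoly ring)"
proof (rule abelian_groupI)
	fix x :: "'k mpoly" assume "x : carrier (poly_ring n)"
	thus "EX y:carrier (poly_ring n). y \<oplus>\<^bsub>poly_ring n\<^esub> x = \<zero>\<^bsub>poly_ring n\<^esub>"
		by (intro bexI[of _ "- x"]) (auto intro: poly_ring_closed)
qed (auto intro: poly_ring_closed simp: algebra_simps)
show "Group.comm_monoid (poly_ring n :: 'k mpoly ring)"
	by (rule comm_monoidI) (auto intro: poly_ring_closed simp: algebra_simps)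
qed (auto simp: algebra_simps)

lemma poly_ring_a_inv:
assumes "x : carrier (poly_ring n)" shows "\<ominus>\<^bsub>poly_ring n\<^esub> x = - (x :: 'k::field mpoly)"
proof -
interpret cring "poly_ring n :: 'k mpoly ring" by (rule cring_poly_ring)
show ?thesis using assms by (intro minus_equality) (auto intro: poly_ring_closed)
qed

lemma ideal_poly_ringD:
assumes "ideal I (poly_ring n :: 'k::field mpoly ring)"
shows "I <: carrier (poly_ring n)" "0 : I" "p : I ==> q : I ==> p + q : I"
	"p : I ==> q : I ==> p - q : I"
	"p : I ==> q : carrier (poly_ring n) ==> q * p : I"
proof -
interpret ideal I "poly_ring n :: 'k mpoly ring" by (fact assms)
show sub: "I <: carrier (poly_ring n)" by (rule a_subset)
show "0 : I" using additive_subgroup.zero_closed[OF ideal.axioms(1)[OF assms]] by simp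
show add: "p : I ==> q : I ==> p + q : I" for p q
	using additive_subgroup.a_closed[OF ideal.axioms(1)[OF assms], of p q] by simp
show "p : I ==> q : carrier (poly_ring n) ==> q * p : I" using I_l_closed[of p q] by simp
show "p : I ==> q : I ==> p - q : I"
proof -
	assume p: "p : I" and q: "q : I"
	have "\<ominus>\<^bsub>poly_ring n\<^esub> q : I" by (rule additive_subgroup.a_inv_closed[OF ideal.axioms(1)[OF assms] q])
	moreover have "\<ominus>\<^bsub>poly_ring n\<^esub> q = - q" by (rule poly_ring_a_inv) (use q sub in blast)
	ultimately show "p - q : I" using add[OF p, of "- q"] by simp
qed
qed

lemma ideal_poly_ring_sum:
assumes "ideal I (poly_ring n :: 'k::field mpoly ring)" "!!x. x : A ==> f x : I"
shows "sum f A : I"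
using assms(2) by (induction A rule: infinite_finite_induct) (auto intro: ideal_poly_ringD[OF assms(1)])

text \<open>Every ideal used here depends only on the supports of monomials: the Stanley-Reisner
  ideal, the maximal ideal, the coordinate primes and the whole ring are all of this form with an
  upward closed \<open>U\<close>.\<close>

definition supp_ideal :: "nat => (nat set => bool) => 'k::field mpoly set" where
"supp_ideal n U = {p:carrier (poly_ring n). ALL m:keys p. U (keys m)}"

lemma ideal_supp_ideal:
assumes up: "!!A B. U A ==> A <: B ==> B <: {1..n} ==> U B"
shows "ideal (supp_ideal n U :: 'k::field mpoly set) (poly_ring n)"
proof -
interpret cring "poly_ring n :: 'k mpoly ring" by (rule cring_poly_ring)
have mult: "a * x : supp_ideal n U" if "a : supp_ideal n U" "x : carrier (poly_ring n)" for a x :: "'k mpoly"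
	unfolding supp_ideal_def
proof (intro CollectI conjI ballI)
	show c: "a * x : carrier (poly_ring n)" using that by (auto simp: supp_ideal_def intro: poly_ring_closed)
	fix m assume m: "m : keys (a * x)"
	then obtain s t where st: "s : keys a" "t : keys x" "m = s + t" by (rule keys_multE)
	have "U (keys s)" using that(1) st(1) by (simp add: supp_ideal_def)
	moreover have "keys m <: {1..n}" using c m by (simp add: carrier_poly_ring)
	moreover have "keys s <: keys m" using st by (simp add: keys_add_nat)
	ultimately show "U (keys m)" using up by blast
qed
show ?thesis
proof (rule idealI)
	show "subgroup (supp_ideal n U) (add_monoid (poly_ring n :: 'k mpoly ring))"
	proof (rule subgroup.intro)
		fix x y :: "'k mpoly" assume x: "x : supp_ideal n U" and y: "y : supp_ideal n U"
		show "x \<otimes>\<^bsub>add_monoid (poly_ring n)\<^esub> y : supp_ideal n U"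
			using x y keys_add[of x y] by (auto simp: supp_ideal_def intro: poly_ring_closed)
		have "x : carrier (poly_ring n)" using x by (simp add: supp_ideal_def)
		hence "inv\<^bsub>add_monoid (poly_ring n)\<^esub> x = - x" using poly_ring_a_inv[of x n] by (simp add: a_inv_def)
		thus "inv\<^bsub>add_monoid (poly_ring n)\<^esub> x : supp_ideal n U"
			using x by (auto simp: supp_ideal_def keys_uminus_eq intro: poly_ring_closed)
	qed (auto simp: supp_ideal_def intro: poly_ring_closed)
	fix a x :: "'k mpoly" assume "a : supp_ideal n U" "x : carrier (poly_ring n)"
	hence "a * x : supp_ideal n U" by (rule mult)
	thus "x \<otimes>\<^bsub>poly_ring n\<^esub> a : supp_ideal n U" "a \<otimes>\<^bsub>poly_ring n\<^esub> x : supp_ideal n U" by (simp_all add: mult.commute)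
qed (rule ring_axioms)
qed

definition xmon :: "nat set => nat \<Rightarrow>\<^sub>0 nat" where
"xmon F = (SUM i:F. single i 1)"

lemma lookup_xmon: "finite F ==> lookup (xmon F) i = (if i : F then 1 else 0)"
by (simp add: xmon_def lookup_sum lookup_single when_def)

lemma keys_xmon: "finite F ==> keys (xmon F) = F"
by (auto simp: in_keys_iff lookup_xmon split: if_splits)

lemma prod_var: "finite F ==> (PROD i:F. var i) = (single (xmon F) 1 :: 'k::field mpoly)"
by (induction F rule: finite_induct) (auto simp: xmon_def var_def mult_single)

lemma poly_eq_sum_monomials:
"(p :: 'a \<Rightarrow>\<^sub>0 'b::comm_monoid_add) = (SUM m:keys p. single m (lookup p m))"
proof (rule poly_mapping_eqI)
fix k
have "(SUM m:keys p. (if m = k then lookup p m else 0)) = lookup p k"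
	by (simp add: in_keys_iff)
thus "lookup p k =
	 lookup (SUM m:keys p. single m (lookup p m)) k"
	by (simp add: lookup_sum lookup_single when_def)
qed

lemma minus_xmon_add:
assumes "F <: keys m" shows "(m - xmon F) + xmon F = m"
proof (rule poly_mapping_eqI)
have "finite F" using assms finite_keys finite_subset by blast
thus "lookup (m - xmon F + xmon F) i = lookup m i" for i
	using assms by (auto simp: lookup_add lookup_minus lookup_xmon in_keys_iff Suc_leI)
qed

lemma keys_minus_subset: "keys (a - b :: 'x \<Rightarrow>\<^sub>0 nat) <: keys a"
by (auto simp: in_keys_iff lookup_minus)

lemma genideal_monomials:
assumes S: "S <: Pow {1..n}"
shows "genideal (poly_ring n :: 'k::field mpoly ring) {PROD i:F. var i | F. F : S} =
	supp_ideal n (%A. EX F:S. F <: A)" (is "genideal ?R ?G = ?J")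
proof
interpret cring "poly_ring n :: 'k mpoly ring" by (rule cring_poly_ring)
have finS: "finite F" if "F : S" for F using that S by (meson PowD finite_atLeastAtMost finite_subset subsetD)
have gen: "(PROD i:F. var i) : ?J" if F: "F : S" for F
	using F S by (auto simp: prod_var[OF finS[OF F]] supp_ideal_def carrier_poly_ring keys_xmon[OF finS[OF F]])
have iJ: "ideal ?J ?R" by (rule ideal_supp_ideal) blast
show "genideal ?R ?G <: ?J" by (rule genideal_minimal[OF iJ]) (use gen in blast)
have sub: "?G <: carrier ?R" using gen by (auto simp: supp_ideal_def)
have iI: "ideal (genideal ?R ?G) ?R" by (rule genideal_ideal[OF sub])
show "?J <: genideal ?R ?G"
proof
	fix p assume p: "p : ?J"
	have "single m (lookup p m) : genideal ?R ?G" if m: "m : keys p" for m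
	proof -
		obtain F where F: "F : S" "F <: keys m" using p m by (auto simp: supp_ideal_def)
		have "keys m <: {1..n}" using p m by (auto simp: supp_ideal_def carrier_poly_ring)
		hence c: "single (m - xmon F) (lookup p m) : carrier ?R"
			using keys_minus_subset[of m "xmon F"] by (auto simp: carrier_poly_ring)
		have "(PROD i:F. var i) : genideal ?R ?G" using genideal_self[OF sub] F by blast
		hence "single (m - xmon F) (lookup p m) * (PROD i:F. var i) : genideal ?R ?G"
			by (rule ideal_poly_ringD(5)[OF iI _ c])
		thus ?thesis by (simp add: prod_var[OF finS[OF F(1)]] mult_single minus_xmon_add[OF F(2)])
	qed
	hence "(SUM m:keys p. single m (lookup p m)) : genideal ?R ?G"
		by (rule ideal_poly_ring_sum[OF iI])
	thus "p : genideal ?R ?G" using poly_eq_sum_monomials[of p] by simp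
qed
qed

lemma supp_ideal_cong:
assumes "!!A. A <: {1..n} ==> U A <-> U' A"
shows "supp_ideal n U = supp_ideal n U'"
using assms by (auto simp: supp_ideal_def carrier_poly_ring)

lemma sr_ideal_eq:
assumes "down_closed Dl"
shows "(sr_ideal n Dl :: 'k::field mpoly set) = supp_ideal n (%A. A ~: Dl)"
proof -
have "(sr_ideal n Dl :: 'k mpoly set) = supp_ideal n (%A. EX F:{F. F <: {1..n} & F ~: Dl}. F <: A)"
	unfolding sr_ideal_def by (subst genideal_monomials[symmetric]) (auto intro!: arg_cong[of _ _ "genideal _"])
also have "... = supp_ideal n (%A. A ~: Dl)"
	by (rule supp_ideal_cong) (use down_closedD[OF assms] in blast)
finally show ?thesis .
qed

lemma ideal_sr_ideal:
assumes "down_closed Dl" shows "ideal (sr_ideal n Dl :: 'k::field mpoly set) (poly_ring n)"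
unfolding sr_ideal_eq[OF assms] by (rule ideal_supp_ideal) (use down_closedD[OF assms] in blast)

lemma maximal_ideal_eq:
"(maximal_ideal n :: 'k::field mpoly set) = supp_ideal n (%A. A ~= {})"
proof -
have "(var ` {1..n} :: 'k mpoly set) = {PROD i:F. var i | F. F : (%i. {i}) ` {1..n}}"
	by (simp add: Setcompr_eq_image image_image)
hence "(maximal_ideal n :: 'k mpoly set) = supp_ideal n (%A. EX F:(%i. {i}) ` {1..n}. F <: A)"
	unfolding maximal_ideal_def by (simp only:) (rule genideal_monomials, auto)
also have "... = supp_ideal n (%A. A ~= {})"
	by (rule supp_ideal_cong) auto
finally show ?thesis .
qed

subsection \<open>Coordinate primes\<close>

definition off_ideal :: "nat => nat set => 'k::field mpoly set" where
"off_ideal n G = supp_ideal n (%A. ~ A <: G)"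

lemma lookup_restrict:
"lookup (\<Sum>m | m : keys p & Q m. single m (lookup p m)) k =
	(if Q k then lookup p k else 0)"
proof -
have "(\<Sum>m | m : keys p & Q m. (if m = k then lookup p m else 0)) =
	(if Q k then lookup p k else 0)"
	by (simp add: in_keys_iff)
thus ?thesis by (simp add: lookup_sum lookup_single when_def)
qed

text \<open>The ideal is generated by the variables outside \<open>G\<close>, and the quotient is a
  polynomial ring in the variables of \<open>G\<close>.\<close>

lemma prime_off_ideal: "primeideal (off_ideal n G :: 'k::field mpoly set) (poly_ring n)"
proof (rule primeidealI)
show ideal: "ideal (off_ideal n G :: 'k mpoly set) (poly_ring n)"
	unfolding off_ideal_def by (rule ideal_supp_ideal) blast
show "cring (poly_ring n :: 'k mpoly ring)" by (rule cring_poly_ring)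
have "(1 :: 'k mpoly) ~: off_ideal n G" by (simp add: off_ideal_def supp_ideal_def)
thus "carrier (poly_ring n) ~= (off_ideal n G :: 'k mpoly set)"
	using poly_ring_closed(5)[of n] by auto
fix p q :: "'k mpoly" assume p: "p : carrier (poly_ring n)" and q: "q : carrier (poly_ring n)"
	and "p \<otimes>\<^bsub>poly_ring n\<^esub> q : off_ideal n G"
hence pq: "p * q : off_ideal n G" by simp
\<comment> \<open>\<open>r\<close> sets the variables outside \<open>G\<close> to zero. If
  \<open>p * q\<close> is in the ideal then so is \<open>r p * r q\<close>, whose monomials are
  supported in \<open>G\<close>; hence it is 0, and one of the factors is 0.\<close>
define r where "r p = (\<Sum>m | m : keys p & keys m <: G. single m (lookup p m))"
	for p :: "'k mpoly"
have lr: "lookup (r p) m = (if keys m <: G then lookup p m else 0)" for p m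
	unfolding r_def by (rule lookup_restrict)
have kr: "m : keys (r p) ==> keys m <: G & m : keys p" for p m
	unfolding in_keys_iff lr by (simp split: if_splits)
have rc: "r p : carrier (poly_ring n)" if "p : carrier (poly_ring n)" for p
	using that kr by (simp add: carrier_poly_ring)
have r0: "r p = 0 ==> p : off_ideal n G" if "p : carrier (poly_ring n)" for p
proof -
	assume "r p = 0"
	hence "lookup p m = 0" if "keys m <: G" for m using lr[of p m] that by simp
	thus ?thesis using that by (auto simp: off_ideal_def supp_ideal_def in_keys_iff)
qed
have diff: "p - r p : off_ideal n G" if "p : carrier (poly_ring n)" for p
proof -
	have "p - r p : carrier (poly_ring n)"
		using poly_ring_closed(1)[OF that poly_ring_closed(3)[OF rc[OF that]]] by simp
	thus ?thesis by (auto simp: off_ideal_def supp_ideal_def in_keys_iff lookup_minus lr)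
qed
have "p * q - r p * r q = q * (p - r p) + r p * (q - r q)" by (simp add: algebra_simps)
also have "... : off_ideal n G"
	by (intro ideal_poly_ringD(3)[OF ideal] ideal_poly_ringD(5)[OF ideal] diff rc p q)
finally have "p * q - (p * q - r p * r q) : off_ideal n G" by (rule ideal_poly_ringD(4)[OF ideal pq])
hence rr: "r p * r q : off_ideal n G" by simp
have "r p * r q = 0"
proof (rule ccontr)
	assume "r p * r q ~= 0"
	then obtain m where m: "m : keys (r p * r q)" by (metis keys_eq_empty ex_in_conv)
	then obtain a b where "a : keys (r p)" "b : keys (r q)" "m = a + b" by (rule keys_multE)
	hence "keys m <: G" using kr by (simp add: keys_add_nat)
	thus False using rr m by (auto simp: off_ideal_def supp_ideal_def)
qed
hence "r p = 0 \<or> r q = 0" by simp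
thus "p : off_ideal n G \<or> q : off_ideal n G" using r0 p q by blast
qed

text \<open>Starting from the coordinate prime of \<open>F\<close>, the variables of
  \<open>F\<close> are put into the ideal one after the other; each step is strict because of the
  variable just added.\<close>

lemma prime_chain_off:
assumes "F <: {1..n}"
shows "EX P. prime_chain (poly_ring n :: 'k::field mpoly ring) (card F) P &
	(\<forall>i\<le>card F. off_ideal n F <: P i)"
proof -
have fin: "finite F" using assms finite_subset by blast
then obtain xs where xs: "set xs = F" "distinct xs" using finite_distinct_list by blast
hence len: "length xs = card F" using distinct_card by fastforce
define P where "P i = (off_ideal n (set (drop i xs)) :: 'k mpoly set)" for i
have mono: "off_ideal n G <: (off_ideal n G' :: 'k mpoly set)" if "G' <: G" for G G'
	using that by (auto simp: off_ideal_def supp_ideal_def)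
have "P i \<subset> P (Suc i)" if i: "i < card F" for i
proof
	have d: "drop i xs = xs ! i # drop (Suc i) xs" using i len by (simp add: Cons_nth_drop_Suc)
	show "P i <: P (Suc i)" unfolding P_def by (rule mono) (auto simp: d)
	have "distinct (drop i xs)" using xs by simp
	hence n: "xs ! i ~: set (drop (Suc i) xs)" unfolding d by simp
	have "xs ! i : F" using i len xs(1) nth_mem by metis
	hence "xs ! i : {1..n}" using assms by blast
	hence "(var (xs ! i) :: 'k mpoly) : P (Suc i)"
		using n by (auto simp: P_def off_ideal_def supp_ideal_def carrier_poly_ring var_def)
	moreover have "(var (xs ! i) :: 'k mpoly) ~: P i"
		by (auto simp: P_def off_ideal_def supp_ideal_def var_def d)
	ultimately show "P i ~= P (Suc i)" by blast
qed
moreover have "primeideal (P i) (poly_ring n)" for i unfolding P_def by (rule prime_off_ideal)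
moreover have "off_ideal n F <: P i" for i
	unfolding P_def by (rule mono) (use xs set_drop_subset in fast)
ultimately show ?thesis by (intro exI[of _ P]) (simp add: prime_chain_def)
qed

subsection \<open>Algebraic dependence bounds chains of primes\<close>

definition power_mon :: "(nat => 'k::field mpoly) => nat list => 'k mpoly" where
"power_mon y al = (\<Prod>i<length al. y i ^ (al ! i))"

lemma power_mon_Nil [simp]: "power_mon y [] = 1" by (simp add: power_mon_def)

lemma power_mon_Cons: "power_mon y (a # al) = y 0 ^ a * power_mon (%i. y (Suc i)) al"
unfolding power_mon_def length_Cons prod.lessThan_Suc_shift by simp

lemma power_mon_carrier:
assumes "!!i. i < length al ==> y i : carrier (poly_ring n)"
shows "power_mon y al : carrier (poly_ring n)"
using assms
proof (induction al arbitrary: y)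
case Nil
thus ?case by (simp add: poly_ring_closed)
next
case (Cons a al)
have "power_mon (%i. y (Suc i)) al : carrier (poly_ring n)" using Cons.prems by (intro Cons.IH) auto
moreover have "y 0 : carrier (poly_ring n)" using Cons.prems[of 0] by simp
ultimately show ?case unfolding power_mon_Cons
	by (intro poly_ring_closed carrier_poly_ring_power)
qed

text \<open>A relation of lowest order in the first element survives modulo the next prime.\<close>

lemma no_relation_along_prime_chain:
fixes c :: "nat list => 'k::field"
assumes "finite A" "!!al. al : A ==> length al = l" "al0 : A" "c al0 ~= 0"
	and "!!i. i <= l ==> primeideal (P i) (poly_ring n)" "!!i. i < l ==> P i <: P (Suc i)"
	and "!!i. i < l ==> y i : P (Suc i) - P i"
shows "(SUM al:A. single 0 (c al) * power_mon y al) ~: P 0"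
using assms
proof (induction l arbitrary: A c P y al0)
case 0
hence A: "A = {[]}" by auto
interpret P: primeideal "P 0" "poly_ring n" using "0.prems"(5) by simp
show ?case
proof
	assume "(SUM al:A. single 0 (c al) * power_mon y al) : P 0"
	hence "single 0 (c []) : P 0" unfolding A by simp
	hence "single 0 (1 / c []) * single 0 (c []) : P 0"
		by (rule ideal_poly_ringD(5)[OF P.is_ideal]) (rule poly_ring_closed)
	moreover have "c [] ~= 0" using "0.prems"(3,4) A by auto
	ultimately have "1 : P 0" by (simp add: mult_single)
	thus False using P.I_notcarr P.one_imp_carrier by simp
qed
next
case (Suc l)
interpret P: primeideal "P 0" "poly_ring n" using Suc.prems(5) by simp
have y: "y i : carrier (poly_ring n)" if "i < Suc l" for i
	using Suc.prems(7)[OF that] ideal_poly_ringD(1)[of "P (Suc i)"] Suc.prems(5)[of "Suc i"] that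
	by (auto simp: primeideal_def)
define B where "B = {al:A. c al ~= 0}"
have finB: "finite B" and B0: "al0 : B" using Suc.prems by (auto simp: B_def)
have lenB: "length al = Suc l" if "al : B" for al using Suc.prems(2) that by (simp add: B_def)
\<comment> \<open>The lowest exponent of \<open>y 0\<close> among the terms with nonzero
  coefficient. The factor \<open>y 0 ^ a\<close> can be cancelled modulo the prime
  \<open>P 0\<close>, which does not contain \<open>y 0\<close>.\<close>
define a where "a = Min (hd ` B)"
have amin: "a <= hd al" if "al : B" for al using finB that by (simp add: a_def)
have "a : hd ` B" unfolding a_def using finB B0 by (intro Min_in) auto
then obtain bt0 where bt0: "bt0 : B" "hd bt0 = a" by blast
let ?y = "%i. y (Suc i)"
let ?t = "%al. single 0 (c al) * power_mon ?y (tl al)"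
define B1 where "B1 = {al:B. hd al = a}"
\<comment> \<open>After the cancellation \<open>S1 + y 0 * S2\<close> lies in \<open>P 0\<close>,
  hence in \<open>P 1\<close>, which contains \<open>y 0\<close>. So \<open>S1\<close>, a relation
  among the remaining elements with a nonzero coefficient at \<open>tl bt0\<close>, lies in
  \<open>P 1\<close>, where induction applies.\<close>
define S1 where "S1 = (SUM al:B1. ?t al)"
define S2 where "S2 = (SUM al:B - B1. y 0 ^ (hd al - a - 1) * ?t al)"
have tc: "?t al : carrier (poly_ring n)" if "al : B" for al
	using lenB[OF that] y by (intro poly_ring_closed power_mon_carrier) auto
have S2c: "S2 : carrier (poly_ring n)"
	unfolding S2_def using y[of 0] tc
	by (intro carrier_poly_ring_sum poly_ring_closed(2)[OF carrier_poly_ring_power]) auto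
have S1c: "S1 : carrier (poly_ring n)"
	unfolding S1_def using tc by (intro carrier_poly_ring_sum) (auto simp: B1_def)
have tm: "single 0 (c al) * power_mon y al = y 0 ^ hd al * ?t al" if "al : B" for al
proof -
	have "length al = Suc l" by (rule lenB[OF that])
	then obtain x al' where "al = x # al'" by (cases al) auto
	thus ?thesis by (simp add: power_mon_Cons mult_ac)
qed
have "(SUM al:A. single 0 (c al) * power_mon y al) =
	(SUM al:B. single 0 (c al) * power_mon y al)"
	using Suc.prems(1) by (intro sum.mono_neutral_right) (auto simp: B_def)
also have "... = (SUM al:B. y 0 ^ hd al * ?t al)" by (intro sum.cong refl tm)
also have "... = (SUM al:B1. y 0 ^ hd al * ?t al) + (SUM al:B - B1. y 0 ^ hd al * ?t al)"
	using finB by (subst add.commute) (intro sum.subset_diff, auto simp: B1_def)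
also have "(SUM al:B1. y 0 ^ hd al * ?t al) = y 0 ^ a * S1"
	unfolding S1_def sum_distrib_left by (intro sum.cong) (auto simp: B1_def)
also have "(SUM al:B - B1. y 0 ^ hd al * ?t al) = y 0 ^ a * (y 0 * S2)"
	unfolding S2_def sum_distrib_left
proof (intro sum.cong refl)
	fix al assume "al : B - B1"
	hence "a < hd al" using amin[of al] by (auto simp: B1_def)
	hence "hd al = a + Suc (hd al - a - 1)" by simp
	hence "y 0 ^ hd al = y 0 ^ a * (y 0 * y 0 ^ (hd al - a - 1))" by (metis power_Suc power_add)
	thus "y 0 ^ hd al * ?t al = y 0 ^ a * (y 0 * (y 0 ^ (hd al - a - 1) * ?t al))" by (simp add: mult.assoc)
qed
finally have eq: "(SUM al:A. single 0 (c al) * power_mon y al) = y 0 ^ a * (S1 + y 0 * S2)"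
	by (simp add: distrib_left)
show ?case
proof
	assume "(SUM al:A. single 0 (c al) * power_mon y al) : P 0"
	hence in0: "y 0 ^ a * (S1 + y 0 * S2) : P 0" unfolding eq .
	have y0: "y 0 ~: P 0" "y 0 : P (Suc 0)" using Suc.prems(7)[of 0] by auto
	have step: "x : P 0" if "y 0 * x : P 0" "x : carrier (poly_ring n)" for x
		using P.I_prime[of "y 0" x] that y0 y[of 0] by simp
	have Sc: "S1 + y 0 * S2 : carrier (poly_ring n)"
		using S1c S2c y[of 0] by (intro poly_ring_closed) auto
	have pw: "x : P 0" if "y 0 ^ k * x : P 0" "x : carrier (poly_ring n)" for k x
		using that(1)
	proof (induction k)
		case 0
		thus ?case by simp
	next
		case (Suc k)
		have "y 0 ^ k * x : carrier (poly_ring n)"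
			by (rule poly_ring_closed(2)[OF carrier_poly_ring_power[OF y[OF zero_less_Suc]] that(2)])
		moreover have "y 0 * (y 0 ^ k * x) : P 0" using Suc.prems by (simp add: mult.assoc)
		ultimately have "y 0 ^ k * x : P 0" by (rule step[rotated])
		thus ?case by (rule Suc.IH)
	qed
	have "S1 + y 0 * S2 : P 0" by (rule pw[OF in0 Sc])
	hence in1: "S1 + y 0 * S2 : P (Suc 0)" using Suc.prems(6)[of 0] by auto
	have id1: "ideal (P (Suc 0)) (poly_ring n)" using Suc.prems(5)[of "Suc 0"] by (simp add: primeideal_def)
	have "S2 * y 0 : P (Suc 0)" by (rule ideal_poly_ringD(5)[OF id1 y0(2) S2c])
	hence "S1 + y 0 * S2 - S2 * y 0 : P (Suc 0)" by (rule ideal_poly_ringD(4)[OF id1 in1])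
	hence S1in: "S1 : P (Suc 0)" by (simp add: mult.commute)
	have inj: "inj_on tl B1"
	proof (rule inj_onI)
		fix al bt assume "al : B1" "bt : B1" "tl al = tl bt"
		thus "al = bt" using lenB[of al] lenB[of bt] by (cases al; cases bt) (auto simp: B1_def)
	qed
	let ?c = "%bt. c (a # bt)"
	have "S1 = (SUM bt:tl ` B1. single 0 (?c bt) * power_mon ?y bt)"
		unfolding S1_def sum.reindex[OF inj] comp_def
	proof (intro sum.cong refl)
		fix al assume "al : B1"
		hence "al = a # tl al" using lenB[of al] by (cases al) (auto simp: B1_def)
		thus "?t al = single 0 (c (a # tl al)) * power_mon ?y (tl al)" by simp
	qed
	moreover have "(SUM bt:tl ` B1. single 0 (?c bt) * power_mon ?y bt) ~: P (Suc 0)"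
	proof (rule Suc.IH[where P = "%i. P (Suc i)"])
		show "finite (tl ` B1)" using finB by (simp add: B1_def)
		show "length bt = l" if "bt : tl ` B1" for bt using that lenB by (auto simp: B1_def)
		show "tl bt0 : tl ` B1" using bt0 by (auto simp: B1_def)
		have "bt0 = a # tl bt0" using lenB[OF bt0(1)] bt0(2) by (cases bt0) auto
		thus "c (a # tl bt0) ~= 0" using bt0(1) by (simp add: B_def)
	qed (use Suc.prems in auto)
	ultimately show False using S1in by simp
qed
qed

lemma mdeg_eq_sum: "finite A ==> keys m <: A ==> mdeg m = (SUM i:A. lookup m i)"
unfolding mdeg_def by (intro sum.mono_neutral_left) (auto simp: in_keys_iff)

lemma mdeg_add: "mdeg (a + b) = mdeg a + mdeg b"
proof -
let ?A = "keys a Un keys b"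
have "mdeg (a + b) = (SUM i:?A. lookup (a + b) i)"
	by (rule mdeg_eq_sum) (auto simp: keys_add_nat)
also have "... = mdeg a + mdeg b"
	by (simp add: lookup_add sum.distrib mdeg_eq_sum[of ?A a] mdeg_eq_sum[of ?A b])
finally show ?thesis .
qed

lemma lookup_le_mdeg: "lookup m i <= mdeg m"
proof (cases "i : keys m")
case True
thus ?thesis unfolding mdeg_def by (intro member_le_sum) auto
qed (simp add: in_keys_iff)

lemma degree_power:
assumes "ALL m:keys p. mdeg m <= D" "m : keys (p ^ k)"
shows "mdeg m <= k * D"
using assms(2)
proof (induction k arbitrary: m)
case 0
thus ?case by (auto simp: mdeg_def)
next
case (Suc k)
hence "m : keys (p * p ^ k)" by simp
then obtain a b where "a : keys p" "b : keys (p ^ k)" "m = a + b" by (rule keys_multE)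
thus ?case using assms(1) Suc.IH[of b] by (fastforce simp: mdeg_add)
qed

lemma degree_power_mon:
assumes "!!i. i < length al ==> ALL m:keys (y i). mdeg m <= D" "ALL a:set al. a <= N"
	and "m : keys (power_mon y al)"
shows "mdeg m <= length al * (N * D)"
using assms
proof (induction al arbitrary: y m)
case Nil
thus ?case by (simp add: mdeg_def)
next
case (Cons x al)
obtain a b where ab: "a : keys (y 0 ^ x)" "b : keys (power_mon (%i. y (Suc i)) al)" "m = a + b"
	using Cons.prems(3) unfolding power_mon_Cons by (rule keys_multE)
have "mdeg a <= x * D" using Cons.prems(1)[of 0] ab(1) by (intro degree_power) auto
also have "... <= N * D" using Cons.prems(2) by simp
finally have "mdeg a <= N * D" .
moreover have "mdeg b <= length al * (N * D)"
proof (rule Cons.IH)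
	show "ALL m:keys (y (Suc i)). mdeg m <= D" if "i < length al" for i using Cons.prems(1)[of "Suc i"] that by simp
qed (use Cons.prems ab in auto)
ultimately show ?case by (simp add: ab(3) mdeg_add)
qed

lemma bounded_monomials:
assumes "finite F"
shows "finite {m. keys m <: F & mdeg m <= B}"
	and "card {m. keys m <: F & mdeg m <= B} <= (B + 1) ^ card F"
proof -
let ?M = "{m. keys m <: F & mdeg m <= B}"
let ?f = "%m. restrict (lookup m) F"
have inj: "inj_on ?f ?M"
proof (rule inj_onI, rule poly_mapping_eqI)
	fix a b i assume ab: "a : ?M" "b : ?M" "?f a = ?f b"
	show "lookup a i = lookup b i"
	proof (cases "i : F")
		case True
		thus ?thesis using fun_cong[OF ab(3), of i] by simp
	next
		case False
		hence "i ~: keys a" "i ~: keys b" using ab by auto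
		thus ?thesis by (simp add: in_keys_iff)
	qed
qed
have sub: "?f ` ?M <: PiE F (%_. {0..B})"
	by (auto simp: restrict_PiE_iff intro: order_trans[OF lookup_le_mdeg])
have fin: "finite (PiE F (%_. {0..B}))" using assms by (intro finite_PiE) auto
show "finite ?M" using inj_on_finite[OF inj sub fin] .
have "card ?M = card (?f ` ?M)" using card_image[OF inj] by simp
also have "... <= card (PiE F (%_. {0..B}))" by (rule card_mono[OF fin sub])
also have "... = (B + 1) ^ card F" using assms by (simp add: card_PiE)
finally show "card ?M <= (B + 1) ^ card F" .
qed

text \<open>Counting replaces transcendence degree. The products of powers of \<open>y\<close> grow
  in number like \<open>N ^ l\<close>, the face-supported monomials they involve only like
  \<open>N ^ d\<close>. If \<open>l > d\<close>, some nontrivial combination has no face-supported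
  monomial, so it lies in \<open>P 0\<close>, against
  \<open>no_relation_along_prime_chain\<close>.\<close>

theorem prime_chain_length:
fixes P :: "nat => 'k::field mpoly set"
assumes chain: "prime_chain (poly_ring n) l P" and I: "supp_ideal n (%A. A ~: Dl) <: P 0"
	and fin: "finite Dl" and dim: "!!F. F : Dl ==> finite F & card F <= d"
shows "l <= d"
proof (rule ccontr)
assume "~ l <= d"
have prime: "primeideal (P i) (poly_ring n)" if "i <= l" for i using chain that by (simp add: prime_chain_def)
have "EX z. z : P (Suc i) - P i" if "i < l" for i using chain that unfolding prime_chain_def by blast
then obtain y where y: "!!i. i < l ==> y i : P (Suc i) - P i" by metis
have yc: "y i : carrier (poly_ring n)" if "i < l" for i
	using y[OF that] prime[of "Suc i"] that ideal_poly_ringD(1)[of "P (Suc i)" n] by (auto simp: primeideal_def)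
define D where "D = Max (insert 0 (\<Union>i<l. mdeg ` keys (y i)))"
have D: "ALL m:keys (y i). mdeg m <= D" if "i < l" for i
	using that by (auto simp: D_def intro!: Max_ge)
\<comment> \<open>Chosen so that the bound \<open>card Dl * (B + 1) ^ d\<close> is at most
  \<open>N * (N + 1) ^ d\<close>, strictly less than \<open>(N + 1) ^ Suc d\<close>; here
  \<open>B + 1\<close> is at most \<open>(l * D + 1) * (N + 1)\<close>.\<close>
define N where "N = card Dl * (l * D + 1) ^ d"
define B where "B = l * (N * D)"
define M where "M = (UN F:Dl. {m. keys m <: F & mdeg m <= B})"
define A where "A = {al. set al <: {0..N} & length al = l}"
have finM: "finite M" using fin dim bounded_monomials(1) by (auto simp: M_def)
have finA: "finite A" unfolding A_def by (rule finite_lists_length_eq) simp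
have "card M <= (SUM F:Dl. card {m. keys m <: F & mdeg m <= B})"
	unfolding M_def by (rule card_UN_le[OF fin])
also have "... <= (SUM F:Dl. (B + 1) ^ d)"
proof (rule sum_mono)
	fix F assume F: "F : Dl"
	have "card {m. keys m <: F & mdeg m <= B} <= (B + 1) ^ card F"
		using dim[OF F] bounded_monomials(2) by blast
	also have "... <= (B + 1) ^ d" using dim[OF F] by (intro power_increasing) auto
	finally show "card {m. keys m <: F & mdeg m <= B} <= (B + 1) ^ d" .
qed
also have "... = card Dl * (B + 1) ^ d" by simp
also have "... <= card Dl * ((l * D + 1) * (N + 1)) ^ d"
	by (intro mult_left_mono power_mono) (auto simp: B_def algebra_simps)
also have "... = N * (N + 1) ^ d" by (simp only: N_def power_mult_distrib mult.assoc)
also have "... < (N + 1) ^ Suc d" by simp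
also have "... <= (N + 1) ^ l" using \<open>\<not> l \<le> d\<close> by (intro power_increasing) auto
also have "... = card A" unfolding A_def by (subst card_lists_length_eq) auto
finally have "card M < card A" .
then obtain c where c: "EX al:A. c al ~= 0"
	"ALL m:M. (SUM al:A. c al * lookup (power_mon y al) m) = 0"
	using homogeneous_system_nontrivial_solution[OF finM finA, of "%al. lookup (power_mon y al)"] by blast
let ?s = "SUM al:A. single 0 (c al) * power_mon y al"
have lk: "lookup ?s m = (SUM al:A. c al * lookup (power_mon y al) m)" for m
	by (simp add: lookup_sum lookup_single_0_mult)
have deg: "mdeg m <= B" if "al : A" "m : keys (power_mon y al)" for al m
proof -
	have "ALL a:set al. a <= N" "length al = l" using that(1) by (auto simp: A_def)
	thus ?thesis using degree_power_mon[of al y D N m] that(2) D by (simp add: B_def)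
qed
have "?s : supp_ideal n (%A. A ~: Dl)"
	unfolding supp_ideal_def
proof (intro CollectI conjI ballI notI)
	show "?s : carrier (poly_ring n)"
		using yc by (intro carrier_poly_ring_sum poly_ring_closed(2)[OF poly_ring_closed(6)] power_mon_carrier)
			(auto simp: A_def)
	fix m assume m: "m : keys ?s" "keys m : Dl"
	have nz: "(SUM al:A. c al * lookup (power_mon y al) m) ~= 0"
		using m(1) unfolding in_keys_iff lk .
	then obtain al where "al : A" "c al * lookup (power_mon y al) m ~= 0" by (meson sum.neutral)
	hence "mdeg m <= B" using deg[of al m] by (simp add: in_keys_iff)
	hence "m : M" using m by (auto simp: M_def)
	thus False using c nz by blast
qed
hence "?s : P 0" using I by blast
moreover obtain al0 where "al0 : A" "c al0 ~= 0" using c by blast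
hence "?s ~: P 0"
	by (rule no_relation_along_prime_chain[OF finA, of l, rotated])
		(use prime y chain in "auto simp: A_def prime_chain_def")
ultimately show False by blast
qed

lemma krull_dim_quotient:
assumes down: "down_closed Dl" and sub: "Dl <: Pow {1..n}"
	and dim: "!!F. F : Dl ==> card F <= d" and F: "F : Dl" "card F = d"
shows "krull_dim (poly_ring n Quot (sr_ideal n Dl :: 'k::field mpoly set)) = enat d"
proof -
interpret cring "poly_ring n :: 'k mpoly ring" by (rule cring_poly_ring)
let ?I = "sr_ideal n Dl :: 'k mpoly set"
have I: "ideal ?I (poly_ring n)" by (rule ideal_sr_ideal[OF down])
have fin: "finite Dl" using sub by (meson finite_Pow_iff finite_atLeastAtMost finite_subset)
have finF: "finite F" if "F : Dl" for F using that sub by (meson PowD finite_atLeastAtMost finite_subset subsetD)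
obtain P where P: "prime_chain (poly_ring n :: 'k mpoly ring) (card F) P" "\<forall>i\<le>card F. off_ideal n F <: P i"
	using prime_chain_off[of F n] F sub by blast
have "?I <: off_ideal n F"
	unfolding sr_ideal_eq[OF down] off_ideal_def supp_ideal_def using down_closedD[OF down F(1)] by blast
hence sub': "?I <: P i" if "i <= card F" for i using P(2) that by blast
show ?thesis
proof (rule krull_dim_eqI)
	show "prime_chain (poly_ring n Quot ?I) d (%i. (+>\<^bsub>poly_ring n\<^esub>) ?I ` P i)"
		using prime_chain_imp_quot[OF I P(1) sub'] F by simp
	fix l Q assume "prime_chain (poly_ring n Quot ?I) l Q"
	then obtain P where "prime_chain (poly_ring n) l P" "\<forall>i\<le>l. ?I <: P i"
		using prime_chain_quot_imp[OF I] by blast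
	thus "l <= d" using fin dim finF
		by (intro prime_chain_length[of n l P Dl]) (auto simp: sr_ideal_eq[OF down])
qed
qed

text \<open>The polynomial ring is treated as the Stanley-Reisner ring of the full simplex, whose
  ideal is zero.\<close>

lemma krull_dim_poly_ring: "krull_dim (poly_ring n :: 'k::field mpoly ring) = enat n"
proof -
have "EX P. prime_chain (poly_ring n :: 'k mpoly ring) n P" using prime_chain_off[of "{1..n}" n] by auto
then obtain P where P: "prime_chain (poly_ring n :: 'k mpoly ring) n P" by blast
show ?thesis
proof (rule krull_dim_eqI[OF _ P])
	fix l and Q :: "nat => 'k mpoly set" assume Q: "prime_chain (poly_ring n) l Q"
	have "p = 0" if "p : supp_ideal n (%A. A ~: Pow {1..n})" for p :: "'k mpoly"
	proof -
		have "keys p = {}" using that by (auto simp: supp_ideal_def carrier_poly_ring)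
		thus ?thesis by simp
	qed
	moreover have "0 : Q 0"
		using Q ideal_poly_ringD(2)[of "Q 0" n] by (auto simp: prime_chain_def primeideal_def)
	ultimately have "supp_ideal n (%A. A ~: Pow {1..n}) <: Q 0" by blast
	thus "l <= n"
		by (rule prime_chain_length[OF Q])
			(use card_mono[of "{1..n}"] in "auto simp: finite_subset")
qed
qed

section \<open>Initial degree and multiplicity\<close>

lemma hom_component_D:
"p : hom_component n j <-> p : carrier (poly_ring n) & (ALL m:keys p. mdeg m = j)"
by (simp add: hom_component_def)

lemma vector_space_mpoly: "vector_space (%(c::'k::field) (p::'k mpoly). single 0 c * p)"
by unfold_locales (auto simp: algebra_simps single_add mult_single)

lemma card_le_mdeg: "card (keys m) <= mdeg m"
proof -
have "(SUM i:keys m. 1) <= mdeg m"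
	unfolding mdeg_def by (intro sum_mono) (auto simp: in_keys_iff Suc_le_eq)
thus ?thesis by simp
qed

lemma mdeg_xmon: "finite F ==> mdeg (xmon F) = card F"
by (simp add: mdeg_def keys_xmon lookup_xmon)

lemma squarefree_in_sr_ideal:
assumes "down_closed Dl" "F <: {1..n}" "F ~: Dl"
shows "(single (xmon F) 1 :: 'k::field mpoly) : sr_ideal n Dl Int hom_component n (card F)"
proof -
have "finite F" using assms(2) finite_subset by blast
thus ?thesis
	using assms by (simp add: sr_ideal_eq supp_ideal_def hom_component_D carrier_poly_ring keys_xmon mdeg_xmon)
qed

text \<open>The support of a monomial in the ideal is a nonface, and its degree is at least the size
  of the support; a smallest nonface attains the minimum by its squarefree monomial.\<close>

lemma initial_degree_eqI:
assumes down: "down_closed Dl" and F: "F <: {1..n}" "F ~: Dl" "card F = q"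
	and min: "!!F. F <: {1..n} ==> F ~: Dl ==> q <= card F"
shows "initial_degree n (sr_ideal n Dl :: 'k::field mpoly set) = q"
unfolding initial_degree_def
proof (rule Least_equality)
have "(single (xmon F) 1 :: 'k mpoly) ~= 0"
	by (metis keys_eq_empty keys_single insert_not_empty zero_neq_one)
thus "(sr_ideal n Dl :: 'k mpoly set) Int hom_component n q ~= {0}"
	using squarefree_in_sr_ideal[OF down F(1,2), where 'k='k] F(3) by blast
fix j assume j: "(sr_ideal n Dl :: 'k mpoly set) Int hom_component n j ~= {0}"
have "0 : (sr_ideal n Dl :: 'k mpoly set) Int hom_component n j"
	using ideal_poly_ringD(2)[OF ideal_sr_ideal[OF down]] by (simp add: hom_component_D poly_ring_closed)
with j obtain p where p: "p : (sr_ideal n Dl :: 'k mpoly set)" "p : hom_component n j" "p ~= 0" by blast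
then obtain m where m: "m : keys p" by (metis ex_in_conv keys_eq_empty)
hence "keys m <: {1..n}" "keys m ~: Dl" "mdeg m = j"
	using p by (auto simp: sr_ideal_eq[OF down] supp_ideal_def hom_component_D carrier_poly_ring)
thus "q <= j" using min[of "keys m"] card_le_mdeg[of m] by simp
qed

lemma skeleton_below_initial_degree:
assumes down: "down_closed Dl" and q: "initial_degree n (sr_ideal n Dl :: 'k::field mpoly set) = q"
	and F: "F <: {1..n}" "card F < q"
shows "F : Dl"
proof (rule ccontr)
assume "F ~: Dl"
have "(single (xmon F) 1 :: 'k mpoly) ~= 0"
	by (metis keys_eq_empty keys_single insert_not_empty zero_neq_one)
hence "(sr_ideal n Dl :: 'k mpoly set) Int hom_component n (card F) ~= {0}"
	using squarefree_in_sr_ideal[OF down F(1) \<open>F \<notin> Dl\<close>, where 'k='k] by blast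
hence "q <= card F" using q unfolding initial_degree_def by (metis (lifting) Least_le)
thus False using F by simp
qed

section \<open>The Hilbert function and its growth\<close>

definition face_mons :: "nat set set => nat => (nat \<Rightarrow>\<^sub>0 nat) set" where
"face_mons Dl j = {m. keys m : Dl & mdeg m = j}"

lemma finite_face_mons:
assumes "Dl <: Pow {1..n}" shows "finite (face_mons Dl j)"
proof (rule finite_subset)
show "face_mons Dl j <: {m. keys m <: {1..n} & mdeg m <= j}"
	using assms by (auto simp: face_mons_def)
qed (rule bounded_monomials, simp)

lemma hilbert_function_eq:
assumes down: "down_closed Dl" and sub: "Dl <: Pow {1..n}"
shows "hilbert_function n (sr_ideal n Dl :: 'k::field mpoly set) j = card (face_mons Dl j)"
proof -
interpret vector_space "%(c::'k) (p::'k mpoly). single 0 c * p" by (rule vector_space_mpoly)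
let ?Z = "hom_component n j :: 'k mpoly set" and ?B = "sr_ideal n Dl Int hom_component n j :: 'k mpoly set"
let ?x = "%m. single m (1::'k)"
note I = ideal_sr_ideal[OF down, where 'k='k, of n]
have Z: "subspace ?Z"
proof (rule subspaceI)
	show "0 : ?Z" by (simp add: hom_component_D poly_ring_closed)
	show "p + q : ?Z" if "p : ?Z" "q : ?Z" for p q
		using that keys_add[of p q] by (auto simp: hom_component_D intro: poly_ring_closed)
	show "single 0 c * p : ?Z" if "p : ?Z" for c p
	proof -
		have "keys (single 0 c * p) <: keys p"
			by (auto simp: in_keys_iff lookup_single_0_mult)
		thus ?thesis using that by (auto simp: hom_component_D intro: poly_ring_closed)
	qed
qed
have sI: "subspace (sr_ideal n Dl :: 'k mpoly set)"
	by (rule subspaceI) (auto intro: ideal_poly_ringD[OF I] poly_ring_closed)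
have B: "subspace ?B" using sI Z by (rule subspace_inter)
have fin: "finite (face_mons Dl j)" using sub by (rule finite_face_mons)
have inj: "inj_on ?x A" for A
proof (rule inj_onI)
	fix a b assume "?x a = ?x b"
	hence "lookup (?x a) a = lookup (?x b) a" by simp
	thus "a = b" by (simp add: lookup_single when_def split: if_splits)
qed
have lk: "lookup (SUM x:?x ` face_mons Dl j. single 0 (c x) * x) m =
	(if m : face_mons Dl j then c (?x m) else 0)" for c m
	using fin by (simp add: sum.reindex[OF inj] lookup_sum mult_single lookup_single when_def)
have d: "has_quot_dim (%c p. single 0 c * p) ?Z ?B (card (face_mons Dl j))"
proof (rule has_quot_dimI[OF B, of "?x ` face_mons Dl j"])
	show "?x ` face_mons Dl j <: ?Z"
		using sub by (auto simp: face_mons_def hom_component_D carrier_poly_ring)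
	show "card (?x ` face_mons Dl j) = card (face_mons Dl j)" by (rule card_image[OF inj])
	fix c :: "'k mpoly => 'k"
	assume s: "(SUM x:?x ` face_mons Dl j. single 0 (c x) * x) : ?B" (is "?s : _")
	show "ALL x:?x ` face_mons Dl j. c x = 0"
	proof
		fix x assume "x : ?x ` face_mons Dl j"
		then obtain m where m: "m : face_mons Dl j" "x = ?x m" by blast
		have "?s : sr_ideal n Dl" using s by (rule IntD1)
		hence "ALL m:keys ?s. keys m ~: Dl"
			unfolding sr_ideal_eq[OF down] supp_ideal_def by (elim CollectE conjE)
		moreover have "keys m : Dl" using m(1) by (simp add: face_mons_def)
		ultimately have "m ~: keys ?s" by blast
		hence "lookup ?s m = 0" by (simp only: in_keys_iff not_not)
		hence "c (?x m) = 0" unfolding lk using m(1) by simp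
		thus "c x = 0" unfolding m(2) .
	qed
next
	fix z :: "'k mpoly" assume z: "z : ?Z"
	define c where "c x = lookup z (SOME m. x = ?x m)" for x :: "'k mpoly"
	have cx: "c (?x m) = lookup z m" for m
	proof -
		have "(SOME m'. ?x m = ?x m') = m"
		proof (rule some_equality)
			fix m' assume e: "?x m = ?x m'"
			show "m' = m" using inj_onD[OF inj[of UNIV] e] by simp
		qed simp
		thus ?thesis by (simp add: c_def)
	qed
	let ?s = "SUM x:?x ` face_mons Dl j. single 0 (c x) * x"
	have l: "lookup (z - ?s) m = (if m : face_mons Dl j then 0 else lookup z m)" for m
		by (simp add: lookup_minus lk cx)
	hence k: "m : keys (z - ?s) ==> m : keys z & m ~: face_mons Dl j" for m
		unfolding in_keys_iff by (simp split: if_splits)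
	have "y : ?B" if "!!m. m : keys y ==> m : keys z & m ~: face_mons Dl j" for y
		using z that by (auto simp: sr_ideal_eq[OF down] supp_ideal_def hom_component_D carrier_poly_ring face_mons_def)
	from this[OF k] have "z - ?s : ?B" .
	thus "EX c. z - (SUM x:?x ` face_mons Dl j. single 0 (c x) * x) : ?B" by (rule exI[of _ c])
qed (use fin in simp)
show ?thesis unfolding hilbert_function_def
proof (rule the_equality)
	fix h assume "has_quot_dim (%c p. single 0 c * p) ?Z ?B h"
	thus "h = card (face_mons Dl j)" by (rule quot_dim_unique[OF _ d Z B])
qed (rule d)
qed

text \<open>Splitting by the positive exponent \<open>v\<close> of a new variable gives the sum of
  \<open>s choose card F\<close> over \<open>s < t\<close>, which the hockey-stick identity
  evaluates.\<close>

lemma card_monomials_support: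
assumes "finite F"
shows "finite {m. keys m = F & mdeg m <= t} &
	card {m. keys m = F & mdeg m <= t} = t choose card F"
using assms
proof (induction F arbitrary: t rule: finite_induct)
case empty
have "{m. keys m = ({}::nat set) & mdeg m <= t} = {0}" by (auto simp: mdeg_def)
thus ?case by simp
next
case (insert a F)
let ?M = "%F t. {m. keys m = F & mdeg m <= t}"
let ?f = "%(v::nat) m. m + single a v"
have eq: "?M (insert a F) t = (UN v:{1..t}. ?f v ` ?M F (t - v))"
proof (intro equalityI subsetI)
	fix m assume "m : ?M (insert a F) t"
	hence m: "keys m = insert a F" "mdeg m <= t" by auto
	let ?v = "lookup m a"
	have v: "?v ~= 0" using m(1) by (metis insertI1 lookup_not_eq_zero_eq_in_keys)
	have e: "m = (m - single a ?v) + single a ?v"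
		by (rule poly_mapping_eqI) (simp add: lookup_add lookup_minus lookup_single when_def)
	have k: "keys (m - single a ?v) = F"
	proof -
		have "x : keys (m - single a ?v) <-> x : keys m & x ~= a" for x
			by (auto simp: in_keys_iff lookup_minus lookup_single when_def)
		thus ?thesis using m(1) insert.hyps by auto
	qed
	have "mdeg m = mdeg (m - single a ?v) + ?v"
		by (subst e, subst mdeg_add) (simp add: mdeg_def v)
	hence "m - single a ?v : ?M F (t - ?v)" "?v : {1..t}" using k m(2) v by auto
	thus "m : (UN v:{1..t}. ?f v ` ?M F (t - v))" using e by blast
next
	fix m assume "m : (UN v:{1..t}. ?f v ` ?M F (t - v))"
	then obtain v m' where v: "v : {1..t}" "keys m' = F" "mdeg m' <= t - v" "m = ?f v m'" by blast
	have "mdeg (single a v) = v" by (simp add: mdeg_def)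
	moreover have "v <= t" "v ~= 0" using v(1) by auto
	ultimately show "m : ?M (insert a F) t" using v(2-4) by (simp add: keys_add_nat mdeg_add)
qed
have inj: "inj_on (?f v) A" for v A by (auto simp: inj_on_def)
have disj: "?f v ` ?M F s Int ?f v' ` ?M F s' = {}" if "v ~= v'" for v v' s s'
proof (rule ccontr)
	assume "~ ?thesis"
	then obtain z where z: "z : ?f v ` ?M F s" "z : ?f v' ` ?M F s'" by blast
	obtain m where "keys m = F" "z = ?f v m" using z(1) by (elim imageE CollectE conjE)
	moreover obtain m' where "keys m' = F" "z = ?f v' m'" using z(2) by (elim imageE CollectE conjE)
	ultimately have m: "keys m = F" "keys m' = F" "?f v m = ?f v' m'" by simp_all
	have "a ~: keys m" "a ~: keys m'" unfolding m(1,2) by (rule insert.hyps(2))+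
	hence "lookup m a = 0" "lookup m' a = 0" by (simp_all only: in_keys_iff not_not)
	moreover have "lookup m a + v = lookup m' a + v'"
		using arg_cong[OF m(3), of "%m. lookup m a"] by (simp only: lookup_add lookup_single_eq)
	ultimately show False using that by linarith
qed
have fin: "finite (?f v ` ?M F s)" for v s using insert.IH by simp
have "card (?M (insert a F) t) = (SUM v:{1..t}. card (?f v ` ?M F (t - v)))"
	unfolding eq by (rule card_UN_disjoint) (use fin in simp, use fin in simp, intro ballI impI disj)
also have "... = (SUM v:{1..t}. (t - v) choose card F)"
	using insert.IH by (simp add: card_image[OF inj])
also have "... = (\<Sum>s<t. s choose card F)"
	by (rule sum.reindex_bij_witness[of _ "%s. t - s" "%v. t - v"]) auto
also have "... = t choose Suc (card F)"
	by (induction t) auto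
finally have "card (?M (insert a F) t) = t choose card (insert a F)" using insert.hyps by simp
moreover have "finite (?M (insert a F) t)" unfolding eq using fin by auto
ultimately show ?case by blast
qed

text \<open>Monomials supported on faces form a basis of the quotient, and each has exactly one face
  as its support. Summing below \<open>Suc t\<close> makes the degree bound
  \<open>t\<close>.\<close>

lemma sum_hilbert_function:
assumes down: "down_closed Dl" and sub: "Dl <: Pow {1..n}"
shows "(\<Sum>j<Suc t. hilbert_function n (sr_ideal n Dl :: 'k::field mpoly set) j) = (SUM F:Dl. t choose card F)"
proof -
have fin: "finite Dl" using sub by (meson finite_Pow_iff finite_atLeastAtMost finite_subset)
have finF: "finite F" if "F : Dl" for F using that sub by (meson PowD finite_atLeastAtMost finite_subset subsetD)
have "(\<Sum>j<Suc t. hilbert_function n (sr_ideal n Dl :: 'k mpoly set) j) = (\<Sum>j<Suc t. card (face_mons Dl j))"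
	by (simp only: hilbert_function_eq[OF assms])
also have "... = card (\<Union>j<Suc t. face_mons Dl j)"
	by (rule card_UN_disjoint[symmetric]) (use finite_face_mons[OF sub] in "auto simp: face_mons_def")
also have "(\<Union>j<Suc t. face_mons Dl j) = (UN F:Dl. {m. keys m = F & mdeg m <= t})"
	by (auto simp: face_mons_def)
also have "card ... = (SUM F:Dl. card {m. keys m = F & mdeg m <= t})"
	by (rule card_UN_disjoint) (use fin finF card_monomials_support in auto)
also have "... = (SUM F:Dl. t choose card F)"
	using finF card_monomials_support by (intro sum.cong) auto
finally show ?thesis .
qed

text \<open>Only \<open>k = d\<close> has the full order of growth, so in the limit only the faces
  with \<open>d\<close> vertices count, each with weight one. The denominator uses
  \<open>Suc t\<close> to match the range of degrees up to \<open>t\<close>.\<close>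

lemma binomial_growth:
assumes "k <= d"
shows "(%t. fact d * real (t choose k) / real (Suc t) ^ d) \<longlonglongrightarrow> (if k = d then 1 else 0)"
proof -
have e: "fact d * real (t choose k) / real (Suc t) ^ d =
	fact d / fact k * (\<Prod>i<k. (real t - real i) / real (Suc t)) * (1 / real (Suc t)) ^ (d - k)" for t
proof -
	have "real (t choose k) = (\<Prod>i<k. real t - real i) / fact k"
		by (simp add: binomial_gbinomial gbinomial_prod_rev atLeast0LessThan)
	moreover have "real (Suc t) ^ d = real (Suc t) ^ k * real (Suc t) ^ (d - k)"
		using assms by (simp flip: power_add)
	ultimately show ?thesis by (simp add: prod_dividef power_divide)
qed
have f: "(%t. (real t - real i) / real (Suc t)) \<longlonglongrightarrow> 1" for i
proof -
	have "(%t. 1 - (1 + real i) * inverse (real (Suc t))) \<longlonglongrightarrow> 1 - (1 + real i) * 0"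
		by (intro tendsto_intros LIMSEQ_inverse_real_of_nat)
	moreover have "1 - (1 + real i) * inverse (real (Suc t)) = (real t - real i) / real (Suc t)" for t
		by (simp add: field_simps)
	ultimately show ?thesis by simp
qed
have g: "(%t. 1 / real (Suc t)) \<longlonglongrightarrow> 0" using LIMSEQ_inverse_real_of_nat by (simp add: inverse_eq_divide)
have "(%t. fact d / fact k * (\<Prod>i<k. (real t - real i) / real (Suc t)) * (1 / real (Suc t)) ^ (d - k)) \<longlonglongrightarrow>
	fact d / fact k * (\<Prod>i<k. 1) * 0 ^ (d - k)"
	by (intro tendsto_mult tendsto_const tendsto_prod tendsto_power f g)
moreover have "fact d / fact k * (\<Prod>i<k. 1) * 0 ^ (d - k) = (if k = d then 1 else (0::real))"
	using assms by auto
ultimately show ?thesis by (simp only: e)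
qed

theorem multiplicity_sr_ideal:
assumes down: "down_closed Dl" and sub: "Dl <: Pow {1..n}"
	and dim: "!!F. F : Dl ==> card F <= d" and F: "F : Dl" "card F = d"
shows "multiplicity_of n (sr_ideal n Dl :: 'k::field mpoly set) = real (card {F:Dl. card F = d})"
proof -
have fin: "finite Dl" using sub by (meson finite_Pow_iff finite_atLeastAtMost finite_subset)
let ?s = "%t. fact d * real (\<Sum>j<t. hilbert_function n (sr_ideal n Dl :: 'k mpoly set) j) / real t ^ d"
have "?s (Suc t) = (SUM F:Dl. fact d * real (t choose card F) / real (Suc t) ^ d)" for t
	unfolding sum_hilbert_function[OF down sub] by (simp add: sum_distrib_left sum_divide_distrib)
moreover have "(%t. SUM F:Dl. fact d * real (t choose card F) / real (Suc t) ^ d) \<longlonglongrightarrow> (SUM F:Dl. if card F = d then 1 else 0)"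
	by (intro tendsto_sum binomial_growth dim)
moreover have "(SUM F:Dl. if card F = d then 1 else 0) = real (card {F:Dl. card F = d})"
	using fin by (simp add: sum.If_cases Int_def)
ultimately have "(%t. ?s (Suc t)) \<longlonglongrightarrow> real (card {F:Dl. card F = d})" by simp
\<comment> \<open>The limit was computed along \<open>Suc t\<close>; dropping the shift does not
  change it.\<close>
hence "?s \<longlonglongrightarrow> real (card {F:Dl. card F = d})" by (rule LIMSEQ_imp_Suc)
hence "lim ?s = real (card {F:Dl. card F = d})" by (rule limI)
moreover have "krull_dim (poly_ring n Quot (sr_ideal n Dl :: 'k mpoly set)) = enat d"
	by (rule krull_dim_quotient[OF down sub dim F])
ultimately show ?thesis unfolding multiplicity_of_def by (simp add: Let_def)
qed

section \<open>Faces of cyclic polytopes\<close>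

subsection \<open>The alternating dependency on the moment curve\<close>

text \<open>The sum is the divided difference of the monomial of degree \<open>k\<close> at the
  nodes \<open>S\<close>, that is, the top coefficient of its interpolation polynomial. That
  polynomial is the monomial itself, whose degree is too small.\<close>

lemma lagrange_weights_sum_zero:
fixes S :: "real set"
assumes S: "finite S" and k: "k + 1 < card S"
shows "(SUM s:S. s ^ k / (PROD l:S - {s}. s - l)) = 0"
proof -
define g where "g = monom (1::real) k"
define N where "N s = (PROD l:S - {s}. [:- l, 1:])" for s
define L where "L = (SUM s:S. smult (poly g s / (PROD l:S - {s}. s - l)) (N s))"
have pg: "poly g s = s ^ k" for s by (simp add: g_def poly_monom)
have pN: "poly (N s) x = (PROD l:S - {s}. x - l)" for s x
	by (simp add: N_def poly_prod)
have dN: "degree (N s) = card S - 1" "coeff (N s) (card S - 1) = 1" if "s : S" for s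
proof -
	have "degree (N s) = (SUM l:S - {s}. degree [:- l, 1:])"
		unfolding N_def by (rule degree_prod_eq_sum_degree) auto
	thus d: "degree (N s) = card S - 1" using that S by simp
	have "lead_coeff (N s) = 1" unfolding N_def by (simp add: lead_coeff_prod)
	thus "coeff (N s) (card S - 1) = 1" using d by simp
qed
have pL: "poly L x = poly g x" if x: "x : S" for x
proof -
	have "poly L x = (SUM s:S. if s = x then poly g x else 0)"
		unfolding L_def poly_sum
	proof (rule sum.cong[OF refl])
		fix s assume s: "s : S"
		show "poly (smult (poly g s / (PROD l:S - {s}. s - l)) (N s)) x = (if s = x then poly g x else 0)"
		proof (cases "s = x")
			case True
			have "(PROD l:S - {x}. x - l) ~= 0" using S by simp
			thus ?thesis using True by (simp add: pN)
		next
			case False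
			hence "(PROD l:S - {s}. x - l) = 0" using S x by (intro prod_zero) auto
			thus ?thesis using False by (simp add: pN)
		qed
	qed
	thus ?thesis using S x by simp
qed
have "degree L <= card S - 1"
	unfolding L_def by (rule degree_sum_le[OF S]) (use dN in "auto intro: order_trans[OF degree_smult_le]")
moreover have "degree g <= card S - 1" using k by (simp add: g_def degree_monom_eq)
ultimately have dL: "degree (L - g) <= card S - 1" by (rule degree_diff_le)
have "L - g = 0"
proof (rule ccontr)
	assume nz: "L - g ~= 0"
	have "S <: {x. poly (L - g) x = 0}" using pL by auto
	hence "card S <= card {x. poly (L - g) x = 0}" by (rule card_mono[OF poly_roots_finite[OF nz]])
	also have "... <= degree (L - g)" by (rule card_poly_roots_bound[OF nz])
	finally show False using dL k by simp
qed
hence "coeff L (card S - 1) = coeff g (card S - 1)" by simp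
moreover have "coeff g (card S - 1) = 0" using k by (simp add: g_def)
moreover have "coeff L (card S - 1) = (SUM s:S. poly g s / (PROD l:S - {s}. s - l))"
	unfolding L_def coeff_sum by (intro sum.cong refl) (simp only: coeff_smult dN mult_1_right)
ultimately show ?thesis by (simp add: pg)
qed

text \<open>The weights of the divided difference at the \<open>2 * card J\<close> nodes alternate
  in sign. Every other pair \<open>A j\<close>, \<open>B j\<close> lies entirely on one side of a
  given node and contributes a positive factor, so the sign at a node is decided by its own
  partner.\<close>

lemma alternating_dependency:
fixes A B :: "'j => real"
assumes J: "finite J" and inj: "inj_on A J" and AB: "!!i. i : J ==> A i < B i"
	and sep: "!!i j. i : J ==> j : J ==> A i < A j ==> B i < A j"
shows "\<exists>al \<gamma>. (ALL i:J. 0 < al i & 0 < \<gamma> i) &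
	(ALL k. k + 1 < 2 * card J --> (SUM i:J. al i * A i ^ k) = (SUM i:J. \<gamma> i * B i ^ k))"
proof -
have injB: "inj_on B J"
proof (rule inj_onI, rule ccontr)
	fix i j assume ij: "i : J" "j : J" "B i = B j" "i ~= j"
	hence "A i ~= A j" using inj by (auto dest: inj_onD)
	thus False using sep[of i j] sep[of j i] AB[of i] AB[of j] ij by linarith
qed
have disj: "A i ~= B j" if "i : J" "j : J" for i j
	using sep[of j i] AB[of i] AB[of j] that by fastforce
have disj': "B i ~= A j" if "i : J" "j : J" for i j using disj[OF that(2,1)] by simp
define S where "S = A ` J Un B ` J"
have dj: "A ` J Int B ` J = {}" using disj by auto
have finS: "finite S" and cS: "card S = 2 * card J"
	using J inj injB dj by (auto simp: S_def card_Un_disjoint card_image)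
define w where "w s = (PROD l:S - {s}. s - l)" for s
have wA: "w (A i) < 0" if i: "i : J" for i
proof -
	have "S - {A i} = B ` J Un A ` (J - {i})" using i disj inj by (auto simp: S_def dest: inj_onD)
	moreover have "B ` J Int A ` (J - {i}) = {}" using disj by fastforce
	moreover have "inj_on A (J - {i})" using inj by (rule inj_on_diff)
	ultimately have "w (A i) = (PROD j:J. A i - B j) * (PROD j:J - {i}. A i - A j)"
		unfolding w_def using J injB by (simp add: prod.union_disjoint prod.reindex)
	also have "... = (A i - B i) * (PROD j:J - {i}. (A i - B j) * (A i - A j))"
		using J i by (simp add: prod.remove[of J i] prod.distrib)
	finally have e: "w (A i) = (A i - B i) * (PROD j:J - {i}. (A i - B j) * (A i - A j))" .
	have "0 < (PROD j:J - {i}. (A i - B j) * (A i - A j))"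
	proof (rule prod_pos)
		fix j assume "j : J - {i}"
		hence j: "j : J" "j ~= i" by auto
		hence "A i ~= A j" using inj i by (auto dest: inj_onD)
		then consider "A i < A j" | "A j < A i" by linarith
		thus "0 < (A i - B j) * (A i - A j)"
		proof cases
			case 1 thus ?thesis using AB[OF j(1)] by (intro mult_neg_neg) auto
		next
			case 2 thus ?thesis using sep[OF j(1) i 2] by (intro mult_pos_pos) auto
		qed
	qed
	thus ?thesis unfolding e using AB[OF i] by (intro mult_neg_pos) auto
qed
have wB: "0 < w (B i)" if i: "i : J" for i
proof -
	have "S - {B i} = A ` J Un B ` (J - {i})" using i disj' injB by (auto simp: S_def dest: inj_onD)
	moreover have "A ` J Int B ` (J - {i}) = {}" using disj by fastforce
	moreover have "inj_on B (J - {i})" using injB by (rule inj_on_diff)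
	ultimately have "w (B i) = (PROD j:J. B i - A j) * (PROD j:J - {i}. B i - B j)"
		unfolding w_def using J inj by (simp add: prod.union_disjoint prod.reindex)
	also have "... = (B i - A i) * (PROD j:J - {i}. (B i - A j) * (B i - B j))"
		using J i by (simp add: prod.remove[of J i] prod.distrib)
	finally have e: "w (B i) = (B i - A i) * (PROD j:J - {i}. (B i - A j) * (B i - B j))" .
	have "0 < (PROD j:J - {i}. (B i - A j) * (B i - B j))"
	proof (rule prod_pos)
		fix j assume "j : J - {i}"
		hence j: "j : J" "j ~= i" by auto
		hence "A i ~= A j" using inj i by (auto dest: inj_onD)
		then consider "A i < A j" | "A j < A i" by linarith
		thus "0 < (B i - A j) * (B i - B j)"
		proof cases
			case 1 thus ?thesis using sep[OF i j(1) 1] AB[OF j(1)] by (intro mult_neg_neg) auto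
		next
			case 2 thus ?thesis using sep[OF j(1) i 2] AB[OF i] by (intro mult_pos_pos) auto
		qed
	qed
	thus ?thesis unfolding e using AB[OF i] by (intro mult_pos_pos) auto
qed
show ?thesis
proof (rule exI[of _ "%i. - 1 / w (A i)"], rule exI[of _ "%i. 1 / w (B i)"], intro conjI ballI allI impI)
	show "0 < - 1 / w (A i)" "0 < 1 / w (B i)" if "i : J" for i
		using wA[OF that] wB[OF that] by (auto intro: divide_neg_neg)
	fix k assume "k + 1 < 2 * card J"
	hence "(SUM s:S. s ^ k / w s) = 0" unfolding w_def cS[symmetric] by (rule lagrange_weights_sum_zero[OF finS])
	hence "(SUM i:J. A i ^ k / w (A i)) + (SUM i:J. B i ^ k / w (B i)) = 0"
		unfolding S_def using J dj inj injB by (simp add: sum.union_disjoint sum.reindex)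
	thus "(SUM i:J. - 1 / w (A i) * A i ^ k) = (SUM i:J. 1 / w (B i) * B i ^ k)"
		by (simp add: sum_negf)
qed
qed

text \<open>Between two consecutive points of \<open>R\<close>, and beyond the last, there is
  another point of \<open>V\<close>; one of them is assigned to each \<open>u\<close> on its right.
  The assignment can be arranged so that the given \<open>x\<close> is used.\<close>

lemma right_system:
fixes t :: "'v => real"
assumes V: "finite V" "inj_on t V" and R: "R <: V"
	and sep: "!!u v. u : R ==> v : R ==> t u < t v ==> EX w:V. t u < t w & t w < t v"
	and top: "w : V" "!!u. u : R ==> t u < t w"
	and x: "x : V" "x ~: R" "u0 : R" "t u0 < t x"
shows "EX bt. (ALL u:R. bt u : V & t u < t (bt u) & (ALL v:R. t u < t v --> t (bt u) < t v)) & x : bt ` R"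
proof -
have finR: "finite R" using R V(1) by (rule finite_subset)
have ex: "EX b. b : V & t u < t b & (ALL v:R. t u < t v --> t b < t v)" if u: "u : R" for u
proof (cases "EX v:R. t u < t v")
	case False
	thus ?thesis using top u by (intro exI[of _ w]) auto
next
	case True
	define m where "m = arg_min_on t {v:R. t u < t v}"
	have f: "finite {v:R. t u < t v}" "{v:R. t u < t v} ~= {}" using finR True by auto
	have m: "m : R" "t u < t m" using arg_min_if_finite(1)[OF f, of t] by (auto simp: m_def)
	have least: "t m <= t v" if "v : R" "t u < t v" for v
		unfolding m_def by (rule arg_min_least[OF f]) (use that in simp)
	obtain b where b: "b : V" "t u < t b" "t b < t m" using sep[OF u m] by blast
	show ?thesis using b least by (intro exI[of _ b]) fastforce
qed
then obtain bt0 where bt0: "!!u. u : R ==> bt0 u : V & t u < t (bt0 u) & (ALL v:R. t u < t v --> t (bt0 u) < t v)"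
	by metis
\<comment> \<open>\<open>m\<close> is the last point of \<open>R\<close> before \<open>x\<close>. No
  point of \<open>R\<close> lies between \<open>m\<close> and \<open>x\<close>, so the partner of
  \<open>m\<close> may be changed to \<open>x\<close>.\<close>
define m where "m = arg_min_on (%v. - t v) {v:R. t v < t x}"
have f: "finite {v:R. t v < t x}" "{v:R. t v < t x} ~= {}" using finR x by auto
have m: "m : R" "t m < t x" using arg_min_if_finite(1)[OF f, of "%v. - t v"] by (auto simp: m_def)
have greatest: "t v <= t m" if "v : R" "t v < t x" for v
	using arg_min_least[OF f, of v "%v. - t v"] that by (simp add: m_def)
have mx: "t x < t v" if "v : R" "t m < t v" for v
proof -
	have "t v ~= t x" using that x(1,2) R V(2) by (auto dest: inj_onD)
	thus ?thesis using greatest[of v] that by fastforce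
qed
show ?thesis
proof (intro exI[of _ "bt0(m := x)"] conjI ballI)
	fix u assume u: "u : R"
	show "(bt0(m := x)) u : V" "t u < t ((bt0(m := x)) u)" using bt0[OF u] x m by auto
	show "t u < t v --> t ((bt0(m := x)) u) < t v" if "v : R" for v using bt0[OF u] mx that by auto
qed (use m in force)
qed

text \<open>A positive combination of the points of \<open>R\<close> is matched, in all moments up
  to \<open>2 * card R - 2\<close>, with a positive combination of points of \<open>V\<close> that
  includes \<open>x\<close>. Right neighbours serve if \<open>x\<close> lies beyond some point of
  \<open>R\<close> and there is a point beyond all of \<open>R\<close>; otherwise left neighbours
  do. An \<open>x\<close> outside the range of \<open>R\<close> is itself the outer point.\<close>

lemma separated_dependency:
fixes t :: "'v => real"
assumes V: "finite V" "inj_on t V" and R: "R <: V"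
	and sep: "!!u v. u : R ==> v : R ==> t u < t v ==> EX w:V. t u < t w & t w < t v"
	and outer: "w : V" "(ALL u:R. t u < t w) \<or> (ALL u:R. t w < t u)"
	and x: "x : V" "x ~: R" and two: "2 <= card R"
shows "\<exists>bt al \<gamma>. x : bt ` R & (ALL u:R. bt u : V & 0 < al u & 0 < \<gamma> u) &
	(ALL k. k + 1 < 2 * card R --> (SUM u:R. al u * t u ^ k) = (SUM u:R. \<gamma> u * t (bt u) ^ k))"
proof -
have finR: "finite R" using R V(1) by (rule finite_subset)
have main: "\<exists>bt al \<gamma>. x : bt ` R & (ALL u:R. bt u : V & 0 < al u & 0 < \<gamma> u) &
	(ALL k. k + 1 < 2 * card R --> (SUM u:R. al u * s u ^ k) = (SUM u:R. \<gamma> u * s (bt u) ^ k))"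
	if s: "inj_on s V" and sep': "!!u v. u : R ==> v : R ==> s u < s v ==> EX w:V. s u < s w & s w < s v"
		and top: "w : V" "!!u. u : R ==> s u < s w" and u0: "u0 : R" "s u0 < s x" for s :: "'v => real" and w u0
proof -
	obtain bt where b: "x : bt ` R" "!!u. u : R ==> bt u : V & s u < s (bt u) & (ALL v:R. s u < s v --> s (bt u) < s v)"
		using right_system[OF V(1) s R sep' top x u0] by blast
	have injR: "inj_on s R" using s R by (rule inj_on_subset)
	obtain al \<gamma> where "ALL u:R. 0 < al u & 0 < \<gamma> u"
		"ALL k. k + 1 < 2 * card R --> (SUM u:R. al u * s u ^ k) = (SUM u:R. \<gamma> u * s (bt u) ^ k)"
		using alternating_dependency[OF finR injR, of "%u. s (bt u)"] b(2) by blast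
	hence P: "x : bt ` R & (ALL u:R. bt u : V & 0 < al u & 0 < \<gamma> u) &
		(ALL k. k + 1 < 2 * card R --> (SUM u:R. al u * s u ^ k) = (SUM u:R. \<gamma> u * s (bt u) ^ k))"
		using b by simp
	show ?thesis by (rule exI[of _ bt], rule exI[of _ al], rule exI[of _ \<gamma>], rule P)
qed
\<comment> \<open>Left neighbours are right neighbours for the parameter \<open>- t\<close>.
  Reflection multiplies both sides of the \<open>k\<close>-th moment equation by
  \<open>(-1) ^ k\<close>.\<close>
have reflect: "\<exists>bt al \<gamma>. x : bt ` R & (ALL u:R. bt u : V & 0 < al u & 0 < \<gamma> u) &
	(ALL k. k + 1 < 2 * card R --> (SUM u:R. al u * t u ^ k) = (SUM u:R. \<gamma> u * t (bt u) ^ k))"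
	if low: "w : V" "!!u. u : R ==> t w < t u" and u0: "u0 : R" "t x < t u0" for w u0
proof -
	have i: "inj_on (%v. - t v) V" using V(2) by (auto simp: inj_on_def)
	have sp: "EX w:V. - t u < - t w & - t w < - t v" if "u : R" "v : R" "- t u < - t v" for u v
		using sep[of v u] that by auto
	obtain bt al \<gamma> where *: "x : bt ` R" "ALL u:R. bt u : V & 0 < al u & 0 < \<gamma> u"
		"ALL k. k + 1 < 2 * card R --> (SUM u:R. al u * (- t u) ^ k) = (SUM u:R. \<gamma> u * (- t (bt u)) ^ k)"
		using main[of "%v. - t v" w u0, OF i sp low(1)] low(2) u0 by auto
	have "(SUM u:R. al u * t u ^ k) = (SUM u:R. \<gamma> u * t (bt u) ^ k)" if "k + 1 < 2 * card R" for k
	proof -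
		have pull: "(SUM u:R. a u * (- b u) ^ k) = (-1) ^ k * (SUM u:R. a u * b u ^ k)" for a b :: "'v => real"
			by (simp add: sum_distrib_left power_minus[of "b _"] mult_ac)
		have "(-1) ^ k * (SUM u:R. al u * t u ^ k) = (-1) ^ k * (SUM u:R. \<gamma> u * t (bt u) ^ k)"
			using *(3)[rule_format, OF that] unfolding pull .
		thus ?thesis unfolding mult_cancel_left by simp
	qed
	with * show ?thesis by blast
qed
have R0: "R ~= {}" using two by auto
have tx: "t u ~= t x" if "u : R" for u using that x R V(2) by (auto dest: inj_onD)
consider (up) w u0 where "w : V" "!!u. u : R ==> t u < t w" "u0 : R" "t u0 < t x"
	| (down) w u0 where "w : V" "!!u. u : R ==> t w < t u" "u0 : R" "t x < t u0"
proof -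
	consider (hi) "ALL u:R. t u < t x" | (lo) "ALL u:R. t x < t u"
		| (mid) u v where "u : R" "t u < t x" "v : R" "t x < t v"
		using tx by (meson linorder_neqE_linordered_idom)
	thus thesis
	proof cases
		case hi
		obtain u where "u : R" using R0 by blast
		with hi show thesis by (intro up[OF x(1), of u]) auto
	next
		case lo
		obtain u where "u : R" using R0 by blast
		with lo show thesis by (intro down[OF x(1), of u]) auto
	next
		case mid
		from outer(2) show thesis
		proof
			assume "ALL u:R. t u < t w"
			thus thesis using mid by (intro up[OF outer(1), of u]) auto
		next
			assume "ALL u:R. t w < t u"
			thus thesis using mid by (intro down[OF outer(1), of v]) auto
		qed
	qed
qed
thus ?thesis
proof cases
	case up
	show ?thesis by (rule main[OF V(2) sep up])
next
	case down
	show ?thesis by (rule reflect[OF down])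
qed
qed

subsection \<open>Faces and supporting polynomials\<close>

text \<open>The point \<open>y j\<close> and the renormalized combination \<open>z\<close> of the
  others span a segment with the given point of \<open>T\<close> in its interior, unless the two
  coincide.\<close>

lemma face_of_convex_combination:
fixes T S :: "'a::real_vector set"
assumes T: "T face_of S" and S: "convex S" and J: "finite J" and c: "!!j. j : J ==> 0 < c j" "(SUM j:J. c j) = 1"
	and y: "!!j. j : J ==> y j : S" and in_T: "(SUM j:J. c j *\<^sub>R y j) : T" and j: "j : J"
shows "y j : T"
proof (cases "J = {j}")
case True
thus ?thesis using in_T c by simp
next
case False
let ?K = "J - {j}"
have sK: "(SUM i:?K. c i) = 1 - c j" using J j c(2) by (simp add: sum.remove)
have "?K ~= {}" using False j by auto
hence "0 < (SUM i:?K. c i)" using J c(1) by (intro sum_pos) auto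
hence cj: "c j < 1" using sK by simp
define z where "z = (SUM i:?K. (c i / (1 - c j)) *\<^sub>R y i)"
have z: "z : S" unfolding z_def
proof (rule convex_sum)
	show "(SUM i:?K. c i / (1 - c j)) = 1" using sK cj by (simp flip: sum_divide_distrib)
	show "0 <= c i / (1 - c j)" if "i : ?K" for i using c(1)[of i] that cj by (simp add: less_imp_le)
qed (use J S y in auto)
have "(1 - c j) *\<^sub>R z = (SUM i:?K. c i *\<^sub>R y i)"
	unfolding z_def using cj by (simp add: scaleR_sum_right)
hence e: "(SUM j:J. c j *\<^sub>R y j) = c j *\<^sub>R y j + (1 - c j) *\<^sub>R z"
	using J j by (simp add: sum.remove)
show ?thesis
proof (cases "y j = z")
	case True
	hence "c j *\<^sub>R y j + (1 - c j) *\<^sub>R z = y j" by (simp flip: scaleR_add_left)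
	thus ?thesis using in_T e by simp
next
	case False
	have "c j *\<^sub>R y j + (1 - c j) *\<^sub>R z : open_segment z (y j)"
		unfolding in_segment using False c(1)[OF j] cj by (intro conjI exI[of _ "c j"]) (auto simp: add.commute)
	thus ?thesis using T y[OF j] z in_T unfolding e face_of_def by blast
qed
qed

lemma lookup_moment_curve: "lookup (moment_curve f s) j = (if j : {1..f} then s ^ j else 0)"
by (simp add: moment_curve_def lookup_sum lookup_single when_def)

lemma lookup_scaleR: "lookup (c *\<^sub>R x) j = c * lookup x j"
for x :: "nat \<Rightarrow>\<^sub>0 real"
by (simp add: scaleR_poly_mapping_def Abs_poly_mapping_inverse)

text \<open>The affine function on the ambient space that restricts to the polynomial
  \<open>g\<close> on the moment curve. Supporting hyperplanes are thus polynomials of degree at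
  most \<open>f\<close> that are nonnegative at the parameters.\<close>

definition supp_val :: "nat => real poly => (nat \<Rightarrow>\<^sub>0 real) => real" where
"supp_val f g x = coeff g 0 + (\<Sum>j=1..f. coeff g j * lookup x j)"

lemma supp_val_moment:
assumes "degree g <= f" shows "supp_val f g (moment_curve f s) = poly g s"
proof -
have "poly g s = (\<Sum>j\<le>f. coeff g j * s ^ j)"
	unfolding poly_altdef using assms by (intro sum.mono_neutral_left) (auto simp: coeff_eq_0)
also have "... = coeff g 0 + (\<Sum>j=1..f. coeff g j * s ^ j)"
	by (simp add: atMost_atLeast0 sum.atLeast_Suc_atMost)
finally show ?thesis by (simp add: supp_val_def lookup_moment_curve)
qed

lemma supp_val_combination:
assumes "u + v = 1" shows "supp_val f g (u *\<^sub>R x + v *\<^sub>R y) = u * supp_val f g x + v * supp_val f g y"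
proof -
have "coeff g 0 = u * coeff g 0 + v * coeff g 0" using assms by (simp flip: distrib_right)
thus ?thesis
	by (simp add: supp_val_def lookup_add lookup_scaleR distrib_left sum.distrib sum_distrib_left mult_ac)
qed


lemma cyclic_polytope_subset:
assumes "convex C" "!!i. i : {1..n} ==> moment_curve f (t i) : C"
shows "cyclic_polytope n f t <: C"
unfolding cyclic_polytope_def by (rule hull_minimal) (use assms in auto)

lemma vertex_in_cyclic_polytope: "i : {1..n} ==> moment_curve f (t i) : cyclic_polytope n f t"
unfolding cyclic_polytope_def by (rule hull_inc) simp

lemma supp_val_nonneg:
assumes "degree g <= f" "!!i. i : {1..n} ==> 0 <= poly g (t i)" "x : cyclic_polytope n f t"
shows "0 <= supp_val f g x"
proof -
have "convex {x. 0 <= supp_val f g x}"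
	by (rule convexI) (simp add: supp_val_combination)
hence "cyclic_polytope n f t <: {x. 0 <= supp_val f g x}"
	by (rule cyclic_polytope_subset) (simp add: supp_val_moment assms)
thus ?thesis using assms(3) by blast
qed

lemma supp_val_open_segment:
assumes "0 <= supp_val f g a" "0 <= supp_val f g b" "x : open_segment a b" "supp_val f g x = 0"
shows "supp_val f g a = 0" "supp_val f g b = 0"
proof -
obtain u where u: "0 < u" "u < 1" "x = (1 - u) *\<^sub>R a + u *\<^sub>R b" using assms(3) by (auto simp: in_segment)
have e: "(1 - u) * supp_val f g a + u * supp_val f g b = 0"
	using assms(4) unfolding u(3) by (simp add: supp_val_combination)
have p: "0 <= (1 - u) * supp_val f g a" "0 <= u * supp_val f g b" using assms u by simp_all
hence "(1 - u) * supp_val f g a = 0" "u * supp_val f g b = 0" using e by linarith+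
thus "supp_val f g a = 0" "supp_val f g b = 0" using u by simp_all
qed

lemma face_of_supp_val:
assumes "degree g <= f" "!!i. i : {1..n} ==> 0 <= poly g (t i)"
shows "{x:cyclic_polytope n f t. supp_val f g x = 0} face_of cyclic_polytope n f t"
unfolding face_of_def
proof (intro conjI ballI impI)
let ?P = "cyclic_polytope n f t"
show "convex {x:?P. supp_val f g x = 0}"
proof (rule convexI)
	fix x y and u v :: real assume *: "x : {x:?P. supp_val f g x = 0}" "y : {x:?P. supp_val f g x = 0}" "0 <= u" "0 <= v" "u + v = 1"
	have "convex ?P" by (simp add: cyclic_polytope_def)
	hence "u *\<^sub>R x + v *\<^sub>R y : ?P" using * by (auto simp: convex_def)
	thus "u *\<^sub>R x + v *\<^sub>R y : {x:?P. supp_val f g x = 0}" using * by (simp add: supp_val_combination)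
qed
fix a b x assume *: "a : ?P" "b : ?P" "x : {x:?P. supp_val f g x = 0}" "x : open_segment a b"
have "0 <= supp_val f g a" "0 <= supp_val f g b" using supp_val_nonneg[OF assms] * by auto
from supp_val_open_segment[OF this *(4)] *
show "a : {x:?P. supp_val f g x = 0}" "b : {x:?P. supp_val f g x = 0}" by auto
qed auto

text \<open>The square of the linear polynomial with root \<open>t i\<close> supports the polytope
  at this vertex alone; its degree is the reason for \<open>2 <= f\<close>.\<close>

lemma vertex_extreme:
assumes "inj_on t {1..n}" "i : {1..n}" "2 <= f"
shows "moment_curve f (t i) extreme_point_of cyclic_polytope n f t"
unfolding extreme_point_of_def
proof (intro conjI ballI)
let ?P = "cyclic_polytope n f t" and ?p = "moment_curve f (t i)"
show "?p : ?P" using assms(2) by (rule vertex_in_cyclic_polytope)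
define g where "g = [:- t i, 1:] ^ 2"
have dg: "degree g <= f" using assms(3) by (simp add: g_def degree_power_eq)
have pg: "poly g s = (s - t i)\<^sup>2" for s by (simp add: g_def)
\<comment> \<open>An open half-space with one boundary point added is convex. It contains all
  vertices, hence the polytope, so \<open>?p\<close> is the only point of the polytope on the
  hyperplane.\<close>
let ?C = "insert ?p {x. 0 < supp_val f g x}"
have p0: "supp_val f g ?p = 0" by (simp add: supp_val_moment[OF dg] pg)
have "convex ?C"
proof (rule convexI)
	fix x y and u v :: real assume *: "x : ?C" "y : ?C" "0 <= u" "0 <= v" "u + v = 1"
	show "u *\<^sub>R x + v *\<^sub>R y : ?C"
	proof (cases "u = 0 \<or> v = 0 \<or> (x = ?p & y = ?p)")
		case True
		thus ?thesis using * by (auto simp flip: scaleR_add_left)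
	next
		case False
		hence uv: "0 < u" "0 < v" "x ~= ?p \<or> y ~= ?p" using * by auto
		have "0 <= supp_val f g x" "0 <= supp_val f g y" "0 < supp_val f g x \<or> 0 < supp_val f g y"
			using * uv(3) p0 by auto
		hence "0 < u * supp_val f g x + v * supp_val f g y"
			using uv by (auto intro: add_pos_nonneg add_nonneg_pos)
		thus ?thesis using *(5) by (simp add: supp_val_combination)
	qed
qed
hence C: "?P <: ?C"
proof (rule cyclic_polytope_subset)
	fix j assume j: "j : {1..n}"
	show "moment_curve f (t j) : ?C"
	proof (cases "j = i")
		case False
		hence "t j ~= t i" using assms j by (auto dest: inj_onD)
		thus ?thesis by (simp add: supp_val_moment[OF dg] pg)
	qed simp
qed
fix a b assume ab: "a : ?P" "b : ?P"
show "?p ~: open_segment a b"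
proof
	assume o: "?p : open_segment a b"
	have "0 <= supp_val f g a" "0 <= supp_val f g b" using C ab p0 by auto
	from supp_val_open_segment[OF this o p0] have "a = ?p" "b = ?p" using C ab by auto
	thus False using o by (auto simp: in_segment)
qed
qed

lemma vertex_extreme_face_iff:
assumes "inj_on t {1..n}" "i : {1..n}" "2 <= f" "T face_of cyclic_polytope n f t"
shows "moment_curve f (t i) extreme_point_of T <-> moment_curve f (t i) : T"
using vertex_extreme[OF assms(1-3)] assms(4) unfolding extreme_point_of_def face_of_def by blast

text \<open>A proper face cannot contain \<open>m + 1\<close> separated vertices. The dependency
  exhibits a point of \<open>T\<close> as a convex combination with positive weight at any
  prescribed vertex \<open>x\<close>, which forces \<open>x\<close> into \<open>T\<close>.\<close>

lemma face_eq_polytope: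
assumes inj: "inj_on t {1..n}" and T: "T face_of cyclic_polytope n (2 * m) t" and m: "1 <= m"
	and R: "R <: {1..n}" "card R = Suc m" "!!u. u : R ==> moment_curve (2 * m) (t u) : T"
	and sep: "!!u v. u : R ==> v : R ==> t u < t v ==> EX w:{1..n}. t u < t w & t w < t v"
	and outer: "w : {1..n}" "(ALL u:R. t u < t w) \<or> (ALL u:R. t w < t u)"
shows "T = cyclic_polytope n (2 * m) t"
proof
let ?P = "cyclic_polytope n (2 * m) t" and ?p = "%u. moment_curve (2 * m) (t u)"
show "T <: ?P" using T by (simp add: face_of_def)
have cT: "convex T" using T by (simp add: face_of_def)
have cP: "convex ?P" by (simp add: cyclic_polytope_def)
have finR: "finite R" using R(1) finite_subset by blast
show "?P <: T"
proof (rule cyclic_polytope_subset[OF cT])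
	fix x assume x: "x : {1..n}"
	show "?p x : T"
	proof (cases "x : R")
		case True
		thus ?thesis by (rule R(3))
	next
		case False
		have two: "2 <= card R" using R m by simp
		obtain bt al \<gamma> where b: "x : bt ` R" "ALL u:R. bt u : {1..n} & 0 < al u & 0 < \<gamma> u"
			and dep: "ALL k. k + 1 < 2 * card R --> (SUM u:R. al u * t u ^ k) = (SUM u:R. \<gamma> u * t (bt u) ^ k)"
			using separated_dependency[OF finite_atLeastAtMost inj R(1) sep outer x False two] by blast
		define \<sigma> where "\<sigma> = (SUM u:R. al u)"
		\<comment> \<open>The equation for the power 0 says that both sides have the same total weight, so
		  one normalization makes both convex combinations. The powers from 1 to \<open>2 * m\<close> are
		  the coordinates.\<close>
		have \<sigma>': "\<sigma> = (SUM u:R. \<gamma> u)" using dep[rule_format, of 0] two by (simp add: \<sigma>_def)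
		have R0: "R ~= {}" using two by auto
		have \<sigma>0: "0 < \<sigma>" unfolding \<sigma>_def using finR R0 b(2) by (intro sum_pos) auto
		have eq: "(SUM u:R. (al u / \<sigma>) *\<^sub>R ?p u) = (SUM u:R. (\<gamma> u / \<sigma>) *\<^sub>R ?p (bt u))"
		proof (rule poly_mapping_eqI)
			fix j
			show "lookup (SUM u:R. (al u / \<sigma>) *\<^sub>R ?p u) j = lookup (SUM u:R. (\<gamma> u / \<sigma>) *\<^sub>R ?p (bt u)) j"
			proof (cases "j : {1..2 * m}")
				case True
				hence "j + 1 < 2 * card R" using R(2) by simp
				hence "(SUM u:R. al u * t u ^ j) / \<sigma> = (SUM u:R. \<gamma> u * t (bt u) ^ j) / \<sigma>" using dep by simp
				thus ?thesis using True
					by (simp add: lookup_sum lookup_scaleR lookup_moment_curve sum_divide_distrib)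
			next
				case False
				hence "lookup (?p u) j = 0" for u unfolding lookup_moment_curve by (rule if_not_P)
				thus ?thesis by (simp add: lookup_sum lookup_scaleR)
			qed
		qed
		have "(SUM u:R. (al u / \<sigma>) *\<^sub>R ?p u) : T"
		proof (rule convex_sum[OF finR cT])
			show "(SUM u:R. al u / \<sigma>) = 1" using \<sigma>0 by (simp add: \<sigma>_def flip: sum_divide_distrib)
			show "0 <= al u / \<sigma>" if "u : R" for u using b(2) that \<sigma>0 by (simp add: less_imp_le)
		qed (rule R(3))
		hence y: "(SUM u:R. (\<gamma> u / \<sigma>) *\<^sub>R ?p (bt u)) : T" unfolding eq .
		obtain u where u: "u : R" "x = bt u" using b(1) by blast
		have "?p (bt u) : T"
		proof (rule face_of_convex_combination[OF T cP finR _ _ _ y u(1)])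
			show "0 < \<gamma> u / \<sigma>" if "u : R" for u using b(2) that \<sigma>0 by simp
			show "(SUM u:R. \<gamma> u / \<sigma>) = 1" using \<sigma>0 by (simp add: \<sigma>' flip: sum_divide_distrib)
			show "?p (bt u) : ?P" if "u : R" for u using b(2) that vertex_in_cyclic_polytope by blast
		qed
		thus ?thesis using u by simp
	qed
qed
qed

subsection \<open>Cyclically separated sets of positions\<close>

text \<open>Stable sets in a cycle of length \<open>n\<close> with positions \<open>0\<close> to
  \<open>n - 1\<close>; the condition \<open>j + 2 <= i + n\<close> excludes only the pair joined
  across the seam.\<close>

definition cyc_stable :: "nat => nat set => bool" where
"cyc_stable n I <-> (ALL i:I. ALL j:I. i < j --> i + 2 <= j & j + 2 <= i + n)"

definition gapped :: "nat set => bool" where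
"gapped I <-> (ALL i:I. ALL j:I. i < j --> Suc i < j)"

definition cut :: "nat => (nat => nat) => nat => nat => nat" where
"cut n pos v u = (if pos v < pos u then pos u - pos v - 1 else pos u + n - pos v - 1)"

lemma cut_bij:
assumes pos: "bij_betw pos V {..<n}" and v: "v : V"
shows "bij_betw (cut n pos v) (V - {v}) {..<n - 1}"
proof -
have inj: "inj_on pos V" and im: "pos ` V = {..<n}" using pos by (auto simp: bij_betw_def)
have lt: "pos u < n" if "u : V" for u using im that by blast
have ne: "pos u ~= pos v" if "u : V - {v}" for u using inj v that by (auto dest: inj_onD)
have injc: "inj_on (cut n pos v) (V - {v})"
proof (rule inj_onI)
	fix u w assume uw: "u : V - {v}" "w : V - {v}" "cut n pos v u = cut n pos v w"
	hence "pos u = pos w"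
		using lt[of u] lt[of w] lt[OF v] ne[OF uw(1)] ne[OF uw(2)] by (auto simp: cut_def split: if_splits)
	thus "u = w" using inj uw by (auto dest: inj_onD)
qed
have sub: "cut n pos v ` (V - {v}) <: {..<n - 1}"
proof
	fix k assume "k : cut n pos v ` (V - {v})"
	then obtain u where u: "u : V - {v}" "k = cut n pos v u" by blast
	thus "k : {..<n - 1}" using lt[of u] lt[OF v] ne[OF u(1)] by (auto simp: cut_def split: if_splits)
qed
have finV: "finite V" using pos bij_betw_finite by blast
have "card V = n" using bij_betw_same_card[OF pos] by simp
hence "card (cut n pos v ` (V - {v})) = card {..<n - 1}"
	using card_image[OF injc] finV v by simp
hence "cut n pos v ` (V - {v}) = {..<n - 1}" using sub by (intro card_subset_eq) auto
thus ?thesis using injc by (simp add: bij_betw_def)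
qed

lemma cut_arith:
fixes a b a' b' v n :: nat
assumes "a = a' + v + 1 & v < a \<or> a + n = a' + v + 1 & a < v"
	and "b = b' + v + 1 & v < b \<or> b + n = b' + v + 1 & b < v" and "a < n" "b < n" "v < n"
shows "(a < b --> a + 2 <= b & b + 2 <= a + n) & (b < a --> b + 2 <= a & a + 2 <= b + n) <->
	(a' < b' --> Suc a' < b') & (b' < a' --> Suc b' < a')"
using assms(1)
proof (elim disjE conjE)
assume a: "a = a' + v + 1" "v < a"
from assms(2) show ?thesis
proof (elim disjE conjE)
	assume b: "b = b' + v + 1" "v < b"
	have "(a < b) = (a' < b')" "(b < a) = (b' < a')" "(a + 2 <= b) = (Suc a' < b')" "(b + 2 <= a) = (Suc b' < a')"
		using a(1) b(1) by auto
	moreover have "b + 2 <= a + n" "a + 2 <= b + n" using a b assms by linarith+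
	ultimately show ?thesis by simp
next
	assume b: "b + n = b' + v + 1" "b < v"
	have "b < a" "a' < b'" "b + 2 <= a" using a b assms by linarith+
	moreover have "(a + 2 <= b + n) = (Suc a' < b')" using a(1) b(1) by linarith
	ultimately show ?thesis by simp
qed
next
assume a: "a + n = a' + v + 1" "a < v"
from assms(2) show ?thesis
proof (elim disjE conjE)
	assume b: "b = b' + v + 1" "v < b"
	have "a < b" "b' < a'" "a + 2 <= b" using a b assms by linarith+
	moreover have "(b + 2 <= a + n) = (Suc b' < a')" using a(1) b(1) by linarith
	ultimately show ?thesis by simp
next
	assume b: "b + n = b' + v + 1" "b < v"
	have "(a < b) = (a' < b')" "(b < a) = (b' < a')" "(a + 2 <= b) = (Suc a' < b')" "(b + 2 <= a) = (Suc b' < a')"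
		using a(1) b(1) by linarith+
	moreover have "b + 2 <= a + n" "a + 2 <= b + n" using a b assms by linarith+
	ultimately show ?thesis by simp
qed
qed

text \<open>For sets that avoid \<open>v\<close> the circle may be opened at \<open>v\<close>, where
  no two chosen points can be adjacent across the opening. Cyclic stability then becomes the linear
  gap condition, which is accessible to induction.\<close>

lemma cyc_stable_cut:
assumes pos: "bij_betw pos V {..<n}" and v: "v : V" and R: "R <: V - {v}"
shows "cyc_stable n (pos ` R) <-> gapped (cut n pos v ` R)"
proof -
have inj: "inj_on pos V" and im: "pos ` V = {..<n}" using pos by (auto simp: bij_betw_def)
have lt: "pos u < n" if "u : V" for u using im that by blast
have ne: "pos u ~= pos v" if "u : R" for u using inj v that R by (auto dest: inj_onD)
have pair: "(pos u < pos w --> pos u + 2 <= pos w & pos w + 2 <= pos u + n) &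
		(pos w < pos u --> pos w + 2 <= pos u & pos u + 2 <= pos w + n) <->
	(cut n pos v u < cut n pos v w --> Suc (cut n pos v u) < cut n pos v w) &
		(cut n pos v w < cut n pos v u --> Suc (cut n pos v w) < cut n pos v u)" if "u : R" "w : R" for u w
proof -
	have "pos u < n" "pos w < n" "pos v < n" "pos u ~= pos v" "pos w ~= pos v"
		using that R v lt ne by auto
	hence "pos u = cut n pos v u + pos v + 1 & pos v < pos u \<or> pos u + n = cut n pos v u + pos v + 1 & pos u < pos v"
		"pos w = cut n pos v w + pos v + 1 & pos v < pos w \<or> pos w + n = cut n pos v w + pos v + 1 & pos w < pos v"
		"pos u < n" "pos w < n" "pos v < n"
		unfolding cut_def by auto
	thus ?thesis by (rule cut_arith)
qed
have "cyc_stable n (pos ` R) <-> (ALL u:R. ALL w:R. (pos u < pos w --> pos u + 2 <= pos w & pos w + 2 <= pos u + n) &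
		(pos w < pos u --> pos w + 2 <= pos u & pos u + 2 <= pos w + n))"
	unfolding cyc_stable_def by blast
also have "... <-> (ALL u:R. ALL w:R. (cut n pos v u < cut n pos v w --> Suc (cut n pos v u) < cut n pos v w) &
		(cut n pos v w < cut n pos v u --> Suc (cut n pos v w) < cut n pos v u))"
	using pair by simp
also have "... <-> gapped (cut n pos v ` R)"
	unfolding gapped_def by blast
finally show ?thesis .
qed

text \<open>Gale evenness, read greedily: cover \<open>W\<close> from the left by pairs of neighbours; the left ends
of the pairs form a gapped set, and the product of the corresponding quadratics vanishes
exactly on \<open>W\<close>.\<close>

lemma greedy_supporting_polynomial:
fixes \<tau> :: "nat => real"
assumes pair: "!!i. Suc i < N ==> EX q. degree q <= 2 &
		(ALL x:X. 0 <= poly q x & (poly q x = 0 <-> x = \<tau> i \<or> x = \<tau> (Suc i)))"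
	and W: "W <: {k..<N}"
shows "EX I g. I <: W & gapped I & degree g <= 2 * card I &
	(ALL x:X. 0 <= poly g x & (poly g x = 0 <-> x : \<tau> ` W))"
using W
proof (induction "N - k" arbitrary: k W rule: less_induct)
case less
have finW: "finite W" using less.prems finite_subset by blast
show ?case
proof (cases "W = {}")
	case True
	show ?thesis by (rule exI[of _ "{}"], rule exI[of _ 1]) (simp add: True gapped_def)
next
	case False
	define a where "a = Min W"
	have a: "a : W" "!!b. b : W ==> a <= b" using finW False by (auto simp: a_def)
	hence ak: "k <= a" "a < N" using less.prems by auto
	define W' where "W' = W - {a, Suc a}"
	have W'sub: "W' <: {a + 2..<N}"
	proof
		fix b assume "b : W'"
		thus "b : {a + 2..<N}" using a(2)[of b] less.prems by (auto simp: W'_def)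
	qed
	have smaller: "N - (a + 2) < N - k" using ak by simp
	obtain I g where I: "I <: W'" "gapped I" "degree g <= 2 * card I"
		"!!x. x : X ==> 0 <= poly g x & (poly g x = 0 <-> x : \<tau> ` W')"
		using less.hyps[OF smaller W'sub] by blast
	obtain q where q: "degree q <= 2"
		"!!x. x : X ==> 0 <= poly q x & (poly q x = 0 <-> x : \<tau> ` (W Int {a, Suc a}))"
	proof (cases "Suc a : W")
		case True
		hence "Suc a < N" using less.prems by auto
		from pair[OF this] obtain q where q: "degree q <= 2"
			"ALL x:X. 0 <= poly q x & (poly q x = 0 <-> x = \<tau> a \<or> x = \<tau> (Suc a))" by blast
		have "W Int {a, Suc a} = {a, Suc a}" using True a by auto
		thus thesis using q by (intro that[of q]) auto
	next
		case False
		\<comment> \<open>If the right neighbour is not in \<open>W\<close>, a double root at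
		  \<open>a\<close> replaces the pair, so the polynomial gets no zero outside
		  \<open>W\<close>.\<close>
		have "W Int {a, Suc a} = {a}" using False a by auto
		moreover have "degree ([:- \<tau> a, 1:] ^ 2) <= 2" by (simp add: degree_power_eq)
		ultimately show thesis by (intro that[of "[:- \<tau> a, 1:] ^ 2"]) auto
	qed
	have fI: "finite I" using I(1) finW finite_subset W'_def by (metis finite_Diff)
	have aI: "a ~: I" using I(1) by (auto simp: W'_def)
	show ?thesis
	proof (rule exI[of _ "insert a I"], rule exI[of _ "q * g"], intro conjI ballI)
		show "insert a I <: W" using I(1) a by (auto simp: W'_def)
		show "gapped (insert a I)"
			unfolding gapped_def
		proof (intro ballI impI)
			fix i j assume ij: "i : insert a I" "j : insert a I" "i < j"
			have ge: "a + 2 <= b" if "b : I" for b using that I(1) W'sub by auto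
			show "Suc i < j"
			proof (cases "i = a")
				case True thus ?thesis using ij ge[of j] by auto
			next
				case False
				hence "i : I" "j : I" using ij ge[of i] by auto
				thus ?thesis using I(2) ij by (auto simp: gapped_def)
			qed
		qed
		have "degree (q * g) <= degree q + degree g" by (rule degree_mult_le)
		thus "degree (q * g) <= 2 * card (insert a I)" using q(1) I(3) fI aI by simp
		fix x assume x: "x : X"
		show "0 <= poly (q * g) x" using q(2)[OF x] I(4)[OF x] by simp
		have "W = (W Int {a, Suc a}) Un W'" by (auto simp: W'_def)
		hence "\<tau> ` W = \<tau> ` (W Int {a, Suc a}) Un \<tau> ` W'" by (metis image_Un)
		thus "poly (q * g) x = 0 <-> x : \<tau> ` W" using q(2)[OF x] I(4)[OF x] by simp
	qed
qed
qed

lemma rank_bij: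
fixes t :: "nat => real"
assumes V: "finite V" "inj_on t V"
defines "pos \<equiv> %u. card {w:V. t w < t u}"
shows "bij_betw pos V {..<card V}" and "!!u v. u : V ==> v : V ==> pos u < pos v <-> t u < t v"
proof -
have mono: "pos u < pos v" if "u : V" "v : V" "t u < t v" for u v
	unfolding pos_def by (rule psubset_card_mono) (use V that in force)+
have inj: "inj_on pos V"
proof (rule inj_onI, rule ccontr)
	fix u v assume *: "u : V" "v : V" "pos u = pos v" "u ~= v"
	hence "t u ~= t v" using V by (auto dest: inj_onD)
	thus False using mono[of u v] mono[of v u] * by linarith
qed
have sub: "pos ` V <: {..<card V}"
proof
	fix k assume "k : pos ` V"
	then obtain u where u: "u : V" "k = pos u" by blast
	have "pos u < card V" unfolding pos_def by (rule psubset_card_mono) (use V u in auto)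
	thus "k : {..<card V}" using u by simp
qed
have "pos ` V = {..<card V}" by (rule card_subset_eq) (use sub card_image[OF inj] in auto)
thus "bij_betw pos V {..<card V}" using inj by (simp add: bij_betw_def)
show "pos u < pos v <-> t u < t v" if "u : V" "v : V" for u v
	using mono[of u v] mono[of v u] that by (metis linorder_neqE_linordered_idom not_less_iff_gr_or_eq V(2) inj_onD)
qed

text \<open>A stable set of \<open>m + 1\<close> vertices lies in no proper face by
  \<open>face_eq_polytope\<close>. Conversely, a set without one is not all of \<open>V\<close>, so
  the circle can be opened at a missing vertex and the greedy polynomial has degree at most
  \<open>2 * m\<close>.\<close>

theorem cyclic_boundary_complex_iff:
assumes inj: "inj_on t {1..n}" and m: "1 <= m" and n: "2 * m + 2 <= n"
shows "EX pos. bij_betw pos {1..n} {..<n} & (ALL W. W : cyclic_boundary_complex n (2 * m) t <->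
	W <: {1..n} & ~ (\<exists>R\<subseteq>W. card R = Suc m & cyc_stable n (pos ` R)))"
proof -
define V where "V = {1..n}"
have finV: "finite V" and cV: "card V = n" by (auto simp: V_def)
have injV: "inj_on t V" using inj by (simp add: V_def)
let ?P = "cyclic_polytope n (2 * m) t" and ?p = "%u. moment_curve (2 * m) (t u)"
define pos where "pos u = card {w:V. t w < t u}" for u
have bij: "bij_betw pos V {..<n}" and mono: "!!u v. u : V ==> v : V ==> pos u < pos v <-> t u < t v"
	using rank_bij[OF finV injV] unfolding cV pos_def by blast+
have injp: "inj_on pos V" and im: "pos ` V = {..<n}" using bij by (auto simp: bij_betw_def)
have lt: "pos u < n" if "u : V" for u using im that by blast
have at: "EX w:V. pos w = k" if "k < n" for k using im that by (metis imageE lessThan_iff)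
have vface: "{i:{1..n}. ?p i extreme_point_of T} = {i:V. ?p i : T}" if "T face_of ?P" for T
	using vertex_extreme_face_iff[OF inj _ _ that] m by (auto simp: V_def)
have "W : cyclic_boundary_complex n (2 * m) t <->
	W <: {1..n} & ~ (\<exists>R\<subseteq>W. card R = Suc m & cyc_stable n (pos ` R))" for W
proof
	assume "W : cyclic_boundary_complex n (2 * m) t"
	then obtain T where T: "T face_of ?P" "T ~= ?P" and W: "W = {i:V. ?p i : T}"
		unfolding cyclic_boundary_complex_def using vface by auto
	show "W <: {1..n} & ~ (\<exists>R\<subseteq>W. card R = Suc m & cyc_stable n (pos ` R))"
	proof (intro conjI notI)
		show "W <: {1..n}" using W by (auto simp: V_def)
		assume "\<exists>R\<subseteq>W. card R = Suc m & cyc_stable n (pos ` R)"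
		then obtain R where R: "R <: W" "card R = Suc m" and st: "cyc_stable n (pos ` R)" by blast
		have RV: "R <: V" using R W by auto
		have finR: "finite R" "R ~= {}" using R(2) card_gt_0_iff[of R] by auto
		have stp: "pos u + 2 <= pos v & pos v + 2 <= pos u + n" if "u : R" "v : R" "pos u < pos v" for u v
			using st that unfolding cyc_stable_def by blast
		have sep: "EX w:{1..n}. t u < t w & t w < t v" if uv: "u : R" "v : R" "t u < t v" for u v
		proof -
			have UV: "u : V" "v : V" using uv RV by auto
			hence p: "pos u < pos v" using mono uv by blast
			hence "pos u + 2 <= pos v" using stp uv by blast
			hence "Suc (pos u) < pos v" by simp
			moreover from this obtain w where "w : V" "pos w = Suc (pos u)" using at[of "Suc (pos u)"] lt[OF UV(2)] by auto
			ultimately show ?thesis using mono[of u w] mono[of w v] UV by (intro bexI[of _ w]) (auto simp: V_def)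
		qed
		\<comment> \<open>A stable set cannot contain both the first and the last position, so one of
		  these two lies strictly outside the range of \<open>R\<close> and is the required outer
		  point.\<close>
		have "EX w:V. (ALL u:R. t u < t w) \<or> (ALL u:R. t w < t u)"
		proof -
			let ?a = "Min (pos ` R)" and ?b = "Max (pos ` R)"
			have "?a : pos ` R" "?b : pos ` R" using finR by (auto intro!: Min_in Max_in)
			then obtain a b where ab: "a : R" "pos a = ?a" "b : R" "pos b = ?b" by (metis imageE)
			have bounds: "pos a <= pos u & pos u <= pos b" if "u : R" for u using finR that ab by simp
			have "pos b < n" using lt ab RV by blast
			have d: "pos b + 2 <= pos a + n" using stp[of a b] ab(1,3) n by (cases "pos a < pos b") auto
			show ?thesis
			proof (cases "pos a = 0")
				case False
				obtain w where w: "w : V" "pos w = 0" using at[of 0] n by auto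
				have "t w < t u" if "u : R" for u
					using bounds[OF that] False w mono[of w u] that RV by auto
				thus ?thesis using w by blast
			next
				case True
				obtain w where w: "w : V" "pos w = n - 1" using at[of "n - 1"] n by auto
				have "t u < t w" if "u : R" for u
				proof -
					have "pos u < pos w" using bounds[OF that] True d w n by linarith
					thus ?thesis using w mono[of u w] that RV by auto
				qed
				thus ?thesis using w by blast
			qed
		qed
		then obtain w where w: "w : {1..n}" "(ALL u:R. t u < t w) \<or> (ALL u:R. t w < t u)" by (auto simp: V_def)
		have inT: "?p u : T" if "u : R" for u using that R W by auto
		have "R <: {1..n}" using RV by (simp add: V_def)
		from face_eq_polytope[OF inj T(1) m this R(2) inT sep w] T(2) show False by simp
	qed
next
	assume W: "W <: {1..n} & ~ (\<exists>R\<subseteq>W. card R = Suc m & cyc_stable n (pos ` R))"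
	hence WV: "W <: V" and no: "!!R. R <: W ==> card R = Suc m ==> ~ cyc_stable n (pos ` R)"
		by (auto simp: V_def)
	\<comment> \<open>Otherwise the even positions \<open>0, 2, ..., 2 * m\<close> would be a stable
	  subset; they do not meet across the seam because \<open>2 * m + 2 <= n\<close>.\<close>
	have "W ~= V"
	proof
		assume e: "W = V"
		define I where "I = (%i. 2 * i) ` {..m}"
		have In: "I <: pos ` V" unfolding im using n by (auto simp: I_def)
		define R where "R = {u:V. pos u : I}"
		have pR: "pos ` R = I" using In by (auto simp: R_def)
		have "card R = card I" unfolding pR[symmetric]
			by (rule card_image[symmetric]) (use injp in "auto simp: R_def inj_on_def")
		also have "... = Suc m" unfolding I_def by (subst card_image) (auto simp: inj_on_def)
		finally have "card R = Suc m" .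
		moreover have "cyc_stable n (pos ` R)" unfolding pR cyc_stable_def using n by (auto simp: I_def)
		ultimately show False using no[of R] e by (auto simp: R_def)
	qed
	then obtain v where v: "v : V" "v ~: W" using WV by blast
	define c where "c = cut n pos v"
	have cb: "bij_betw c (V - {v}) {..<n - 1}" unfolding c_def by (rule cut_bij[OF bij v(1)])
	have injc: "inj_on c (V - {v})" and imc: "c ` (V - {v}) = {..<n - 1}" using cb by (auto simp: bij_betw_def)
	define e where "e = inv_into (V - {v}) c"
	have e: "e i : V - {v}" "c (e i) = i" if "i < n - 1" for i
	proof -
		have "i : c ` (V - {v})" using that imc by simp
		thus "e i : V - {v}" "c (e i) = i" unfolding e_def by (rule inv_into_into, rule f_inv_into_f)
	qed
	have ec: "e (c u) = u" if "u : V - {v}" for u unfolding e_def using injc that by (rule inv_into_f_f)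
	have pair: "EX q. degree q <= 2 & (ALL x:t ` V. 0 <= poly q x & (poly q x = 0 <-> x = t (e i) \<or> x = t (e (Suc i))))"
		if i: "Suc i < n - 1" for i
	proof -
		define a b where "a = e i" and "b = e (Suc i)"
		have ab: "a : V" "b : V" "a ~= v" "b ~= v" "c a = i" "c b = Suc i" using e[of i] e[of "Suc i"] i by (auto simp: a_def b_def)
		have pv: "pos a ~= pos v" "pos b ~= pos v" using ab injp v by (auto dest: inj_onD)
		\<comment> \<open>Neighbours after the cut are neighbours on the circle. Either their positions
		  are consecutive or they form the seam between the last and the first position.\<close>
		have "pos b = Suc (pos a) \<or> (pos a = n - 1 & pos b = 0)"
			using ab(5,6) lt[OF ab(1)] lt[OF ab(2)] lt[OF v(1)] pv unfolding c_def cut_def by (auto split: if_splits)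
		thus ?thesis
		proof
			assume s: "pos b = Suc (pos a)"
			define q where "q = [:- t a, 1:] * [:- t b, 1:]"
			have "0 <= poly q x & (poly q x = 0 <-> x = t a \<or> x = t b)" if xV: "x : t ` V" for x
			proof -
				obtain u where u: "u : V" "x = t u" using xV by blast
				have "pos u <= pos a \<or> pos b <= pos u" using s by linarith
				hence "(x <= t a & x <= t b) \<or> (t a <= x & t b <= x)"
				proof
					assume "pos u <= pos a"
					hence "~ t a < t u" "t u < t b" using mono[OF ab(1) u(1)] mono[OF u(1) ab(2)] s by auto
					thus ?thesis using u(2) by simp
				next
					assume "pos b <= pos u"
					hence "~ t u < t b" "t a < t u" using mono[OF u(1) ab(2)] mono[OF ab(1) u(1)] s by auto
					thus ?thesis using u(2) by simp
				qed
				hence "0 <= (x - t a) * (x - t b)" by (auto intro: mult_nonneg_nonneg mult_nonpos_nonpos)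
				moreover have "poly q x = (x - t a) * (x - t b)" by (simp add: q_def algebra_simps)
				ultimately show ?thesis by simp
			qed
			moreover have "degree q <= 2" unfolding q_def by (rule order_trans[OF degree_mult_le]) simp
			ultimately show ?thesis unfolding a_def b_def by blast
		next
			assume s: "pos a = n - 1 & pos b = 0"
			\<comment> \<open>At the seam all parameters lie between the two roots, so the leading sign is
			  reversed to keep the quadratic nonnegative on them.\<close>
			define q where "q = [:t a, - 1:] * [:- t b, 1:]"
			have "0 <= poly q x & (poly q x = 0 <-> x = t a \<or> x = t b)" if xV: "x : t ` V" for x
			proof -
				obtain u where u: "u : V" "x = t u" using xV by blast
				have "~ pos a < pos u" "~ pos u < pos b" using s lt[OF u(1)] by auto
				hence "x <= t a" "t b <= x" using mono[OF ab(1) u(1)] mono[OF u(1) ab(2)] u(2) by auto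
				hence "0 <= (t a - x) * (x - t b)" by (intro mult_nonneg_nonneg) auto
				moreover have "poly q x = (t a - x) * (x - t b)" by (simp add: q_def algebra_simps)
				ultimately show ?thesis by auto
			qed
			moreover have "degree q <= 2" unfolding q_def by (rule order_trans[OF degree_mult_le]) simp
			ultimately show ?thesis unfolding a_def b_def by blast
		qed
	qed
	have "c ` W <: c ` (V - {v})" using WV v by (intro image_mono) blast
	hence cW: "c ` W <: {0..<n - 1}" unfolding imc by (simp add: atLeast0LessThan)
	have "EX I g. I <: c ` W & gapped I & degree g <= 2 * card I &
			(ALL x:t ` V. 0 <= poly g x & (poly g x = 0 <-> x : (%i. t (e i)) ` c ` W))"
		by (rule greedy_supporting_polynomial[of "n - 1" "t ` V" "%i. t (e i)", OF pair cW])
	then obtain I g where I: "I <: c ` W" "gapped I" "degree g <= 2 * card I"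
		and g: "ALL x:t ` V. 0 <= poly g x & (poly g x = 0 <-> x : (%i. t (e i)) ` c ` W)"
		by (elim exE conjE)
	have finI: "finite I" by (rule finite_subset[OF order_trans[OF I(1) cW]]) simp
	\<comment> \<open>A gapped set of \<open>m + 1\<close> positions would, carried back to the circle,
	  be a stable subset of \<open>W\<close>.\<close>
	have "card I <= m"
	proof (rule ccontr)
		assume "~ card I <= m"
		then obtain J where J: "J <: I" "card J = Suc m" by (meson not_less_eq_eq obtain_subset_with_card_n)
		define R where "R = {u:W. c u : J}"
		have cR: "c ` R = J" using J I by (auto simp: R_def)
		have RV: "R <: V - {v}" using WV v by (auto simp: R_def)
		have "card R = Suc m" using card_image[OF inj_on_subset[OF injc RV]] J(2) unfolding cR by simp
		moreover have "gapped (c ` R)" unfolding cR using I(2) J(1) by (auto simp: gapped_def)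
		hence "cyc_stable n (pos ` R)" using cyc_stable_cut[OF bij v(1) RV] by (simp add: c_def)
		ultimately show False using no[of R] by (auto simp: R_def)
	qed
	hence dg: "degree g <= 2 * m" using I(3) by linarith
	have zero: "poly g (t u) = 0 <-> u : W" if u: "u : V" for u
	proof -
		have "(%i. t (e i)) ` c ` W = t ` W" unfolding image_image
		proof (rule image_cong[OF refl])
			fix w assume "w : W"
			hence "w : V" "w ~= v" using WV v by auto
			thus "t (e (c w)) = t w" using ec by simp
		qed
		moreover have "t u : t ` W <-> u : W" by (rule inj_on_image_mem_iff[OF injV u WV])
		ultimately show ?thesis using bspec[OF g, of "t u"] u by simp
	qed
	let ?T = "{x:?P. supp_val (2 * m) g x = 0}"
	have T: "?T face_of ?P" by (rule face_of_supp_val[OF dg]) (use g in "auto simp: V_def")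
	have mem: "?p u : ?T <-> u : W" if "u : V" for u
		using zero[OF that] vertex_in_cyclic_polytope[of u n] that by (simp add: supp_val_moment[OF dg] V_def)
	have "?p v : ?P" using v vertex_in_cyclic_polytope by (simp add: V_def)
	hence "?T ~= ?P" using mem[OF v(1)] v(2) by blast
	moreover have "W = {i:{1..n}. ?p i extreme_point_of ?T}"
		unfolding vface[OF T] using mem WV by blast
	ultimately show "W : cyclic_boundary_complex n (2 * m) t"
		unfolding cyclic_boundary_complex_def using T by blast
qed
thus ?thesis using bij by (intro exI[of _ pos]) (simp add: V_def)
qed

section \<open>Local cohomology of Buchsbaum Stanley--Reisner rings\<close>

subsection \<open>Laurent polynomials and localizations\<close>

lemma lookup_map_mult: "lookup (Poly_Mapping.map ((*) p) x) b = (p::'r::semiring_0) * lookup x b"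
by (simp add: Poly_Mapping.map.rep_eq when_def)

lemma lookup_single_0_mult': "lookup (single 0 c * (p :: 'y::comm_monoid_add \<Rightarrow>\<^sub>0 'k::field)) m = c * lookup p m"
by (simp add: mult_map_scale_conv_mult[symmetric] lookup_map_mult)

abbreviation (input) mscale :: "'k::field => ('x \<Rightarrow>\<^sub>0 ('y::comm_monoid_add \<Rightarrow>\<^sub>0 'k)) => ('x \<Rightarrow>\<^sub>0 ('y \<Rightarrow>\<^sub>0 'k))" where
"mscale \<equiv> %c. Poly_Mapping.map ((*) (single 0 c))"

abbreviation (input) co2 :: "('x \<Rightarrow>\<^sub>0 ('y \<Rightarrow>\<^sub>0 'k::zero)) => 'x => 'y => 'k" where
"co2 z T a \<equiv> lookup (lookup z T) a"

lemma co2_eqI: "(!!T a. co2 z T a = co2 z' T a) ==> z = z'"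
by (intro poly_mapping_eqI) (simp add: poly_mapping_eqI)

lemma co2_mscale: "co2 (mscale c z) T a = c * co2 z T a"
by (simp add: lookup_map_mult lookup_single_0_mult')

lemma co2_sum: "co2 (sum f A) T a = (SUM x:A. co2 (f x) T a)"
by (simp add: lookup_sum)

lemma vector_space_mscale: "vector_space (mscale :: 'k::field => ('x \<Rightarrow>\<^sub>0 ('y::comm_monoid_add \<Rightarrow>\<^sub>0 'k)) => _)"
proof
fix a b :: 'k and x y :: "'x \<Rightarrow>\<^sub>0 ('y \<Rightarrow>\<^sub>0 'k)"
show "mscale a (x + y) = mscale a x + mscale a y"
	by (rule co2_eqI) (simp add: co2_mscale lookup_add distrib_left)
show "mscale (a + b) x = mscale a x + mscale b x"
	by (rule co2_eqI) (simp add: co2_mscale lookup_add distrib_right)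
show "mscale a (mscale b x) = mscale (a * b) x"
	by (rule co2_eqI) (simp add: co2_mscale)
show "mscale 1 x = x"
	by (rule co2_eqI) (simp only: co2_mscale mult_1_left)
qed

lemma co2_mem_keys:
assumes "T : keys z"
obtains a where "co2 z T a ~= 0"
proof -
have "lookup z T ~= 0" using assms by (simp add: in_keys_iff)
hence "EX a. co2 z T a ~= 0" by (metis poly_mapping_eqI lookup_zero)
thus ?thesis using that by blast
qed

lemma co2_keys: "co2 z T a ~= 0 ==> T : keys z & a : keys (lookup z T)"
by (auto simp: in_keys_iff)

lemma lookup_single_mult_plus:
fixes p :: "'a::cancel_comm_monoid_add \<Rightarrow>\<^sub>0 'k::semiring_0"
shows "lookup (single b c * p) (b + k) = c * lookup p k"
	and "(!!k. m ~= b + k) ==> lookup (single b c * p) m = 0"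
proof -
have e: "single b c * p = (SUM k:keys p. single (b + k) (c * lookup p k))"
	by (subst poly_eq_sum_monomials[of p]) (simp add: sum_distrib_left mult_single)
have "lookup (single b c * p) (b + k) =
		(SUM j:keys p. if j = k then c * lookup p j else 0)"
	unfolding e by (simp add: lookup_sum lookup_single when_def)
also have "... = c * lookup p k" by (simp add: in_keys_iff)
finally show "lookup (single b c * p) (b + k) = c * lookup p k" .
assume "!!k. m ~= b + k"
hence "b + k ~= m" for k by metis
thus "lookup (single b c * p) m = 0"
	unfolding e by (simp add: lookup_sum lookup_single when_def)
qed

definition int_exp :: "(nat \<Rightarrow>\<^sub>0 nat) => (nat \<Rightarrow>\<^sub>0 int)" where
"int_exp m = Poly_Mapping.map int m"

lemma lookup_int_exp: "lookup (int_exp m) i = int (lookup m i)"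
by (simp add: int_exp_def Poly_Mapping.map.rep_eq when_def)

lemma keys_int_exp: "keys (int_exp m) = keys m"
by (auto simp: in_keys_iff lookup_int_exp)

lemma inj_int_exp: "inj int_exp"
by (rule injI, rule poly_mapping_eqI) (metis lookup_int_exp of_nat_eq_iff)

lemma int_exp_exists:
assumes "!!i. 0 <= lookup a i" shows "EX m. a = int_exp m"
proof (intro exI poly_mapping_eqI)
fix i show "lookup a i = lookup (int_exp (Poly_Mapping.map nat a)) i"
	using assms[of i] by (simp add: lookup_int_exp Poly_Mapping.map.rep_eq when_def)
qed

lemma lookup_to_laurent:
"lookup (to_laurent p) (int_exp m) = lookup p m"
"(!!m. a ~= int_exp m) ==> lookup (to_laurent p) a = 0"
proof -
have e: "to_laurent p = (SUM k:keys p. single (int_exp k) (lookup p k))"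
	by (simp add: to_laurent_def int_exp_def)
have "lookup (to_laurent p) (int_exp m) =
	 (SUM k:keys p. if k = m then lookup p k else 0)"
	unfolding e by (simp add: lookup_sum lookup_single when_def inj_eq[OF inj_int_exp])
thus "lookup (to_laurent p) (int_exp m) = lookup p m"
	by (simp add: in_keys_iff)
assume "!!m. a ~= int_exp m"
hence "int_exp m ~= a" for m by metis
thus "lookup (to_laurent p) a = 0" unfolding e by (simp add: lookup_sum lookup_single when_def)
qed

lemma to_laurent_single: "to_laurent (single m c) = single (int_exp m) c"
by (simp add: to_laurent_def int_exp_def)

lemma to_laurent_image_iff:
"h : to_laurent ` supp_ideal n U <->
	(ALL a:keys h. (ALL i. 0 <= lookup a i) & keys a <: {1..n} & U (keys a))"
proof
assume "h : to_laurent ` supp_ideal n U"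
then obtain p where p: "p : supp_ideal n U" "h = to_laurent p" by blast
show "ALL a:keys h. (ALL i. 0 <= lookup a i) & keys a <: {1..n} & U (keys a)"
proof
	fix a assume a: "a : keys h"
	then obtain m where m: "a = int_exp m" using lookup_to_laurent(2)[of a p] p(2) by (auto simp: in_keys_iff)
	hence "m : keys p" using a p(2) by (simp add: in_keys_iff lookup_to_laurent)
	thus "(ALL i. 0 <= lookup a i) & keys a <: {1..n} & U (keys a)"
		using p(1) m by (simp add: supp_ideal_def carrier_poly_ring lookup_int_exp keys_int_exp)
qed
next
assume h: "ALL a:keys h. (ALL i. 0 <= lookup a i) & keys a <: {1..n} & U (keys a)"
define p where "p = Poly_Mapping.map_key int_exp h"
have lp: "lookup p m = lookup h (int_exp m)" for m
	unfolding p_def using inj_int_exp by (simp add: Poly_Mapping.map_key.rep_eq)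
have "h = to_laurent p"
proof (rule poly_mapping_eqI)
	fix a show "lookup h a = lookup (to_laurent p) a"
	proof (cases "EX m. a = int_exp m")
		case True
		thus ?thesis by (auto simp: lookup_to_laurent lp)
	next
		case False
		hence "a ~: keys h" using h int_exp_exists by blast
		thus ?thesis using False by (simp add: lookup_to_laurent(2) in_keys_iff)
	qed
qed
moreover have "p : supp_ideal n U"
	unfolding supp_ideal_def
proof (intro CollectI conjI ballI)
	have *: "keys m <: {1..n} & U (keys m)" if "m : keys p" for m
	proof -
		have "int_exp m : keys h" using that by (simp add: in_keys_iff lp)
		hence "keys (int_exp m) <: {1..n} & U (keys (int_exp m))" using h by blast
		thus ?thesis unfolding keys_int_exp .
	qed
	thus "p : carrier (poly_ring n)" by (simp add: carrier_poly_ring)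
	show "U (keys m)" if "m : keys p" for m using * that by blast
qed
ultimately show "h : to_laurent ` supp_ideal n U" by blast
qed

definition pmon :: "nat set => nat => (nat \<Rightarrow>\<^sub>0 nat)" where
"pmon T r = (SUM i:T. single i r)"

lemma lookup_pmon: "finite T ==> lookup (pmon T r) i = (if i : T then r else 0)"
by (simp add: pmon_def lookup_sum lookup_single when_def)

lemma prod_var_power:
assumes "finite T"
shows "(PROD i:T. var i) ^ r = (single (pmon T r) 1 :: 'k::field mpoly)"
proof (induction r)
case 0
have "pmon T 0 = 0" by (simp add: pmon_def)
thus ?case by simp
next
case (Suc r)
have "xmon T + pmon T r = pmon T (Suc r)"
	by (rule poly_mapping_eqI) (simp add: lookup_add lookup_xmon lookup_pmon assms)
thus ?case using Suc by (simp add: prod_var[OF assms] mult_single)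
qed

definition neg_set :: "(nat \<Rightarrow>\<^sub>0 int) => nat set" where
"neg_set a = {i. lookup a i < 0}"

text \<open>Multiplying by a high power of the product of the variables in \<open>T\<close> makes
  the exponents on \<open>T\<close> positive and leaves the others alone. So the support becomes
  \<open>keys a Un T\<close>, and all negative exponents must have been in \<open>T\<close>.\<close>

lemma localize_iff:
fixes g :: "'k::field laurent"
assumes T: "T <: {1..n}" and up: "!!A B. U A ==> A <: B ==> B <: {1..n} ==> U B"
shows "g : localize T (supp_ideal n U) <->
	(ALL a:keys g. neg_set a <: T & keys a <: {1..n} & U (keys a Un T))"
proof -
have finT: "finite T" using T finite_subset by blast
let ?b = "%r. int_exp (pmon T r)"
have lb: "lookup (?b r) i = (if i : T then int r else 0)" for r i
	by (simp add: lookup_int_exp lookup_pmon[OF finT])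
have tl: "to_laurent ((PROD i:T. var i) ^ r) = (single (?b r) 1 :: 'k laurent)" for r
	by (simp add: prod_var_power[OF finT] to_laurent_single)
have keys: "keys (to_laurent ((PROD i:T. var i) ^ r) * g) = (%a. ?b r + a) ` keys g" for r
proof (intro equalityI subsetI)
	fix c assume c: "c : keys (to_laurent ((PROD i:T. var i) ^ r) * g)"
	have "c = ?b r + (c - ?b r)" by simp
	hence "c - ?b r : keys g"
		using c lookup_single_mult_plus(1)[of "?b r" "1::'k" g "c - ?b r"] unfolding tl by (simp add: in_keys_iff)
	thus "c : (%a. ?b r + a) ` keys g" using \<open>c = ?b r + (c - ?b r)\<close> by blast
next
	fix c assume "c : (%a. ?b r + a) ` keys g"
	thus "c : keys (to_laurent ((PROD i:T. var i) ^ r) * g)"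
		unfolding tl by (auto simp: in_keys_iff lookup_single_mult_plus)
qed
show ?thesis
proof
	assume "g : localize T (supp_ideal n U)"
	then obtain r where r: "to_laurent ((PROD i:T. var i) ^ r) * g : to_laurent ` supp_ideal n U" by (auto simp: localize_def)
	show "ALL a:keys g. neg_set a <: T & keys a <: {1..n} & U (keys a Un T)"
	proof
		fix a assume "a : keys g"
		hence "?b r + a : keys (to_laurent ((PROD i:T. var i) ^ r) * g)" unfolding keys by blast
		hence *: "ALL i. 0 <= lookup (?b r + a) i" "keys (?b r + a) <: {1..n}"
			"U (keys (?b r + a))"
			using r unfolding to_laurent_image_iff by blast+
		have "neg_set a <: T"
		proof
			fix i assume "i : neg_set a"
			thus "i : T" using *(1)[rule_format, of i] by (auto simp: neg_set_def lookup_add lb split: if_splits)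
		qed
		moreover have k: "keys a <: {1..n}"
		proof
			fix i assume "i : keys a"
			hence "i : T \<or> i : keys (?b r + a)" by (auto simp: in_keys_iff lookup_add lb)
			thus "i : {1..n}" using T *(2) by blast
		qed
		moreover have "keys (?b r + a) <: keys a Un T"
			by (auto simp: in_keys_iff lookup_add lb)
		hence "U (keys a Un T)" using up[OF *(3)] k T by blast
		ultimately show "neg_set a <: T & keys a <: {1..n} & U (keys a Un T)" by blast
	qed
next
	assume g: "ALL a:keys g. neg_set a <: T & keys a <: {1..n} & U (keys a Un T)"
	define N where "N = Max (insert 0 (UN a:keys g. (%i. \<bar>lookup a i\<bar>) ` keys a))"
	have N: "\<bar>lookup a i\<bar> <= N" if "a : keys g" for a i
	proof (cases "i : keys a")
		case True
		thus ?thesis unfolding N_def using that by (intro Max_ge) auto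
	next
		case False
		thus ?thesis unfolding N_def by (intro Max_ge) (auto simp: in_keys_iff)
	qed
	\<comment> \<open>One more than the largest absolute exponent: exponents on \<open>T\<close> must
	  become strictly positive, since the support of the product has to be exactly
	  \<open>keys a Un T\<close>.\<close>
	define r where "r = nat (N + 1)"
	have "0 <= N" unfolding N_def by (rule Max_ge) auto
	hence r: "int r = N + 1" by (simp add: r_def)
	have "to_laurent ((PROD i:T. var i) ^ r) * g : to_laurent ` supp_ideal n U"
		unfolding to_laurent_image_iff keys
	proof (intro ballI)
		fix c assume "c : (%a. ?b r + a) ` keys g"
		then obtain a where a: "a : keys g" "c = ?b r + a" by blast
		have pos: "0 <= lookup c i" for i
		proof (cases "i : T")
			case True
			thus ?thesis using N[OF a(1), of i] r by (simp add: a(2) lookup_add lb)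
		next
			case False
			hence "i ~: neg_set a" using g a(1) by blast
			thus ?thesis using False by (simp add: a(2) lookup_add lb neg_set_def)
		qed
		have "keys c = keys a Un T"
		proof -
			have "i : keys c <-> i : keys a \<or> i : T" for i
				using N[OF a(1), of i] r by (auto simp: a(2) in_keys_iff lookup_add lb)
			thus ?thesis by blast
		qed
		thus "(ALL i. 0 <= lookup c i) & keys c <: {1..n} & U (keys c)"
			using pos g a(1) T by auto
	qed
	thus "g : localize T (supp_ideal n U)" unfolding localize_def by blast
qed
qed

subsection \<open>The Cech complex, degree by degree\<close>

lemma cech_cochains_iff:
fixes z :: "nat set \<Rightarrow>\<^sub>0 'k::field laurent"
shows "z : cech_cochains n i <-> (ALL T a. co2 z T a ~= 0 -->
	T <: {1..n} & int (card T) = i & neg_set a <: T & keys a <: {1..n})"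
proof -
have c: "carrier (poly_ring n) = (supp_ideal n (%_. True) :: 'k mpoly set)" by (auto simp: supp_ideal_def)
have l: "g : localize T (carrier (poly_ring n)) <-> (ALL a:keys g. neg_set a <: T & keys a <: {1..n})"
	if "T <: {1..n}" for T and g :: "'k laurent"
	unfolding c using localize_iff[OF that, of "%_. True" g] by simp
show ?thesis
proof
	assume z: "z : cech_cochains n i"
	show "ALL T a. co2 z T a ~= 0 --> T <: {1..n} & int (card T) = i & neg_set a <: T & keys a <: {1..n}"
	proof (intro allI impI)
		fix T a assume "co2 z T a ~= 0"
		hence k: "T : keys z" "a : keys (lookup z T)" by (auto simp: in_keys_iff)
		hence *: "T <: {1..n}" "int (card T) = i" "lookup z T : localize T (carrier (poly_ring n))"
			using z by (auto simp: cech_cochains_def)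
		thus "T <: {1..n} & int (card T) = i & neg_set a <: T & keys a <: {1..n}" using l[OF *(1)] k by blast
	qed
next
	assume z: "ALL T a. co2 z T a ~= 0 --> T <: {1..n} & int (card T) = i & neg_set a <: T & keys a <: {1..n}"
	show "z : cech_cochains n i"
		unfolding cech_cochains_def
	proof (intro CollectI ballI)
		fix T assume "T : keys z"
		then obtain a where "co2 z T a ~= 0" by (rule co2_mem_keys)
		hence T: "T <: {1..n}" "int (card T) = i" using z by blast+
		moreover have "lookup z T : localize T (carrier (poly_ring n))"
			unfolding l[OF T(1)] using z by (auto simp: in_keys_iff)
		ultimately show "T <: {1..n} & int (card T) = i & lookup z T : localize T (carrier (poly_ring n))" by blast
	qed
qed
qed

lemma cech_null_iff:
fixes z :: "nat set \<Rightarrow>\<^sub>0 'k::field laurent"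
assumes down: "down_closed Dl"
shows "z : cech_null n (sr_ideal n Dl) <-> (ALL T a. co2 z T a ~= 0 -->
	T <: {1..n} & neg_set a <: T & keys a <: {1..n} & keys a Un T ~: Dl)"
proof -
have l: "g : localize T (sr_ideal n Dl) <-> (ALL a:keys g. neg_set a <: T & keys a <: {1..n} &
	keys a Un T ~: Dl)" if "T <: {1..n}" for T and g :: "'k laurent"
	unfolding sr_ideal_eq[OF down] by (rule localize_iff[OF that]) (use down_closedD[OF down] in blast)
show ?thesis
proof
	assume z: "z : cech_null n (sr_ideal n Dl)"
	show "ALL T a. co2 z T a ~= 0 --> T <: {1..n} & neg_set a <: T & keys a <: {1..n} & keys a Un T ~: Dl"
	proof (intro allI impI)
		fix T a assume "co2 z T a ~= 0"
		hence k: "T : keys z" "a : keys (lookup z T)" by (auto simp: in_keys_iff)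
		hence *: "T <: {1..n}" "lookup z T : localize T (sr_ideal n Dl)"
			using z by (auto simp: cech_null_def)
		thus "T <: {1..n} & neg_set a <: T & keys a <: {1..n} & keys a Un T ~: Dl" using l[OF *(1)] k by blast
	qed
next
	assume z: "ALL T a. co2 z T a ~= 0 --> T <: {1..n} & neg_set a <: T & keys a <: {1..n} & keys a Un T ~: Dl"
	show "z : cech_null n (sr_ideal n Dl)"
		unfolding cech_null_def
	proof (intro CollectI ballI)
		fix T assume "T : keys z"
		then obtain a where "co2 z T a ~= 0" by (rule co2_mem_keys)
		hence T: "T <: {1..n}" using z by blast
		moreover have "lookup z T : localize T (sr_ideal n Dl)"
			unfolding l[OF T] using z by (auto simp: in_keys_iff)
		ultimately show "T <: {1..n} & lookup z T : localize T (sr_ideal n Dl)" by blast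
	qed
qed
qed

lemma lookup_sign_mult: "lookup ((-1) ^ k * p) a = (-1) ^ k * lookup p a"
for p :: "'a::comm_monoid_add \<Rightarrow>\<^sub>0 'k::field"
by (cases "even k") simp_all

text \<open>For a fixed exponent \<open>a\<close> the Cech differential is the simplicial
  coboundary, so the Cech complex splits by exponents into pieces of the type already
  studied.\<close>

lemma co2_cech_diff:
fixes z :: "nat set \<Rightarrow>\<^sub>0 'k::field laurent"
shows "co2 (cech_diff n z) T a = (if T <: {1..n} then cobd (%S. co2 z S a) T else 0)"
proof -
have "lookup (cech_diff n z) T = (SUM S:Pow {1..n}. if S = T then
	(SUM u:S. (-1) ^ card {b:S. b < u} * lookup z (S - {u})) else 0)"
	unfolding cech_diff_def by (simp add: lookup_sum lookup_single when_def)
also have "... = (if T <: {1..n} then (SUM u:T. (-1) ^ card {b:T. b < u} * lookup z (T - {u})) else 0)"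
	by simp
finally show ?thesis
	by (simp add: lookup_sum lookup_sign_mult cobd_def osign_def)
qed

definition assemble :: "('x \<times> 'y) set => ('x => 'y => 'k::field) => ('x \<Rightarrow>\<^sub>0 ('y \<Rightarrow>\<^sub>0 'k))" where
"assemble F c = (SUM p:F. single (fst p) (single (snd p) (c (fst p) (snd p))))"

lemma co2_assemble:
assumes "finite F" shows "co2 (assemble F c) T a = (if (T, a) : F then c T a else 0)"
proof -
have "co2 (assemble F c) T a = (SUM p:F. if p = (T, a) then c T a else 0)"
	unfolding assemble_def
	by (simp add: lookup_sum lookup_single when_def if_distrib[of "%x. lookup x a"] prod_eq_iff cong: if_cong)
		(intro sum.cong, auto simp: lookup_single when_def)
thus ?thesis using assms by simp
qed

text \<open>Cochains on sets containing \<open>G\<close> are identified with cochains on the sets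
  \<open>T\<close> disjoint from \<open>G\<close>. The product of signs accounts for the vertices of
  \<open>G\<close> that precede the elements of \<open>T\<close> in the orientation.\<close>

lemma twisted_cobd:
fixes g :: "nat set => 'k::field"
assumes fin: "finite G" "finite T" "T Int G = {}" and g: "!!S. g S ~= 0 ==> G <: S"
shows "cobd (%S. (PROD u:S. osign u G) * g (G Un S)) T = (PROD u:T. osign u G) * cobd g (G Un T)"
proof -
have "cobd g (G Un T) = (SUM u:T. osign u (G Un T) * g (G Un T - {u}))"
	unfolding cobd_def
proof (rule sum.mono_neutral_right)
	show "ALL u:G Un T - T. osign u (G Un T) * g (G Un T - {u}) = 0"
	proof
		fix u assume u: "u : G Un T - T"
		hence "g (G Un T - {u}) = 0" using g[of "G Un T - {u}"] by blast
		thus "osign u (G Un T) * g (G Un T - {u}) = 0" by simp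
	qed
qed (use fin in auto)
hence "(PROD u:T. osign u G) * cobd g (G Un T) = (SUM u:T. (PROD u:T. osign u G) * (osign u (G Un T) * g (G Un T - {u})))"
	by (simp add: sum_distrib_left)
also have "... = (SUM u:T. osign u T * ((PROD v:T - {u}. osign v G) * g (G Un (T - {u}))))"
proof (rule sum.cong[OF refl])
	fix u assume u: "u : T"
	have s: "G Un T - {u} = G Un (T - {u})" using u fin by blast
	have "{x:G Un T. x < u} = {x:G. x < u} Un {x:T. x < u}" by blast
	moreover have "{x:G. x < u} Int {x:T. x < u} = {}" using fin by blast
	ultimately have o: "osign u (G Un T) = osign u G * (osign u T :: 'k)"
		using fin by (simp add: osign_def card_Un_disjoint power_add)
	have p: "(PROD v:T. osign v G) = osign u G * (PROD v:T - {u}. osign v G :: 'k)"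
		using fin u by (simp add: prod.remove)
	show "(PROD u:T. osign u G) * (osign u (G Un T) * g (G Un T - {u})) = osign u T * ((PROD v:T - {u}. osign v G) * g (G Un (T - {u})))"
		unfolding s o p by (simp add: mult_ac)
qed
finally show ?thesis by (simp add: cobd_def)
qed

lemma prod_osign_square: "(PROD u:T. osign u G) * ((PROD u:T. osign u G) * x) = (x::'k::field)"
proof -
have "(PROD u:T. osign u G) * (PROD u:T. osign u G) = (1::'k)"
	by (simp flip: prod.distrib)
thus ?thesis by (simp flip: mult.assoc)
qed

text \<open>The assumptions say that \<open>L\<close> induces an isomorphism of \<open>Z'\<close>
  modulo \<open>B'\<close> onto \<open>Z\<close> modulo \<open>B\<close>, stated so that only
  representatives are handled.\<close>

lemma (in vector_space_pair) quot_dim_transfer: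
assumes d: "has_quot_dim s1 Z' B' h" and Z': "vs1.subspace Z'" and B': "vs1.subspace B'" and B: "vs2.subspace B"
	and L: "Vector_Spaces.linear s1 s2 L" and LZ: "!!g. g : Z' ==> L g : Z" and LB: "!!g. g : Z' ==> L g : B <-> g : B'"
	and surj: "!!z. z : Z ==> EX g:Z'. z - L g : B"
shows "has_quot_dim s2 Z B h"
proof -
interpret L: Vector_Spaces.linear s1 s2 L by (fact L)
obtain X where X: "X <: Z'" "finite X" "card X = h"
	"!!c. (SUM x:X. s1 (c x) x) : B' ==> (ALL x:X. c x = 0)"
	"!!z. z : Z' ==> EX c. z - (SUM x:X. s1 (c x) x) : B'"
	by (rule vs1.has_quot_dimE[OF d Z' B']) blast
have comb: "(SUM x:X. s1 (c x) x) : Z'" for c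
	using X(1) Z' by (intro vs1.subspace_sum vs1.subspace_scale) auto
have inj: "inj_on L X"
proof (rule inj_onI, rule ccontr)
	fix x y assume xy: "x : X" "y : X" "L x = L y" "x ~= y"
	define c where "c z = (if z = x then 1 else if z = y then - 1 else (0::'a))" for z
	have "(SUM z:X. s1 (c z) z) = (SUM z:{x, y}. s1 (c z) z)"
		using xy X(2) by (intro sum.mono_neutral_right) (auto simp: c_def)
	also have "... = x - y" using xy(4) by (simp add: c_def)
	finally have e: "(SUM z:X. s1 (c z) z) = x - y" .
	have "L (x - y) : B" using xy(3) vs2.subspace_0[OF B] by (simp add: L.diff)
	hence "(SUM z:X. s1 (c z) z) : B'" using LB[OF comb[of c]] unfolding e by blast
	hence "c x = 0" using X(4) xy(1) by blast
	thus False by (simp add: c_def)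
qed
have sumL: "(SUM y:L ` X. s2 (c y) y) = L (SUM x:X. s1 (c (L x)) x)" for c
	unfolding sum.reindex[OF inj] by (simp add: L.sum L.scale)
show ?thesis
proof (rule vs2.has_quot_dimI[OF B, of "L ` X"])
	show "L ` X <: Z" using LZ X(1) by blast
	show "card (L ` X) = h" using X(3) card_image[OF inj] by simp
	fix c assume "(SUM y:L ` X. s2 (c y) y) : B"
	hence "(SUM x:X. s1 (c (L x)) x) : B'" unfolding sumL by (rule LB[OF comb, THEN iffD1])
	thus "ALL y:L ` X. c y = 0" using X(4)[of "%x. c (L x)"] by blast
next
	fix z assume "z : Z"
	then obtain g where g: "g : Z'" "z - L g : B" using surj by blast
	then obtain c where c: "g - (SUM x:X. s1 (c x) x) : B'" using X(5) by blast
	define c' where "c' y = c (inv_into X L y)" for y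
	have e: "(SUM x:X. s1 (c' (L x)) x) = (SUM x:X. s1 (c x) x)"
		by (intro sum.cong) (auto simp: c'_def inv_into_f_f[OF inj])
	have "g - (SUM x:X. s1 (c x) x) : Z'" using g(1) comb Z' by (intro vs1.subspace_diff) auto
	hence "L (g - (SUM x:X. s1 (c x) x)) : B" using LB c by blast
	hence "(z - L g) + L (g - (SUM x:X. s1 (c x) x)) : B" by (rule vs2.subspace_add[OF B g(2)])
	hence "z - (SUM y:L ` X. s2 (c' y) y) : B" unfolding sumL e by (simp add: L.diff)
	thus "EX c. z - (SUM y:L ` X. s2 (c y) y) : B" by (rule exI[of _ c'])
qed (use X in simp)
qed

text \<open>Hochster's description of local cohomology. An exponent with a positive entry gives an
  acyclic piece, a nonzero exponent without positive entries gives cohomology of the link of its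
  negative support, and the exponent 0 gives cohomology of \<open>Dl\<close>. The assumption
  \<open>van\<close> removes all links of nonempty faces.\<close>

theorem local_cohomology_dim:
assumes down: "down_closed Dl" and sub: "Dl <: Pow {1..n}"
	and van: "!!G. G : Dl ==> G ~= {} ==> card G <= i ==> cvan TYPE('k::field) (link Dl G) (i - card G)"
	and h: "has_quot_dim fscale (cocycles Dl i :: (nat set => 'k) set) (cobs Dl i) h"
shows "has_local_cohomology_dim n (sr_ideal n Dl :: 'k mpoly set) i h' <-> h' = h"
proof -
let ?V = "{1..n}" and ?I = "sr_ideal n Dl :: 'k mpoly set"
have finD: "finite Dl" using sub by (meson finite_Pow_iff finite_atLeastAtMost finite_subset)
have finF: "finite F" if "F : Dl" for F using that sub by (meson PowD finite_atLeastAtMost finite_subset subsetD)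
interpret fc: finite_complex Dl by unfold_locales (use finD down finF in auto)
interpret vector_space_pair "fscale :: 'k => (nat set => 'k) => _" "mscale :: 'k => (nat set \<Rightarrow>\<^sub>0 'k laurent) => _"
	by (intro vector_space_pair.intro fc.fs vector_space_mscale)
define Z where "Z = {z:cech_cochains n (int i). cech_diff n z : cech_null n ?I}"
define B where "B = {z:cech_cochains n (int i). EX w:cech_cochains n (int i - 1). z - cech_diff n w : cech_null n ?I}"
have nullD: "co2 z T a = 0" if "z : cech_null n ?I" "keys a Un T : Dl" for z T a
	using that unfolding cech_null_iff[OF down] by blast
have cob_add: "cobd (%S. co2 (x + y) S a) T = cobd (%S. co2 x S a) T + cobd (%S. co2 y S a) T"
	for x y :: "nat set \<Rightarrow>\<^sub>0 'k laurent" and a T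
	using cobd_add[of "%S. co2 x S a" "%S. co2 y S a" T] by (simp add: lookup_add)
have diff_add: "cech_diff n (x + y) = cech_diff n x + cech_diff n y" for x y :: "nat set \<Rightarrow>\<^sub>0 'k laurent"
	by (rule co2_eqI) (simp add: lookup_add co2_cech_diff cob_add[unfolded lookup_add])
have diff_scale: "cech_diff n (mscale c x) = mscale c (cech_diff n x)" for c and x :: "nat set \<Rightarrow>\<^sub>0 'k laurent"
	by (rule co2_eqI) (simp add: co2_mscale co2_cech_diff cobd_scale)
have sub_cc: "vs2.subspace (cech_cochains n j :: (nat set \<Rightarrow>\<^sub>0 'k laurent) set)" for j
proof (rule vs2.subspaceI)
	fix x y :: "nat set \<Rightarrow>\<^sub>0 'k laurent" assume xy: "x : cech_cochains n j" "y : cech_cochains n j"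
	show "x + y : cech_cochains n j"
		unfolding cech_cochains_iff
	proof (intro allI impI)
		fix T a assume "co2 (x + y) T a ~= 0"
		hence "co2 x T a ~= 0 \<or> co2 y T a ~= 0" by (auto simp: lookup_add)
		thus "T <: ?V & int (card T) = j & neg_set a <: T & keys a <: ?V"
			by (elim disjE xy[unfolded cech_cochains_iff, rule_format])
	qed
next
	fix c and x :: "nat set \<Rightarrow>\<^sub>0 'k laurent" assume x: "x : cech_cochains n j"
	show "mscale c x : cech_cochains n j"
		unfolding cech_cochains_iff co2_mscale
	proof (intro allI impI)
		fix T a assume "c * co2 x T a ~= 0"
		hence "co2 x T a ~= 0" by simp
		thus "T <: ?V & int (card T) = j & neg_set a <: T & keys a <: ?V"
			by (rule x[unfolded cech_cochains_iff, rule_format])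
	qed
qed (simp add: cech_cochains_iff)
have sub_null: "vs2.subspace (cech_null n ?I)"
proof (rule vs2.subspaceI)
	fix x y assume xy: "x : cech_null n ?I" "y : cech_null n ?I"
	show "x + y : cech_null n ?I"
		unfolding cech_null_iff[OF down]
	proof (intro allI impI)
		fix T a assume "co2 (x + y) T a ~= 0"
		hence "co2 x T a ~= 0 \<or> co2 y T a ~= 0" by (auto simp: lookup_add)
		thus "T <: ?V & neg_set a <: T & keys a <: ?V & keys a Un T ~: Dl"
			by (elim disjE xy[unfolded cech_null_iff[OF down], rule_format])
	qed
next
	fix c and x :: "nat set \<Rightarrow>\<^sub>0 'k laurent" assume x: "x : cech_null n ?I"
	show "mscale c x : cech_null n ?I"
		unfolding cech_null_iff[OF down] co2_mscale
	proof (intro allI impI)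
		fix T a assume "c * co2 x T a ~= 0"
		hence "co2 x T a ~= 0" by simp
		thus "T <: ?V & neg_set a <: T & keys a <: ?V & keys a Un T ~: Dl"
			by (rule x[unfolded cech_null_iff[OF down], rule_format])
	qed
qed (simp add: cech_null_iff[OF down])
have sub_B: "vs2.subspace B"
proof (rule vs2.subspaceI)
	have "cech_diff n 0 = (0 :: nat set \<Rightarrow>\<^sub>0 'k laurent)"
		by (rule co2_eqI) (simp add: co2_cech_diff cobd_zero)
	thus "0 : B" unfolding B_def
		using vs2.subspace_0[OF sub_cc] vs2.subspace_0[OF sub_null] by (intro CollectI conjI bexI[of _ 0]) auto
next
	fix x y assume "x : B" "y : B"
	then obtain v w where vw: "x : cech_cochains n (int i)" "y : cech_cochains n (int i)"
		"v : cech_cochains n (int i - 1)" "w : cech_cochains n (int i - 1)"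
		"x - cech_diff n v : cech_null n ?I" "y - cech_diff n w : cech_null n ?I" unfolding B_def by blast
	have e: "x + y - cech_diff n (v + w) = (x - cech_diff n v) + (y - cech_diff n w)" by (simp add: diff_add)
	have "x + y - cech_diff n (v + w) : cech_null n ?I" unfolding e by (rule vs2.subspace_add[OF sub_null vw(5,6)])
	thus "x + y : B" unfolding B_def
		using vs2.subspace_add[OF sub_cc vw(1,2)] vs2.subspace_add[OF sub_cc vw(3,4)] by blast
next
	fix c x assume "x : B"
	then obtain v where v: "x : cech_cochains n (int i)" "v : cech_cochains n (int i - 1)"
		"x - cech_diff n v : cech_null n ?I" unfolding B_def by blast
	have e: "mscale c x - cech_diff n (mscale c v) = mscale c (x - cech_diff n v)"
		by (simp add: diff_scale vs2.scale_right_diff_distrib)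
	have "mscale c x - cech_diff n (mscale c v) : cech_null n ?I" unfolding e by (rule vs2.subspace_scale[OF sub_null v(3)])
	thus "mscale c x : B" unfolding B_def
		using vs2.subspace_scale[OF sub_cc v(1)] vs2.subspace_scale[OF sub_cc v(2)] by blast
qed
\<comment> \<open>Simplicial cochains are placed in exponent 0, where the Cech complex modulo the
  ideal is the cochain complex of \<open>Dl\<close>.\<close>
define L where "L g = (assemble (Dl \<times> {0}) (%T a. g T) :: nat set \<Rightarrow>\<^sub>0 'k laurent)" for g :: "nat set => 'k"
have coL: "co2 (L g) T a = (if T : Dl & a = 0 then g T else 0)" for g :: "nat set => 'k" and T and a :: "nat \<Rightarrow>\<^sub>0 int"
	unfolding L_def using finD by (subst co2_assemble) auto
have linL: "Vector_Spaces.linear (fscale :: 'k => (nat set => 'k) => _) (mscale :: 'k => (nat set \<Rightarrow>\<^sub>0 'k laurent) => _) L"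
	unfolding Vector_Spaces.linear_iff
proof (intro conjI allI fc.fs vector_space_mscale)
	fix f g :: "nat set => 'k" show "L (f + g) = (L f + L g :: nat set \<Rightarrow>\<^sub>0 'k laurent)"
		by (rule co2_eqI) (simp add: lookup_add coL)
next
	fix c :: 'k and g :: "nat set => 'k" show "L (%x. c * g x) = (mscale c (L g) :: nat set \<Rightarrow>\<^sub>0 'k laurent)"
		by (rule co2_eqI) (simp add: co2_mscale coL)
qed
have neg0: "neg_set 0 = {}" by (simp add: neg_set_def)
have LC: "L g : cech_cochains n (int i)" if g: "supp_on Dl i g" for g :: "nat set => 'k"
	unfolding cech_cochains_iff coL using supp_onD[OF g] sub by (auto simp: neg0 split: if_splits)
have cob0: "cobd (%S. co2 (L g) S a) T = (if a = 0 then cobd g T else 0)" if T: "T : Dl" for g :: "nat set => 'k" and T and a :: "nat \<Rightarrow>\<^sub>0 int"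
	unfolding cobd_def coL using down_closedD[OF down T] by (auto intro!: sum.cong)
have LZ: "L g : Z" if "g : cocycles Dl i" for g :: "nat set => 'k"
proof -
	have g: "supp_on Dl i g" "ALL T:Dl. cobd g T = 0" using that by (auto simp: cocycles_def)
	have "cech_diff n (L g) : cech_null n ?I"
		unfolding cech_null_iff[OF down]
	proof (intro allI impI)
		fix T a assume nz: "co2 (cech_diff n (L g)) T a ~= 0"
		hence T: "T <: ?V" "cobd (%S. co2 (L g) S a) T ~= 0" by (auto simp: co2_cech_diff split: if_splits)
		have a: "a = 0"
		proof (rule ccontr)
			assume "a ~= 0"
			hence "cobd (%S. co2 (L g) S a) T = 0" by (simp add: coL cobd_def)
			thus False using T by simp
		qed
		have "T ~: Dl" using cob0[of T g a] g(2) T(2) by (auto simp: a)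
		thus "T <: ?V & neg_set a <: T & keys a <: ?V & keys a Un T ~: Dl"
			using T by (simp add: a neg0)
	qed
	thus ?thesis using LC[OF g(1)] by (simp add: Z_def)
qed
have LB: "L g : B <-> g : cobs Dl i" if "g : cocycles Dl i" for g :: "nat set => 'k"
proof
	have g: "supp_on Dl i g" using that by (auto simp: cocycles_def)
	{
		assume "L g : B"
		then obtain w where w: "w : cech_cochains n (int i - 1)" "L g - cech_diff n w : cech_null n ?I" unfolding B_def by blast
		define y where "y T = (if T : Dl then co2 w T 0 else 0)" for T
		have "g = cobd_on Dl y"
		proof
			fix T show "g T = cobd_on Dl y T"
			proof (cases "T : Dl")
				case True
				have "co2 (L g - cech_diff n w) T 0 = 0" by (rule nullD[OF w(2)]) (simp add: True)
				hence "g T = cobd (%S. co2 w S 0) T" using True sub by (auto simp: lookup_minus coL co2_cech_diff)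
				also have "... = cobd y T" unfolding cobd_def y_def using down_closedD[OF down True] by (intro sum.cong) auto
				finally show ?thesis using True by (simp add: cobd_on_def)
			next
				case False
				thus ?thesis using supp_onD[OF g, of T] by (auto simp: cobd_on_def)
			qed
		qed
		moreover have "ALL T. y T ~= 0 --> T : Dl & Suc (card T) = i"
		proof (intro allI impI)
			fix T assume "y T ~= 0"
			hence T: "T : Dl" "co2 w T 0 ~= 0" by (auto simp: y_def split: if_splits)
			have "int (card T) = int i - 1" using w(1) T(2) unfolding cech_cochains_iff by blast
			thus "T : Dl & Suc (card T) = i" using T by linarith
		qed
		ultimately show "g : cobs Dl i" unfolding cobs_def by (intro CollectI exI[of _ y]) simp
	}
	assume "g : cobs Dl i"
	then obtain y :: "nat set => 'k" where y: "ALL T. y T ~= 0 --> T : Dl & Suc (card T) = i" "g = cobd_on Dl y"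
		unfolding cobs_def by (elim CollectE exE conjE)
	have "L y : cech_cochains n (int i - 1)"
		unfolding cech_cochains_iff
	proof (intro allI impI)
		fix T a assume "co2 (L y) T a ~= 0"
		hence T: "T : Dl" "a = 0" "y T ~= 0" by (auto simp: coL split: if_splits)
		hence "Suc (card T) = i" using y(1) by blast
		thus "T <: ?V & int (card T) = int i - 1 & neg_set a <: T & keys a <: ?V"
			using T sub by (auto simp: neg0)
	qed
	moreover have "L g - cech_diff n (L y) : cech_null n ?I"
		unfolding cech_null_iff[OF down]
	proof (intro allI impI)
		fix T a assume nz: "co2 (L g - cech_diff n (L y)) T a ~= 0"
		have T: "T ~: Dl"
		proof
			assume T: "T : Dl"
			hence "co2 (L g - cech_diff n (L y)) T a = 0"
				using sub cob0[OF T, of y a] by (auto simp: lookup_minus coL co2_cech_diff y(2) cobd_on_def)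
			thus False using nz by simp
		qed
		hence c: "co2 (cech_diff n (L y)) T a ~= 0" using nz by (simp add: lookup_minus coL)
		hence TV: "T <: ?V" by (auto simp: co2_cech_diff split: if_splits)
		have "a = 0"
		proof (rule ccontr)
			assume "a ~= 0"
			hence "co2 (cech_diff n (L y)) T a = 0" by (simp add: co2_cech_diff coL cobd_def)
			thus False using c by simp
		qed
		thus "T <: ?V & neg_set a <: T & keys a <: ?V & keys a Un T ~: Dl"
			using T TV by (simp add: neg0)
	qed
	ultimately show "L g : B" unfolding B_def using LC[OF g] by blast
qed
have surj: "EX g:cocycles Dl i. z - L g : B" if z: "z : Z" for z
proof -
	have zc: "z : cech_cochains n (int i)" and zn: "cech_diff n z : cech_null n ?I" using z by (auto simp: Z_def)
	have adm: "T <: ?V & card T = i & neg_set a <: T & keys a <: ?V" if "co2 z T a ~= 0" for T a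
		using zc that unfolding cech_cochains_iff by fastforce
	have zcob: "cobd (%S. co2 z S a) T = 0" if "T <: ?V" "keys a Un T : Dl" for T a
		using nullD[OF zn that(2)] that(1) by (simp add: co2_cech_diff)
	define g where "g T = (if T : Dl then co2 z T 0 else 0)" for T
	have gc: "g : cocycles Dl i"
		unfolding cocycles_def
	proof (intro CollectI conjI ballI)
		show "supp_on Dl i g" using adm by (auto simp: supp_on_def g_def split: if_splits)
		fix T assume T: "T : Dl"
		have "cobd g T = cobd (%S. co2 z S 0) T"
			unfolding cobd_def g_def using down_closedD[OF down T] by (intro sum.cong) auto
		thus "cobd g T = 0" using zcob[of T 0] T sub by auto
	qed
	\<comment> \<open>In a nonzero exponent every cocycle is a coboundary. The equation is required
	  only where \<open>keys a Un T\<close> is a face, since elsewhere the component lies in the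
	  localized ideal.\<close>
	have local: "EX y. (ALL T. y T ~= 0 --> T <: ?V & Suc (card T) = i & neg_set a <: T) &
		(ALL T. T <: ?V --> keys a Un T : Dl --> co2 z T a = cobd y T)"
		if a: "a ~= 0" and aV: "keys a <: ?V" for a
	proof (cases "EX v. 0 < lookup a v")
		case True
		then obtain v where v: "0 < lookup a v" by blast
		\<comment> \<open>Adding or removing \<open>v\<close> changes neither \<open>keys a Un T\<close>
		  nor the condition \<open>neg_set a <: T\<close>. Contraction by \<open>v\<close> therefore stays
		  inside this piece and is a homotopy on it.\<close>
		have vk: "v : keys a" "v ~: neg_set a" using v by (auto simp: in_keys_iff neg_set_def)
		let ?y = "contract v (%S. co2 z S a)"
		have sy: "T <: ?V & Suc (card T) = i & neg_set a <: T" if "?y T ~= 0" for T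
		proof -
			have *: "v ~: T" "co2 z (insert v T) a ~= 0" using that by (auto simp: contract_def split: if_splits)
			hence ad: "insert v T <: ?V" "card (insert v T) = i" "neg_set a <: insert v T" using adm by blast+
			have "finite T" using ad(1) finite_subset by auto
			thus ?thesis using ad * vk by auto
		qed
		have "co2 z T a = cobd ?y T" if T: "T <: ?V" "keys a Un T : Dl" for T
		proof -
			have fT: "finite T" using T(1) finite_subset by blast
			have "contract v (cobd (%S. co2 z S a)) T = 0"
			proof (cases "v : T")
				case False
				have "insert v T <: ?V" "keys a Un insert v T = keys a Un T" using T(1) vk aV by auto
				hence "cobd (%S. co2 z S a) (insert v T) = 0" using zcob T(2) by simp
				thus ?thesis using False by (simp add: contract_def)
			qed (simp add: contract_def)
			thus ?thesis using cobd_contract[OF fT, of v "%S. co2 z S a"] by simp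
		qed
		with sy show ?thesis by (intro exI[of _ ?y]) blast
	next
		case False
		define G where "G = neg_set a"
		have kG: "keys a = G"
		proof -
			have "v : keys a <-> v : G" for v
				using False[unfolded not_ex, rule_format, of v] by (auto simp: G_def neg_set_def in_keys_iff)
			thus ?thesis by blast
		qed
		have G0: "G ~= {}" using a kG keys_eq_empty[of a] by auto
		have finG: "finite G" using kG by (metis finite_keys)
		show ?thesis
		proof (cases "G : Dl & card G <= i")
			\<comment> \<open>Every admissible set contains \<open>G\<close> and has \<open>i\<close>
			  elements, so here no nonzero component sits over a face.\<close>
			case False
			show ?thesis
			proof (intro exI[of _ "%_. 0"] conjI allI impI)
				fix T assume T: "T <: ?V" "keys a Un T : Dl"
				have "co2 z T a = 0"
				proof (rule ccontr)
					assume "co2 z T a ~= 0"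
					hence "T <: ?V" "card T = i" "G <: T" using adm by (auto simp: G_def)
					hence "card G <= i" using card_mono[of T G] finite_subset by auto
					moreover have "G : Dl" by (rule down_closedD[OF down T(2)]) (simp add: kG)
					ultimately show False using False by blast
				qed
				thus "co2 z T a = cobd (%_. 0) T" by (simp add: cobd_zero)
			qed simp_all
		next
			case True
			let ?L = "link Dl G" and ?e = "%S. PROD u:S. osign u G :: 'k"
			\<comment> \<open>Without positive entries the support of \<open>a\<close> is \<open>G\<close>,
			  and the sets \<open>T\<close> over faces are the \<open>G Un S\<close> with \<open>S\<close> in
			  the link. The degree drops by \<open>card G\<close>.\<close>
			define f where "f S = (if S : ?L then ?e S * co2 z (G Un S) a else 0)" for S
			have dl: "down_closed ?L" using down by (rule down_closed_link)
			have linkD: "S Int G = {}" "G Un S : Dl" "finite S" if "S : ?L" for S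
				using that finF[of "S Un G"] by (auto simp: link_def Un_commute)
			have suppz: "G <: S" if "co2 z S a ~= 0" for S using adm[OF that] by (simp add: G_def)
			have cf: "cobd f S = ?e S * cobd (%S. co2 z S a) (G Un S)" if S: "S : ?L" for S
			proof -
				have "cobd f S = cobd (%S. ?e S * co2 z (G Un S) a) S"
					unfolding cobd_def f_def using down_closedD[OF dl S] by (intro sum.cong) auto
				also have "... = ?e S * cobd (%S. co2 z S a) (G Un S)"
					by (rule twisted_cobd[OF finG linkD(3)[OF S] linkD(1)[OF S] suppz])
				finally show ?thesis .
			qed
			have sf: "supp_on ?L (i - card G) f"
				unfolding supp_on_def
			proof (intro allI impI)
				fix S assume "f S ~= 0"
				hence S: "S : ?L" "co2 z (G Un S) a ~= 0" by (auto simp: f_def split: if_splits)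
				hence "card (G Un S) = i" using adm by blast
				moreover have "card (G Un S) = card G + card S" using linkD[OF S(1)] finG by (intro card_Un_disjoint) auto
				ultimately show "S : ?L & card S = i - card G" using S by simp
			qed
			have "ALL S:?L. cobd f S = 0"
			proof
				fix S assume S: "S : ?L"
				have "G Un S <: ?V" "keys a Un (G Un S) : Dl" using linkD(2)[OF S] sub kG by auto
				thus "cobd f S = 0" using cf[OF S] zcob by simp
			qed
			moreover have "cvan TYPE('k) ?L (i - card G)" by (rule van) (use True G0 in simp_all)
			ultimately have "EX y. (ALL T. y T ~= 0 --> T : ?L & Suc (card T) = i - card G) & (ALL T:?L. f T = cobd y T)"
				unfolding cvan_def using sf by (elim allE[of _ f] impE)
			then obtain y' where y': "!!T. y' T ~= 0 ==> T : ?L & Suc (card T) = i - card G" "!!T. T : ?L ==> f T = cobd y' T"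
				by blast
			define y where "y T = (if G <: T then ?e (T - G) * y' (T - G) else 0)" for T
			have y'y: "y' S = ?e S * y (G Un S)" if "S Int G = {}" for S
			proof -
				have "G Un S - G = S" using that by blast
				thus ?thesis by (simp add: y_def prod_osign_square)
			qed
			have sy: "T <: ?V & Suc (card T) = i & neg_set a <: T" if "y T ~= 0" for T
			proof -
				have *: "G <: T" "y' (T - G) ~= 0" using that by (auto simp: y_def split: if_splits)
				have **: "T - G : ?L" "Suc (card (T - G)) = i - card G" using y'(1)[OF *(2)] by auto
				have u: "G Un (T - G) = T" using * by blast
				hence "T : Dl" using linkD(2)[OF **(1)] by simp
				moreover have "card T = card G + card (T - G)"
					using card_Un_disjoint[of G "T - G"] finG linkD(3)[OF **(1)] u by auto
				ultimately show ?thesis using ** * sub True by (auto simp: G_def)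
			qed
			have "co2 z T a = cobd y T" if T: "T <: ?V" "keys a Un T : Dl" for T
			proof (cases "G <: T")
				case GT: True
				let ?S = "T - G"
				have u: "G Un ?S = T" using GT by blast
				have SL: "?S : ?L" using T(2) GT kG by (auto simp: link_def Un_absorb1 Un_absorb2)
				have "cobd y' ?S = cobd (%S. ?e S * y (G Un S)) ?S"
					unfolding cobd_def by (intro sum.cong refl) (subst y'y, auto)
				also have "... = ?e ?S * cobd y (G Un ?S)"
					by (rule twisted_cobd[OF finG linkD(3)[OF SL]]) (auto simp: y_def split: if_splits)
				finally have "?e ?S * co2 z T a = ?e ?S * cobd y T" using y'(2)[OF SL] SL u by (simp add: f_def)
				hence "?e ?S * (?e ?S * co2 z T a) = ?e ?S * (?e ?S * cobd y T)" by simp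
				thus ?thesis unfolding prod_osign_square .
			next
				case nGT: False
				have "co2 z T a = 0" using suppz[of T] nGT by blast
				moreover have "cobd y T = 0"
					unfolding cobd_def
				proof (intro sum.neutral ballI)
					fix u assume "u : T"
					have "~ G <: T - {u}" using nGT by blast
					thus "osign u T * y (T - {u}) = 0" by (simp add: y_def)
				qed
				ultimately show ?thesis by simp
			qed
			with sy show ?thesis by (intro exI[of _ y]) blast
		qed
	qed
	\<comment> \<open>Only finitely many exponents occur in \<open>z\<close>, so the solutions found
	  exponent by exponent can be assembled. Exponent 0 is left out because \<open>L g\<close> takes
	  care of it.\<close>
	define A where "A = (UN T:keys z. keys (lookup z T)) - {0}"
	have finA: "finite A" by (simp add: A_def)
	have inA: "a : A" if "co2 z T a ~= 0" "a ~= 0" for T a using co2_keys[OF that(1)] that(2) by (auto simp: A_def)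
	have "ALL a:A. EX y. (ALL T. y T ~= 0 --> T <: ?V & Suc (card T) = i & neg_set a <: T) &
		(ALL T. T <: ?V --> keys a Un T : Dl --> co2 z T a = cobd y T)"
	proof
		fix a assume a: "a : A"
		then obtain T where "a : keys (lookup z T)" unfolding A_def by blast
		hence "co2 z T a ~= 0" by (simp add: in_keys_iff)
		hence "keys a <: ?V" using adm by blast
		thus "EX y. (ALL T. y T ~= 0 --> T <: ?V & Suc (card T) = i & neg_set a <: T) &
			(ALL T. T <: ?V --> keys a Un T : Dl --> co2 z T a = cobd y T)"
			using local a by (auto simp: A_def)
	qed
	then obtain Y where Y: "ALL a:A. (ALL T. Y a T ~= 0 --> T <: ?V & Suc (card T) = i & neg_set a <: T) &
		(ALL T. T <: ?V --> keys a Un T : Dl --> co2 z T a = cobd (Y a) T)"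
		by (rule bchoice[THEN exE])
	have AV: "keys a <: ?V" if aA: "a : A" for a
	proof -
		obtain T where "a : keys (lookup z T)" using aA unfolding A_def by blast
		hence "co2 z T a ~= 0" by (simp add: in_keys_iff)
		thus ?thesis using adm by blast
	qed
	define w where "w = assemble (Pow ?V \<times> A) (%T a. Y a T)"
	have cw: "co2 w T a = (if T <: ?V & a : A then Y a T else 0)" for T a
		unfolding w_def using finA by (subst co2_assemble) auto
	have cobw: "cobd (%S. co2 w S a) T = (if a : A then cobd (Y a) T else 0)" if T: "T <: ?V" for T a
		unfolding cobd_def cw using T by (auto intro!: sum.cong)
	have "w : cech_cochains n (int i - 1)"
		unfolding cech_cochains_iff
	proof (intro allI impI)
		fix T a assume "co2 w T a ~= 0"
		hence aA: "a : A" "Y a T ~= 0" by (auto simp: cw split: if_splits)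
		hence "T <: ?V" "Suc (card T) = i" "neg_set a <: T" using Y by blast+
		thus "T <: ?V & int (card T) = int i - 1 & neg_set a <: T & keys a <: ?V" using AV[OF aA(1)] by auto
	qed
	moreover have "(z - L g) - cech_diff n w : cech_null n ?I"
		unfolding cech_null_iff[OF down]
	proof (intro allI impI)
		fix T a assume nz: "co2 ((z - L g) - cech_diff n w) T a ~= 0"
		have e: "co2 ((z - L g) - cech_diff n w) T a = co2 z T a - co2 (L g) T a - co2 (cech_diff n w) T a"
			by (simp add: lookup_minus)
		have c: "T <: ?V & neg_set a <: T & keys a <: ?V"
		proof -
			consider "co2 z T a ~= 0" | "co2 (L g) T a ~= 0" | "co2 (cech_diff n w) T a ~= 0" using nz e by force
			thus ?thesis
			proof cases
				case 1 thus ?thesis using adm by blast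
			next
				case 2 thus ?thesis using sub by (auto simp: coL neg0 split: if_splits)
			next
				case 3
				hence *: "T <: ?V" "a : A" "cobd (Y a) T ~= 0" using cobw[of T a] by (auto simp: co2_cech_diff split: if_splits)
				have "EX u:T. osign u T * Y a (T - {u}) ~= 0"
				proof (rule ccontr)
					assume "~ ?thesis"
					hence "cobd (Y a) T = 0" unfolding cobd_def by (intro sum.neutral) simp
					thus False using *(3) by simp
				qed
				then obtain u where "u : T" "Y a (T - {u}) ~= 0" by auto
				hence "neg_set a <: T - {u}" using bspec[OF Y *(2)] by blast
				thus ?thesis using * AV by blast
			qed
		qed
		have "keys a Un T ~: Dl"
		proof
			assume k: "keys a Un T : Dl"
			hence TD: "T : Dl" using down_closedD[OF down] by blast
			have "co2 z T a - co2 (L g) T a - co2 (cech_diff n w) T a = 0"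
			proof (cases "a = 0")
				case True
				hence "co2 (cech_diff n w) T a = 0" using c cobw[of T a] by (simp add: co2_cech_diff A_def)
				thus ?thesis using True TD by (simp add: coL g_def)
			next
				case a0: False
				show ?thesis
				proof (cases "a : A")
					case True
					have "co2 z T a = cobd (Y a) T"
						by (rule conjunct2[OF bspec[OF Y True], rule_format]) (use c k in simp_all)
					thus ?thesis using a0 True c cobw[of T a] by (simp add: coL co2_cech_diff)
				next
					case False
					hence "co2 z T a = 0" using inA a0 by blast
					thus ?thesis using a0 False c cobw[of T a] by (simp add: coL co2_cech_diff)
				qed
			qed
			thus False using nz e by simp
		qed
		thus "T <: ?V & neg_set a <: T & keys a <: ?V & keys a Un T ~: Dl" using c by blast
	qed
	moreover have "z - L g : cech_cochains n (int i)"
		by (rule vs2.subspace_diff[OF sub_cc zc LC]) (use gc in "simp add: cocycles_def")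
	ultimately have "z - L g : B" unfolding B_def by blast
	thus ?thesis using gc by blast
qed
have "has_quot_dim mscale Z B h"
	by (rule quot_dim_transfer[OF h fc.sub_cocycles fc.sub_cobs sub_B linL LZ LB surj])
moreover have "vs2.subspace Z"
proof (rule vs2.subspaceI)
	have "cech_diff n 0 = (0 :: nat set \<Rightarrow>\<^sub>0 'k laurent)"
		by (rule co2_eqI) (simp add: co2_cech_diff cobd_zero)
	thus "0 : Z" using vs2.subspace_0[OF sub_cc] vs2.subspace_0[OF sub_null] by (simp add: Z_def)
next
	fix x y assume "x : Z" "y : Z"
	thus "x + y : Z" using vs2.subspace_add[OF sub_cc] vs2.subspace_add[OF sub_null] by (simp add: Z_def diff_add)
next
	fix c x assume "x : Z"
	thus "mscale c x : Z" using vs2.subspace_scale[OF sub_cc] vs2.subspace_scale[OF sub_null] by (simp add: Z_def diff_scale)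
qed
ultimately have "has_quot_dim mscale Z B h' <-> h' = h" using vs2.quot_dim_unique[of Z B h' h] sub_B by blast
thus ?thesis unfolding has_local_cohomology_dim_def Z_def B_def .
qed

section \<open>Graded Betti numbers\<close>

subsection \<open>Independence of the resolution\<close>

lemma lookup_lin_ext:
assumes "finite A" "keys x <: A"
shows "lookup (lin_ext f x) c = (SUM b:A. lookup x b * lookup (f b) c)"
proof -
have "lookup (lin_ext f x) c = (SUM b:keys x. lookup x b * lookup (f b) c)"
	by (simp add: lin_ext_def lookup_sum lookup_map_mult)
also have "... = (SUM b:A. lookup x b * lookup (f b) c)"
	by (rule sum.mono_neutral_left[OF assms]) (simp add: in_keys_iff)
finally show ?thesis .
qed

lemma lin_ext_add: "lin_ext f (x + y) = lin_ext f x + lin_ext f y"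
proof (rule poly_mapping_eqI)
fix c
let ?A = "keys x Un keys y"
have A: "finite ?A" "keys x <: ?A" "keys y <: ?A" "keys (x + y) <: ?A"
	using keys_add[of x y] by auto
show "lookup (lin_ext f (x + y)) c = lookup (lin_ext f x + lin_ext f y) c"
	unfolding lookup_add lookup_lin_ext[OF A(1,2)] lookup_lin_ext[OF A(1,3)] lookup_lin_ext[OF A(1,4)]
	by (simp add: distrib_right sum.distrib)
qed

lemma lin_ext_zero [simp]: "lin_ext f 0 = 0"
by (simp add: lin_ext_def)

lemma lin_ext_uminus: "lin_ext f (- x) = - lin_ext f x"
using lin_ext_add[of f "- x" x] by (simp add: eq_neg_iff_add_eq_0)

lemma lin_ext_diff: "lin_ext f (x - y) = lin_ext f x - lin_ext f y"
using lin_ext_add[of f x "- y"] by (simp add: lin_ext_uminus)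

lemma lin_ext_scale: "lin_ext f (Poly_Mapping.map ((*) p) x) = Poly_Mapping.map ((*) p) (lin_ext f x)"
proof (rule poly_mapping_eqI)
fix c
have A: "finite (keys x)" "keys (Poly_Mapping.map ((*) p) x) <: keys x"
	by (auto simp: in_keys_iff lookup_map_mult)
show "lookup (lin_ext f (Poly_Mapping.map ((*) p) x)) c = lookup (Poly_Mapping.map ((*) p) (lin_ext f x)) c"
	unfolding lookup_map_mult lookup_lin_ext[OF A] lookup_lin_ext[OF A(1) order_refl]
	by (simp add: sum_distrib_left mult.assoc)
qed

lemma lin_ext_sum: "lin_ext f (sum g A) = (SUM a:A. lin_ext f (g a))"
by (induction A rule: infinite_finite_induct) (simp_all add: lin_ext_add)

lemma lin_ext_cong: "(!!b. b : keys x ==> f b = g b) ==> lin_ext f x = lin_ext g x"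
unfolding lin_ext_def by (rule sum.cong[OF refl]) simp

lemma lin_ext_lin_ext: "lin_ext f (lin_ext g x) = lin_ext (%b. lin_ext f (g b)) x"
proof -
have "lin_ext f (lin_ext g x) = (SUM b:keys x. lin_ext f (Poly_Mapping.map ((*) (lookup x b)) (g b)))"
	unfolding lin_ext_def[of g] by (rule lin_ext_sum)
thus ?thesis unfolding lin_ext_def[of "%b. lin_ext f (g b)"] by (simp only: lin_ext_scale)
qed

lemma lin_ext_single_1: "lin_ext f (single b 1) = f b"
by (rule poly_mapping_eqI) (simp add: lookup_lin_ext[of "{b}"])

lemma lin_ext_id: "lin_ext (%b. single b 1) x = x"
proof (rule poly_mapping_eqI)
fix c
have "lookup (lin_ext (%b. single b 1) x) c =
		(SUM b:keys x. if b = c then lookup x c else 0)"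
	unfolding lookup_lin_ext[OF finite_keys order_refl]
	by (rule sum.cong[OF refl]) (simp add: lookup_single when_def)
thus "lookup (lin_ext (%b. single b 1) x) c = lookup x c"
	by (simp add: in_keys_iff)
qed

lemma lin_ext_minus_fun: "lin_ext (%b. f b - g b) x = lin_ext f x - lin_ext g x"
by (rule poly_mapping_eqI)
	(simp add: lookup_lin_ext[OF finite_keys order_refl] lookup_minus right_diff_distrib sum_subtractf)

text \<open>Linear maps between free modules carry families with coefficients in \<open>I\<close> to
  such families, so they act on the complex reduced modulo \<open>I\<close>.\<close>

lemma lookup_lin_ext_ideal:
assumes I: "ideal I (poly_ring n :: 'k::field mpoly ring)" and x: "!!b. lookup x b : I"
	and f: "!!b. b : keys x ==> lookup (f b) c : carrier (poly_ring n)"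
shows "lookup (lin_ext f x) c : I"
unfolding lookup_lin_ext[OF finite_keys order_refl]
proof (rule ideal_poly_ring_sum[OF I])
fix b assume "b : keys x"
thus "lookup x b * lookup (f b) c : I"
	using ideal_poly_ringD(5)[OF I x f] by (simp add: mult.commute)
qed

lemma free_module_iff: "x : free_module n B <->
	(ALL b m. co2 x b m ~= 0 --> b : B & keys m <: {1..n})"
proof
assume x: "x : free_module n B"
show "ALL b m. co2 x b m ~= 0 --> b : B & keys m <: {1..n}"
proof (intro allI impI)
	fix b m assume "co2 x b m ~= 0"
	hence "b : keys x" "m : keys (lookup x b)" by (auto simp: in_keys_iff)
	thus "b : B & keys m <: {1..n}" using x unfolding free_module_def carrier_poly_ring by blast
qed
next
assume x: "ALL b m. co2 x b m ~= 0 --> b : B & keys m <: {1..n}"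
show "x : free_module n B"
	unfolding free_module_def carrier_poly_ring
proof (intro CollectI conjI subsetI allI ballI)
	fix b assume "b : keys x"
	then obtain m where "co2 x b m ~= 0" by (rule co2_mem_keys)
	thus "b : B" using x by blast
next
	fix b m v assume "m : keys (lookup x b)" "v : keys m"
	moreover from this have "co2 x b m ~= 0" by (simp add: in_keys_iff)
	hence "keys m <: {1..n}" using x by blast
	ultimately show "v : {1..n}" by blast
qed
qed

lemma free_component_iff: "x : free_component n B e j <->
	(ALL b m. co2 x b m ~= 0 --> b : B & keys m <: {1..n} & mdeg m + e b = j)"
(is "_ <-> ?R")
proof
assume x: "x : free_component n B e j"
show ?R
proof (intro allI impI)
	fix b m assume nz: "co2 x b m ~= 0"
	hence "b : keys x" "m : keys (lookup x b)" by (auto simp: in_keys_iff)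
	hence "mdeg m + e b = j" using x unfolding free_component_def by blast
	moreover have "x : free_module n B" using x by (simp add: free_component_def)
	ultimately show "b : B & keys m <: {1..n} & mdeg m + e b = j"
		using nz unfolding free_module_iff by blast
qed
next
assume x: ?R
hence "x : free_module n B" unfolding free_module_iff by blast
moreover have "mdeg m + e b = j" if "m : keys (lookup x b)" for b m
	using x[rule_format, of b m] that by (simp add: in_keys_iff)
ultimately show "x : free_component n B e j" unfolding free_component_def by blast
qed

lemma free_component_subset: "free_component n B e j <: free_module n B"
by (auto simp: free_component_def)

lemma free_module_carrier: "x : free_module n B ==> lookup x b : carrier (poly_ring n)"
by (simp add: free_module_def)

lemma free_module_add: "x : free_module n B ==> y : free_module n B ==> x + y : free_module n B"
proof -
assume xy: "x : free_module n B" "y : free_module n B"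
show ?thesis unfolding free_module_iff
proof (intro allI impI)
	fix b m assume "co2 (x + y) b m ~= 0"
	hence "co2 x b m ~= 0 \<or> co2 y b m ~= 0" by (auto simp: lookup_add)
	thus "b : B & keys m <: {1..n}" by (elim disjE xy[unfolded free_module_iff, rule_format])
qed
qed

lemma free_module_uminus: "x : free_module n B ==> - x : free_module n B"
by (simp add: free_module_iff)

lemma free_module_diff: "x : free_module n B ==> y : free_module n B ==> x - y : free_module n B"
using free_module_add[of x n B "- y"] free_module_uminus[of y n B] by simp

lemma free_module_single_1: "b : B ==> single b 1 : free_module n B"
by (auto simp: free_module_iff lookup_single when_def lookup_one split: if_splits)

lemma lin_ext_free_component:
assumes f: "!!b. b : B ==> f b : free_component n B' e' (e b)" and x: "x : free_component n B e j"
shows "lin_ext f x : free_component n B' e' j"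
unfolding free_component_iff
proof (intro allI impI)
fix c m assume "co2 (lin_ext f x) c m ~= 0"
hence "(SUM b:keys x. lookup (lookup x b * lookup (f b) c) m) ~= 0"
	by (simp only: lookup_lin_ext[OF finite_keys order_refl] lookup_sum) simp
then obtain b where b: "b : keys x" "m : keys (lookup x b * lookup (f b) c)"
	by (meson in_keys_iff sum.neutral)
obtain m1 m2 where m: "m1 : keys (lookup x b)" "m2 : keys (lookup (f b) c)" "m = m1 + m2"
	using b(2) by (rule keys_multE)
have 1: "b : B & keys m1 <: {1..n} & mdeg m1 + e b = j"
	using x[unfolded free_component_iff, rule_format, of b m1] m(1) by (simp add: in_keys_iff)
have "f b : free_component n B' e' (e b)" using f 1 by blast
hence 2: "c : B' & keys m2 <: {1..n} & mdeg m2 + e' c = e b"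
	unfolding free_component_iff using m(2) by (simp add: in_keys_iff)
show "c : B' & keys m <: {1..n} & mdeg m + e' c = j"
	using 1 2 by (auto simp: m(3) mdeg_add keys_add_nat)
qed

lemma lin_ext_module:
assumes f: "!!b. b : B ==> f b : free_module n B'" and x: "x : free_module n B"
shows "lin_ext f x : free_module n B'"
unfolding free_module_iff
proof (intro allI impI)
fix c m assume "co2 (lin_ext f x) c m ~= 0"
hence "(SUM b:keys x. lookup (lookup x b * lookup (f b) c) m) ~= 0"
	by (simp only: lookup_lin_ext[OF finite_keys order_refl] lookup_sum) simp
then obtain b where b: "b : keys x" "m : keys (lookup x b * lookup (f b) c)"
	by (meson in_keys_iff sum.neutral)
obtain m1 m2 where m: "m1 : keys (lookup x b)" "m2 : keys (lookup (f b) c)" "m = m1 + m2"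
	using b(2) by (rule keys_multE)
have 1: "b : B & keys m1 <: {1..n}"
	using x[unfolded free_module_iff, rule_format, of b m1] m(1) by (simp add: in_keys_iff)
have "f b : free_module n B'" using f 1 by blast
hence 2: "c : B' & keys m2 <: {1..n}"
	unfolding free_module_iff using m(2) by (simp add: in_keys_iff)
show "c : B' & keys m <: {1..n}"
	using 1 2 by (auto simp: m(3) keys_add_nat)
qed

definition hom_part :: "(nat => nat) => nat => (nat \<Rightarrow>\<^sub>0 'k::field mpoly) => (nat \<Rightarrow>\<^sub>0 'k mpoly)" where
"hom_part e j z = assemble {(b, m). b : keys z & m : keys (lookup z b) & mdeg m + e b = j} (co2 z)"

lemma co2_hom_part: "co2 (hom_part e j z) b m = (if mdeg m + e b = j then co2 z b m else 0)"
proof -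
let ?F = "{(b, m). b : keys z & m : keys (lookup z b) & mdeg m + e b = j}"
have "?F <: Sigma (keys z) (%b. keys (lookup z b))" by auto
hence "finite ?F" by (rule finite_subset) (intro finite_SigmaI finite_keys)
thus ?thesis unfolding hom_part_def by (subst co2_assemble) (auto simp: in_keys_iff)
qed

lemma hom_part_free_component: "z : free_module n B ==> hom_part e j z : free_component n B e j"
unfolding free_component_iff co2_hom_part free_module_iff by simp

lemma lookup_mult_homogeneous_part:
fixes p p' q :: "'k::field mpoly"
assumes q: "!!m. m : keys q ==> mdeg m + ec = eb"
	and p': "!!m. lookup p' m = (if mdeg m + eb = j then lookup p m else 0)"
shows "lookup (p' * q) m = (if mdeg m + ec = j then lookup (p * q) m else 0)"
proof (cases "mdeg m + ec = j")
case True
have "lookup ((p - p') * q) m = 0"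
proof (rule ccontr)
	assume "lookup ((p - p') * q) m ~= 0"
	hence "m : keys ((p - p') * q)" by (simp add: in_keys_iff)
	then obtain a b where ab: "a : keys (p - p')" "b : keys q" "m = a + b" by (rule keys_multE)
	have "mdeg a + eb ~= j" using ab(1) by (auto simp: in_keys_iff lookup_minus p')
	thus False using q[OF ab(2)] True by (simp add: ab(3) mdeg_add)
qed
thus ?thesis using True by (simp add: left_diff_distrib lookup_minus)
next
case False
have "lookup (p' * q) m = 0"
proof (rule ccontr)
	assume "lookup (p' * q) m ~= 0"
	hence "m : keys (p' * q)" by (simp add: in_keys_iff)
	then obtain a b where ab: "a : keys p'" "b : keys q" "m = a + b" by (rule keys_multE)
	have "mdeg a + eb = j" using ab(1) by (auto simp: in_keys_iff p' split: if_splits)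
	thus False using q[OF ab(2)] False by (simp add: ab(3) mdeg_add)
qed
thus ?thesis using False by simp
qed

lemma lin_ext_hom_part:
assumes D: "!!b. b : B ==> D b : free_component n B' e' (e b)" and z: "z : free_module n B"
shows "lin_ext D (hom_part e j z) = hom_part e' j (lin_ext D z)"
proof (rule co2_eqI)
fix c m
let ?A = "keys z"
have A: "keys (hom_part e j z) <: ?A"
proof
	fix b assume "b : keys (hom_part e j z)"
	then obtain m where "co2 (hom_part e j z) b m ~= 0" by (rule co2_mem_keys)
	hence "co2 z b m ~= 0" by (auto simp: co2_hom_part split: if_splits)
	thus "b : ?A" by (auto simp: in_keys_iff)
qed
have "co2 (lin_ext D (hom_part e j z)) c m =
		(SUM b:?A. lookup (lookup (hom_part e j z) b * lookup (D b) c) m)"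
	by (simp only: lookup_lin_ext[OF finite_keys A] lookup_sum)
also have "... = (SUM b:?A. if mdeg m + e' c = j then lookup (lookup z b * lookup (D b) c) m else 0)"
proof (rule sum.cong[OF refl])
	fix b assume "b : ?A"
	hence "b : B" using z by (auto simp: free_module_def)
	hence Db: "D b : free_component n B' e' (e b)" by (rule D)
	show "lookup (lookup (hom_part e j z) b * lookup (D b) c) m =
		(if mdeg m + e' c = j then lookup (lookup z b * lookup (D b) c) m else 0)"
	proof (rule lookup_mult_homogeneous_part)
		fix m' assume "m' : keys (lookup (D b) c)"
		thus "mdeg m' + e' c = e b" using Db[unfolded free_component_iff, rule_format, of c m'] by (simp add: in_keys_iff)
	qed (rule co2_hom_part)
qed
also have "... = co2 (hom_part e' j (lin_ext D z)) c m"
	unfolding co2_hom_part by (simp add: lookup_lin_ext[OF finite_keys order_refl] lookup_sum)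
finally show "co2 (lin_ext D (hom_part e j z)) c m = co2 (hom_part e' j (lin_ext D z)) c m" .
qed

lemma hom_part_eq: "x : free_component n B e j ==> hom_part e j x = x"
by (rule co2_eqI) (auto simp: co2_hom_part free_component_iff)

text \<open>At \<open>i = 0\<close> the cycles are the elements that die in \<open>S/J\<close>; this makes exactness uniform in \<open>i\<close>.\<close>

definition is_cycle :: "'k::field mpoly set => (nat => nat => (nat \<Rightarrow>\<^sub>0 'k mpoly)) => nat => (nat \<Rightarrow>\<^sub>0 'k mpoly) => bool" where
"is_cycle J D i x <-> (if i = 0 then lookup x 0 : J else lin_ext (D i) x = 0)"

locale resolution =
fixes n :: nat and J :: "'k::field mpoly set" and B e D
assumes res: "graded_free_resolution n J B e D"
begin

lemma B0: "B 0 = {0}" and e0: "e 0 0 = 0"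
using res by (simp_all add: graded_free_resolution_def)

lemma D_component: "b : B (Suc i) ==> D (Suc i) b : free_component n (B i) (e i) (e (Suc i) b)"
using res by (simp add: graded_free_resolution_def)

lemma D_module: "b : B (Suc i) ==> D (Suc i) b : free_module n (B i)"
using D_component free_component_subset by blast

lemma exact: "{x:free_module n (B i). is_cycle J D i x} = lin_ext (D (Suc i)) ` free_module n (B (Suc i))"
proof (cases i)
case 0
have J: "(%x. lookup (lin_ext (D 1) x) 0) ` free_module n (B 1) = J"
	using res by (simp add: graded_free_resolution_def)
have D1: "lin_ext (D 1) y : free_module n (B 0)" if "y : free_module n (B 1)" for y
	by (rule lin_ext_module[OF _ that]) (use D_module[of _ 0] in simp)
have eqI: "x = y" if "x : free_module n (B 0)" "y : free_module n (B 0)" "lookup x 0 = lookup y 0" for x y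
proof (rule poly_mapping_eqI)
	fix b show "lookup x b = lookup y b"
	proof (cases "b = 0")
		case False
		hence "b ~: keys x" "b ~: keys y" using that(1,2) by (auto simp: free_module_def B0)
		thus ?thesis by (simp add: in_keys_iff)
	qed (simp add: that)
qed
show ?thesis unfolding 0
proof (intro equalityI subsetI)
	fix x assume "x : {x:free_module n (B 0). is_cycle J D 0 x}"
	hence x: "x : free_module n (B 0)" "lookup x 0 : J" by (simp_all add: is_cycle_def)
	then obtain y where y: "y : free_module n (B 1)" "lookup x 0 = lookup (lin_ext (D 1) y) 0"
		unfolding J[symmetric] by blast
	have "x = lin_ext (D 1) y" by (rule eqI[OF x(1) D1[OF y(1)] y(2)])
	thus "x : lin_ext (D (Suc 0)) ` free_module n (B (Suc 0))" using y(1) by simp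
next
	fix x assume "x : lin_ext (D (Suc 0)) ` free_module n (B (Suc 0))"
	then obtain y where y: "y : free_module n (B 1)" "x = lin_ext (D 1) y" by auto
	hence "lookup x 0 : J" unfolding J[symmetric] by blast
	thus "x : {x:free_module n (B 0). is_cycle J D 0 x}" using D1[OF y(1)] y(2) by (simp add: is_cycle_def)
qed
next
case (Suc i')
thus ?thesis using res by (simp add: graded_free_resolution_def is_cycle_def)
qed

lemma lift_cycle:
assumes "x : free_module n (B i)" "is_cycle J D i x"
shows "EX y:free_module n (B (Suc i)). lin_ext (D (Suc i)) y = x"
proof -
have "x : lin_ext (D (Suc i)) ` free_module n (B (Suc i))" using assms unfolding exact[symmetric] by simp
thus ?thesis by blast
qed

lemma D_is_cycle:
assumes "y : free_module n (B (Suc i))"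
shows "lin_ext (D (Suc i)) y : free_module n (B i)" "is_cycle J D i (lin_ext (D (Suc i)) y)"
using imageI[OF assms, of "lin_ext (D (Suc i))"] unfolding exact[symmetric] by simp_all

text \<open>Exactness in the definition is ungraded; the homogeneous part of any preimage is again a
  preimage because the differential respects degrees.\<close>

lemma lift_graded_cycle:
assumes x: "x : free_component n (B i) (e i) j" "is_cycle J D i x"
shows "EX y:free_component n (B (Suc i)) (e (Suc i)) j. lin_ext (D (Suc i)) y = x"
proof -
obtain y where y: "y : free_module n (B (Suc i))" "lin_ext (D (Suc i)) y = x"
	using lift_cycle x free_component_subset by blast
show ?thesis
proof
	show "hom_part (e (Suc i)) j y : free_component n (B (Suc i)) (e (Suc i)) j"
		by (rule hom_part_free_component[OF y(1)])
	show "lin_ext (D (Suc i)) (hom_part (e (Suc i)) j y) = x"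
		using lin_ext_hom_part[OF D_component y(1), where j=j] hom_part_eq[OF x(1)] y(2) by simp
qed
qed

end

text \<open>The comparison theorem. The maps preserve degrees so that they act on each strand of
  degree \<open>j\<close>, and the recursion carries along that cycles go to cycles, which is what
  allows the next lift.\<close>

lemma chain_map_exists:
fixes J :: "'k::field mpoly set"
assumes R: "resolution n J B e D" and R': "resolution n J B' e' D'"
shows "EX ph. ph 0 = (%b. single b 1) &
	(ALL i. ALL b:B i. ph i b : free_component n (B' i) (e' i) (e i b)) &
	(ALL i. ALL b:B (Suc i). lin_ext (D' (Suc i)) (ph (Suc i) b) = lin_ext (ph i) (D (Suc i) b))"
proof -
interpret R: resolution n J B e D by (fact R)
interpret R': resolution n J B' e' D' by (fact R')
define P where "P i f <-> (i = 0 --> f = (%b. single b 1)) & (ALL b:B i. f b : free_component n (B' i) (e' i) (e i b)) &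
	(ALL x:free_module n (B i). is_cycle J D i x --> is_cycle J D' i (lin_ext f x))"
	for i and f :: "nat => (nat \<Rightarrow>\<^sub>0 'k mpoly)"
define Q where "Q i f g <-> (ALL b:B (Suc i). lin_ext (D' (Suc i)) (g b) = lin_ext f (D (Suc i) b))"
	for i and f g :: "nat => (nat \<Rightarrow>\<^sub>0 'k mpoly)"
have "P 0 (%b. single b 1)"
	unfolding P_def
proof (intro conjI ballI impI refl)
	fix b assume "b : B 0"
	thus "single b 1 : free_component n (B' 0) (e' 0) (e 0 b)"
		by (auto simp: free_component_iff R.B0 R'.B0 R.e0 R'.e0 lookup_single when_def lookup_one mdeg_def split: if_splits)
next
	fix x assume "is_cycle J D 0 x"
	thus "is_cycle J D' 0 (lin_ext (%b. single b 1) x)" by (simp add: is_cycle_def lin_ext_id)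
qed
hence ex0: "EX f. P 0 f" by (rule exI[of "P 0"])
have step: "EX g. P (Suc i) g & Q i f g" if "P i f" for i f
proof -
	have f: "!!b. b : B i ==> f b : free_component n (B' i) (e' i) (e i b)"
		and fc: "!!x. x : free_module n (B i) ==> is_cycle J D i x ==> is_cycle J D' i (lin_ext f x)"
		using that by (simp_all add: P_def)
	have "ALL b:B (Suc i). EX y. y : free_component n (B' (Suc i)) (e' (Suc i)) (e (Suc i) b) &
			lin_ext (D' (Suc i)) y = lin_ext f (D (Suc i) b)"
	proof
		fix b assume b: "b : B (Suc i)"
		have "is_cycle J D i (lin_ext (D (Suc i)) (single b 1))"
			by (rule R.D_is_cycle(2)[OF free_module_single_1[OF b]])
		hence "is_cycle J D' i (lin_ext f (D (Suc i) b))" unfolding lin_ext_single_1 by (rule fc[OF R.D_module[OF b]])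
		moreover have "lin_ext f (D (Suc i) b) : free_component n (B' i) (e' i) (e (Suc i) b)"
			by (rule lin_ext_free_component[OF f R.D_component[OF b]])
		ultimately show "EX y. y : free_component n (B' (Suc i)) (e' (Suc i)) (e (Suc i) b) &
			lin_ext (D' (Suc i)) y = lin_ext f (D (Suc i) b)" using R'.lift_graded_cycle by blast
	qed
	then obtain g where g: "ALL b:B (Suc i). g b : free_component n (B' (Suc i)) (e' (Suc i)) (e (Suc i) b) &
			lin_ext (D' (Suc i)) (g b) = lin_ext f (D (Suc i) b)" by (rule bchoice[THEN exE])
	have "is_cycle J D' (Suc i) (lin_ext g x)" if x: "x : free_module n (B (Suc i))" "is_cycle J D (Suc i) x" for x
	proof -
		have "lin_ext (D' (Suc i)) (lin_ext g x) = lin_ext (%b. lin_ext f (D (Suc i) b)) x"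
			unfolding lin_ext_lin_ext
			by (rule lin_ext_cong) (use g x in "auto simp: free_module_def")
		also have "... = lin_ext f (lin_ext (D (Suc i)) x)" by (rule lin_ext_lin_ext[symmetric])
		also have "... = 0" using x(2) by (simp add: is_cycle_def)
		finally show ?thesis by (simp add: is_cycle_def)
	qed
	hence "P (Suc i) g" using g unfolding P_def by simp
	moreover have "Q i f g" using g unfolding Q_def by simp
	ultimately show ?thesis by blast
qed
have "EX ph. ALL i. P i (ph i) & Q i (ph i) (ph (Suc i))"
	by (rule dependent_nat_choice[of P Q, OF ex0 step])
then obtain ph where "ALL i. P i (ph i) & Q i (ph i) (ph (Suc i))" by (elim exE)
thus ?thesis unfolding P_def Q_def by (intro exI[of _ ph]) simp
qed

lemma chain_map_lin_ext:
assumes "!!b. b : B ==> lin_ext D' (g b) = lin_ext f (D b)" and "x : free_module n B"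
shows "lin_ext D' (lin_ext g x) = lin_ext f (lin_ext D x)"
unfolding lin_ext_lin_ext by (rule lin_ext_cong) (use assms in "auto simp: free_module_def")

text \<open>A chain endomorphism lifting the identity is homotopic to the identity. The homotopy is
  taken ungraded, which fits \<open>tor_dim\<close>, where boundaries come from arbitrary elements
  of the free module.\<close>

lemma (in resolution) homotopy_exists:
assumes th0: "!!b. th 0 b = single b 1"
	and th: "!!i b. b : B i ==> th i b : free_module n (B i)"
	and thD: "!!i b. b : B (Suc i) ==> lin_ext (D (Suc i)) (th (Suc i) b) = lin_ext (th i) (D (Suc i) b)"
shows "EX s. (ALL i. ALL b:B i. s i b : free_module n (B (Suc i))) &
	(ALL i. ALL x:free_module n (B (Suc i)).
		lin_ext (D (Suc (Suc i))) (lin_ext (s (Suc i)) x) = lin_ext (th (Suc i)) x - x - lin_ext (s i) (lin_ext (D (Suc i)) x))"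
proof -
define P where "P i f <-> (ALL b:B i. f b : free_module n (B (Suc i))) &
	(ALL x:free_module n (B i). is_cycle J D i x --> lin_ext (D (Suc i)) (lin_ext f x) = lin_ext (th i) x - x)"
	for i and f :: "nat => (nat \<Rightarrow>\<^sub>0 'k mpoly)"
define Q where "Q i f g <-> (ALL x:free_module n (B (Suc i)).
		lin_ext (D (Suc (Suc i))) (lin_ext g x) = lin_ext (th (Suc i)) x - x - lin_ext f (lin_ext (D (Suc i)) x))"
	for i and f g :: "nat => (nat \<Rightarrow>\<^sub>0 'k mpoly)"
have thid: "lin_ext (th 0) x = x" for x
proof -
	have "th 0 = (%b. single b 1)" using th0 by (rule ext)
	thus ?thesis by (simp add: lin_ext_id)
qed
have z: "lin_ext (%_. 0) x = 0" for x :: "nat \<Rightarrow>\<^sub>0 'k mpoly"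
	by (rule poly_mapping_eqI) (simp add: lookup_lin_ext[OF finite_keys order_refl])
\<comment> \<open>In degree 0 the map is the identity, so the homotopy starts with zero.\<close>
have "P 0 (%_. 0)" unfolding P_def by (auto simp: free_module_def carrier_poly_ring thid z)
hence ex0: "EX f. P 0 f" by (rule exI[of "P 0"])
have step: "EX g. P (Suc i) g & Q i f g" if "P i f" for i f
proof -
	have f: "!!b. b : B i ==> f b : free_module n (B (Suc i))"
		and fc: "!!x. x : free_module n (B i) ==> is_cycle J D i x ==> lin_ext (D (Suc i)) (lin_ext f x) = lin_ext (th i) x - x"
		using that by (simp_all add: P_def)
	let ?y = "%b. th (Suc i) b - single b 1 - lin_ext f (D (Suc i) b)"
	have "ALL b:B (Suc i). EX y. y : free_module n (B (Suc (Suc i))) & lin_ext (D (Suc (Suc i))) y = ?y b"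
	proof
		fix b assume b: "b : B (Suc i)"
		have "is_cycle J D i (lin_ext (D (Suc i)) (single b 1))"
			by (rule D_is_cycle(2)[OF free_module_single_1[OF b]])
		hence "lin_ext (D (Suc i)) (lin_ext f (D (Suc i) b)) = lin_ext (th i) (D (Suc i) b) - D (Suc i) b"
			unfolding lin_ext_single_1 by (rule fc[OF D_module[OF b]])
		hence "is_cycle J D (Suc i) (?y b)"
			by (simp add: is_cycle_def lin_ext_diff lin_ext_single_1 thD[OF b])
		moreover have "?y b : free_module n (B (Suc i))"
			by (intro free_module_diff th[OF b] free_module_single_1[OF b] lin_ext_module[OF f D_module[OF b]])
		ultimately show "EX y. y : free_module n (B (Suc (Suc i))) & lin_ext (D (Suc (Suc i))) y = ?y b" using lift_cycle by blast
	qed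
	then obtain g where g: "ALL b:B (Suc i). g b : free_module n (B (Suc (Suc i))) & lin_ext (D (Suc (Suc i))) (g b) = ?y b"
		by (rule bchoice[THEN exE])
	have q: "lin_ext (D (Suc (Suc i))) (lin_ext g x) = lin_ext (th (Suc i)) x - x - lin_ext f (lin_ext (D (Suc i)) x)"
		if x: "x : free_module n (B (Suc i))" for x
	proof -
		have "lin_ext (D (Suc (Suc i))) (lin_ext g x) = lin_ext ?y x"
			unfolding lin_ext_lin_ext by (rule lin_ext_cong) (use g x in "auto simp: free_module_def")
		thus ?thesis by (simp only: lin_ext_minus_fun lin_ext_id lin_ext_lin_ext)
	qed
	hence "Q i f g" unfolding Q_def by blast
	moreover have "P (Suc i) g" unfolding P_def
	proof (intro conjI ballI impI)
		show "g b : free_module n (B (Suc (Suc i)))" if "b : B (Suc i)" for b using g that by blast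
		fix x assume x: "x : free_module n (B (Suc i))" "is_cycle J D (Suc i) x"
		show "lin_ext (D (Suc (Suc i))) (lin_ext g x) = lin_ext (th (Suc i)) x - x"
			unfolding q[OF x(1)] using x(2) by (simp add: is_cycle_def)
	qed
	ultimately show ?thesis by blast
qed
have "EX s. ALL i. P i (s i) & Q i (s i) (s (Suc i))"
	by (rule dependent_nat_choice[of P Q, OF ex0 step])
then obtain s where "ALL i. P i (s i) & Q i (s i) (s (Suc i))" by (elim exE)
thus ?thesis unfolding P_def Q_def by (intro exI[of _ s]) simp
qed

section \<open>Invariance of the Tor dimensions\<close>

definition tor_cycles where
"tor_cycles n (I :: 'k::field mpoly set) B e D i j = {x:free_component n (B i) (e i) j.
	 i = 0 \<or> (ALL b. lookup (lin_ext (D i) x) b : I)}"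

definition tor_boundaries where
"tor_boundaries n (I :: 'k::field mpoly set) B e D i j = {x:free_component n (B i) (e i) j.
	 EX y:free_module n (B (Suc i)). ALL b. lookup (x - lin_ext (D (Suc i)) y) b : I}"

lemma subspace_free_component:
"module.subspace (mscale :: 'k::field => _) (free_component n B e j :: (nat \<Rightarrow>\<^sub>0 'k mpoly) set)"
proof -
interpret vector_space "mscale :: 'k => (nat \<Rightarrow>\<^sub>0 'k mpoly) => _" by (rule vector_space_mscale)
show ?thesis
proof (rule subspaceI)
	fix x y :: "nat \<Rightarrow>\<^sub>0 'k mpoly" assume xy: "x : free_component n B e j" "y : free_component n B e j"
	show "x + y : free_component n B e j" unfolding free_component_iff
	proof (intro allI impI)
		fix b m assume "co2 (x + y) b m ~= 0"
		hence "co2 x b m ~= 0 \<or> co2 y b m ~= 0" by (auto simp: lookup_add)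
		thus "b : B & keys m <: {1..n} & mdeg m + e b = j" by (elim disjE xy[unfolded free_component_iff, rule_format])
	qed
next
	fix c and x :: "nat \<Rightarrow>\<^sub>0 'k mpoly" assume x: "x : free_component n B e j"
	show "mscale c x : free_component n B e j" unfolding free_component_iff co2_mscale
	proof (intro allI impI)
		fix b m assume "c * co2 x b m ~= 0"
		hence "co2 x b m ~= 0" by simp
		thus "b : B & keys m <: {1..n} & mdeg m + e b = j" by (rule x[unfolded free_component_iff, rule_format])
	qed
qed (simp add: free_component_iff)
qed

lemma free_module_mscale: "x : free_module n B ==> mscale c x : free_module n B"
unfolding free_module_iff co2_mscale by (metis mult_zero_right)

lemma subspace_tor:
fixes I :: "'k::field mpoly set"
assumes I: "ideal I (poly_ring n)"
shows "module.subspace (mscale :: 'k => _) (tor_cycles n I B e D i j)"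
	and "module.subspace (mscale :: 'k => _) (tor_boundaries n I B e D i j)"
proof -
interpret vector_space "mscale :: 'k => (nat \<Rightarrow>\<^sub>0 'k mpoly) => _" by (rule vector_space_mscale)
note fc = subspace_free_component[of n "B i" "e i" j, where 'k='k]
have Isc: "single 0 c * p : I" if "p : I" for c p
	by (rule ideal_poly_ringD(5)[OF I that poly_ring_closed(6)])
show "subspace (tor_cycles n I B e D i j)"
proof (rule subspaceI)
	show "0 : tor_cycles n I B e D i j"
		using subspace_0[OF fc] ideal_poly_ringD(2)[OF I] by (simp add: tor_cycles_def)
	show "x + y : tor_cycles n I B e D i j" if "x : tor_cycles n I B e D i j" "y : tor_cycles n I B e D i j" for x y
		using that subspace_add[OF fc, of x y] ideal_poly_ringD(3)[OF I] by (auto simp: tor_cycles_def lin_ext_add lookup_add)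
	show "mscale c x : tor_cycles n I B e D i j" if "x : tor_cycles n I B e D i j" for c x
		using that subspace_scale[OF fc, of x c] Isc by (auto simp: tor_cycles_def lin_ext_scale lookup_map_mult)
qed
show "subspace (tor_boundaries n I B e D i j)"
proof (rule subspaceI)
	have "0 : free_module n (B (Suc i))" by (simp add: free_module_iff)
	thus "0 : tor_boundaries n I B e D i j"
		using subspace_0[OF fc] ideal_poly_ringD(2)[OF I]
		unfolding tor_boundaries_def by (intro CollectI conjI bexI[of _ 0]) simp_all
next
	fix x y assume "x : tor_boundaries n I B e D i j" "y : tor_boundaries n I B e D i j"
	then obtain v w where x: "x : free_component n (B i) (e i) j" "y : free_component n (B i) (e i) j"
		"v : free_module n (B (Suc i))" "w : free_module n (B (Suc i))"
		and b: "ALL b. lookup (x - lin_ext (D (Suc i)) v) b : I" "ALL b. lookup (y - lin_ext (D (Suc i)) w) b : I"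
		unfolding tor_boundaries_def by blast
	have e: "x + y - lin_ext (D (Suc i)) (v + w) = (x - lin_ext (D (Suc i)) v) + (y - lin_ext (D (Suc i)) w)"
		by (simp add: lin_ext_add)
	have "ALL b. lookup (x + y - lin_ext (D (Suc i)) (v + w)) b : I"
		unfolding e lookup_add[of "x - lin_ext (D (Suc i)) v"]
		by (intro allI ideal_poly_ringD(3)[OF I] b[rule_format])
	thus "x + y : tor_boundaries n I B e D i j"
		unfolding tor_boundaries_def using subspace_add[OF fc x(1,2)] free_module_add[OF x(3,4)] by blast
next
	fix c x assume "x : tor_boundaries n I B e D i j"
	then obtain v where x: "x : free_component n (B i) (e i) j" "v : free_module n (B (Suc i))"
		and b: "ALL b. lookup (x - lin_ext (D (Suc i)) v) b : I"
		unfolding tor_boundaries_def by blast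
	have e: "mscale c x - lin_ext (D (Suc i)) (mscale c v) = mscale c (x - lin_ext (D (Suc i)) v)"
		by (simp only: lin_ext_scale scale_right_diff_distrib)
	have "ALL b. lookup (mscale c x - lin_ext (D (Suc i)) (mscale c v)) b : I"
		unfolding e lookup_map_mult by (intro allI Isc b[rule_format])
	thus "mscale c x : tor_boundaries n I B e D i j"
		unfolding tor_boundaries_def using subspace_scale[OF fc x(1)] free_module_mscale[OF x(2)] by blast
qed
qed

text \<open>A chain map from \<open>B\<close> to \<open>B'\<close> is injective on Tor because
  composing it with a chain map back is homotopic to the identity. Exchanging the resolutions gives
  equality.\<close>

lemma tor_dim_le:
fixes I J :: "'k::field mpoly set"
assumes R: "resolution n J B e D" and R': "resolution n J B' e' D'" and I: "ideal I (poly_ring n)"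
	and h: "has_quot_dim mscale (tor_cycles n I B e D i j) (tor_boundaries n I B e D i j) h"
	and h': "has_quot_dim mscale (tor_cycles n I B' e' D' i j) (tor_boundaries n I B' e' D' i j) h'"
shows "h <= h'"
proof -
interpret R: resolution n J B e D by (fact R)
interpret R': resolution n J B' e' D' by (fact R')
interpret vector_space_pair "mscale :: 'k => (nat \<Rightarrow>\<^sub>0 'k mpoly) => _" "mscale :: 'k => (nat \<Rightarrow>\<^sub>0 'k mpoly) => _"
	by (intro vector_space_pair.intro vector_space_mscale)
obtain ph where "ph 0 = (%b. single b 1) &
	(ALL i. ALL b:B i. ph i b : free_component n (B' i) (e' i) (e i b)) &
	(ALL i. ALL b:B (Suc i). lin_ext (D' (Suc i)) (ph (Suc i) b) = lin_ext (ph i) (D (Suc i) b))"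
	using chain_map_exists[OF R R'] by (elim exE)
hence ph0: "ph 0 = (%b. single b 1)"
	and ph: "!!i b. b : B i ==> ph i b : free_component n (B' i) (e' i) (e i b)"
	and phD: "!!i b. b : B (Suc i) ==> lin_ext (D' (Suc i)) (ph (Suc i) b) = lin_ext (ph i) (D (Suc i) b)" by simp_all
obtain ps where "ps 0 = (%b. single b 1) &
	(ALL i. ALL b:B' i. ps i b : free_component n (B i) (e i) (e' i b)) &
	(ALL i. ALL b:B' (Suc i). lin_ext (D (Suc i)) (ps (Suc i) b) = lin_ext (ps i) (D' (Suc i) b))"
	using chain_map_exists[OF R' R] by (elim exE)
hence ps0: "ps 0 = (%b. single b 1)"
	and ps: "!!i b. b : B' i ==> ps i b : free_component n (B i) (e i) (e' i b)"
	and psD: "!!i b. b : B' (Suc i) ==> lin_ext (D (Suc i)) (ps (Suc i) b) = lin_ext (ps i) (D' (Suc i) b)" by simp_all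
have phm: "ph i b : free_module n (B' i)" if "b : B i" for i b using ph[OF that] free_component_subset by blast
have psm: "ps i b : free_module n (B i)" if "b : B' i" for i b using ps[OF that] free_component_subset by blast
define th where "th i b = lin_ext (ps i) (ph i b)" for i b
have "EX s. (ALL i. ALL b:B i. s i b : free_module n (B (Suc i))) &
	(ALL i. ALL x:free_module n (B (Suc i)).
		lin_ext (D (Suc (Suc i))) (lin_ext (s (Suc i)) x) = lin_ext (th (Suc i)) x - x - lin_ext (s i) (lin_ext (D (Suc i)) x))"
proof (rule R.homotopy_exists)
	show "th 0 b = single b 1" for b by (simp add: th_def ph0 ps0 lin_ext_single_1)
	show "th i b : free_module n (B i)" if "b : B i" for i b
		unfolding th_def by (rule lin_ext_module[OF psm phm[OF that]])
	show "lin_ext (D (Suc i)) (th (Suc i) b) = lin_ext (th i) (D (Suc i) b)" if b: "b : B (Suc i)" for i b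
	proof -
		have "lin_ext (D (Suc i)) (th (Suc i) b) = lin_ext (ps i) (lin_ext (D' (Suc i)) (ph (Suc i) b))"
			unfolding th_def by (rule chain_map_lin_ext[OF psD phm[OF b]])
		also have "... = lin_ext (ps i) (lin_ext (ph i) (D (Suc i) b))" by (simp only: phD[OF b])
		finally show ?thesis unfolding lin_ext_lin_ext[of "ps i" "ph i"] th_def .
	qed
qed
then obtain s where s: "!!i b. b : B i ==> s i b : free_module n (B (Suc i))"
	and sD: "!!i x. x : free_module n (B (Suc i)) ==>
		lin_ext (D (Suc (Suc i))) (lin_ext (s (Suc i)) x) = lin_ext (th (Suc i)) x - x - lin_ext (s i) (lin_ext (D (Suc i)) x)"
	by (elim exE conjE) blast
note sub = subspace_tor[OF I]
show ?thesis
proof (rule quot_dim_le[OF h h' sub(1,2) sub(1,2), of "lin_ext (ph i)"])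
	fix x assume "x : tor_cycles n I B e D i j"
	hence x: "x : free_component n (B i) (e i) j" "i = 0 \<or> (ALL b. lookup (lin_ext (D i) x) b : I)"
		by (simp_all add: tor_cycles_def)
	have xm: "x : free_module n (B i)" using x(1) free_component_subset by blast
	have "i = 0 \<or> (ALL b. lookup (lin_ext (D' i) (lin_ext (ph i) x)) b : I)"
	proof (cases i)
		case (Suc i')
		have e: "lin_ext (D' i) (lin_ext (ph i) x) = lin_ext (ph i') (lin_ext (D i) x)"
			unfolding Suc by (rule chain_map_lin_ext[OF phD xm[unfolded Suc]])
		have Dx: "lin_ext (D i) x : free_module n (B i')" unfolding Suc by (rule R.D_is_cycle(1)[OF xm[unfolded Suc]])
		have "lookup (lin_ext (ph i') (lin_ext (D i) x)) b : I" for b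
		proof (rule lookup_lin_ext_ideal[OF I])
			show "lookup (lin_ext (D i) x) b : I" for b using x(2) Suc by simp
			fix c assume "c : keys (lin_ext (D i) x)"
			hence "c : B i'" using Dx by (auto simp: free_module_def)
			thus "lookup (ph i' c) b : carrier (poly_ring n)" using free_module_carrier[OF phm] by blast
		qed
		thus ?thesis unfolding e by blast
	qed simp
	thus "lin_ext (ph i) x : tor_cycles n I B' e' D' i j"
		using lin_ext_free_component[OF ph x(1)] by (simp add: tor_cycles_def)
next
	fix X c assume X: "finite X" "X <: tor_cycles n I B e D i j"
		"(SUM x:X. mscale (c x) (lin_ext (ph i) x)) : tor_boundaries n I B' e' D' i j"
	define x where "x = (SUM x:X. mscale (c x) x)"
	have "x : tor_cycles n I B e D i j" unfolding x_def using X(2)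
		by (intro vs1.subspace_sum[OF sub(1)] vs1.subspace_scale[OF sub(1)]) blast
	hence xc: "x : free_component n (B i) (e i) j" and xD: "i = 0 \<or> (ALL b. lookup (lin_ext (D i) x) b : I)"
		by (simp_all add: tor_cycles_def)
	have xm: "x : free_module n (B i)" using xc free_component_subset by blast
	have "lin_ext (ph i) x = (SUM x:X. mscale (c x) (lin_ext (ph i) x))" unfolding x_def by (simp only: lin_ext_sum lin_ext_scale)
	then obtain y where y: "y : free_module n (B' (Suc i))"
		"!!b. lookup (lin_ext (ph i) x - lin_ext (D' (Suc i)) y) b : I"
		using X(3) unfolding tor_boundaries_def by auto
	have py: "lin_ext (ps (Suc i)) y : free_module n (B (Suc i))" by (rule lin_ext_module[OF psm y(1)])
	have thx: "lin_ext (ps i) (lin_ext (ph i) x) = lin_ext (th i) x" unfolding lin_ext_lin_ext th_def ..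
	have psy: "lin_ext (D (Suc i)) (lin_ext (ps (Suc i)) y) = lin_ext (ps i) (lin_ext (D' (Suc i)) y)"
		by (rule chain_map_lin_ext[OF psD y(1)])
	have 1: "lookup (lin_ext (th i) x - lin_ext (D (Suc i)) (lin_ext (ps (Suc i)) y)) b : I" for b
	proof -
		let ?d = "lin_ext (ph i) x - lin_ext (D' (Suc i)) y"
		have "lin_ext (th i) x - lin_ext (D (Suc i)) (lin_ext (ps (Suc i)) y) = lin_ext (ps i) ?d"
			unfolding psy thx[symmetric] by (rule lin_ext_diff[symmetric])
		moreover have "lookup (lin_ext (ps i) ?d) b : I"
		proof (rule lookup_lin_ext_ideal[OF I y(2)])
			have "?d : free_module n (B' i)"
				by (intro free_module_diff lin_ext_module[OF phm xm] R'.D_is_cycle(1)[OF y(1)])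
			moreover fix c assume "c : keys ?d"
			ultimately have "c : B' i" by (auto simp: free_module_def)
			thus "lookup (ps i c) b : carrier (poly_ring n)" using free_module_carrier[OF psm] by blast
		qed
		ultimately show ?thesis by simp
	qed
	have "EX z:free_module n (B (Suc i)). ALL b. lookup (x - lin_ext (D (Suc i)) z) b : I"
	proof (cases i)
		case 0
		have "lin_ext (th i) x = x" unfolding 0 th_def ph0 ps0 lin_ext_single_1 by (rule lin_ext_id)
		thus ?thesis using 1 py by (intro bexI[of _ "lin_ext (ps (Suc i)) y"] allI) simp_all
	next
		case (Suc i')
		let ?z = "lin_ext (ps (Suc i)) y - lin_ext (s i) x"
		have zm: "?z : free_module n (B (Suc i))" by (intro free_module_diff py lin_ext_module[OF s xm])
		have Dx: "lin_ext (D i) x : free_module n (B i')" unfolding Suc by (rule R.D_is_cycle(1)[OF xm[unfolded Suc]])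
		have sx: "lin_ext (D (Suc i)) (lin_ext (s i) x) = lin_ext (th i) x - x - lin_ext (s i') (lin_ext (D i) x)"
			unfolding Suc by (rule sD[OF xm[unfolded Suc]])
		\<comment> \<open>The first term has coefficients in \<open>I\<close> as the image of such a
		  family under \<open>ps\<close>; the second as the image under the homotopy of
		  \<open>lin_ext (D i) x\<close>, whose coefficients lie in \<open>I\<close> because
		  \<open>x\<close> is a Tor cycle.\<close>
		have e: "x - lin_ext (D (Suc i)) ?z = (lin_ext (th i) x - lin_ext (D (Suc i)) (lin_ext (ps (Suc i)) y)) - lin_ext (s i') (lin_ext (D i) x)"
			unfolding lin_ext_diff sx by simp
		have 2: "lookup (lin_ext (s i') (lin_ext (D i) x)) b : I" for b
		proof (rule lookup_lin_ext_ideal[OF I])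
			show "lookup (lin_ext (D i) x) b : I" for b using xD Suc by simp
			fix c assume "c : keys (lin_ext (D i) x)"
			hence "c : B i'" using Dx by (auto simp: free_module_def)
			thus "lookup (s i' c) b : carrier (poly_ring n)" using free_module_carrier[OF s] by blast
		qed
		have "lookup (x - lin_ext (D (Suc i)) ?z) b : I" for b
			unfolding e lookup_minus[of "lin_ext (th i) x - lin_ext (D (Suc i)) (lin_ext (ps (Suc i)) y)"]
			by (rule ideal_poly_ringD(4)[OF I 1 2])
		thus ?thesis using zm by blast
	qed
	thus "(SUM x:X. mscale (c x) x) : tor_boundaries n I B e D i j"
		unfolding x_def[symmetric] tor_boundaries_def using xc by blast
qed
qed

text \<open>The definite description quantifies over all resolutions, so a value computed from one
  of them is only usable after comparison with every other.\<close>

lemma tor_dim_eqI: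
fixes I J :: "'k::field mpoly set"
assumes R: "graded_free_resolution n J B e D" and I: "ideal I (poly_ring n)"
	and h: "has_quot_dim mscale (tor_cycles n I B e D i j) (tor_boundaries n I B e D i j) h"
shows "tor_dim n I J i j = h"
unfolding tor_dim_def
proof (rule the_equality, fold tor_cycles_def tor_boundaries_def)
show "EX B e D. graded_free_resolution n J B e D &
	has_quot_dim mscale (tor_cycles n I B e D i j) (tor_boundaries n I B e D i j) h" using R h by blast
fix h' assume "EX B e D. graded_free_resolution n J B e D &
	has_quot_dim mscale (tor_cycles n I B e D i j) (tor_boundaries n I B e D i j) h'"
then obtain B' e' D' where R': "graded_free_resolution n J B' e' D'"
	and h': "has_quot_dim mscale (tor_cycles n I B' e' D' i j) (tor_boundaries n I B' e' D' i j) h'" by (elim exE conjE)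
have r: "resolution n J B e D" "resolution n J B' e' D'" using R R' by (simp_all add: resolution_def)
show "h' = h" using tor_dim_le[OF r(1,2) I h h'] tor_dim_le[OF r(2,1) I h' h] by simp
qed

subsection \<open>The Koszul resolution\<close>

text \<open>Complementation inside \<open>W\<close> exchanges adding a vertex with removing one. The
  product of the signs \<open>osign v W\<close> over \<open>v\<close> in \<open>F\<close> is the
  sign with which this turns \<open>bd\<close> into \<open>cobd\<close>.\<close>

lemma bd_complement:
fixes h :: "nat set => 'k::field"
assumes V: "finite V" and W: "W <: V" and F: "F <: W" and h: "!!T. h T ~= 0 ==> T <: W"
shows "(PROD v:F. osign v W) * bd V h (W - F) = cobd (%F. (PROD v:F. osign v W) * h (W - F)) F"
proof -
have fW: "finite W" by (rule finite_subset[OF W V])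
have fF: "finite F" by (rule finite_subset[OF F fW])
have "bd V h (W - F) = (SUM u:F. osign u (W - F) * h (insert u (W - F)))"
	unfolding bd_def
proof (rule sum.mono_neutral_right)
	show "ALL u:V - (W - F) - F. osign u (W - F) * h (insert u (W - F)) = 0"
	proof
		fix u assume "u : V - (W - F) - F"
		hence "h (insert u (W - F)) = 0" using h[of "insert u (W - F)"] by blast
		thus "osign u (W - F) * h (insert u (W - F)) = 0" by simp
	qed
qed (use V W F in auto)
hence "(PROD v:F. osign v W) * bd V h (W - F) =
		(SUM u:F. (PROD v:F. osign v W) * (osign u (W - F) * h (insert u (W - F))))"
	by (simp add: sum_distrib_left)
also have "... = (SUM u:F. osign u F * ((PROD v:F - {u}. osign v W) * h (W - (F - {u}))))"
proof (rule sum.cong[OF refl])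
	fix u assume u: "u : F"
	have s: "insert u (W - F) = W - (F - {u})" using u F by blast
	have "{x:W. x < u} = {x:F. x < u} Un {x:W - F. x < u}" using F by blast
	moreover have "card ({x:F. x < u} Un {x:W - F. x < u}) = card {x:F. x < u} + card {x:W - F. x < u}"
		by (rule card_Un_disjoint) (use fW fF in auto)
	ultimately have "osign u W = osign u F * (osign u (W - F) :: 'k)" by (simp add: osign_def power_add)
	hence o: "osign u (W - F) = osign u F * (osign u W :: 'k)" by simp
	have p: "(PROD v:F. osign v W) = osign u W * (PROD v:F - {u}. osign v W :: 'k)"
		using fF u by (simp add: prod.remove)
	show "(PROD v:F. osign v W) * (osign u (W - F) * h (insert u (W - F))) =
			osign u F * ((PROD v:F - {u}. osign v W) * h (W - (F - {u})))"
		unfolding s o p by (simp add: mult_ac)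
qed
finally show ?thesis by (simp add: cobd_def)
qed

text \<open>Reduced to \<open>cobd_cobd\<close> by complementing twice inside
  \<open>V\<close>.\<close>

lemma bd_bd:
fixes g :: "nat set => 'k::field"
assumes V: "finite V" and g: "!!T. g T ~= 0 ==> T <: V" and T: "T <: V"
shows "bd V (bd V g) T = 0"
proof -
let ?w = "%F. PROD v:F. osign v V :: 'k"
define F where "F = V - T"
have F: "F <: V" "T = V - F" using T by (auto simp: F_def)
have bg: "bd V g S ~= 0 ==> S <: V" for S
proof (rule ccontr)
	assume "bd V g S ~= 0" "~ S <: V"
	hence "g (insert u S) = 0" for u using g[of "insert u S"] by blast
	thus False using \<open>bd V g S \<noteq> 0\<close> by (simp add: bd_def)
qed
have "?w F * bd V (bd V g) T = cobd (%F. ?w F * bd V g (V - F)) F"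
	unfolding F(2) by (rule bd_complement[OF V order_refl F(1) bg])
also have "... = cobd (cobd (%F. ?w F * g (V - F))) F"
	unfolding cobd_def[of _ F]
proof (rule sum.cong[OF refl])
	fix u assume "u : F"
	have "?w (F - {u}) * bd V g (V - (F - {u})) = cobd (%F. ?w F * g (V - F)) (F - {u})"
		by (rule bd_complement[OF V order_refl _ g]) (use F(1) in blast)
	thus "osign u F * (?w (F - {u}) * bd V g (V - (F - {u}))) = osign u F * cobd (%F. ?w F * g (V - F)) (F - {u})"
		by simp
qed
also have "... = 0" by (rule cobd_cobd) (use F(1) V finite_subset in blast)
finally have "?w F * (?w F * bd V (bd V g) T) = 0" by simp
thus ?thesis unfolding prod_osign_square .
qed

text \<open>Bases of free modules are sets of natural numbers here, so subsets of the vertex set are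
  coded by \<open>set_encode\<close>.\<close>

definition kbasis :: "nat => nat => nat set" where
"kbasis n i = set_encode ` {T. T <: {1..n} & card T = i}"

definition kdiff :: "nat => (nat \<Rightarrow>\<^sub>0 'k::field mpoly)" where
"kdiff b = (SUM u:set_decode b. single (set_encode (set_decode b - {u}))
	 (single (single u 1) (osign u (set_decode b))))"

text \<open>The part of \<open>x\<close> in the fine degree \<open>a \<in> \<nat>\<^sup>n\<close>, as a function on the sets \<open>T\<close>.\<close>

definition kdeg :: "nat => (nat \<Rightarrow>\<^sub>0 'k::field mpoly) => (nat \<Rightarrow>\<^sub>0 nat) => nat set => 'k" where
"kdeg n x a T = (if T <: keys a & T <: {1..n} then co2 x (set_encode T) (a - xmon T) else 0)"

lemma finite_sub: "T <: {1..n::nat} ==> finite T"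
using finite_subset by blast

lemma set_encode_eq: "finite S ==> finite T ==> set_encode S = set_encode T ==> S = T"
by (metis set_encode_inverse)

lemma set_encode_in_basis: "T <: {1..n} ==> set_encode T : kbasis n i <-> card T = i"
proof
assume T: "T <: {1..n}"
show "card T = i" if b: "set_encode T : kbasis n i"
proof -
	obtain T' where T': "T' <: {1..n}" "card T' = i" "set_encode T = set_encode T'" using b unfolding kbasis_def by blast
	hence "T = T'" using set_encode_eq[of T T'] T finite_sub by blast
	thus ?thesis using T' by simp
qed
show "set_encode T : kbasis n i" if "card T = i" using T that by (auto simp: kbasis_def)
qed

lemma co2_eq_kdeg: "T <: {1..n} ==> co2 x (set_encode T) m = kdeg n x (m + xmon T) T"
using finite_sub[of T n] by (simp add: kdeg_def keys_add_nat keys_xmon)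

lemma kdeg_eq: "T <: keys a ==> T <: {1..n} ==> kdeg n x a T = co2 x (set_encode T) (a - xmon T)"
by (simp add: kdeg_def)

lemma kdeg_nonzero:
assumes x: "x : free_module n (kbasis n i)" and nz: "kdeg n x a T ~= 0"
shows "T <: {1..n}" "T <: keys a" "card T = i" "keys a <: {1..n}"
proof -
show T: "T <: {1..n}" "T <: keys a" using nz by (auto simp: kdeg_def split: if_splits)
have "co2 x (set_encode T) (a - xmon T) ~= 0" using nz T by (simp add: kdeg_eq)
hence b: "set_encode T : kbasis n i" and k: "keys (a - xmon T) <: {1..n}"
	using x unfolding free_module_iff by blast+
show "card T = i" using b set_encode_in_basis[OF T(1)] by blast
have "keys a = keys (a - xmon T) Un T"
	using arg_cong[OF minus_xmon_add[OF T(2)], of keys] finite_sub[OF T(1)]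
	by (simp add: keys_add_nat keys_xmon)
thus "keys a <: {1..n}" using k T(1) by blast
qed

lemma free_module_koszul_eqI:
assumes x: "x : free_module n (kbasis n i)" and y: "y : free_module n (kbasis n i)"
	and eq: "!!a T. kdeg n x a T = kdeg n y a T"
shows "x = y"
proof (rule co2_eqI)
fix b m show "co2 x b m = co2 y b m"
proof (cases "b : kbasis n i")
	case True
	then obtain T where T: "b = set_encode T" "T <: {1..n}" by (auto simp: kbasis_def)
	show ?thesis unfolding T(1) co2_eq_kdeg[OF T(2)] by (rule eq)
next
	case False
	have "co2 x b m = 0" using x False unfolding free_module_iff by blast
	moreover have "co2 y b m = 0" using y False unfolding free_module_iff by blast
	ultimately show ?thesis by simp
qed
qed

lemma component_koszul_iff:
"x : free_component n (kbasis n i) (%_. i) j <->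
	x : free_module n (kbasis n i) & (ALL a T. kdeg n x a T ~= 0 --> mdeg a = j)"
proof
assume x: "x : free_component n (kbasis n i) (%_. i) j"
hence xm: "x : free_module n (kbasis n i)" using free_component_subset by blast
have "mdeg a = j" if nz: "kdeg n x a T ~= 0" for a T
proof -
	note T = kdeg_nonzero[OF xm nz]
	have "co2 x (set_encode T) (a - xmon T) ~= 0" using nz T by (simp add: kdeg_eq)
	hence "mdeg (a - xmon T) + i = j" using x unfolding free_component_iff by blast
	thus ?thesis
		using arg_cong[OF minus_xmon_add[OF T(2)], of mdeg] T(3) finite_sub[OF T(1)] by (simp add: mdeg_add mdeg_xmon)
qed
thus "x : free_module n (kbasis n i) & (ALL a T. kdeg n x a T ~= 0 --> mdeg a = j)" using xm by blast
next
assume x: "x : free_module n (kbasis n i) & (ALL a T. kdeg n x a T ~= 0 --> mdeg a = j)"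
show "x : free_component n (kbasis n i) (%_. i) j"
	unfolding free_component_iff
proof (intro allI impI)
	fix b m assume nz: "co2 x b m ~= 0"
	have bm: "b : kbasis n i & keys m <: {1..n}" using x nz unfolding free_module_iff by blast
	then obtain T where T: "b = set_encode T" "T <: {1..n}" "card T = i" by (auto simp: kbasis_def)
	have "mdeg (m + xmon T) = j" using x nz unfolding T(1) co2_eq_kdeg[OF T(2)] by blast
	thus "b : kbasis n i & keys m <: {1..n} & mdeg m + i = j"
		using bm T finite_sub[OF T(2)] by (simp add: mdeg_add mdeg_xmon)
qed
qed

lemma kdeg_diff: "kdeg n (x - y) a T = kdeg n x a T - kdeg n y a T"
by (simp add: kdeg_def lookup_minus)

lemma kdeg_zero: "kdeg n 0 a T = 0"
by (simp add: kdeg_def)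

lemma kdiff_component:
assumes "b : kbasis n (Suc i)"
shows "(kdiff b :: nat \<Rightarrow>\<^sub>0 'k::field mpoly) : free_component n (kbasis n i) (%_. i) (Suc i)"
unfolding free_component_iff
proof (intro allI impI)
obtain T where T: "b = set_encode T" "T <: {1..n}" "card T = Suc i" using assms by (auto simp: kbasis_def)
have dec: "set_decode b = T" using finite_sub[OF T(2)] by (simp add: T(1))
fix c m assume "co2 (kdiff b :: nat \<Rightarrow>\<^sub>0 'k mpoly) c m ~= 0"
hence "(SUM u:T. co2 (single (set_encode (T - {u}))
		(single (single u 1) (osign u T :: 'k))) c m) ~= 0"
	unfolding kdiff_def dec by (simp only: lookup_sum) simp
then obtain u where u: "u : T" and nz: "co2 (single (set_encode (T - {u}))
		(single (single u 1) (osign u T :: 'k))) c m ~= 0"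
	by (meson sum.neutral)
have cm: "c = set_encode (T - {u})" "m = single u 1"
	using nz by (auto simp: lookup_single when_def split: if_splits)
have "T - {u} <: {1..n}" "card (T - {u}) = i" using T u finite_sub[OF T(2)] by auto
hence "c : kbasis n i" unfolding cm(1) by (simp add: set_encode_in_basis)
thus "c : kbasis n i & keys m <: {1..n} & mdeg m + i = Suc i"
	using u T(2) by (auto simp: cm(2) mdeg_def)
qed

lemma kdiff_module: "b : kbasis n (Suc i) ==> kdiff b : free_module n (kbasis n i)"
using kdiff_component free_component_subset by blast

lemma lookup_kdiff:
assumes "T <: {1..n}" "S <: {1..n}"
shows "lookup (kdiff (set_encode T)) (set_encode S) =
	(SUM u:{1..n}. if u ~: S & T = insert u S then single (single u 1) (osign u S :: 'k::field) else 0)"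
proof -
note fin = finite_sub[OF assms(1)] finite_sub[OF assms(2)]
have dec: "set_decode (set_encode T) = T" using fin by simp
have "lookup (kdiff (set_encode T)) (set_encode S) =
		(SUM u:T. if T - {u} = S then single (single u 1) (osign u T :: 'k) else 0)"
	unfolding kdiff_def dec lookup_sum
proof (rule sum.cong[OF refl])
	fix u assume "u : T"
	have "set_encode (T - {u}) = set_encode S <-> T - {u} = S" using set_encode_eq[of "T - {u}" S] fin by blast
	thus "lookup (single (set_encode (T - {u})) (single (single u 1) (osign u T :: 'k)))
			(set_encode S) = (if T - {u} = S then single (single u 1) (osign u T :: 'k) else 0)"
		by (simp add: lookup_single when_def)
qed
also have "... = (SUM u:T. if u ~: S & T = insert u S then single (single u 1) (osign u S :: 'k) else 0)"
proof (rule sum.cong[OF refl])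
	fix u assume u: "u : T"
	show "(if T - {u} = S then single (single u 1) (osign u T :: 'k) else 0) =
		(if u ~: S & T = insert u S then single (single u 1) (osign u S) else 0)"
	proof (cases "T - {u} = S")
		case True
		hence "u ~: S & T = insert u S" using u by blast
		moreover have "osign u T = (osign u S :: 'k)" using True osign_remove_self[of u T] by metis
		ultimately show ?thesis using True by simp
	next
		case False
		hence "~ (u ~: S & T = insert u S)" by blast
		thus ?thesis using False by (simp only: if_False)
	qed
qed
also have "... = (SUM u:{1..n}. if u ~: S & T = insert u S then single (single u 1) (osign u S :: 'k) else 0)"
proof (rule sum.mono_neutral_left)
	show "ALL u:{1..n} - T. (if u ~: S & T = insert u S then single (single u 1) (osign u S :: 'k) else 0) = 0"
		by auto
qed (use assms in auto)
finally show ?thesis .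
qed

lemma lookup_lin_ext_koszul:
assumes x: "x : free_module n (kbasis n i)" and S: "S <: {1..n}"
shows "lookup (lin_ext kdiff x) (set_encode S) =
	(SUM u:{1..n} - S. single (single u 1) (osign u S :: 'k::field) * lookup x (set_encode (insert u S)))"
proof -
let ?V = "{1..n}" and ?m = "%u. single (single u 1) (osign u S :: 'k)"
let ?x = "%T. lookup x (set_encode T)"
have A: "finite (set_encode ` Pow ?V)" "keys x <: set_encode ` Pow ?V"
	using x by (auto simp: free_module_def kbasis_def)
have inj: "inj_on set_encode (Pow ?V)"
	by (rule inj_onI) (use set_encode_eq finite_sub in blast)
have "lookup (lin_ext kdiff x) (set_encode S) =
		(SUM T:Pow ?V. ?x T * lookup (kdiff (set_encode T)) (set_encode S))"
	unfolding lookup_lin_ext[OF A] sum.reindex[OF inj] by simp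
also have "... = (SUM T:Pow ?V. SUM u:?V. if u ~: S & T = insert u S then ?x T * ?m u else 0)"
proof (rule sum.cong[OF refl])
	fix T assume "T : Pow ?V"
	hence T: "T <: ?V" by simp
	show "?x T * lookup (kdiff (set_encode T)) (set_encode S) =
		(SUM u:?V. if u ~: S & T = insert u S then ?x T * ?m u else 0)"
		unfolding lookup_kdiff[OF T S] sum_distrib_left by (rule sum.cong[OF refl]) (simp only: if_distrib[of "(*) (?x T)"] mult_zero_right)
qed
also have "... = (SUM u:?V. SUM T:Pow ?V. if u ~: S & T = insert u S then ?x T * ?m u else 0)"
	by (rule sum.swap)
also have "... = (SUM u:?V. if u ~: S then ?m u * ?x (insert u S) else 0)"
proof (rule sum.cong[OF refl])
	fix u assume u: "u : ?V"
	show "(SUM T:Pow ?V. if u ~: S & T = insert u S then ?x T * ?m u else 0) = (if u ~: S then ?m u * ?x (insert u S) else 0)"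
	proof (cases "u : S")
		case False
		have "(SUM T:Pow ?V. if u ~: S & T = insert u S then ?x T * ?m u else 0) = (SUM T:Pow ?V. if T = insert u S then ?x T * ?m u else 0)"
			using False by simp
		also have "... = (if insert u S : Pow ?V then ?x (insert u S) * ?m u else 0)" by (rule sum.delta) simp
		also have "... = ?m u * ?x (insert u S)" using u S by (simp add: mult.commute)
		finally show ?thesis using False by simp
	qed simp
qed
also have "... = (SUM u:?V - S. ?m u * ?x (insert u S))"
proof -
	have "(SUM u:?V - S. ?m u * ?x (insert u S)) = (SUM u:?V - S. if u ~: S then ?m u * ?x (insert u S) else 0)"
		by (rule sum.cong[OF refl]) simp
	also have "... = (SUM u:?V. if u ~: S then ?m u * ?x (insert u S) else 0)"
		by (rule sum.mono_neutral_left) auto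
	finally show ?thesis by simp
qed
finally show ?thesis .
qed

lemma lookup_var_mult:
"lookup (single (single u 1) c * p) m =
	(if u : keys m then c * lookup p (m - single u 1) else (0::'k::field))"
for m :: "nat \<Rightarrow>\<^sub>0 nat"
proof (cases "u : keys m")
case True
have e: "single u 1 + (m - single u 1) = m"
	by (rule poly_mapping_eqI) (use True in "auto simp: lookup_add lookup_minus lookup_single when_def in_keys_iff")
show ?thesis using True lookup_single_mult_plus(1)[of "single u 1" c p "m - single u 1"]
	unfolding e by simp
next
case False
have "m ~= single u 1 + k" for k
proof
	assume "m = single u 1 + k"
	hence "u : keys m" by (simp add: keys_add_nat)
	thus False using False by simp
qed
thus ?thesis using False lookup_single_mult_plus(2)[of m "single u 1" c p] by simp
qed

text \<open>In a fine degree \<open>a\<close> the Koszul complex is the augmented chain complex of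
  the full simplex on \<open>keys a\<close>.\<close>

lemma kdeg_koszul:
fixes x :: "nat \<Rightarrow>\<^sub>0 'k::field mpoly"
assumes x: "x : free_module n (kbasis n i)"
shows "kdeg n (lin_ext kdiff x) a S = bd {1..n} (kdeg n x a) S"
proof (cases "S <: keys a & S <: {1..n}")
case True
hence S: "S <: keys a" "S <: {1..n}" by simp_all
show ?thesis
	unfolding kdeg_eq[OF S] bd_def lookup_lin_ext_koszul[OF x S(2)] lookup_sum
proof (rule sum.cong[OF refl])
	fix u assume u: "u : {1..n} - S"
	have fS: "finite S" "finite (insert u S)" using finite_sub[OF S(2)] by simp_all
	have k: "u : keys (a - xmon S) <-> u : keys a"
		using u fS by (simp add: in_keys_iff lookup_minus lookup_xmon)
	have e: "a - xmon S - single u 1 = a - xmon (insert u S)"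
		by (rule poly_mapping_eqI) (use u fS in "auto simp: lookup_minus lookup_xmon lookup_single when_def")
	have i: "insert u S <: {1..n}" using u S by blast
	show "lookup (single (single u 1) (osign u S :: 'k) * lookup x (set_encode (insert u S)))
			(a - xmon S) = osign u S * kdeg n x a (insert u S)"
		unfolding lookup_var_mult k e using i S by (simp add: kdeg_def)
qed
next
case False
have "bd {1..n} (kdeg n x a) S = 0" unfolding bd_def
	by (rule sum.neutral) (use False in "auto simp: kdeg_def")
moreover have "kdeg n (lin_ext kdiff x) a S = 0" unfolding kdeg_def by (rule if_not_P[OF False])
ultimately show ?thesis by (simp only:)
qed

text \<open>The way back from families of chains to module elements; finiteness of \<open>A\<close>
  ensures finite support.\<close>

lemma kdeg_realize:
fixes Y :: "(nat \<Rightarrow>\<^sub>0 nat) => nat set => 'k::field"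
assumes A: "finite A" and Y: "!!a T. Y a T ~= 0 ==>
	a : A & T <: {1..n} & T <: keys a & card T = i & keys a <: {1..n}"
shows "EX y:free_module n (kbasis n i). ALL a T. kdeg n y a T = Y a T"
proof -
define F where "F = (%(a, T). (set_encode T, a - xmon T)) ` (A \<times> Pow {1..n})"
have finF: "finite F" using A by (simp add: F_def)
define y where "y = assemble F (%b m. Y (m + xmon (set_decode b)) (set_decode b))"
have cy: "co2 y b m = (if (b, m) : F then Y (m + xmon (set_decode b)) (set_decode b) else 0)" for b m
	unfolding y_def by (rule co2_assemble[OF finF])
have "y : free_module n (kbasis n i)"
	unfolding free_module_iff
proof (intro allI impI)
	fix b m assume "co2 y b m ~= 0"
	hence nz: "(b, m) : F" "Y (m + xmon (set_decode b)) (set_decode b) ~= 0" by (auto simp: cy split: if_splits)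
	obtain T where T: "T <: {1..n}" "b = set_encode T" using nz(1) by (auto simp: F_def)
	have dec: "set_decode b = T" using finite_sub[OF T(1)] T(2) by simp
	have "card T = i" "keys (m + xmon T) <: {1..n}" using Y[OF nz(2)] unfolding dec by simp_all
	thus "b : kbasis n i & keys m <: {1..n}"
		using T by (auto simp: keys_add_nat kbasis_def)
qed
moreover have "kdeg n y a T = Y a T" for a T
proof (cases "T <: keys a & T <: {1..n}")
	case True
	have dec: "set_decode (set_encode T) = T" by (rule set_encode_inverse[OF finite_sub[OF conjunct2[OF True]]])
	have "kdeg n y a T = (if (set_encode T, a - xmon T) : F then Y a T else 0)"
		using True by (simp add: kdeg_eq cy dec minus_xmon_add)
	moreover have "(set_encode T, a - xmon T) : F" if "Y a T ~= 0"
		unfolding F_def using Y[OF that] by (intro image_eqI[of _ _ "(a, T)"]) auto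
	ultimately show ?thesis by auto
next
	case False
	hence "Y a T = 0" using Y[of a T] by blast
	moreover have "kdeg n y a T = 0" unfolding kdeg_def by (rule if_not_P[OF False])
	ultimately show ?thesis by (simp only:)
qed
ultimately show ?thesis by blast
qed

text \<open>In a nonzero fine degree the simplex on \<open>keys a\<close> is nonempty and hence a
  cone. Fine degree 0 contains only the empty set, and there \<open>x0\<close> excludes the one
  obstruction.\<close>

lemma koszul_exact:
fixes x :: "nat \<Rightarrow>\<^sub>0 'k::field mpoly"
assumes x: "x : free_module n (kbasis n i)"
	and cyc: "!!a T. bd {1..n} (kdeg n x a) T = 0" and x0: "kdeg n x 0 {} = 0"
shows "EX y:free_module n (kbasis n (Suc i)). lin_ext kdiff y = x"
proof -
let ?V = "{1..n}"
define A where "A = (UN T:Pow ?V. (%m. m + xmon T) ` keys (lookup x (set_encode T))) - {0}"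
have finA: "finite A" by (simp add: A_def)
have zero: "kdeg n x 0 T = 0" for T
proof (cases "T = {}")
	case False
	thus ?thesis by (simp add: kdeg_def)
qed (simp add: x0)
have inA: "a : A" if nz: "kdeg n x a T ~= 0" for a T
proof -
	have T: "T <: ?V" "T <: keys a" by (rule kdeg_nonzero[OF x nz])+
	have a0: "a ~= 0" using nz zero by metis
	have "a - xmon T : keys (lookup x (set_encode T))"
		using nz T by (simp add: kdeg_eq in_keys_iff)
	hence "a : (%m. m + xmon T) ` keys (lookup x (set_encode T))"
		by (rule rev_image_eqI) (simp add: minus_xmon_add[OF T(2)])
	thus ?thesis unfolding A_def using T(1) a0 by blast
qed
\<comment> \<open>The apex of the cone in fine degree \<open>a\<close>.\<close>
define u where "u a = (SOME v. v : keys a)" for a :: "nat \<Rightarrow>\<^sub>0 nat"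
have u: "u a : keys a" if "a : A" for a
proof -
	have "keys a ~= {}" using that by (simp add: A_def)
	thus ?thesis unfolding u_def by (meson all_not_in_conv someI_ex)
qed
define Y where "Y a = (if a : A then wedge (u a) (kdeg n x a) else (%_. 0))" for a
have suppY: "a : A & T <: ?V & T <: keys a & card T = Suc i & keys a <: ?V"
	if nz: "Y a T ~= 0" for a T
proof -
	have a: "a : A" "u a : T" "kdeg n x a (T - {u a}) ~= 0" using nz by (auto simp: Y_def wedge_def split: if_splits)
	note k = kdeg_nonzero[OF x a(3)]
	have "finite T" using finite_sub[OF k(1)] by simp
	hence "card T = Suc (card (T - {u a}))" using a(2) by (rule card_insert_mem)
	thus ?thesis using a k u[OF a(1)] by auto
qed
obtain y where y: "y : free_module n (kbasis n (Suc i))" "!!a T. kdeg n y a T = Y a T"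
	using kdeg_realize[OF finA, of Y n "Suc i"] suppY by blast
have fn: "kdeg n y a = Y a" for a using y(2) by (rule ext)
have "lin_ext kdiff y = x"
proof (rule free_module_koszul_eqI[OF _ x])
	show "lin_ext kdiff y : free_module n (kbasis n i)"
		by (rule lin_ext_module[OF kdiff_module y(1)])
	fix a T
	have "kdeg n (lin_ext kdiff y) a T = bd ?V (Y a) T" unfolding kdeg_koszul[OF y(1)] fn ..
	also have "... = kdeg n x a T"
	proof (cases "a : A & T <: ?V & keys a <: ?V")
		case True
		hence "u a : ?V" using u by blast
		hence "bd ?V (Y a) T = kdeg n x a T - wedge (u a) (bd ?V (kdeg n x a)) T"
			using True bd_wedge[of ?V "u a" T "kdeg n x a"] by (simp add: Y_def)
		thus ?thesis by (simp add: wedge_def cyc del: One_nat_def)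
	next
		case False
		have "Y a (insert v T) = 0" for v using suppY[of a "insert v T"] False by blast
		hence "bd ?V (Y a) T = 0" by (simp add: bd_def)
		moreover have "kdeg n x a T = 0" using inA[of a T] kdeg_nonzero(1,4)[OF x, of a T] False by blast
		ultimately show ?thesis by simp
	qed
	finally show "kdeg n (lin_ext kdiff y) a T = kdeg n x a T" .
qed
thus ?thesis using y(1) by blast
qed

lemma kbasis_0: "kbasis n 0 = {0}"
proof -
have "{T. T <: {1..n} & card T = 0} = {{}}" using finite_sub by auto
thus ?thesis by (simp add: kbasis_def)
qed

lemma koszul_resolution:
"graded_free_resolution n (maximal_ideal n :: 'k::field mpoly set) (kbasis n) (%i _. i) (%_. kdiff)"
unfolding graded_free_resolution_def
proof (intro conjI allI ballI impI refl)
let ?V = "{1..n}"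
show "kbasis n 0 = {0}" by (rule kbasis_0)
show "kdiff b : free_component n (kbasis n i) (%_. i) (Suc i)" if "b : kbasis n (Suc i)" for i b
	by (rule kdiff_component[OF that])
show "(%x. lookup (lin_ext kdiff x) 0) ` free_module n (kbasis n 1) = (maximal_ideal n :: 'k mpoly set)"
proof (intro equalityI subsetI)
	fix p :: "'k mpoly" assume "p : (%x. lookup (lin_ext kdiff x) 0) ` free_module n (kbasis n 1)"
	then obtain y :: "nat \<Rightarrow>\<^sub>0 'k mpoly" where y: "y : free_module n (kbasis n 1)" "p = lookup (lin_ext kdiff y) 0" by blast
	have "lin_ext kdiff y : free_module n (kbasis n 0)"
		by (rule lin_ext_module[OF kdiff_module]) (use y in simp_all)
	hence pc: "p : carrier (poly_ring n)" unfolding y(2) by (rule free_module_carrier)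
	have "lookup p 0 = kdeg n (lin_ext kdiff y) 0 {}"
		unfolding y(2) by (simp add: kdeg_def xmon_def)
	also have "... = 0" unfolding kdeg_koszul[OF y(1)] by (simp add: bd_def kdeg_def)
	finally show "p : maximal_ideal n"
		using pc unfolding maximal_ideal_eq supp_ideal_def by (auto simp: in_keys_iff)
next
	fix p :: "'k mpoly" assume "p : maximal_ideal n"
	hence p: "p : carrier (poly_ring n)" "!!m. m : keys p ==> keys m ~= {}"
		unfolding maximal_ideal_eq supp_ideal_def by blast+
	have p0: "lookup p 0 = 0" using p(2)[of 0] by (auto simp: in_keys_iff)
	let ?x = "single 0 p :: nat \<Rightarrow>\<^sub>0 'k mpoly"
	have x: "?x : free_module n (kbasis n 0)"
		using p(1) by (auto simp: free_module_def kbasis_0 lookup_single when_def carrier_poly_ring)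
	have "EX y:free_module n (kbasis n (Suc 0)). lin_ext kdiff y = ?x"
	proof (rule koszul_exact[OF x])
		show "kdeg n ?x 0 {} = 0" by (simp add: kdeg_def xmon_def p0)
		fix a T
		have "kdeg n ?x a (insert v T) = 0" for v
		proof (rule ccontr)
			assume nz: "kdeg n ?x a (insert v T) ~= 0"
			have "card (insert v T) = 0" "finite (insert v T)" using kdeg_nonzero[OF x nz] finite_sub by auto
			thus False by simp
		qed
		thus "bd ?V (kdeg n ?x a) T = 0" by (simp add: bd_def)
	qed
	then obtain y where "y : free_module n (kbasis n 1)" "lin_ext kdiff y = ?x" by auto
	thus "p : (%x. lookup (lin_ext kdiff x) 0) ` free_module n (kbasis n 1)"
		by (intro rev_image_eqI[of y]) simp_all
qed
fix i :: nat assume "1 <= i"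
then obtain i' where i: "i = Suc i'" by (cases i) simp_all
show "{x:free_module n (kbasis n i). lin_ext kdiff x = (0 :: nat \<Rightarrow>\<^sub>0 'k mpoly)} =
		lin_ext kdiff ` free_module n (kbasis n (Suc i))"
proof (intro equalityI subsetI)
	fix x :: "nat \<Rightarrow>\<^sub>0 'k mpoly" assume "x : {x:free_module n (kbasis n i). lin_ext kdiff x = 0}"
	hence x: "x : free_module n (kbasis n i)" "lin_ext kdiff x = 0" by simp_all
	have "kdeg n x 0 {} = 0" using kdeg_nonzero(3)[OF x(1), of 0 "{}"] i by fastforce
	moreover have "bd ?V (kdeg n x a) T = 0" for a T
		using kdeg_koszul[OF x(1), of a T] unfolding x(2) kdeg_zero by (rule sym)
	ultimately show "x : lin_ext kdiff ` free_module n (kbasis n (Suc i))"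
		using koszul_exact[OF x(1)] by blast
next
	fix x :: "nat \<Rightarrow>\<^sub>0 'k mpoly" assume "x : lin_ext kdiff ` free_module n (kbasis n (Suc i))"
	then obtain y where y: "y : free_module n (kbasis n (Suc i))" "x = lin_ext kdiff y" by blast
	have x: "x : free_module n (kbasis n i)"
		unfolding y(2) by (rule lin_ext_module[OF kdiff_module y(1)])
	have "lin_ext kdiff x = 0"
	proof (rule free_module_koszul_eqI)
		show "lin_ext kdiff x : free_module n (kbasis n i')"
			by (rule lin_ext_module[OF kdiff_module]) (use x i in simp_all)
		show "0 : free_module n (kbasis n i')" by (simp add: free_module_iff)
		fix a T
		have fn: "kdeg n x a = bd ?V (kdeg n y a)" unfolding y(2) by (rule ext) (rule kdeg_koszul[OF y(1)])
		have "bd ?V (bd ?V (kdeg n y a)) T = 0"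
		proof (cases "T <: ?V")
			case True
			show ?thesis by (rule bd_bd[OF _ _ True]) (simp, rule kdeg_nonzero(1)[OF y(1)])
		next
			case False
			hence "kdeg n y a (insert v (insert w T)) = 0" for v w by (simp add: kdeg_def)
			thus ?thesis by (simp add: bd_def)
		qed
		thus "kdeg n (lin_ext kdiff x) a T = kdeg n 0 a T"
			unfolding kdeg_koszul[OF x] fn by (simp add: kdeg_def)
	qed
	thus "x : {x:free_module n (kbasis n i). lin_ext kdiff x = 0}" using x by simp
qed
qed

subsection \<open>Betti numbers of Stanley--Reisner rings\<close>

lemma cvanD:
fixes g :: "nat set => 'k::field"
assumes "cvan TYPE('k) L p" "supp_on L p g" "ALL T:L. cobd g T = 0"
shows "EX y. (ALL T. y T ~= 0 --> T : L & Suc (card T) = p) & (ALL T:L. g T = cobd y T)"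
using assms(1) unfolding cvan_def using assms(2,3) by (elim allE[of _ g] impE)

lemma sr_ideal_family_iff:
fixes z :: "nat \<Rightarrow>\<^sub>0 'k::field mpoly"
assumes down: "down_closed Dl" and z: "z : free_module n (kbasis n k)"
shows "(ALL b. lookup z b : sr_ideal n Dl) <->
	(ALL a S. S <: {1..n} --> S <: keys a --> keys (a - xmon S) : Dl --> kdeg n z a S = 0)"
(is "?L <-> ?R")
proof
assume l: ?L
show ?R
proof (intro allI impI, rule ccontr)
	fix a S assume S: "S <: {1..n}" "S <: keys a" "keys (a - xmon S) : Dl" and nz: "kdeg n z a S ~= 0"
	have "a - xmon S : keys (lookup z (set_encode S))"
		using nz S by (simp add: kdeg_eq in_keys_iff)
	moreover have "lookup z (set_encode S) : supp_ideal n (%A. A ~: Dl)"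
		using l unfolding sr_ideal_eq[OF down] by blast
	ultimately show False using S(3) unfolding supp_ideal_def by blast
qed
next
assume r: ?R
show ?L
proof
	fix b
	have "keys m ~: Dl" if m: "m : keys (lookup z b)" for m
	proof
		assume k: "keys m : Dl"
		have nz: "co2 z b m ~= 0" using m by (simp add: in_keys_iff)
		hence "b : kbasis n k" using z unfolding free_module_iff by blast
		then obtain T where T: "b = set_encode T" "T <: {1..n}" by (auto simp: kbasis_def)
		have "kdeg n z (m + xmon T) T = 0"
		proof (rule r[rule_format, OF T(2)])
			show "T <: keys (m + xmon T)" using finite_sub[OF T(2)] by (simp add: keys_add_nat keys_xmon)
			show "keys (m + xmon T - xmon T) : Dl" using k by simp
		qed
		thus False using nz unfolding T(1) co2_eq_kdeg[OF T(2)] by simp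
	qed
	thus "lookup z b : sr_ideal n Dl"
		using free_module_carrier[OF z, of b] unfolding sr_ideal_eq[OF down] supp_ideal_def by blast
qed
qed

abbreviation (input) koszul_cycles where
"koszul_cycles n I \<equiv> tor_cycles n I (kbasis n) (%i _. i) (%_. kdiff)"

abbreviation (input) koszul_boundaries where
"koszul_boundaries n I \<equiv> tor_boundaries n I (kbasis n) (%i _. i) (%_. kdiff)"

lemma koszul_cycles_iff:
fixes x :: "nat \<Rightarrow>\<^sub>0 'k::field mpoly"
assumes down: "down_closed Dl"
shows "x : koszul_cycles n (sr_ideal n Dl) i j <-> x : free_component n (kbasis n i) (%_. i) j &
	(ALL a S. S <: {1..n} --> S <: keys a --> keys (a - xmon S) : Dl --> bd {1..n} (kdeg n x a) S = 0)"
proof (cases "x : free_component n (kbasis n i) (%_. i) j")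
case True
hence x: "x : free_module n (kbasis n i)" using free_component_subset by blast
show ?thesis
proof (cases i)
	case 0
	have "bd {1..n} (kdeg n x a) S = 0" for a S
	proof -
		have "kdeg n x a (insert v S) = 0" for v
		proof (rule ccontr)
			assume nz: "kdeg n x a (insert v S) ~= 0"
			have "card (insert v S) = 0" using kdeg_nonzero(3)[OF x nz] 0 by simp
			moreover have "finite (insert v S)" by (rule finite_sub[OF kdeg_nonzero(1)[OF x nz]])
			ultimately show False by simp
		qed
		thus ?thesis by (simp add: bd_def)
	qed
	thus ?thesis using True 0 by (simp add: tor_cycles_def)
next
	case (Suc i')
	have m: "lin_ext kdiff x : free_module n (kbasis n i')"
		by (rule lin_ext_module[OF kdiff_module]) (use x Suc in simp_all)
	have "x : koszul_cycles n (sr_ideal n Dl) i j <-> (ALL b. lookup (lin_ext kdiff x) b : sr_ideal n Dl)"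
		using True Suc by (simp add: tor_cycles_def)
	also have "... <-> (ALL a S. S <: {1..n} --> S <: keys a --> keys (a - xmon S) : Dl --> bd {1..n} (kdeg n x a) S = 0)"
		unfolding sr_ideal_family_iff[OF down m] kdeg_koszul[OF x] ..
	finally show ?thesis using True by blast
qed
next
case False
thus ?thesis by (simp add: tor_cycles_def)
qed

lemma koszul_boundaries_iff:
fixes x :: "nat \<Rightarrow>\<^sub>0 'k::field mpoly"
assumes down: "down_closed Dl"
shows "x : koszul_boundaries n (sr_ideal n Dl) i j <-> x : free_component n (kbasis n i) (%_. i) j &
	(EX y:free_module n (kbasis n (Suc i)). ALL a S. S <: {1..n} --> S <: keys a -->
		keys (a - xmon S) : Dl --> kdeg n x a S = bd {1..n} (kdeg n y a) S)"
proof (cases "x : free_component n (kbasis n i) (%_. i) j")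
case True
hence x: "x : free_module n (kbasis n i)" using free_component_subset by blast
have "(ALL b. lookup (x - lin_ext kdiff y) b : sr_ideal n Dl) <->
	(ALL a S. S <: {1..n} --> S <: keys a -->
		keys (a - xmon S) : Dl --> kdeg n x a S = bd {1..n} (kdeg n y a) S)"
	if y: "y : free_module n (kbasis n (Suc i))" for y
proof -
	have m: "x - lin_ext kdiff y : free_module n (kbasis n i)"
		by (intro free_module_diff x lin_ext_module[OF kdiff_module y])
	show ?thesis unfolding sr_ideal_family_iff[OF down m] kdeg_diff kdeg_koszul[OF y] eq_iff_diff_eq_0[symmetric] ..
qed
thus ?thesis using True unfolding tor_boundaries_def by simp
next
case False
thus ?thesis by (simp add: tor_boundaries_def)
qed

text \<open>The strand of degree \<open>j\<close> is spanned by finitely many monomials times basis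
  elements, so the dimension that \<open>betti\<close> describes exists.\<close>

lemma koszul_dim_exists:
fixes I :: "'k::field mpoly set"
assumes I: "ideal I (poly_ring n)"
shows "EX h. has_quot_dim mscale (koszul_cycles n I i j) (koszul_boundaries n I i j) h"
proof -
interpret vector_space "mscale :: 'k => (nat \<Rightarrow>\<^sub>0 'k mpoly) => _" by (rule vector_space_mscale)
define F where "F = kbasis n i \<times> {m. keys m <: {1..n} & mdeg m <= j}"
define f where "f p = (single (fst p) (single (snd p) 1) :: nat \<Rightarrow>\<^sub>0 'k mpoly)" for p :: "nat \<times> (nat \<Rightarrow>\<^sub>0 nat)"
have finF: "finite F" unfolding F_def by (intro finite_cartesian_product bounded_monomials) (simp_all add: kbasis_def)
have cof: "co2 (f p) b m = (if p = (b, m) then 1 else 0)" for p b m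
	by (cases p) (simp add: f_def lookup_single when_def)
have inj: "inj_on f F"
proof (rule inj_onI)
	fix p p' assume "f p = f p'"
	hence "co2 (f p) (fst p) (snd p) = co2 (f p') (fst p) (snd p)" by simp
	thus "p = p'" unfolding cof by (simp split: if_splits)
qed
show ?thesis
proof (rule quot_dim_exists[OF subspace_tor[OF I] finite_imageI[OF finF]])
	fix z assume "z : koszul_cycles n I i j"
	hence z: "z : free_component n (kbasis n i) (%_. i) j" by (simp add: tor_cycles_def)
	define c where "c y = co2 z (fst (inv_into F f y)) (snd (inv_into F f y))" for y
	have "(SUM y:f ` F. mscale (c y) y) = (SUM p:F. mscale (co2 z (fst p) (snd p)) (f p))"
		unfolding sum.reindex[OF inj] o_def by (rule sum.cong[OF refl]) (simp add: c_def inv_into_f_f[OF inj])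
	moreover have "z = (SUM p:F. mscale (co2 z (fst p) (snd p)) (f p))"
	proof (rule co2_eqI)
		fix b m
		have "co2 (SUM p:F. mscale (co2 z (fst p) (snd p)) (f p)) b m = (SUM p:F. if p = (b, m) then co2 z b m else 0)"
			unfolding co2_sum co2_mscale cof by (rule sum.cong[OF refl]) simp
		also have "... = (if (b, m) : F then co2 z b m else 0)" using finF by simp
		also have "... = co2 z b m"
		proof (cases "co2 z b m = 0")
			case False
			hence "b : kbasis n i & keys m <: {1..n} & mdeg m + i = j" using z unfolding free_component_iff by blast
			hence "(b, m) : F" by (simp add: F_def)
			thus ?thesis by simp
		qed simp
		finally show "co2 z b m = co2 (SUM p:F. mscale (co2 z (fst p) (snd p)) (f p)) b m" by simp
	qed
	ultimately have "z = (SUM y:f ` F. mscale (c y) y)" by simp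
	thus "EX c. z = (SUM y:f ` F. mscale (c y) y)" by (rule exI[of _ c])
qed
qed

lemma squarefree_eq_xmon:
assumes "!!u. lookup a u < 2"
shows "a = xmon (keys a)"
proof (rule poly_mapping_eqI)
fix u show "lookup a u = lookup (xmon (keys a)) u"
	using assms[of u] by (auto simp: lookup_xmon in_keys_iff)
qed

lemma xmon_minus: "finite W ==> S <: W ==> xmon W - xmon S = xmon (W - S)"
using finite_subset[of S W] by (intro poly_mapping_eqI) (auto simp: lookup_minus lookup_xmon)

text \<open>If some exponent of \<open>a\<close> is at least 2, the reduced Koszul complex in that
  degree is contracted by this variable. Otherwise \<open>a\<close> is the indicator of a set
  \<open>W\<close>, and complementation gives the cochains of the complex induced on
  \<open>W\<close>.\<close>

lemma koszul_acyclic_degree: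
fixes x :: "nat \<Rightarrow>\<^sub>0 'k::field mpoly"
assumes down: "down_closed Dl"
	and van: "!!W. W <: {1..n} ==> card W = j ==> i <= j ==> cvan TYPE('k) {F:Dl. F <: W} (j - i)"
	and x: "x : koszul_cycles n (sr_ideal n Dl) i j"
shows "EX Y. (ALL T. Y T ~= 0 --> T <: {1..n} & T <: keys a & card T = Suc i & keys a <: {1..n}) &
	(ALL S. S <: {1..n} --> S <: keys a --> keys (a - xmon S) : Dl --> kdeg n x a S = bd {1..n} Y S)"
proof -
let ?V = "{1..n}" and ?k = "kdeg n x a"
have xc: "x : free_component n (kbasis n i) (%_. i) j"
	and cyc: "!!S. S <: ?V ==> S <: keys a ==> keys (a - xmon S) : Dl ==> bd ?V ?k S = 0"
	using x unfolding koszul_cycles_iff[OF down] by blast+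
have xm: "x : free_module n (kbasis n i)" and deg: "!!T. ?k T ~= 0 ==> mdeg a = j"
	using xc unfolding component_koszul_iff by blast+
show ?thesis
proof (cases "ALL T. ?k T = 0")
	case True
	thus ?thesis by (intro exI[of _ "%_. 0"]) (simp add: bd_def)
next
	case False
	then obtain T0 where T0: "?k T0 ~= 0" by blast
	note k0 = kdeg_nonzero[OF xm T0]
	have aV: "keys a <: ?V" and dj: "mdeg a = j" using k0 deg[OF T0] by blast+
	show ?thesis
	proof (cases "EX u. 2 <= lookup a u")
		case True
		then obtain u where u: "2 <= lookup a u" by blast
		hence ua: "u : keys a" by (simp add: in_keys_iff)
		show ?thesis
		proof (intro exI[of _ "wedge u ?k"] conjI allI impI)
			fix T assume "wedge u ?k T ~= 0"
			hence T: "u : T" "?k (T - {u}) ~= 0" by (auto simp: wedge_def split: if_splits)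
			note k = kdeg_nonzero[OF xm T(2)]
			show "T <: ?V" "T <: keys a" using k(1,2) ua aV by blast+
			have "finite T" using finite_sub[OF k(1)] by simp
			hence "card T = Suc (card (T - {u}))" using T(1) by (rule card_insert_mem)
			thus "card T = Suc i" using k(3) by simp
			show "keys a <: ?V" by (rule aV)
		next
			fix S assume S: "S <: ?V" "S <: keys a" "keys (a - xmon S) : Dl"
			\<comment> \<open>Dividing by the variable \<open>u\<close> once leaves it in the support, so the
			  face conditions at \<open>S\<close> and at \<open>S - {u}\<close> agree and the cycle condition
			  may be used at the latter.\<close>
			have "wedge u (bd ?V ?k) S = 0"
			proof (cases "u : S")
				case True
				have fS: "finite S" "finite (S - {u})" using finite_sub[OF S(1)] by simp_all
				have "v : keys (a - xmon (S - {u})) <-> v : keys (a - xmon S)" for v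
				proof (cases "v = u")
					case True
					thus ?thesis using u fS by (auto simp: in_keys_iff lookup_minus lookup_xmon)
				next
					case False
					thus ?thesis using fS by (simp add: in_keys_iff lookup_minus lookup_xmon)
				qed
				hence "keys (a - xmon (S - {u})) = keys (a - xmon S)" by blast
				hence "bd ?V ?k (S - {u}) = 0" using S by (intro cyc) auto
				thus ?thesis by (simp add: wedge_def)
			qed (simp add: wedge_def)
			moreover have "u : ?V" using ua aV by blast
			hence "bd ?V (wedge u ?k) S = ?k S - wedge u (bd ?V ?k) S" by (intro bd_wedge S(1)) simp_all
			ultimately show "?k S = bd ?V (wedge u ?k) S" by simp
		qed
	next
		case False
		define W where "W = keys a"
		have lt: "lookup a u < 2" for u using False by (meson not_less)
		have aW: "a = xmon W" unfolding W_def by (rule squarefree_eq_xmon[OF lt])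
		have fW: "finite W" by (simp add: W_def)
		have WV: "W <: ?V" using aV by (simp add: W_def)
		have cW: "card W = j" using dj mdeg_xmon[OF fW] aW by simp
		have ij: "i <= j" using card_mono[OF fW, of T0] k0 cW by (simp add: W_def)
		let ?L = "{F:Dl. F <: W}" and ?w = "%F. PROD v:F. osign v W :: 'k"
		have kW: "keys (a - xmon S) = W - S" if "S <: W" for S
			unfolding aW xmon_minus[OF fW that] using fW by (simp add: keys_xmon)
		have compl: "W - (W - F) = F" if "F <: W" for F using that by blast
		have kW0: "T <: W" if "?k T ~= 0" for T using kdeg_nonzero(2)[OF xm that] by (simp add: W_def)
		have LW: "F <: W" "F : Dl" if "F : ?L" for F using that by blast+
		have Lsub: "F - {u} : ?L" if "F : ?L" for F u using down_closedD[OF down, of F "F - {u}"] that by blast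
		\<comment> \<open>The monomial left over at the basis set \<open>S\<close> has support
		  \<open>W - S\<close>, so the face condition is about the complement; in terms of
		  \<open>F = W - S\<close> the Koszul cycle is a cocycle of the induced complex.\<close>
		define g where "g F = (if F : ?L then ?w F * ?k (W - F) else 0)" for F
		have gs: "supp_on ?L (j - i) g"
			unfolding supp_on_def
		proof (intro allI impI)
			fix F assume "g F ~= 0"
			hence F: "F : ?L" "?k (W - F) ~= 0" by (auto simp: g_def split: if_splits)
			have "card (W - F) = i" by (rule kdeg_nonzero(3)[OF xm F(2)])
			moreover have "card (W - F) = card W - card F" by (rule card_Diff_subset[OF finite_subset[OF LW(1)[OF F(1)] fW] LW(1)[OF F(1)]])
			moreover have "card F <= card W" by (rule card_mono[OF fW LW(1)[OF F(1)]])
			ultimately have "card F = j - i" using cW by linarith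
			thus "F : ?L & card F = j - i" using F(1) by blast
		qed
		have cobg: "cobd g F = ?w F * bd ?V ?k (W - F)" if F: "F : ?L" for F
		proof -
			have "cobd g F = cobd (%F. ?w F * ?k (W - F)) F"
				unfolding cobd_def g_def by (rule sum.cong[OF refl]) (simp only: Lsub[OF F] if_True)
			thus ?thesis using bd_complement[where h = ?k, OF finite_atLeastAtMost WV LW(1)[OF F] kW0] by simp
		qed
		have gc: "ALL F:?L. cobd g F = 0"
		proof
			fix F assume F: "F : ?L"
			have "bd ?V ?k (W - F) = 0"
			proof (rule cyc)
				show "W - F <: ?V" "W - F <: keys a" using WV by (auto simp: W_def)
				show "keys (a - xmon (W - F)) : Dl"
					using kW[of "W - F"] compl[OF LW(1)[OF F]] LW(2)[OF F] by simp
			qed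
			thus "cobd g F = 0" unfolding cobg[OF F] by simp
		qed
		obtain y where y: "ALL T. y T ~= 0 --> T : ?L & Suc (card T) = j - i" "ALL T:?L. g T = cobd y T"
			using cvanD[OF van[OF WV cW ij] gs gc] by (elim exE conjE)
		define Y where "Y T = (if T <: W then ?w (W - T) * y (W - T) else 0)" for T
		have YW: "T <: W" if "Y T ~= 0" for T using that by (auto simp: Y_def split: if_splits)
		show ?thesis
		proof (intro exI[of _ Y] conjI allI impI)
			fix T assume nz: "Y T ~= 0"
			have T: "T <: W" by (rule YW[OF nz])
			thus "T <: ?V" "T <: keys a" using WV by (auto simp: W_def)
			show "keys a <: ?V" by (rule aV)
			have "y (W - T) ~= 0" using nz by (auto simp: Y_def split: if_splits)
			hence "Suc (card (W - T)) = j - i" using y(1) by blast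
			moreover have "card (W - T) = card W - card T" by (rule card_Diff_subset[OF finite_subset[OF T fW] T])
			moreover have "card T <= card W" by (rule card_mono[OF fW T])
			ultimately show "card T = Suc i" using cW by linarith
		next
			fix S assume S: "S <: ?V" "S <: keys a" "keys (a - xmon S) : Dl"
			define F where "F = W - S"
			have SW: "S <: W" using S(2) by (simp add: W_def)
			have FS: "W - F = S" unfolding F_def by (rule compl[OF SW])
			have F: "F : ?L" using S(3) kW[OF SW] by (auto simp: F_def)
			have "cobd (%F. ?w F * Y (W - F)) F = cobd y F"
				unfolding cobd_def
			proof (rule sum.cong[OF refl])
				fix u
				have "F - {u} <: W" using LW(1)[OF F] by blast
				hence "W - (W - (F - {u})) = F - {u}" "W - (F - {u}) <: W" by (rule compl) blast
				thus "osign u F * (?w (F - {u}) * Y (W - (F - {u}))) = osign u F * y (F - {u})"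
					unfolding Y_def by (simp only: if_True prod_osign_square)
			qed
			hence "?w F * bd ?V Y (W - F) = cobd y F" using bd_complement[where h = Y, OF finite_atLeastAtMost WV LW(1)[OF F] YW] by simp
			also have "... = g F" using y(2) F by simp
			also have "... = ?w F * ?k (W - F)" using F by (simp only: g_def if_True)
			finally have "?w F * (?w F * bd ?V Y (W - F)) = ?w F * (?w F * ?k (W - F))" by simp
			thus "?k S = bd ?V Y S" unfolding prod_osign_square FS by simp
		qed
	qed
qed
qed

text \<open>One direction glues the solutions of the finitely many fine degrees of total degree at
  most \<open>j\<close>. The other places a given cocycle on \<open>W\<close> into fine degree
  \<open>xmon W\<close> and reads off a preimage there.\<close>

lemma koszul_cycles_subset_iff:
assumes down: "down_closed Dl"
shows "koszul_cycles n (sr_ideal n Dl :: 'k::field mpoly set) i j <: koszul_boundaries n (sr_ideal n Dl) i j <->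
	(ALL W. W <: {1..n} --> card W = j --> i <= j --> cvan TYPE('k) {F:Dl. F <: W} (j - i))"
(is "?Z <: ?B <-> ?R")
proof
let ?V = "{1..n}"
assume r: ?R
show "?Z <: ?B"
proof
	fix x assume x: "x : ?Z"
	let ?good = "%a Y. (ALL T. Y T ~= 0 --> T <: ?V & T <: keys a & card T = Suc i & keys a <: ?V) &
		(ALL S. S <: ?V --> S <: keys a --> keys (a - xmon S) : Dl --> kdeg n x a S = bd ?V Y S)"
	have "ALL a. EX Y. ?good a Y"
		by (rule allI) (rule koszul_acyclic_degree[OF down _ x], use r in blast)
	then obtain Y where Y: "ALL a. ?good a (Y a)" by (rule choice[THEN exE])
	have xc: "x : free_component n (kbasis n i) (%_. i) j" using x by (simp add: tor_cycles_def)
	hence xm: "x : free_module n (kbasis n i)" and deg: "!!a T. kdeg n x a T ~= 0 ==> mdeg a = j"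
		unfolding component_koszul_iff by blast+
	define A where "A = {a. keys a <: ?V & mdeg a <= j}"
	have finA: "finite A" unfolding A_def by (rule bounded_monomials) simp
	define Y' where "Y' a = (if a : A then Y a else (%_. 0))" for a
	have "a : A & T <: ?V & T <: keys a & card T = Suc i & keys a <: ?V" if "Y' a T ~= 0" for a T
	proof -
		have a: "a : A" "Y a T ~= 0" using that by (auto simp: Y'_def split: if_splits)
		thus ?thesis using Y[rule_format, of a] by blast
	qed
	then obtain y where y: "y : free_module n (kbasis n (Suc i))" "ALL a T. kdeg n y a T = Y' a T"
		using kdeg_realize[OF finA, of Y' n "Suc i"] by blast
	have fn: "kdeg n y a = Y' a" for a using y(2) by blast
	have "kdeg n x a S = bd ?V (kdeg n y a) S"
		if S: "S <: ?V" "S <: keys a" "keys (a - xmon S) : Dl" for a S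
	proof (cases "a : A")
		case True
		have "kdeg n x a S = bd ?V (Y a) S" using Y[rule_format, of a] S by blast
		thus ?thesis unfolding fn Y'_def using True by simp
	next
		case False
		have "kdeg n x a S = 0"
		proof (rule ccontr)
			assume nz: "kdeg n x a S ~= 0"
			show False using False kdeg_nonzero(4)[OF xm nz] deg[OF nz] by (simp add: A_def)
		qed
		thus ?thesis unfolding fn Y'_def using False by (simp add: bd_def)
	qed
	thus "x : ?B" unfolding koszul_boundaries_iff[OF down] using xc y(1) by blast
qed
next
let ?V = "{1..n}"
assume sub: "?Z <: ?B"
show ?R
proof (intro allI impI)
	fix W assume WV: "W <: ?V" and cW: "card W = j" and ij: "i <= j"
	let ?L = "{F:Dl. F <: W}" and ?w = "%F. PROD v:F. osign v W :: 'k"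
	have fW: "finite W" by (rule finite_sub[OF WV])
	have compl: "W - (W - F) = F" if "F <: W" for F using that by blast
	have LW: "F <: W" "F : Dl" if "F : ?L" for F using that by blast+
	have Lsub: "F - {u} : ?L" if "F : ?L" for F u using down_closedD[OF down, of F "F - {u}"] that by blast
	have keyW: "keys (xmon W) = W" by (rule keys_xmon[OF fW])
	have kW: "keys (xmon W - xmon S) = W - S" if "S <: W" for S
		unfolding xmon_minus[OF fW that] using fW by (simp add: keys_xmon)
	show "cvan TYPE('k) ?L (j - i)"
		unfolding cvan_def
	proof (intro allI impI)
		fix g :: "nat set => 'k" assume gs: "supp_on ?L (j - i) g" and gc: "ALL T:?L. cobd g T = 0"
		\<comment> \<open>Complementation in the opposite direction; \<open>prod_osign_square\<close>
		  makes the twist its own inverse.\<close>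
		define h where "h T = (if T <: W then ?w (W - T) * g (W - T) else 0)" for T
		have hW: "T <: W & card T = i" if nz: "h T ~= 0" for T
		proof -
			have T: "T <: W" "g (W - T) ~= 0" using nz by (auto simp: h_def split: if_splits)
			have "card (W - T) = j - i" using supp_onD[OF gs T(2)] by blast
			moreover have "card (W - T) = card W - card T" by (rule card_Diff_subset[OF finite_subset[OF T(1) fW] T(1)])
			moreover have "card T <= card W" by (rule card_mono[OF fW T(1)])
			ultimately show ?thesis using cW ij T(1) by auto
		qed
		have hg: "?w F * h (W - F) = g F" if F: "F <: W" for F
			unfolding h_def using compl[OF F] by (simp only: Diff_subset if_True prod_osign_square)
		define Y where "Y a = (if a = xmon W then h else (%_. 0))" for a
		have "a : {xmon W} & T <: ?V & T <: keys a & card T = i & keys a <: ?V" if "Y a T ~= 0" for a T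
		proof -
			have a: "a = xmon W" "h T ~= 0" using that by (auto simp: Y_def split: if_splits)
			thus ?thesis using hW[OF a(2)] WV keyW by auto
		qed
		then obtain x where x: "x : free_module n (kbasis n i)" "ALL a T. kdeg n x a T = Y a T"
			using kdeg_realize[of "{xmon W}" Y n i] by blast
		have fn: "kdeg n x a = Y a" for a using x(2) by blast
		have xc: "x : free_component n (kbasis n i) (%_. i) j"
			unfolding component_koszul_iff fn Y_def using x(1) cW mdeg_xmon[OF fW] by simp
		have bh: "?w F * bd ?V h (W - F) = cobd g F" if F: "F : ?L" for F
		proof -
			have "?w F * bd ?V h (W - F) = cobd (%F. ?w F * h (W - F)) F"
				by (rule bd_complement[OF _ WV LW(1)[OF F]]) (use hW in auto)
			also have "... = cobd g F" unfolding cobd_def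
			proof (rule sum.cong[OF refl])
				fix u show "osign u F * (?w (F - {u}) * h (W - (F - {u}))) = osign u F * g (F - {u})"
					using hg[of "F - {u}"] LW(1)[OF F] by (simp only: Diff_subset[THEN order_trans])
			qed
			finally show ?thesis .
		qed
		have "x : ?Z"
			unfolding koszul_cycles_iff[OF down]
		proof (intro conjI xc allI impI)
			fix a S assume S: "S <: ?V" "S <: keys a" "keys (a - xmon S) : Dl"
			show "bd ?V (kdeg n x a) S = 0"
			proof (cases "a = xmon W")
				case True
				have SW: "S <: W" using S(2) unfolding True keyW .
				have F: "W - S : ?L" using S(3) unfolding True kW[OF SW] by blast
				have "?w (W - S) * bd ?V h (W - (W - S)) = 0" unfolding bh[OF F] using gc F by blast
				hence "?w (W - S) * (?w (W - S) * bd ?V h S) = 0" unfolding compl[OF SW] by simp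
				thus ?thesis unfolding prod_osign_square fn Y_def using True by simp
			qed (simp add: fn Y_def bd_def)
		qed
		hence "x : ?B" using sub by blast
		then obtain y where y: "y : free_module n (kbasis n (Suc i))" and
			eq: "!!a S. S <: ?V ==> S <: keys a ==> keys (a - xmon S) : Dl ==>
				kdeg n x a S = bd ?V (kdeg n y a) S"
			unfolding koszul_boundaries_iff[OF down] by blast
		let ?y = "kdeg n y (xmon W)"
		define y' where "y' F = (if F : ?L then ?w F * ?y (W - F) else 0)" for F
		have yW: "T <: W" if "?y T ~= 0" for T using kdeg_nonzero(2)[OF y that] unfolding keyW .
		show "EX y. (ALL T. y T ~= 0 --> T : ?L & Suc (card T) = j - i) & (ALL T:?L. g T = cobd y T)"
		proof (intro exI[of _ y'] conjI allI impI ballI)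
			fix F assume "y' F ~= 0"
			hence F: "F : ?L" "?y (W - F) ~= 0" by (auto simp: y'_def split: if_splits)
			show "F : ?L" by (rule F(1))
			have "card (W - F) = Suc i" by (rule kdeg_nonzero(3)[OF y F(2)])
			moreover have "card (W - F) = card W - card F" by (rule card_Diff_subset[OF finite_subset[OF LW(1)[OF F(1)] fW] LW(1)[OF F(1)]])
			ultimately show "Suc (card F) = j - i" using cW by linarith
		next
			fix F assume F: "F : ?L"
			have "cobd y' F = cobd (%F. ?w F * ?y (W - F)) F"
				unfolding cobd_def y'_def by (rule sum.cong[OF refl]) (simp only: Lsub[OF F] if_True)
			also have "... = ?w F * bd ?V ?y (W - F)"
				using bd_complement[where h = ?y, OF finite_atLeastAtMost WV LW(1)[OF F] yW] by simp
			also have "bd ?V ?y (W - F) = kdeg n x (xmon W) (W - F)"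
			proof (rule eq[symmetric])
				show "W - F <: ?V" "W - F <: keys (xmon W)" using WV keyW by auto
				show "keys (xmon W - xmon (W - F)) : Dl"
					using kW[of "W - F"] compl[OF LW(1)[OF F]] LW(2)[OF F] by simp
			qed
			also have "... = h (W - F)" by (simp add: fn Y_def)
			finally show "g F = cobd y' F" using hg[OF LW(1)[OF F]] by simp
		qed
	qed
qed
qed

text \<open>Hochster's formula as a vanishing criterion. Removing the \<open>i\<close> elements of a
  Koszul basis set from the \<open>j\<close> elements of \<open>W\<close> leaves faces with
  \<open>j - i\<close> vertices.\<close>

theorem betti_eq_0_iff:
assumes down: "down_closed Dl"
shows "betti n (sr_ideal n Dl :: 'k::field mpoly set) i j = 0 <->
	(ALL W. W <: {1..n} --> card W = j --> i <= j --> cvan TYPE('k) {F:Dl. F <: W} (j - i))"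
proof -
let ?I = "sr_ideal n Dl :: 'k mpoly set"
interpret vector_space "mscale :: 'k => (nat \<Rightarrow>\<^sub>0 'k mpoly) => _" by (rule vector_space_mscale)
have I: "ideal ?I (poly_ring n)" by (rule ideal_sr_ideal[OF down])
obtain h where h: "has_quot_dim mscale (koszul_cycles n ?I i j) (koszul_boundaries n ?I i j) h"
	using koszul_dim_exists[OF I] by blast
have "betti n ?I i j = h" unfolding betti_def by (rule tor_dim_eqI[OF koszul_resolution I h])
thus ?thesis
	using quot_dim_0_iff[OF h subspace_tor[OF I]] koszul_cycles_subset_iff[OF down, of n i j, where 'k='k] by simp
qed

lemma betti_nonzeroE:
assumes "down_closed Dl" "betti n (sr_ideal n Dl :: 'k::field mpoly set) i j ~= 0"
obtains W where "W <: {1..n}" "card W = j" "i <= j" "~ cvan TYPE('k) {F:Dl. F <: W} (j - i)"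
using assms(2) unfolding betti_eq_0_iff[OF assms(1)] by blast

text \<open>The maximum in the definition of regularity needs a finite set to be meaningful;
  \<open>j - i\<close> is the size of a subset of some \<open>W\<close>.\<close>

lemma finite_regularity_set:
assumes down: "down_closed Dl"
shows "finite {int j - int i | i j. betti n (sr_ideal n Dl :: 'k::field mpoly set) i j ~= 0}"
proof (rule finite_subset)
show "{int j - int i | i j. betti n (sr_ideal n Dl :: 'k mpoly set) i j ~= 0} <: {0..int n}"
proof
	fix k assume "k : {int j - int i | i j. betti n (sr_ideal n Dl :: 'k mpoly set) i j ~= 0}"
	then obtain i j where k: "k = int j - int i" "betti n (sr_ideal n Dl :: 'k mpoly set) i j ~= 0" by blast
	obtain W where "W <: {1..n}" "card W = j" "i <= j" by (rule betti_nonzeroE[OF down k(2)])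
	thus "k : {0..int n}" using card_mono[of "{1..n}" W] k(1) by simp
qed
qed simp

lemma linear_resolution_imp:
assumes down: "down_closed Dl" and lin: "linear_resolution n (sr_ideal n Dl :: 'k::field mpoly set) q"
shows "initial_degree n (sr_ideal n Dl :: 'k mpoly set) = q"
	and "W <: {1..n} ==> q <= p ==> cvan TYPE('k) {F:Dl. F <: W} p"
proof -
show "initial_degree n (sr_ideal n Dl :: 'k mpoly set) = q" using lin by (simp add: linear_resolution_def)
assume W: "W <: {1..n}" and p: "q <= p"
let ?L = "{F:Dl. F <: W}"
have fW: "finite W" by (rule finite_sub[OF W])
have dL: "down_closed ?L" using down unfolding down_closed_def by blast
show "cvan TYPE('k) ?L p"
proof (cases "p <= card W")
	case True
	show ?thesis
	proof (rule ccontr)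
		assume n: "~ cvan TYPE('k) ?L p"
		\<comment> \<open>Cohomology on \<open>p\<close> vertices of the complex induced on
		  \<open>W\<close> is seen by the Betti number with \<open>i = card W - p\<close> and
		  \<open>j = card W\<close>. For \<open>p\<close> beyond \<open>card W\<close> there are no faces
		  to consider.\<close>
		have e: "card W - (card W - p) = p" using True by simp
		have "betti n (sr_ideal n Dl :: 'k mpoly set) (card W - p) (card W) ~= 0"
			unfolding betti_eq_0_iff[OF down] using W n e by auto
		moreover have "int p = int (card W) - int (card W - p)" using True by simp
		ultimately have "int p : {int j - int i | i j. betti n (sr_ideal n Dl :: 'k mpoly set) i j ~= 0}" by blast
		hence "int p <= regularity n (sr_ideal n Dl :: 'k mpoly set)"
			unfolding regularity_def by (rule Max_ge[OF finite_regularity_set[OF down]])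
		thus False using lin p by (simp add: linear_resolution_def)
	qed
next
	case False
	have "card T ~= p" if "T : ?L" for T using card_mono[OF fW, of T] that False by auto
	hence h: "hvan TYPE('k) W ?L p" by (rule hvan_no_faces)
	show ?thesis by (rule hvan_imp_cvan[OF fW _ dL h]) blast
qed
qed

text \<open>The indicator of one facet represents the fundamental class. Were it a coboundary on
  \<open>L\<close>, its coboundary at \<open>W\<close> would vanish by \<open>cobd_cobd\<close>, but
  that value is a sign.\<close>

lemma not_cvan_simplex_boundary:
assumes fin: "finite W" and L: "!!F. F : L <-> F \<subset> W" and W: "card W = Suc p"
shows "~ cvan TYPE('k::field) L p"
proof
assume c: "cvan TYPE('k) L p"
obtain w where w: "w : W" using W by fastforce
define g where "g F = (if F = W - {w} then 1 else 0 :: 'k)" for F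
have cw: "card (W - {w}) = p" using W w fin by simp
have gs: "supp_on L p g"
	unfolding supp_on_def using L w cw by (auto simp: g_def split: if_splits)
have gc: "ALL T:L. cobd g T = 0"
proof
	fix T assume T: "T : L"
	hence TW: "T \<subset> W" using L by blast
	have "g (T - {u}) = 0" if u: "u : T" for u
	proof -
		have "finite T" by (rule finite_subset[OF psubset_imp_subset[OF TW] fin])
		hence "card (T - {u}) < card T" using u by (rule card_Diff1_less)
		moreover have "card T < card W" by (rule psubset_card_mono[OF fin TW])
		ultimately have "card (T - {u}) < p" using W by linarith
		hence "T - {u} ~= W - {w}" using cw by (metis less_irrefl)
		thus ?thesis by (simp add: g_def)
	qed
	thus "cobd g T = 0" by (simp add: cobd_def)
qed
obtain y where y: "ALL T:L. g T = cobd y T" using cvanD[OF c gs gc] by blast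
have "cobd g W = cobd (cobd y) W"
	unfolding cobd_def[of _ W]
proof (rule sum.cong[OF refl])
	fix u assume "u : W"
	hence "W - {u} : L" using L by blast
	thus "osign u W * g (W - {u}) = osign u W * cobd y (W - {u})" using y by simp
qed
also have "... = 0" by (rule cobd_cobd[OF fin])
finally have "cobd g W = 0" .
moreover have "cobd g W = (SUM u:W. if u = w then osign w W else 0)"
	unfolding cobd_def
proof (rule sum.cong[OF refl])
	fix u assume "u : W"
	hence "W - {u} = W - {w} <-> u = w" using w by blast
	thus "osign u W * g (W - {u}) = (if u = w then osign w W else 0)" by (simp add: g_def)
qed
hence "cobd g W = osign w W" using w fin by simp
ultimately show False by simp
qed

text \<open>The vanishing bounds the regularity by \<open>q - 1\<close>. A smallest nonface
  \<open>W0\<close> induces the boundary of a simplex and gives a nonzero first Betti number in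
  degree \<open>q\<close>, so the bound is attained.\<close>

lemma linear_resolutionI:
assumes down: "down_closed Dl" and W0: "W0 <: {1..n}" "W0 ~: Dl" "card W0 = q" and q: "1 <= q"
	and skel: "!!F. F <: {1..n} ==> F ~: Dl ==> q <= card F"
	and van: "!!W p. W <: {1..n} ==> q <= p ==> cvan TYPE('k) {F:Dl. F <: W} p"
shows "linear_resolution n (sr_ideal n Dl :: 'k::field mpoly set) q"
proof -
let ?I = "sr_ideal n Dl :: 'k mpoly set"
have init: "initial_degree n ?I = q" by (rule initial_degree_eqI[OF down W0 skel])
have fW: "finite W0" by (rule finite_sub[OF W0(1)])
have "regularity n ?I = int q - 1"
	unfolding regularity_def
proof (rule Max_eqI[OF finite_regularity_set[OF down]])
	fix k assume "k : {int j - int i | i j. betti n ?I i j ~= 0}"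
	then obtain i j where k: "k = int j - int i" "betti n ?I i j ~= 0" by blast
	obtain W where W: "W <: {1..n}" "card W = j" "i <= j" "~ cvan TYPE('k) {F:Dl. F <: W} (j - i)"
		by (rule betti_nonzeroE[OF down k(2)])
	have "j - i < q" using van[OF W(1), of "j - i"] W(4) by (meson not_less)
	thus "k <= int q - 1" using k(1) W(3) by linarith
next
	have L: "F : {F:Dl. F <: W0} <-> F \<subset> W0" for F
	proof
		assume "F : {F:Dl. F <: W0}"
		thus "F \<subset> W0" using W0(2) by blast
	next
		assume F: "F \<subset> W0"
		have "card F < q" using psubset_card_mono[OF fW F] W0(3) by simp
		moreover have "F <: {1..n}" using F W0(1) by blast
		ultimately have "F : Dl" using skel by (meson not_less)
		thus "F : {F:Dl. F <: W0}" using F by blast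
	qed
	have "~ cvan TYPE('k) {F:Dl. F <: W0} (q - 1)"
		by (rule not_cvan_simplex_boundary[OF fW L]) (use W0(3) q in simp)
	hence "betti n ?I 1 q ~= 0" unfolding betti_eq_0_iff[OF down] using W0 q by blast
	moreover have "int q - 1 = int q - int 1" by simp
	ultimately show "int q - 1 : {int j - int i | i j. betti n ?I i j ~= 0}" by blast
qed
thus ?thesis unfolding linear_resolution_def init by simp
qed

section \<open>The Alexander dual of a cyclic polytope\<close>

subsection \<open>The Buchsbaum property\<close>

lemma reduced_homology_vanishes_low:
assumes "i < -1" shows "reduced_homology_vanishes TYPE('k::field) L i"
unfolding reduced_homology_vanishes_def
proof (intro ballI impI)
fix z :: "nat set \<Rightarrow>\<^sub>0 'k" assume "z : chains L i"
hence "keys z = {}" using assms by (force simp: chains_def)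
hence "z = 0" by simp
thus "EX w:chains L (i + 1). z = boundary_map w"
	by (intro bexI[of _ 0]) (auto simp: boundary_map_def chains_def)
qed

lemma max_card_link:
assumes fin: "finite Dl" "!!F. F : Dl ==> finite F" and dim: "!!F. F : Dl ==> card F <= d"
	and G: "F <: G" "G : Dl" "card G = d"
shows "Max (card ` link Dl F) = d - card F"
proof (rule Max_eqI)
have "link Dl F <: (%A. A - F) ` Dl"
proof
	fix A assume "A : link Dl F"
	hence "A Un F : Dl" "A = A Un F - F" unfolding link_def by blast+
	thus "A : (%A. A - F) ` Dl" by (rule rev_image_eqI)
qed
thus "finite (card ` link Dl F)" by (intro finite_imageI finite_subset[OF _ finite_imageI[OF fin(1)]])
fix k assume "k : card ` link Dl F"
then obtain A where A: "A Int F = {}" "A Un F : Dl" "k = card A" by (auto simp: link_def)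
have "finite (A Un F)" using fin A by blast
hence "card A + card F <= d" using dim[OF A(2)] A(1) by (simp add: card_Un_disjoint)
thus "k <= d - card F" using A by simp
next
have "G - F : link Dl F" using G by (auto simp: link_def Un_absorb2)
moreover have "card (G - F) = d - card F"
	using G fin(2)[OF G(2)] finite_subset by (subst card_Diff_subset) auto
ultimately show "d - card F : card ` link Dl F" by (metis imageI)
qed

text \<open>Purity becomes the extension of every face to one with \<open>d\<close> vertices, which
  also yields the dimension of each link; the range \<open>i < dim\<close> becomes
  \<open>p < d - card F\<close> in the vertex count.\<close>

lemma buchsbaum_iff:
assumes V: "finite V" "Dl <: Pow V" and dim: "!!F. F : Dl ==> card F <= d" and top: "G0 : Dl" "card G0 = d"
shows "buchsbaum TYPE('k::field) Dl <-> (ALL F:Dl. EX G:Dl. F <: G & card G = d) &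
	(ALL F:Dl. F ~= {} --> (\<forall>p < d - card F. hvan TYPE('k) V (link Dl F) p))"
proof -
have fin: "finite Dl" using V by (meson finite_Pow_iff finite_subset)
have finF: "finite F" if "F : Dl" for F using that V by (meson PowD finite_subset subsetD)
have facet: "EX G:facets Dl. F <: G" if F: "F : Dl" for F
proof -
	have "finite {G:Dl. F <: G}" "F : {G:Dl. F <: G}" using fin F by auto
	from finite_has_maximal2[OF this] obtain G where "G : Dl" "F <: G" "ALL H:{G:Dl. F <: G}. G <: H --> G = H" by blast
	thus ?thesis by (intro bexI[of _ G]) (auto simp: facets_def)
qed
have pure: "pure_complex Dl <-> (ALL F:Dl. EX G:Dl. F <: G & card G = d)"
proof
	assume p: "pure_complex Dl"
	have G0: "G0 : facets Dl"
		unfolding facets_def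
	proof (intro CollectI conjI ballI impI top)
		fix G assume "G : Dl" "G0 <: G"
		thus "G0 = G" using dim[of G] finF[of G] top by (intro card_subset_eq) (auto intro: antisym card_mono)
	qed
	show "ALL F:Dl. EX G:Dl. F <: G & card G = d"
	proof
		fix F assume "F : Dl"
		then obtain G where G: "G : facets Dl" "F <: G" using facet by blast
		have "card G = card G0" by (rule p[unfolded pure_complex_def, THEN bspec, OF G(1), THEN bspec, OF G0])
		hence "card G = d" using top by simp
		thus "EX G:Dl. F <: G & card G = d" using G by (auto simp: facets_def)
	qed
next
	assume a: "ALL F:Dl. EX G:Dl. F <: G & card G = d"
	have "card F = d" if "F : facets Dl" for F
	proof -
		have "F : Dl" using that by (simp add: facets_def)
		then obtain G where "G : Dl" "F <: G" "card G = d" using a by blast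
		thus ?thesis using that by (auto simp: facets_def)
	qed
	thus "pure_complex Dl" by (simp add: pure_complex_def)
qed
have linkV: "link Dl F <: Pow V" for F using V by (auto simp: link_def)
have key: "(ALL i. i < complex_dim (link Dl F) --> reduced_homology_vanishes TYPE('k) (link Dl F) i) <->
	(\<forall>p < d - card F. hvan TYPE('k) V (link Dl F) p)"
	if F: "F : Dl" and a: "ALL F:Dl. EX G:Dl. F <: G & card G = d" for F
proof -
	obtain G where G: "G : Dl" "F <: G" "card G = d" using a F by blast
	have m: "complex_dim (link Dl F) = int (d - card F) - 1"
		unfolding complex_dim_def using max_card_link[OF fin finF dim G(2,1,3)] by simp
	note iff = reduced_homology_vanishes_iff[OF V(1) linkV[of F], where 'k='k]
	show ?thesis
	proof
		assume r: "ALL i. i < complex_dim (link Dl F) --> reduced_homology_vanishes TYPE('k) (link Dl F) i"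
		show "\<forall>p < d - card F. hvan TYPE('k) V (link Dl F) p"
		proof (intro allI impI)
			fix p assume "p < d - card F"
			hence "int p - 1 < complex_dim (link Dl F)" using m by simp
			thus "hvan TYPE('k) V (link Dl F) p" using r iff[OF refl, of p] by blast
		qed
	next
		assume r: "\<forall>p < d - card F. hvan TYPE('k) V (link Dl F) p"
		show "ALL i. i < complex_dim (link Dl F) --> reduced_homology_vanishes TYPE('k) (link Dl F) i"
		proof (intro allI impI)
			fix i assume i: "i < complex_dim (link Dl F)"
			show "reduced_homology_vanishes TYPE('k) (link Dl F) i"
			proof (cases "i < -1")
				case True thus ?thesis by (rule reduced_homology_vanishes_low)
			next
				case False
				hence e: "i = int (nat (i + 1)) - 1" by simp
				have "nat (i + 1) < d - card F" using i m False by linarith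
				thus ?thesis using r iff[OF e] by blast
			qed
		qed
	qed
qed
show ?thesis unfolding buchsbaum_def pure by (intro conj_cong refl ball_cong imp_cong key)
qed

subsection \<open>Complexes of sets whose complement contains a gapped set\<close>

text \<open>\<open>U\<close> holds points that are no longer vertices but may still be used by the
  gapped set, such as deleted vertices. Without it the family would not be closed under
  deletion.\<close>

definition gap_complex :: "(nat => nat) => nat set => nat set => nat => nat set set" where
"gap_complex k X U r = {G. G <: X & (\<exists>R\<subseteq>(X - G) Un U. card R = r & gapped (k ` R))}"

lemma gapped_subset: "gapped I ==> J <: I ==> gapped J"
unfolding gapped_def by blast

lemma down_closed_gap_complex: "down_closed (gap_complex k X U r)"
unfolding down_closed_def gap_complex_def
proof (intro ballI allI impI CollectI)
fix F G assume F: "F : {G. G <: X & (\<exists>R\<subseteq>X - G Un U. card R = r & gapped (k ` R))}" and G: "G <: F"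
then obtain R where R: "R <: X - F Un U" "card R = r" "gapped (k ` R)" by blast
have "R <: X - G Un U" using R(1) G by blast
thus "G <: X & (\<exists>R\<subseteq>X - G Un U. card R = r & gapped (k ` R))" using R F G by blast
qed

text \<open>An exchange argument: the last element of a gapped set can be replaced by the last
  available point \<open>x\<close>, which only widens the final gap.\<close>

lemma gapped_with_last:
assumes fin: "finite A" and inj: "inj_on k A" and x: "x : A" "!!y. y : A ==> k y <= k x"
shows "(\<exists>R\<subseteq>A. card R = Suc r & gapped (k ` R)) <->
	(\<exists>R\<subseteq>{y:A. Suc (k y) < k x}. card R = r & gapped (k ` R))"
proof
assume "\<exists>R\<subseteq>A. card R = Suc r & gapped (k ` R)"
then obtain R where R: "R <: A" "card R = Suc r" "gapped (k ` R)" by blast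
have finR: "finite R" "R ~= {}" using R fin finite_subset by auto
have "Max (k ` R) : k ` R" using finR by (intro Max_in) auto
then obtain y where y: "y : R" "k y = Max (k ` R)" by (metis imageE)
have "Suc (k z) < k x" if z: "z : R - {y}" for z
proof -
	have "k z <= k y" using y(2) finR z by simp
	moreover have "k z ~= k y" using inj_onD[OF inj, of z y] z y(1) R(1) by blast
	ultimately have "Suc (k z) < k y" using R(3) y z unfolding gapped_def by (metis DiffD1 imageI le_neq_implies_less)
	thus ?thesis using x(2)[of y] y(1) R(1) by (meson less_le_trans subsetD)
qed
hence "R - {y} <: {y:A. Suc (k y) < k x}" using R(1) by blast
moreover have "card (R - {y}) = r" using R(2) y finR by simp
moreover have "gapped (k ` (R - {y}))" by (rule gapped_subset[OF R(3)]) blast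
ultimately show "\<exists>R\<subseteq>{y:A. Suc (k y) < k x}. card R = r & gapped (k ` R)" by blast
next
assume "\<exists>R\<subseteq>{y:A. Suc (k y) < k x}. card R = r & gapped (k ` R)"
then obtain R where R: "R <: {y:A. Suc (k y) < k x}" "card R = r" "gapped (k ` R)" by blast
have "finite R" using R(1) fin finite_subset[of R A] by auto
moreover have "x ~: R" using R(1) by auto
ultimately have "card (insert x R) = Suc r" using R(2) by simp
moreover have "insert x R <: A" using R(1) x(1) by auto
moreover have "gapped (k ` insert x R)"
	unfolding gapped_def
proof (intro ballI impI)
	fix i j assume ij: "i : k ` insert x R" "j : k ` insert x R" "i < j"
	have lt: "Suc (k y) < k x" if "y : R" for y using R(1) that by auto
	from ij(3) have "i ~= k x"
	proof -
		have "j <= k x" using ij(2) lt by (auto intro: less_imp_le Suc_lessD)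
		thus ?thesis using ij(3) by simp
	qed
	then obtain y where y: "y : R" "i = k y" using ij(1) by auto
	show "Suc i < j"
	proof (cases "j = k x")
		case True thus ?thesis using lt[OF y(1)] y by simp
	next
		case False
		hence "j : k ` R" using ij(2) by auto
		thus ?thesis using R(3) y ij(3) unfolding gapped_def by blast
	qed
qed
ultimately show "\<exists>R\<subseteq>A. card R = Suc r & gapped (k ` R)" by blast
qed

lemma gap_complex_subset: "X <: V ==> gap_complex k X U r <: Pow V"
by (auto simp: gap_complex_def)

lemma gap_complex_vertex:
assumes "finite V" "X <: V" "x : X"
shows "complex_vertex V (gap_complex k X U r) x"
proof
show "gap_complex k X U r <: Pow V" by (rule gap_complex_subset[OF assms(2)])
show "down_closed (gap_complex k X U r)" by (rule down_closed_gap_complex)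
qed (use assms in auto)

lemma link_gap_complex:
assumes "x : X" "x ~: U"
shows "link (gap_complex k X U r) {x} = gap_complex k (X - {x}) U r"
proof -
have e: "X - insert x G = X - {x} - G" for G by blast
show ?thesis
unfolding set_eq_iff
proof
	fix G show "G : link (gap_complex k X U r) {x} <-> G : gap_complex k (X - {x}) U r"
		unfolding link_singleton gap_complex_def mem_Collect_eq e[of G] using assms(1) by blast
qed
qed

lemma del_gap_complex:
assumes "x : X"
shows "del (gap_complex k X U r) x = gap_complex k (X - {x}) (insert x U) r"
proof -
have e: "X - G Un U = X - {x} - G Un insert x U" if "x ~: G" for G using assms that by blast
show ?thesis
unfolding set_eq_iff
proof
	fix G show "G : del (gap_complex k X U r) x <-> G : gap_complex k (X - {x}) (insert x U) r"
	proof (cases "x : G")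
		case True
		thus ?thesis by (auto simp: del_def gap_complex_def)
	next
		case False
		hence "G <: X <-> G <: X - {x}" by blast
		with False show ?thesis unfolding del_def gap_complex_def mem_Collect_eq e[OF False] by simp
	qed
qed
qed

lemma hvan_gap_complex_cone:
assumes V: "finite V" "X <: V" and y: "y : X"
	and indep: "!!G. G <: X ==> (\<exists>R\<subseteq>(X - G) Un U. card R = r & gapped (k ` R)) ==>
		(\<exists>R\<subseteq>(X - insert y G) Un U. card R = r & gapped (k ` R))"
shows "hvan TYPE('k::field) V (gap_complex k X U r) p"
proof (rule hvanI_contracting[OF V(1) gap_complex_subset[OF V(2)] _ down_closed_gap_complex])
show "y : V" using y V by blast
fix T assume "T : gap_complex k X U r"
thus "insert y T : gap_complex k X U r" using indep[of T] y by (simp add: gap_complex_def)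
qed

lemma hvan_complex_vertexI:
assumes "complex_vertex V L u"
	and "hvan TYPE('k::field) V (del L u) p" "!!p'. p = Suc p' ==> hvan TYPE('k) V (link L {u}) p'"
shows "hvan TYPE('k) V L p"
proof -
interpret complex_vertex V L u by fact
show ?thesis
proof (cases p)
	case 0
	thus ?thesis using hvan_0_from_del[of V L u] assms(2) fin by blast
next
	case (Suc p')
	thus ?thesis using hvan_from_del_link[of p'] assms(2,3) by blast
qed
qed

text \<open>Induction on the last vertex \<open>x\<close>. The link loses one vertex while
  \<open>p\<close> drops by one, which keeps the inequality. In the deletion \<open>x\<close> is a
  free point and may be taken as the last element of the gapped set.\<close>

lemma hvan_gap_complex_low:
assumes "finite V" "X <: V" "inj_on k X" "p + r < card X"
shows "hvan TYPE('k::field) V (gap_complex k X {} r) p"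
using assms(2-)
proof (induction "card X" arbitrary: X r p)
case 0
thus ?case by simp
next
case (Suc N)
have finX: "finite X" using Suc.prems assms(1) finite_subset by blast
have X0: "X ~= {}" using Suc.hyps(2) by auto
have "Max (k ` X) : k ` X" using finX X0 by (intro Max_in) auto
then obtain x where x: "x : X" "k x = Max (k ` X)" by (metis imageE)
have xmax: "k y <= k x" if "y : X" for y using x(2) finX that by simp
note IH = Suc.hyps(1)[of "X - {x}"]
have cX: "N = card (X - {x})" "X - {x} <: V" "inj_on k (X - {x})"
	using Suc.hyps(2) x finX Suc.prems by (auto intro: inj_on_subset)
show ?case
proof (cases r)
	case 0
	show ?thesis
		by (rule hvan_gap_complex_cone[OF assms(1) Suc.prems(1) x(1)])
			(auto simp: 0 gapped_def intro!: exI[of _ "{}"])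
next
	case (Suc r')
	have iff: "(\<exists>R\<subseteq>(X - {x} - G) Un insert x {}. card R = r & gapped (k ` R)) <->
		(\<exists>R\<subseteq>{y:X - {x} - G. Suc (k y) < k x}. card R = r' & gapped (k ` R))" if "G <: X - {x}" for G
	proof -
		let ?A = "X - {x} - G Un insert x {}"
		have "(\<exists>R\<subseteq>?A. card R = Suc r' & gapped (k ` R)) <-> (\<exists>R\<subseteq>{y:?A. Suc (k y) < k x}. card R = r' & gapped (k ` R))"
		proof (rule gapped_with_last)
			have sub: "?A <: X" using x(1) by blast
			show "finite ?A" using finX sub by (rule rev_finite_subset)
			show "inj_on k ?A" using Suc.prems(2) sub by (rule inj_on_subset)
			show "k y <= k x" if "y : ?A" for y by (rule xmax) (use that sub in blast)
		qed simp
		moreover have "{y:?A. Suc (k y) < k x} = {y:X - {x} - G. Suc (k y) < k x}" by auto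
		ultimately show ?thesis by (simp add: Suc)
	qed
	have d: "hvan TYPE('k) V (del (gap_complex k X {} r) x) p"
	\<comment> \<open>Once \<open>x\<close> is chosen, a vertex directly before it is useless to the
	  gapped set and becomes the apex of a cone. If there is none, the deletion is the same kind of
	  complex with \<open>r\<close> lowered by one.\<close>
	proof (cases "EX y:X. Suc (k y) = k x")
		case True
		then obtain y where y: "y : X" "Suc (k y) = k x" by blast
		have yx: "y : X - {x}" using y by auto
		show ?thesis
			unfolding del_gap_complex[OF x(1)]
		proof (rule hvan_gap_complex_cone[OF assms(1) cX(2) yx])
			fix G assume G: "G <: X - {x}" and R: "\<exists>R\<subseteq>X - {x} - G Un insert x {}. card R = r & gapped (k ` R)"
			have "{z:X - {x} - G. Suc (k z) < k x} = {z:X - {x} - insert y G. Suc (k z) < k x}" using y by auto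
			thus "\<exists>R\<subseteq>X - {x} - insert y G Un insert x {}. card R = r & gapped (k ` R)"
				using R iff[OF G] iff[of "insert y G"] G yx by simp
		qed
	next
		case False
		have e2: "{y:X - {x} - G. Suc (k y) < k x} = X - {x} - G" for G
		proof -
			have "Suc (k y) < k x" if "y : X - {x}" for y
			proof -
				have "k y ~= k x" using that x(1) Suc.prems(2) by (auto dest: inj_onD)
				thus ?thesis using xmax[of y] False that by (metis DiffD1 Suc_lessI le_neq_implies_less)
			qed
			thus ?thesis by blast
		qed
		have "del (gap_complex k X {} r) x = gap_complex k (X - {x}) {} r'"
			unfolding del_gap_complex[OF x(1)] unfolding gap_complex_def
			by (intro Collect_cong conj_cong refl) (simp only: iff e2 Un_empty_right)
		moreover have "hvan TYPE('k) V (gap_complex k (X - {x}) {} r') p"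
			using IH[OF cX] Suc.prems(3) cX(1) Suc.hyps(2) Suc by simp
		ultimately show ?thesis by simp
	qed
	show ?thesis
	proof (rule hvan_complex_vertexI[OF gap_complex_vertex[OF assms(1) Suc.prems(1) x(1)] d])
		fix p' assume "p = Suc p'"
		thus "hvan TYPE('k) V (link (gap_complex k X {} r) {x}) p'"
			using IH[OF cX, of p' r] Suc.prems(3) cX(1) Suc.hyps(2) by (simp add: link_gap_complex[OF x(1)])
	qed
qed
qed

text \<open>Here the positions fill an interval without holes. Three moves occur: a cone, a link
  that lowers \<open>N\<close> and \<open>p\<close> by one, and the removal of two free end
  positions that lowers \<open>N\<close> by two and \<open>r\<close> by one. The last two preserve
  \<open>N + 2 <= p + 2 * r\<close>.\<close>

lemma hvan_gap_complex_high:
assumes "finite V" "X <: V" "X Int U = {}" "bij_betw k (X Un U) {..<N}" "N + 2 <= p + 2 * r"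
shows "hvan TYPE('k::field) V (gap_complex k X U r) p"
using assms(2-)
proof (induction N arbitrary: X U r p rule: less_induct)
case (less N)
have finX: "finite X" using less.prems(1) assms(1) finite_subset by blast
have inj: "inj_on k (X Un U)" and im: "k ` (X Un U) = {..<N}" using less.prems(3) by (auto simp: bij_betw_def)
have finXU: "finite (X Un U)" using less.prems(3) bij_betw_finite by blast
have cXU: "card (X Un U) = N" using bij_betw_same_card[OF less.prems(3)] by simp
have cX: "card X <= N" using card_mono[OF finXU, of X] cXU by simp
have restrict: "bij_betw k (X Un U - k -` {M..}) {..<M}" if "M <= N" for M
	unfolding bij_betw_def
proof
	show "inj_on k (X Un U - k -` {M..})" using inj by (rule inj_on_subset) blast
	show "k ` (X Un U - k -` {M..}) = {..<M}"
	proof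
		show "{..<M} <: k ` (X Un U - k -` {M..})"
		proof
			fix i assume i: "i : {..<M}"
			hence "i : k ` (X Un U)" using im that by auto
			thus "i : k ` (X Un U - k -` {M..})" using i by auto
		qed
	qed auto
qed
show ?case
proof (cases "r = 0")
	case True
	show ?thesis
	proof (rule hvan_no_faces)
		fix T assume "T : gap_complex k X U r"
		hence "card T <= N" using card_mono[OF finX, of T] cX by (auto simp: gap_complex_def)
		thus "card T ~= p" using less.prems(4) True by simp
	qed
next
	case r0: False
	then obtain r' where r: "r = Suc r'" by (cases r) auto
	show ?thesis
	proof (cases "N = 0")
		case True
		hence "X Un U = {}" using cXU finXU by simp
		hence "gap_complex k X U r = {}" using r by (auto simp: gap_complex_def)
		thus ?thesis by (intro hvan_no_faces) simp
	next
		case False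
		\<comment> \<open>Stated for a general pair with the same union, because it serves both the given
		  pair, when the last point is free, and the pair obtained by deleting the last vertex.\<close>
		have topU: "hvan TYPE('k) V (gap_complex k X' U' r) p"
			if X': "X' <: V" "X' Int U' = {}" "X' Un U' = X Un U" and x: "x : U'" "k x = N - 1" for X' U' x
		proof -
			have finX': "finite X'" using X'(1) assms(1) finite_subset by blast
			have kle: "k y <= k x" if "y : X Un U" for y
			proof -
				have "k y < N" using im that by blast
				thus ?thesis using x(2) by simp
			qed
			have iff: "(\<exists>R\<subseteq>(X' - G) Un U'. card R = r & gapped (k ` R)) <->
				(\<exists>R\<subseteq>{y:(X' - G) Un U'. Suc (k y) < k x}. card R = r' & gapped (k ` R))" for G
				unfolding r
			proof (rule gapped_with_last)
				have sub: "X' - G Un U' <: X Un U" using X'(3) by blast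
				show "finite (X' - G Un U')" using finXU sub finite_subset by blast
				show "inj_on k (X' - G Un U')" using inj sub by (rule inj_on_subset)
				show "k y <= k x" if "y : X' - G Un U'" for y using kle sub that by blast
			qed (use x in simp)
			show ?thesis
			proof (cases "N = 1")
				case True
				have "X' Un U' = {x}"
				proof -
					have "card (X' Un U') = 1" using X'(3) cXU True by simp
					thus ?thesis using x(1) by (metis UnCI card_1_singletonE singletonD)
				qed
				hence "X' = {}" using x X' by auto
				show ?thesis
				proof (rule hvan_no_faces)
					fix T assume T: "T : gap_complex k X' U' r"
					hence "T = {}" using \<open>X' = {}\<close> by (auto simp: gap_complex_def)
					moreover have "r = 1"
					proof -
						obtain R where R: "R <: X' - T Un U'" "card R = r" using T by (auto simp: gap_complex_def)
						hence "R <: {x}" using \<open>X' \<union> U' = {x}\<close> by blast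
						hence "card R <= 1" using card_mono[of "{x}" R] by simp
						thus ?thesis using R r by simp
					qed
					ultimately show "card T ~= p" using less.prems(4) True by simp
				qed
			next
				case N1: False
				hence "N - 2 : k ` (X Un U)" using im False by auto
				then obtain y where y: "y : X' Un U'" "k y = N - 2" unfolding X'(3)[symmetric] by (metis imageE)
				have kyx: "Suc (k y) = k x" using y x N1 False by simp
				show ?thesis
				proof (cases "y : X'")
					case True
					show ?thesis
					proof (rule hvan_gap_complex_cone[OF assms(1) X'(1) True])
						fix G assume G: "G <: X'" and R: "\<exists>R\<subseteq>X' - G Un U'. card R = r & gapped (k ` R)"
						have "{z:X' - G Un U'. Suc (k z) < k x} = {z:X' - insert y G Un U'. Suc (k z) < k x}" using kyx by auto
						thus "\<exists>R\<subseteq>X' - insert y G Un U'. card R = r & gapped (k ` R)"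
							using R iff[of G] iff[of "insert y G"] by simp
					qed
				next
					case yU: False
					\<comment> \<open>The last two positions are both free. Choosing the last one uses both up, and
					  what remains has \<open>N - 2\<close> positions and needs \<open>r'\<close> points.\<close>
					let ?U = "{z:U'. Suc (k z) < k x}"
					have low: "Suc (k z) < k x" if "z : X'" for z
					proof -
						have zz: "z : X Un U" "x : X Un U" "y : X Un U" using that x y X'(3) by auto
						have "z ~= x" "z ~= y" using that x X'(2) yU by auto
						hence "k z ~= k x" "k z ~= k y" using inj zz by (auto dest: inj_onD)
						thus ?thesis using kle[OF zz(1)] kyx by linarith
					qed
					have "{y:(X' - G) Un U'. Suc (k y) < k x} = X' - G Un ?U" for G using low by auto
					hence e: "gap_complex k X' U' r = gap_complex k X' ?U r'"
						unfolding gap_complex_def iff by simp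
					have "X' Un ?U = X Un U - k -` {N - 2..}"
					proof -
						have "X' Un ?U = {z:X' Un U'. Suc (k z) < k x}" using low by auto
						also have "... = X Un U - k -` {N - 2..}" unfolding X'(3) using x N1 False by auto
						finally show ?thesis .
					qed
					hence b: "bij_betw k (X' Un ?U) {..<N - 2}" using restrict[of "N - 2"] by simp
					show ?thesis unfolding e
						by (rule less.IH[OF _ X'(1) _ b]) (use False N1 X'(2) less.prems(4) r in auto)
				qed
			qed
		qed
		have "N - 1 : k ` (X Un U)" using im False by auto
		then obtain x where x: "x : X Un U" "k x = N - 1" by (metis imageE)
		show ?thesis
		proof (cases "x : U")
			case True
			show ?thesis by (rule topU[OF less.prems(1,2) refl True x(2)])
		next
			case False
			hence xX: "x : X" using x by blast
			have d: "hvan TYPE('k) V (del (gap_complex k X U r) x) p"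
				unfolding del_gap_complex[OF xX]
				by (rule topU[of _ _ x]) (use less.prems(1,2) xX x in auto)
			show ?thesis
			proof (rule hvan_complex_vertexI[OF gap_complex_vertex[OF assms(1) less.prems(1) xX] d])
				fix p' assume p': "p = Suc p'"
				have "X - {x} Un U = X Un U - k -` {N - 1..}"
				proof -
					have "z = x" if "z : X Un U" "N - 1 <= k z" for z
					proof -
						have "k z < N" using im that by blast
						hence "k z = k x" using that x by simp
						thus ?thesis using inj_onD[OF inj, of z x] that(1) x(1) by blast
					qed
					thus ?thesis using x False by auto
				qed
				hence b: "bij_betw k (X - {x} Un U) {..<N - 1}" using restrict[of "N - 1"] by simp
				show "hvan TYPE('k) V (link (gap_complex k X U r) {x}) p'"
					unfolding link_gap_complex[OF xX False]
					by (rule less.IH[OF _ _ _ b]) (use \<open>N \<noteq> 0\<close> less.prems p' in auto)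
			qed
		qed
	qed
qed
qed

subsection \<open>The cyclic dual\<close>

locale cyclic_dual =
fixes n m :: nat and V :: "nat set" and pos :: "nat => nat"
assumes finV: "finite V" and pos: "bij_betw pos V {..<n}" and m: "1 <= m" and n: "2 * m + 2 <= n"
begin

definition stable :: "nat set => bool" where
"stable R <-> card R = Suc m & cyc_stable n (pos ` R)"

definition dual :: "nat set set" where
"dual = {F. F <: V & (\<exists>R\<subseteq>V - F. stable R)}"

text \<open>A facet is the complement of a stable set with \<open>Suc m\<close> elements. The value
  \<open>q\<close> is the size of a smallest nonface: more than \<open>2 * m\<close> vertices always
  contain a stable set, while \<open>2 * m\<close> consecutive ones do not.\<close>

abbreviation "d \<equiv> n - Suc m"
abbreviation "q \<equiv> n - 2 * m"

lemma cardV: "card V = n" using bij_betw_same_card[OF pos] by simp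

lemma down_dual: "down_closed dual"
unfolding down_closed_def dual_def by blast

lemma dual_sub: "dual <: Pow V" by (auto simp: dual_def)

lemma stable_gapped:
assumes "v : V" "R <: V - {v}"
shows "stable R <-> card R = Suc m & gapped (cut n pos v ` R)"
unfolding stable_def cyc_stable_cut[OF pos assms] ..

lemma stable_sub_face:
assumes "R <: V" "stable R" shows "V - R : dual" "card (V - R) = d"
proof -
show "V - R : dual" using assms by (auto simp: dual_def)
show "card (V - R) = d"
	using assms card_Diff_subset[of R V] finV finite_subset[of R V] cardV by (simp add: stable_def)
qed

lemma dual_extends:
assumes "F : dual" shows "EX G:dual. F <: G & card G = d"
proof -
obtain R where R: "F <: V" "R <: V - F" "stable R" using assms by (auto simp: dual_def)
hence "R <: V" "F <: V - R" by auto
thus ?thesis using stable_sub_face[OF \<open>R \<subseteq> V\<close> R(3)] by blast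
qed

lemma dual_dim: "F : dual ==> card F <= d"
using dual_extends[of F] finV dual_sub by (metis PowD card_mono finite_subset subsetD)

text \<open>The stable set must avoid \<open>F\<close>, hence \<open>v\<close>, so the circle may be
  opened at any vertex of \<open>F\<close>. For the empty face no such opening exists.\<close>

lemma link_dual:
assumes F: "F : dual" and v: "v : F"
shows "link dual F = gap_complex (cut n pos v) (V - F) {} (Suc m)"
proof -
have vV: "v : V" using assms by (auto simp: dual_def)
have FV: "F <: V" using F by (auto simp: dual_def)
show ?thesis
proof (intro equalityI subsetI)
	fix G assume "G : link dual F"
	then obtain R where R: "G Int F = {}" "G Un F <: V" "R <: V - (G Un F)" "stable R" by (auto simp: link_def dual_def)
	have "R <: V - {v}" using R(3) v by blast
	hence "card R = Suc m" "gapped (cut n pos v ` R)" using stable_gapped[OF vV] R(4) by blast+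
	moreover have "R <: V - F - G Un {}" using R(3) by blast
	ultimately show "G : gap_complex (cut n pos v) (V - F) {} (Suc m)" using R(1,2) unfolding gap_complex_def by blast
next
	fix G assume "G : gap_complex (cut n pos v) (V - F) {} (Suc m)"
	then obtain R where R: "G <: V - F" "R <: V - F - G" "card R = Suc m" "gapped (cut n pos v ` R)" unfolding gap_complex_def Un_empty_right by blast
	have "R <: V - {v}" using R(2) v by blast
	hence "stable R" using stable_gapped[OF vV] R by blast
	moreover have "G Int F = {}" "G Un F <: V" "R <: V - (G Un F)" using R(1,2) FV by blast+
	ultimately show "G : link dual F" unfolding link_def dual_def by blast
qed
qed

lemma hvan_link_dual:
assumes F: "F : dual" "F ~= {}" and p: "p < d - card F"
shows "hvan TYPE('k::field) V (link dual F) p"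
proof -
obtain v where v: "v : F" using F by blast
have FV: "F <: V" using F by (auto simp: dual_def)
have inj: "inj_on (cut n pos v) (V - F)"
	using cut_bij[OF pos, of v] v FV by (auto simp: bij_betw_def intro: inj_on_subset)
have "card (V - F) = n - card F" using FV finite_subset[OF FV finV] cardV by (simp add: card_Diff_subset)
thus ?thesis unfolding link_dual[OF F(1) v]
	by (intro hvan_gap_complex_low[OF finV _ inj]) (use p in auto)
qed

definition dual_on :: "nat set => nat set set" where
"dual_on X = {G. G <: X & (\<exists>R\<subseteq>V - G. stable R)}"

text \<open>Induction on the vertex set: the deletion is the previous complex, and in the link of
  \<open>x\<close> the circle is opened at \<open>x\<close>, leaving \<open>n - 1\<close> positions
  of which those outside \<open>X\<close> are free. From \<open>q <= p\<close> the inequality of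
  \<open>hvan_gap_complex_high\<close> follows with \<open>N = n - 1\<close>.\<close>

lemma hvan_dual_on:
assumes "X <: V" "q <= p"
shows "hvan TYPE('k::field) V (dual_on X) p"
proof -
have finX: "finite X" using assms finV finite_subset by blast
show ?thesis
	using finX assms
proof (induction X rule: finite_induct)
	case empty
	show ?case by (rule hvan_no_faces) (use empty n in "auto simp: dual_on_def")
next
	case (insert x X)
	let ?L = "dual_on (insert x X)"
	have xV: "x : V" using insert by auto
	have cv: "complex_vertex V ?L x"
	proof
		show "?L <: Pow V" using insert.prems by (auto simp: dual_on_def)
		show "down_closed ?L" unfolding down_closed_def dual_on_def by blast
	qed (use finV xV in auto)
	have "del ?L x = dual_on X" using insert.hyps by (auto simp: del_def dual_on_def)
	hence d: "hvan TYPE('k) V (del ?L x) p" using insert by simp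
	let ?k = "cut n pos x" and ?U = "V - insert x X"
	have lk: "link ?L {x} = gap_complex ?k X ?U (Suc m)"
	proof (intro equalityI subsetI)
		fix G assume "G : link ?L {x}"
		then obtain R where R: "x ~: G" "insert x G <: insert x X" "R <: V - insert x G" "stable R"
			by (auto simp: link_singleton dual_on_def)
		have "R <: V - {x}" using R(3) by blast
		hence "card R = Suc m" "gapped (?k ` R)" using stable_gapped[OF xV] R(4) by blast+
		moreover have "R <: X - G Un ?U" using R(3) by blast
		moreover have "G <: X" using R by blast
		ultimately show "G : gap_complex ?k X ?U (Suc m)" unfolding gap_complex_def by blast
	next
		fix G assume "G : gap_complex ?k X ?U (Suc m)"
		then obtain R where R: "G <: X" "R <: X - G Un ?U" "card R = Suc m" "gapped (?k ` R)" by (auto simp: gap_complex_def)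
		have R': "R <: V - insert x G" using R(1,2) insert.prems insert.hyps by blast
		hence "stable R" using stable_gapped[OF xV, of R] R by blast
		hence "insert x G : ?L" using R R' by (auto simp: dual_on_def)
		moreover have "x ~: G" using R(1) insert.hyps by blast
		ultimately show "G : link ?L {x}" by (simp add: link_singleton)
	qed
	have "X Un ?U = V - {x}" using insert by blast
	hence b: "bij_betw ?k (X Un ?U) {..<n - 1}" using cut_bij[OF pos xV] by simp
	show ?case
	proof (rule hvan_complex_vertexI[OF cv d])
		fix p' assume "p = Suc p'"
		thus "hvan TYPE('k) V (link ?L {x}) p'" unfolding lk
			by (intro hvan_gap_complex_high[OF finV _ _ b]) (use insert n in auto)
	qed
qed
qed

lemma dual_restrict: "W <: V ==> {F:dual. F <: W} = dual_on W"
by (auto simp: dual_def dual_on_def)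

text \<open>This is the neighbourliness of the cyclic polytope. A proper subset is opened at a
  missing vertex and treated on the line; for the whole vertex set the even positions are
  taken.\<close>

lemma stable_small:
assumes "S <: V" "2 * m < card S" shows "\<exists>R\<subseteq>S. stable R"
proof -
have "S ~= {}" using assms by auto
show ?thesis
proof (cases "S = V")
	case True
	define I where "I = (%i. 2 * i) ` {..m}"
	have inj: "inj_on pos V" and im: "pos ` V = {..<n}" using pos by (auto simp: bij_betw_def)
	have In: "I <: pos ` V" unfolding im using n by (auto simp: I_def)
	define R where "R = {u:V. pos u : I}"
	have pR: "pos ` R = I" using In by (auto simp: R_def)
	have "card R = card I" unfolding pR[symmetric]
		by (rule card_image[symmetric]) (use inj in "auto simp: R_def inj_on_def")
	also have "... = Suc m" unfolding I_def by (subst card_image) (auto simp: inj_on_def)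
	finally have "card R = Suc m" .
	moreover have "cyc_stable n (pos ` R)" unfolding pR cyc_stable_def using n by (auto simp: I_def)
	ultimately show ?thesis using True by (intro exI[of _ R]) (auto simp: stable_def R_def)
next
	case False
	then obtain v where v: "v : V" "v ~: S" using assms by blast
	let ?k = "cut n pos v"
	have bij: "bij_betw ?k (V - {v}) {..<n - 1}" by (rule cut_bij[OF pos v(1)])
	have SV: "S <: V - {v}" using assms v by blast
	hence injS: "inj_on ?k S" using bij by (auto simp: bij_betw_def intro: inj_on_subset)
	\<comment> \<open>Greedy choice on the line: taking the minimum and discarding its successor costs
	  at most two points per chosen one, and the last choice costs only one.\<close>
	have gap: "\<exists>J\<subseteq>I. card J = r & gapped J" if "finite I" "2 * r <= Suc (card I)" for I r
		using that
	proof (induction r arbitrary: I)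
		case 0
		show ?case by (intro exI[of _ "{}"]) (auto simp: gapped_def)
	next
		case (Suc r)
		have "I ~= {}" using Suc.prems by auto
		define a where "a = Min I"
		have a: "a : I" "!!b. b : I ==> a <= b" using Suc.prems \<open>I \<noteq> {}\<close> by (auto simp: a_def)
		have "card I - 2 <= card (I - {a, Suc a})"
			using diff_card_le_card_Diff[of "{a, Suc a}" I] by simp
		hence "2 * r <= Suc (card (I - {a, Suc a}))" using Suc.prems(2) by arith
		moreover have "finite (I - {a, Suc a})" using Suc.prems(1) by simp
		ultimately have "\<exists>J\<subseteq>I - {a, Suc a}. card J = r & gapped J" by (intro Suc.IH)
		then obtain J where J: "J <: I - {a, Suc a}" "card J = r" "gapped J" by blast
		have lt: "Suc a < b" if "b : J" for b using a(2)[of b] J(1) that by force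
		have "gapped (insert a J)"
			unfolding gapped_def
		proof (intro ballI impI)
			fix i j assume ij: "i : insert a J" "j : insert a J" "i < j"
			show "Suc i < j"
			proof (cases "i = a")
				case True thus ?thesis using ij lt[of j] by auto
			next
				case False
				hence "i : J" "j : J" using ij lt[of i] by auto
				thus ?thesis using J(3) ij by (auto simp: gapped_def)
			qed
		qed
		moreover have "card (insert a J) = Suc r"
			using J Suc.prems(1) finite_subset[of J I] by (subst card_insert_disjoint) auto
		ultimately show ?case using J(1) a(1) by (intro exI[of _ "insert a J"]) auto
	qed
	have finS: "finite S" using assms(1) finV finite_subset by blast
	have "card (?k ` S) = card S" using card_image[OF injS] .
	then obtain J where J: "J <: ?k ` S" "card J = Suc m" "gapped J"
		using gap[of "?k ` S" "Suc m"] finS assms(2) by auto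
	define R where "R = {u:S. ?k u : J}"
	have kR: "?k ` R = J" using J by (auto simp: R_def)
	have "card R = Suc m" using card_image[OF inj_on_subset[OF injS, of R]] J(2) kR by (auto simp: R_def)
	hence "stable R" using stable_gapped[OF v(1), of R] SV J(3) kR by (auto simp: R_def)
	thus ?thesis by (intro exI[of _ R]) (auto simp: R_def)
qed
qed

lemma dual_skeleton:
assumes "F <: V" "card F < q" shows "F : dual"
proof -
have "card (V - F) = n - card F" using assms finite_subset[OF assms(1) finV] cardV by (simp add: card_Diff_subset)
hence "2 * m < card (V - F)" using assms by simp
thus ?thesis using stable_small[of "V - F"] assms by (auto simp: dual_def)
qed

text \<open>The first \<open>2 * m\<close> positions fall into \<open>m\<close> pairs of neighbours,
  and a stable set meets each pair at most once.\<close>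

lemma small_set_not_stable:
assumes "pos ` S = {..<2 * m}" "S <: V" "R <: S" shows "~ stable R"
proof
assume st: "stable R"
have inj: "inj_on pos V" using pos by (auto simp: bij_betw_def)
have "inj_on (%u. pos u div 2) R"
proof (rule inj_onI, rule ccontr)
	fix u w assume uw: "u : R" "w : R" "pos u div 2 = pos w div 2" "u ~= w"
	hence "pos u ~= pos w" using inj_onD[OF inj, of u w] assms by blast
	then consider "pos u < pos w" | "pos w < pos u" by linarith
	thus False
	proof cases
		case 1
		hence "pos u + 2 <= pos w" using st uw unfolding stable_def cyc_stable_def by blast
		thus False using uw(3) by linarith
	next
		case 2
		hence "pos w + 2 <= pos u" using st uw unfolding stable_def cyc_stable_def by blast
		thus False using uw(3) by linarith
	qed
qed
moreover have "(%u. pos u div 2) ` R <: {..<m}"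
proof
	fix k assume "k : (%u. pos u div 2) ` R"
	then obtain u where "u : R" "k = pos u div 2" by blast
	hence "pos u < 2 * m" using assms by blast
	thus "k : {..<m}" using \<open>k = pos u div 2\<close> by auto
qed
ultimately have "card R <= m" using card_inj_on_le[of "%u. pos u div 2" R "{..<m}"] by simp
thus False using st by (simp add: stable_def)
qed

lemma dual_nonface: "\<exists>F\<subseteq>V. F ~: dual & card F = q"
proof -
have inj: "inj_on pos V" and im: "pos ` V = {..<n}" using pos by (auto simp: bij_betw_def)
define S where "S = {u:V. pos u < 2 * m}"
have pS: "pos ` S = {..<2 * m}"
proof
	show "{..<2 * m} <: pos ` S"
	proof
		fix i assume i: "i : {..<2 * m}"
		hence "i : pos ` V" using im n by auto
		thus "i : pos ` S" using i by (auto simp: S_def)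
	qed
qed (auto simp: S_def)
have SV: "S <: V" by (auto simp: S_def)
have "card S = 2 * m" using card_image[OF inj_on_subset[OF inj SV]] pS by simp
hence "card (V - S) = q" using SV finite_subset[OF SV finV] cardV by (simp add: card_Diff_subset)
moreover have "V - S ~: dual"
proof
	assume "V - S : dual"
	then obtain R where "R <: V - (V - S)" "stable R" by (auto simp: dual_def)
	moreover from this have "R <: S" by blast
	ultimately show False using small_set_not_stable[OF pS SV] by blast
qed
ultimately show ?thesis by blast
qed

lemma linear_buchsbaum_dual: "linear_buchsbaum TYPE('k::field) V dual d q"
proof
show "V ~= {}" using cardV n by auto
show "2 <= q" "q <= d" using n m by auto
show "hvan TYPE('k) V {F:dual. F <: W} p" if "W <: V" "q <= p" for W p
	using hvan_dual_on[OF that, where 'k='k] dual_restrict[OF that(1)] by simp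
show "G : dual" if "G <: V" "card G <= q - 1" for G
	by (rule dual_skeleton) (use that n in auto)
show "hvan TYPE('k) V (link dual F) p" if "F : dual" "F ~= {}" "p < d - card F" for F p
	by (rule hvan_link_dual[OF that])
qed (use finV dual_sub down_dual dual_dim in auto)

end

subsection \<open>Counting cyclically stable sets\<close>

definition gapped_sets :: "nat => nat => nat set set" where
"gapped_sets N r = {I. I <: {..<N} & card I = r & gapped I}"

lemma finite_gapped_sets: "finite (gapped_sets N r)"
by (rule finite_subset[of _ "Pow {..<N}"]) (auto simp: gapped_sets_def)

text \<open>Pascal's rule: without the last position \<open>N - 1\<close> the interval shrinks by
  one; with it, its neighbour is excluded as well and one fewer element is needed.\<close>

lemma card_gapped_sets: "card (gapped_sets N r) = (N + 1 - r) choose r"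
proof (induction N arbitrary: r rule: less_induct)
case (less N)
show ?case
proof (cases r)
	case 0
	have "gapped_sets N 0 = {{}}" using finite_subset[of _ "{..<N}"] by (auto simp: gapped_sets_def gapped_def)
	thus ?thesis using 0 by simp
next
	case (Suc r')
	show ?thesis
	proof (cases N)
		case 0
		hence "gapped_sets N r = {}" using Suc by (auto simp: gapped_sets_def)
		thus ?thesis using 0 Suc by simp
	next
		case (Suc N')
		note r = \<open>r = Suc r'\<close>
		have e: "gapped_sets N r = gapped_sets N' r Un insert N' ` gapped_sets (N' - 1) r'"
		proof (intro equalityI subsetI)
			fix I assume I: "I : gapped_sets N r"
			show "I : gapped_sets N' r Un insert N' ` gapped_sets (N' - 1) r'"
			proof (cases "N' : I")
				case False
				hence "I <: {..<N'}" using I Suc by (auto simp: gapped_sets_def less_Suc_eq)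
				thus ?thesis using I by (simp add: gapped_sets_def)
			next
				case True
				let ?J = "I - {N'}"
				have finI: "finite I" using I finite_subset by (auto simp: gapped_sets_def)
				have "Suc j < N'" if "j : ?J" for j
				proof -
					have "j < N'" using that I Suc by (auto simp: gapped_sets_def)
					thus ?thesis using that True I unfolding gapped_sets_def gapped_def by blast
				qed
				hence "?J <: {..<N' - 1}" by (intro subsetI) (simp add: less_diff_conv)
				moreover have "card ?J = r'" using I True finI r by (simp add: gapped_sets_def)
				moreover have "gapped ?J" using I by (auto simp: gapped_sets_def gapped_def)
				ultimately have "?J : gapped_sets (N' - 1) r'" by (simp add: gapped_sets_def)
				moreover have "I = insert N' ?J" using True by blast
				ultimately show ?thesis by blast
			qed
		next
			fix I assume "I : gapped_sets N' r Un insert N' ` gapped_sets (N' - 1) r'"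
			thus "I : gapped_sets N r"
			proof
				assume "I : gapped_sets N' r"
				thus ?thesis using Suc by (auto simp: gapped_sets_def)
			next
				assume "I : insert N' ` gapped_sets (N' - 1) r'"
				then obtain J where J: "J <: {..<N' - 1}" "card J = r'" "gapped J" "I = insert N' J" by (auto simp: gapped_sets_def)
				have lt: "Suc j < N'" if "j : J" for j using that J(1) by auto
				have "N' ~: J" "finite J" using lt J(1) finite_subset by auto
				hence "card I = r" using J r by simp
				moreover have "I <: {..<N}" using J(4) lt Suc by fastforce
				moreover have "gapped I" using J(3) lt unfolding J(4) gapped_def by fastforce
				ultimately show ?thesis by (simp add: gapped_sets_def)
			qed
		qed
		have disj: "gapped_sets N' r Int insert N' ` gapped_sets (N' - 1) r' = {}" by (auto simp: gapped_sets_def)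
		have inj: "inj_on (insert N') (gapped_sets (N' - 1) r')"
		proof (rule inj_onI)
			fix A B assume "A : gapped_sets (N' - 1) r'" "B : gapped_sets (N' - 1) r'" "insert N' A = insert N' B"
			moreover from this have "N' ~: A" "N' ~: B" by (auto simp: gapped_sets_def)
			ultimately show "A = B" using insert_ident[of N' A B] by simp
		qed
		have "card (gapped_sets N r) = card (gapped_sets N' r) + card (gapped_sets (N' - 1) r')"
			unfolding e using disj finite_gapped_sets card_image[OF inj] by (simp add: card_Un_disjoint)
		also have "... = ((N' + 1 - r) choose r) + ((N' - 1 + 1 - r') choose r')"
			using less.IH[of N' r] less.IH[of "N' - 1" r'] Suc by simp
		also have "... = (N + 1 - r) choose r"
		proof (cases "N' = 0")
			case True
			thus ?thesis using Suc r by (cases r') auto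
		next
			case False
			show ?thesis
			proof (cases "r' <= N'")
				case True
				hence "N + 1 - r = Suc (N' - r')" using Suc r by simp
				thus ?thesis using False True r by simp
			next
				case f: False
				thus ?thesis using Suc r False by simp
			qed
		qed
		finally show ?thesis .
	qed
qed
qed

text \<open>Sets avoiding the last position are merely gapped on the rest. Those containing it avoid
  both its cyclic neighbours \<open>0\<close> and \<open>k + 1\<close>, so the remainder is a
  shifted gapped subset of an interval of length \<open>k\<close>. Writing \<open>n = k + 3\<close>
  avoids truncated subtraction.\<close>

lemma card_cyc_stable_sets:
"card {I. I <: {..<k + 3} & card I = Suc r & cyc_stable (k + 3) I} =
	((k + 2 - r) choose Suc r) + ((k + 1 - r) choose r)"
proof -
let ?n = "k + 3"
let ?f = "%J. insert (k + 2) (Suc ` J)"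
have e: "{I. I <: {..<?n} & card I = Suc r & cyc_stable ?n I} = gapped_sets (k + 2) (Suc r) Un ?f ` gapped_sets k r"
proof (intro equalityI subsetI)
	fix I assume "I : {I. I <: {..<?n} & card I = Suc r & cyc_stable ?n I}"
	hence I: "I <: {..<?n}" "card I = Suc r" and st: "!!i j. i : I ==> j : I ==> i < j ==> i + 2 <= j & j + 2 <= i + ?n"
		unfolding cyc_stable_def by blast+
	have finI: "finite I" using I(1) finite_subset by blast
	show "I : gapped_sets (k + 2) (Suc r) Un ?f ` gapped_sets k r"
	proof (cases "k + 2 : I")
		case False
		have "I <: {..<k + 2}"
		proof
			fix i assume "i : I"
			hence "i < ?n" "i ~= k + 2" using I(1) False by auto
			thus "i : {..<k + 2}" by simp
		qed
		moreover have "gapped I" unfolding gapped_def using st by fastforce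
		ultimately show ?thesis using I(2) by (simp add: gapped_sets_def)
	next
		case True
		let ?I = "I - {k + 2}"
		have b: "1 <= i & i <= k" if "i : ?I" for i
		proof -
			have "i < k + 2" using that I(1) by auto
			thus ?thesis using st[of i "k + 2"] True that by auto
		qed
		define J where "J = (%i. i - 1) ` ?I"
		have SJ: "Suc ` J = ?I" using b by (force simp: J_def image_image)
		have "card J = r" using card_image[of Suc J] SJ I(2) True finI by simp
		moreover have "J <: {..<k}" using b by (fastforce simp: J_def)
		moreover have "gapped J" unfolding gapped_def
		proof (intro ballI impI)
			fix i j assume "i : J" "j : J" "i < j"
			hence "Suc i : I" "Suc j : I" "Suc i < Suc j" using SJ by blast+
			thus "Suc i < j" using st[of "Suc i" "Suc j"] by simp
		qed
		ultimately have "J : gapped_sets k r" by (simp add: gapped_sets_def)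
		moreover have "I = ?f J" using SJ True by blast
		ultimately show ?thesis by blast
	qed
next
	fix I assume "I : gapped_sets (k + 2) (Suc r) Un ?f ` gapped_sets k r"
	thus "I : {I. I <: {..<?n} & card I = Suc r & cyc_stable ?n I}"
	proof
		assume "I : gapped_sets (k + 2) (Suc r)"
		thus ?thesis by (fastforce simp: gapped_sets_def gapped_def cyc_stable_def)
	next
		assume "I : ?f ` gapped_sets k r"
		then obtain J where J: "J <: {..<k}" "card J = r" "gapped J" "I = ?f J" by (auto simp: gapped_sets_def)
		have "finite J" using J(1) finite_subset by blast
		moreover have "k + 2 ~: Suc ` J" using J(1) by auto
		ultimately have "card I = Suc r" using J by (simp add: card_image)
		moreover have "I <: {..<?n}" using J(1) by (auto simp: J(4))
		moreover have "cyc_stable ?n I"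
			unfolding cyc_stable_def
		proof (intro ballI impI)
			fix i j assume ij: "i : I" "j : I" "i < j"
			have le: "a <= k + 2" if "a : I" for a using that J(1) by (auto simp: J(4))
			have "i ~= k + 2" using le[OF ij(2)] ij(3) by simp
			then obtain a where a: "a : J" "i = Suc a" "a < k" using ij(1) J(1) by (auto simp: J(4))
			show "i + 2 <= j & j + 2 <= i + ?n"
			proof (cases "j = k + 2")
				case True thus ?thesis using a by simp
			next
				case False
				then obtain b where b: "b : J" "j = Suc b" "b < k" using ij(2) J(1) by (auto simp: J(4))
				hence "Suc a < b" using J(3) a ij(3) unfolding gapped_def by simp
				thus ?thesis using a b by simp
			qed
		qed
		ultimately show ?thesis by simp
	qed
qed
have disj: "gapped_sets (k + 2) (Suc r) Int ?f ` gapped_sets k r = {}" by (auto simp: gapped_sets_def)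
have inj: "inj_on ?f (gapped_sets k r)"
proof (rule inj_onI)
	fix A B assume AB: "A : gapped_sets k r" "B : gapped_sets k r" "?f A = ?f B"
	have "k + 2 ~: Suc ` A" "k + 2 ~: Suc ` B" using AB by (auto simp: gapped_sets_def)
	hence "Suc ` A = Suc ` B" using AB(3) insert_ident[of "k + 2" "Suc ` A" "Suc ` B"] by simp
	thus "A = B" by (simp add: inj_image_eq_iff)
qed
have "card {I. I <: {..<?n} & card I = Suc r & cyc_stable ?n I} =
	card (gapped_sets (k + 2) (Suc r)) + card (gapped_sets k r)"
	unfolding e using disj finite_gapped_sets card_image[OF inj] by (simp add: card_Un_disjoint)
thus ?thesis by (simp add: card_gapped_sets)
qed

context cyclic_dual
begin

lemma card_facets_dual: "card {F:dual. card F = d} = (d choose Suc m) + ((d - 1) choose m)"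
proof -
have inj: "inj_on pos V" and im: "pos ` V = {..<n}" using pos by (auto simp: bij_betw_def)
have e: "{F:dual. card F = d} = (%R. V - R) ` {R. R <: V & stable R}"
proof (intro equalityI subsetI)
	fix F assume "F : {F:dual. card F = d}"
	then obtain R where F: "F <: V" "card F = d" and R: "R <: V - F" "stable R" by (auto simp: dual_def)
	have "card (V - F) = Suc m" using F finite_subset[OF F(1) finV] cardV n by (simp add: card_Diff_subset)
	hence "R = V - F" using R finV by (intro card_subset_eq) (auto simp: stable_def)
	hence "F = V - R" using F by blast
	thus "F : (%R. V - R) ` {R. R <: V & stable R}" using R by blast
next
	fix F assume "F : (%R. V - R) ` {R. R <: V & stable R}"
	thus "F : {F:dual. card F = d}" using stable_sub_face by auto
qed
have i1: "inj_on (%R. V - R) {R. R <: V & stable R}" by (auto simp: inj_on_def)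
have "bij_betw (%R. pos ` R) {R. R <: V & stable R} {I. I <: {..<n} & card I = Suc m & cyc_stable n I}"
proof (rule bij_betwI')
	show "(pos ` R = pos ` S) = (R = S)" if "R : {R. R <: V & stable R}" "S : {R. R <: V & stable R}" for R S
		using that inj_on_image_eq_iff[OF inj] by auto
	show "pos ` R : {I. I <: {..<n} & card I = Suc m & cyc_stable n I}" if "R : {R. R <: V & stable R}" for R
		using that im card_image[OF inj_on_subset[OF inj, of R]] by (auto simp: stable_def)
	fix I assume I: "I : {I. I <: {..<n} & card I = Suc m & cyc_stable n I}"
	define R where "R = {u:V. pos u : I}"
	have RV: "R <: V" by (auto simp: R_def)
	have pR: "pos ` R = I" using I im by (auto simp: R_def)
	have "card R = Suc m" using card_image[OF inj_on_subset[OF inj RV]] pR I by simp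
	thus "EX R:{R. R <: V & stable R}. I = pos ` R" using RV pR I by (intro bexI[of _ R]) (auto simp: stable_def)
qed
hence "card {F:dual. card F = d} = card {I. I <: {..<n} & card I = Suc m & cyc_stable n I}"
	unfolding e card_image[OF i1] by (rule bij_betw_same_card)
moreover have "3 <= n" using n m by linarith
then obtain k where k: "n = k + 3" by (metis le_add_diff_inverse2)
ultimately show ?thesis using card_cyc_stable_sets[of k m] by simp
qed

text \<open>The explicit facet number is inserted into \<open>facet_count\<close>. Two steps of
  Pascal's rule and symmetry reduce the equation to \<open>h\<close> times a binomial coefficient
  equal to that coefficient, which is nonzero because \<open>q <= d\<close>.\<close>

lemma dual_homology_dim:
assumes "has_quot_dim fscale (cocycles dual (q - 1) :: (nat set => 'k::field) set) (cobs dual (q - 1)) h"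
shows "h = 1"
proof -
interpret linear_buchsbaum "TYPE('k)" V dual d q by (rule linear_buchsbaum_dual)
have "card V = Suc m + d" using cardV n by simp
from facet_count[OF assms this]
have f: "h * ((d - 1) choose (q - 1)) + ((d choose Suc m) + ((d - 1) choose m)) = (Suc m + q - 1) choose (q - 1)"
	unfolding card_facets_dual .
have e: "Suc m + q - 1 = Suc d" "d = Suc (d - 1)" "q - 1 = Suc (q - 2)" using n m by auto
have "Suc d choose (q - 1) = (d choose (q - 2)) + (d choose (q - 1))" unfolding e(3) by simp
moreover have "d choose (q - 1) = ((d - 1) choose (q - 2)) + ((d - 1) choose (q - 1))"
	unfolding e(3) by (subst e(2)) simp
moreover have "d choose Suc m = d choose (q - 2)"
	using binomial_symmetric[of "Suc m" d] n m by (simp add: mult_2)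
moreover have "(d - 1) choose m = (d - 1) choose (q - 2)"
	using binomial_symmetric[of m "d - 1"] n m by (simp add: mult_2)
ultimately have "h * ((d - 1) choose (q - 1)) = (d - 1) choose (q - 1)" using f unfolding e(1) by simp
moreover have "(d - 1) choose (q - 1) ~= 0" using n m by simp
ultimately show ?thesis by simp
qed

end

section \<open>Buchsbaum complexes with linear resolution\<close>

context linear_buchsbaum
begin

text \<open>In degree \<open>q - 1\<close> the link of a nonempty face \<open>G\<close> is needed
  only in degree \<open>q - 1 - card G\<close>, which is below \<open>d - card G\<close>; so the
  Buchsbaum range suffices and only exponent 0 contributes.\<close>

lemma local_cohomology_dim_iff:
assumes V': "V = {1..n}"
	and h: "has_quot_dim fscale (cocycles Dl (q - 1) :: (nat set => 'k) set) (cobs Dl (q - 1)) h"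
shows "has_local_cohomology_dim n (sr_ideal n Dl :: 'k mpoly set) (q - 1) h' <-> h' = h"
proof (rule local_cohomology_dim[OF down _ _ h])
show "Dl <: Pow {1..n}" using V(3) V' by simp
fix G assume G: "G : Dl" "G ~= {}" "card G <= q - 1"
show "cvan TYPE('k) (link Dl G) (q - 1 - card G)"
	by (rule cvan_link[OF G(1,2)]) (use G(3) q in linarith)
qed

lemma empty_mem: "{} : Dl"
by (rule skeleton) simp_all

lemma cohomology_vanishing_degree:
"EX h. has_quot_dim fscale (cocycles Dl p :: (nat set => 'k) set) (cobs Dl p) h"
proof -
have finD: "finite Dl" by (rule finite_subset[OF V(3)]) (simp add: V(1))
have finF: "finite F" if "F : Dl" for F using that V(1,3) by (meson PowD finite_subset subsetD)
interpret fc: finite_complex Dl by unfold_locales (use finD down finF in auto)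
show ?thesis by (rule fc.cohomology_dim_exists)
qed

lemma stanley_reisner_ring:
assumes V': "V = {1..n}" and n: "n = c + d"
	and pure: "ALL F:Dl. EX G:Dl. F <: G & card G = d"
	and W0: "W0 <: V" "W0 ~: Dl" "card W0 = q"
shows "simplicial_complex_on n Dl" "buchsbaum TYPE('k) Dl"
	"linear_resolution n (sr_ideal n Dl :: 'k mpoly set) q"
	"sr_dim TYPE('k) n Dl = enat d" "sr_codim TYPE('k) n Dl = enat c"
	"initial_degree n (sr_ideal n Dl :: 'k mpoly set) = q"
	"multiplicity_of n (sr_ideal n Dl :: 'k mpoly set) = real (card {F:Dl. card F = d})"
proof -
have sub: "Dl <: Pow {1..n}" using V(3) V' by simp
obtain G0 where G0: "G0 : Dl" "card G0 = d" using pure empty_mem by blast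
have skel: "q <= card F" if "F <: {1..n}" "F ~: Dl" for F
	using skeleton[of F] that V' q by fastforce
have W0': "W0 <: {1..n}" using W0(1) V' by simp
have single: "{i} : Dl" if "i : {1..n}" for i
	by (rule skeleton) (use that V' q in auto)
show "simplicial_complex_on n Dl"
	unfolding simplicial_complex_on_def using sub single down[unfolded down_closed_def] by blast
have "buchsbaum TYPE('k) Dl <-> (ALL F:Dl. EX G:Dl. F <: G & card G = d) &
	(ALL F:Dl. F ~= {} --> (\<forall>p < d - card F. hvan TYPE('k) V (link Dl F) p))"
	by (rule buchsbaum_iff[OF V(1,3) dim G0])
thus "buchsbaum TYPE('k) Dl" using pure buchs by simp
show "linear_resolution n (sr_ideal n Dl :: 'k mpoly set) q"
proof (rule linear_resolutionI[OF down W0' W0(2,3) _ skel])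
	show "1 <= q" using q by simp
	fix W p assume W: "W <: {1..n}" and p: "q <= p"
	have WV: "W <: V" using W V' by simp
	have dW: "down_closed {F:Dl. F <: W}"
		unfolding down_closed_def
	proof (intro ballI allI impI)
		fix F G assume "F : {F:Dl. F <: W}" "G <: F"
		thus "G : {F:Dl. F <: W}" using down_closedD[OF down, of F G] by blast
	qed
	have sW: "{F:Dl. F <: W} <: Pow V" using V(3) by blast
	show "cvan TYPE('k) {F:Dl. F <: W} p"
		by (rule hvan_imp_cvan[OF V(1) sW dW linear[OF WV p]])
qed
show dm: "sr_dim TYPE('k) n Dl = enat d"
	unfolding sr_dim_def sr_ring_def by (rule krull_dim_quotient[OF down sub dim G0])
show "sr_codim TYPE('k) n Dl = enat c"
	unfolding sr_codim_def dm krull_dim_poly_ring using n by simp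
show "initial_degree n (sr_ideal n Dl :: 'k mpoly set) = q"
	by (rule initial_degree_eqI[OF down W0' W0(2,3) skel])
show "multiplicity_of n (sr_ideal n Dl :: 'k mpoly set) = real (card {F:Dl. card F = d})"
	by (rule multiplicity_sr_ideal[OF down sub dim G0])
qed

end

text \<open>Under \<open>c + q - 2 = d\<close> both sides of \<open>homology_bound\<close> carry the
  same positive binomial coefficient. The rest of the proof recovers the combinatorial data from the
  ring.\<close>

lemma local_cohomology_dim_le_1:
assumes q: "2 <= q" "q <= d" and c: "1 <= c" "c + q - 2 = d"
	and sc: "simplicial_complex_on n Dl" and bb: "buchsbaum TYPE('k::field) Dl"
	and lin: "linear_resolution n (sr_ideal n Dl :: 'k mpoly set) q"
	and dm: "sr_dim TYPE('k) n Dl = enat d" and cd: "sr_codim TYPE('k) n Dl = enat c"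
	and h: "has_local_cohomology_dim n (sr_ideal n Dl :: 'k mpoly set) (q - 1) h"
shows "h <= 1"
proof -
let ?V = "{1..n}"
have n: "n = c + d" using cd c(1) unfolding sr_codim_def dm krull_dim_poly_ring by simp
have sub: "Dl <: Pow ?V" and single: "!!i. i : ?V ==> {i} : Dl"
	and down: "down_closed Dl" using sc by (simp_all add: simplicial_complex_on_def down_closed_def)
have fin: "finite Dl" by (rule finite_subset[OF sub]) simp
have ne: "Dl ~= {}" using single[of 1] n c by auto
\<comment> \<open>The combinatorial dimension is computed first and then identified with the given
  Krull dimension \<open>d\<close>.\<close>
define D where "D = Max (card ` Dl)"
have "D : card ` Dl" unfolding D_def by (rule Max_in) (use fin ne in auto)
then obtain G0 where G0: "G0 : Dl" "card G0 = D" by blast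
have dim: "card F <= D" if "F : Dl" for F unfolding D_def by (rule Max_ge) (use fin that in auto)
have "sr_dim TYPE('k) n Dl = enat D"
	unfolding sr_dim_def sr_ring_def by (rule krull_dim_quotient[OF down sub dim G0])
hence D: "D = d" using dm by simp
have finV: "finite ?V" by simp
have "buchsbaum TYPE('k) Dl <-> (ALL F:Dl. EX G:Dl. F <: G & card G = D) &
	(ALL F:Dl. F ~= {} --> (\<forall>p < D - card F. hvan TYPE('k) ?V (link Dl F) p))"
	by (rule buchsbaum_iff[OF finV sub dim G0])
hence links: "hvan TYPE('k) ?V (link Dl F) p" if "F : Dl" "F ~= {}" "p < d - card F" for F p
	using bb that D by blast
interpret linear_buchsbaum "TYPE('k)" ?V Dl d q
proof
	show "?V ~= {}" using n c by auto
	show "card F <= d" if "F : Dl" for F using dim[OF that] D by simp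
	fix W p assume W: "W <: ?V" and p: "q <= p"
	have dW: "down_closed {F:Dl. F <: W}"
		unfolding down_closed_def
	proof (intro ballI allI impI)
		fix F G assume "F : {F:Dl. F <: W}" "G <: F"
		thus "G : {F:Dl. F <: W}" using down_closedD[OF down, of F G] by blast
	qed
	have sW: "{F:Dl. F <: W} <: Pow ?V" using sub by blast
	show "hvan TYPE('k) ?V {F:Dl. F <: W} p"
		by (rule cvan_imp_hvan[OF finV sW dW linear_resolution_imp(2)[OF down lin W p]])
next
	fix G assume "G <: ?V" "card G <= q - 1"
	thus "G : Dl"
		using skeleton_below_initial_degree[OF down linear_resolution_imp(1)[OF down lin], of G] q by simp
qed (use q sub down links in auto)
obtain h' where h': "has_quot_dim fscale (cocycles Dl (q - 1) :: (nat set => 'k) set) (cobs Dl (q - 1)) h'"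
	using cohomology_vanishing_degree by blast
have "h = h'" using h local_cohomology_dim_iff[OF refl h'] by simp
moreover have "h' * (d choose (q - 1)) <= (c + q - 2) choose (q - 1)"
	by (rule homology_bound[OF h' _ c(1)]) (simp add: n)
hence "h' * (d choose (q - 1)) <= 1 * (d choose (q - 1))" unfolding c(2) by simp
hence "h' <= 1" using q by (simp add: binomial_eq_0_iff)
ultimately show ?thesis by simp
qed

section \<open>A complex with vanishing cohomology\<close>

text \<open>The join of a skeleton of a simplex with a simplex realizes \<open>h = 0\<close>.\<close>

locale skeleton_join =
fixes c d q :: nat
assumes c: "1 <= c" and q: "2 <= q" "q <= d"
begin

abbreviation "V \<equiv> {1..c + d}"
text \<open>Sizes: a facet takes \<open>q - 1\<close> vertices from \<open>U\<close> and all
  \<open>d - q + 1\<close> of \<open>T\<close>, hence \<open>d\<close> in total; \<open>U\<close>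
  exceeds \<open>q - 1\<close> by \<open>c\<close>, which is the codimension, and its
  \<open>q\<close>-subsets are the smallest nonfaces.\<close>

abbreviation "U \<equiv> {1..c + q - 1}"
abbreviation "T \<equiv> {c + q..c + d}"

definition cx :: "nat set set" where
"cx = {F. F <: V & card (F Int U) <= q - 1}"

lemma UT: "U Un T = V" "U Int T = {}" using q by auto

lemma down_cx: "down_closed cx"
unfolding down_closed_def cx_def
proof (intro ballI allI impI CollectI)
fix F G assume F: "F : {F. F <: V & card (F Int U) <= q - 1}" "G <: F"
have "card (G Int U) <= card (F Int U)" by (rule card_mono) (use F in auto)
thus "G <: V & card (G Int U) <= q - 1" using F by auto
qed

lemma sub_cx: "cx <: Pow V" by (auto simp: cx_def)

lemma card_split: "F <: V ==> card F = card (F Int U) + card (F Int T)"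
proof -
assume F: "F <: V"
hence "F = (F Int U) Un (F Int T)" using UT(1) by blast
moreover have "card ((F Int U) Un (F Int T)) = card (F Int U) + card (F Int T)"
	by (rule card_Un_disjoint) (use UT(2) in auto)
ultimately show ?thesis by simp
qed

lemma cardT: "card T = d - q + 1" using q by simp

lemma dim_cx: "F : cx ==> card F <= d"
proof -
assume F: "F : cx"
have "card (F Int T) <= card T" by (rule card_mono) auto
moreover have "F <: V" "card (F Int U) <= q - 1" using F by (auto simp: cx_def)
ultimately show ?thesis using card_split[of F] q unfolding cardT by linarith
qed

lemma insert_T: "F : cx ==> u : T ==> insert u F : cx"
proof -
assume F: "F : cx" and u: "u : T"
have "u ~: U" "u : V" using u UT by blast+
hence "insert u F Int U = F Int U" by blast
thus ?thesis using F \<open>u \<in> V\<close> unfolding cx_def by simp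
qed

lemma pure_cx:
assumes "F : cx" shows "EX G:cx. F <: G & card G = d"
proof -
have F: "F <: V" "card (F Int U) <= q - 1" using assms by (auto simp: cx_def)
have "card (U - F) = card U - card (F Int U)" using card_Diff_subset_Int[of U F] by (simp add: Int_commute)
hence "q - 1 - card (F Int U) <= card (U - F)" using c by simp
then obtain Z where Z: "Z <: U - F" "card Z = q - 1 - card (F Int U)" by (meson obtain_subset_with_card_n)
let ?G = "F Un T Un Z"
have GU: "?G Int U = (F Int U) Un Z" and GT: "?G Int T = T" using Z(1) UT by blast+
have "finite Z" using Z(1) finite_subset by blast
hence cu: "card (?G Int U) = q - 1"
	unfolding GU using Z F by (subst card_Un_disjoint) auto
have GV: "?G <: V" using F(1) Z(1) UT by blast
have cG: "card ?G = d" unfolding card_split[OF GV] cu GT cardT using q by simp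
have mG: "?G : cx" using GV cu by (simp add: cx_def)
show ?thesis by (intro bexI[OF _ mG] conjI cG) blast
qed

text \<open>If some vertex of \<open>T\<close> is left, the link is a cone over it. Otherwise the
  link is a skeleton of the simplex on the rest of \<open>U\<close>, which is a cone below its top
  dimension, and the bound on \<open>p\<close> stays below it.\<close>

lemma hvan_link_cx:
assumes F: "F : cx" "F ~= {}" and p: "p < d - card F"
shows "hvan TYPE('k::field) V (link cx F) p"
proof -
have FV: "F <: V" "card (F Int U) <= q - 1" using F by (auto simp: cx_def)
have lV: "link cx F <: Pow V" using sub_cx by (auto simp: link_def)
note con = hvanI_contracting[OF finite_atLeastAtMost lV _ down_closed_link[OF down_cx]]
show ?thesis
proof (cases "T <: F")
	case False
	then obtain u where u: "u : T" "u ~: F" by blast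
	show ?thesis
	proof (rule con[of u])
		show "u : V" using u(1) UT by blast
		fix G assume "G : link cx F"
		hence G: "G Int F = {}" "G Un F : cx" by (auto simp: link_def)
		have "insert u G Un F : cx" using insert_T[OF G(2) u(1)] by simp
		thus "insert u G : link cx F" using G(1) u(2) by (simp add: link_def)
	qed
next
	case True
	hence "F Int T = T" by blast
	hence cF: "card F = card (F Int U) + (d - q + 1)" using card_split[OF FV(1)] cardT by simp
	have "card U = c + q - 1" by simp
	hence "card (F Int U) < card U" using FV(2) c q by linarith
	hence "F Int U ~= U" by (metis less_irrefl)
	then obtain u where u: "u : U" "u ~: F" by blast
	show ?thesis
	proof (rule con[of u])
		show "u : V" using u(1) UT by blast
		fix G assume G: "G : link cx F" and cG: "card G = p"
		have G': "G Int F = {}" "G Un F <: V" using G by (auto simp: link_def cx_def)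
		have "finite G" using G'(2) finite_subset by blast
		have "(insert u G Un F) Int U <: insert u G Un (F Int U)" by blast
		hence "card ((insert u G Un F) Int U) <= card (insert u G Un (F Int U))"
			by (rule card_mono[rotated]) (use \<open>finite G\<close> in simp)
		also have "... <= card (insert u G) + card (F Int U)" by (rule card_Un_le)
		also have "... <= Suc p + card (F Int U)" using card_insert_le_m1[of "Suc p" G u] cG by simp
		also have "... <= q - 1" using p q unfolding cF by linarith
		finally have "insert u G Un F : cx" using G'(2) u(1) UT by (auto simp: cx_def)
		thus "insert u G : link cx F" using G'(1) u(2) by (simp add: link_def)
	qed
qed
qed

lemma hvan_cone_cx:
assumes "W <: V" "u : W" "u : T"
shows "hvan TYPE('k::field) V {F:cx. F <: W} p"
proof (rule hvanI_contracting)
show "finite V" by simp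
show "{F:cx. F <: W} <: Pow V" using sub_cx by blast
show "u : V" using assms by blast
show "down_closed {F:cx. F <: W}"
	unfolding down_closed_def
proof (intro ballI allI impI)
	fix F G assume "F : {F:cx. F <: W}" "G <: F"
	thus "G : {F:cx. F <: W}" using down_closedD[OF down_cx, of F G] by blast
qed
show "insert u F : {F:cx. F <: W}" if "F : {F:cx. F <: W}" for F
	using that insert_T[of F u] assms by blast
qed

lemma linear_buchsbaum_cx: "linear_buchsbaum TYPE('k::field) V cx d q"
proof
show "V ~= {}" using c by auto
show "hvan TYPE('k) V (link cx F) p" if "F : cx" "F ~= {}" "p < d - card F" for F p
	by (rule hvan_link_cx[OF that])
show "hvan TYPE('k) V {F:cx. F <: W} p" if W: "W <: V" and p: "q <= p" for W p
proof (cases "W Int T = {}")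
	case True
	have "card F ~= p" if F: "F : {F:cx. F <: W}" for F
	proof -
		have "F Int T = {}" using F True by blast
		hence "card F = card (F Int U)" using card_split[of F] F by (auto simp: cx_def)
		thus ?thesis using F p q by (auto simp: cx_def)
	qed
	thus ?thesis by (rule hvan_no_faces)
next
	case False
	then obtain u where "u : W" "u : T" by blast
	thus ?thesis by (rule hvan_cone_cx[OF W])
qed
show "G : cx" if G: "G <: V" "card G <= q - 1" for G
proof -
	have "card (G Int U) <= card G" by (rule card_mono) (use G(1) finite_subset in auto)
	thus ?thesis using G by (simp add: cx_def)
qed
qed (use q sub_cx down_cx dim_cx in auto)

lemma nonface_cx: "{1..q} <: V" "{1..q} ~: cx" "card {1..q} = q"
proof -
show "{1..q} <: V" using q by auto
have "{1..q} Int U = {1..q}" using c by auto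
thus "{1..q} ~: cx" using q by (simp add: cx_def)
qed simp

lemma acyclic_cx: "has_quot_dim fscale (cocycles cx p :: (nat set => 'k::field) set) (cobs cx p) 0"
proof -
interpret linear_buchsbaum "TYPE('k)" V cx d q by (rule linear_buchsbaum_cx)
have finD: "finite cx" by (rule finite_subset[OF sub_cx]) simp
have finF: "finite F" if "F : cx" for F using that sub_cx by (meson PowD finite_atLeastAtMost finite_subset subsetD)
interpret fc: finite_complex cx by unfold_locales (use finD down_cx finF in auto)
interpret vector_space "fscale :: 'k => (nat set => 'k) => _" by (rule fc.fs)
have "c + d : T" "c + d : V" using q c by auto
hence "hvan TYPE('k) V {F:cx. F <: V} p" by (intro hvan_cone_cx[of V "c + d"]) simp_all
moreover have "{F:cx. F <: V} = cx" using sub_cx by blast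
ultimately have hv: "hvan TYPE('k) V cx p" by simp
have "cvan TYPE('k) cx p" by (rule hvan_imp_cvan[OF finite_atLeastAtMost sub_cx down_cx hv])
moreover obtain h where h: "has_quot_dim fscale (cocycles cx p :: (nat set => 'k) set) (cobs cx p) h"
	using fc.cohomology_dim_exists by blast
ultimately have "h = 0" using quot_dim_0_iff[OF h fc.sub_cocycles fc.sub_cobs] unfolding cvan_iff by blast
thus ?thesis using h by simp
qed

end

section \<open>The extremal case\<close>

lemma prod_strict_less:
fixes f g :: "nat => real"
assumes "!!j. j : {0..k} ==> 0 <= f j & f j < g j"
shows "(\<Prod>j=0..k. f j) < (\<Prod>j=0..k. g j)"
using assms
proof (induction k)
case (Suc k)
have "(\<Prod>j=0..k. f j) < (\<Prod>j=0..k. g j)" by (rule Suc.IH) (use Suc.prems in auto)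
moreover have "0 <= (\<Prod>j=0..k. f j)" by (rule prod_nonneg) (use Suc.prems in auto)
moreover have "0 <= f (Suc k)" "f (Suc k) < g (Suc k)" using Suc.prems[of "Suc k"] by auto
ultimately show ?case by (simp add: mult_strict_mono')
qed simp

text \<open>Numerator and denominator are products of \<open>q - 1\<close> consecutive factors,
  descending from \<open>c + q - 2\<close> and from \<open>d\<close>. If the starting points differ,
  one product is strictly larger, factor by factor.\<close>

lemma h_bound_eq_1_imp:
assumes q: "2 <= q" "q <= d" and h: "h_bound c d q = 1"
shows "c + q - 2 = d"
proof -
define k where "k = q - 2"
have kd: "k < d" using q by (simp add: k_def)
let ?N = "\<Prod>j=0..k. real c + real j" and ?D = "\<Prod>j=0..k. real d - real j"
have "0 < ?D" by (rule prod_pos) (use kd in auto)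
hence e: "?N = ?D" using h by (simp add: h_bound_def k_def)
have N: "?N = (\<Prod>j=0..k. real (c + k) - real j)"
	by (subst prod.atLeastAtMost_rev) (rule prod.cong[OF refl], simp add: of_nat_diff)
consider "c + k < d" | "c + k = d" | "d < c + k" by linarith
thus ?thesis
proof cases
	case 1
	have "?N < ?D" unfolding N
	proof (rule prod_strict_less)
		fix j assume "j : {0..k}"
		thus "0 <= real (c + k) - real j & real (c + k) - real j < real d - real j" using 1 by auto
	qed
	thus ?thesis using e by simp
next
	case 2
	thus ?thesis using q by (simp add: k_def)
next
	case 3
	have "?D < ?N" unfolding N
	proof (rule prod_strict_less)
		fix j assume "j : {0..k}"
		thus "0 <= real d - real j & real d - real j < real (c + k) - real j" using 3 kd by auto
	qed
	thus ?thesis using e by simp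
qed
qed

context cyclic_dual
begin

lemma dual_ring:
assumes V': "V = {1..n}"
shows "simplicial_complex_on n dual" "buchsbaum TYPE('k::field) dual"
	"linear_resolution n (sr_ideal n dual :: 'k mpoly set) q"
	"sr_dim TYPE('k) n dual = enat d" "sr_codim TYPE('k) n dual = enat (Suc m)"
	"minimal_multiplicity TYPE('k) n dual q"
	"has_local_cohomology_dim n (sr_ideal n dual :: 'k mpoly set) (q - 1) 1"
proof -
interpret lb: linear_buchsbaum "TYPE('k)" V dual d q by (rule linear_buchsbaum_dual)
obtain W0 where W0: "W0 <: V" "W0 ~: dual" "card W0 = q" using dual_nonface by blast
have nd: "n = Suc m + d" using n by simp
have pure: "ALL F:dual. EX G:dual. F <: G & card G = d" using dual_extends by blast
note r = lb.stanley_reisner_ring[OF V' nd pure W0]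
show "simplicial_complex_on n dual" "buchsbaum TYPE('k::field) dual"
	"linear_resolution n (sr_ideal n dual :: 'k mpoly set) q"
	"sr_dim TYPE('k) n dual = enat d" "sr_codim TYPE('k) n dual = enat (Suc m)"
	by (rule r)+
have d0: "d ~= 0" "Suc m + q - 2 = d" using n m by auto
have s: "d choose Suc m = d choose (q - 2)"
	using binomial_symmetric[of "Suc m" d] n m by (simp add: mult_2)
\<comment> \<open>Absorption expresses the second summand of the facet count as
  \<open>Suc m / d\<close> times the first, so the total is \<open>(c + d) / d\<close> times a
  single binomial coefficient with \<open>c = Suc m\<close>.\<close>
have "Suc m * (d choose Suc m) = d * ((d - 1) choose m)" by (rule binomial_absorption)
hence "real (Suc m) * real (d choose Suc m) = real d * real ((d - 1) choose m)"
	by (simp only: of_nat_mult[symmetric])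
hence a: "real ((d - 1) choose m) = real (Suc m) / real d * real (d choose Suc m)"
	using d0(1) by (simp add: field_simps)
have "real (card {F:dual. card F = d}) = (real (Suc m) + real d) / real d * real (d choose (q - 2))"
	unfolding card_facets_dual of_nat_add a s[symmetric] using d0(1) by (simp add: field_simps)
hence "multiplicity_of n (sr_ideal n dual :: 'k mpoly set) =
		(real (Suc m) + real d) / real d * real ((Suc m + q - 2) choose (q - 2))"
	unfolding r(7) d0(2) .
thus "minimal_multiplicity TYPE('k) n dual q"
	unfolding minimal_multiplicity_def using r(1,2,4,5,6) by blast
obtain h where h: "has_quot_dim fscale (cocycles dual (q - 1) :: (nat set => 'k) set) (cobs dual (q - 1)) h"
	using lb.cohomology_vanishing_degree by blast
show "has_local_cohomology_dim n (sr_ideal n dual :: 'k mpoly set) (q - 1) 1"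
	using lb.local_cohomology_dim_iff[OF V' h] dual_homology_dim[OF h] by simp
qed

end

lemma cyclic_polytope_dual:
assumes q: "2 <= q" "q <= d" and n_eq: "n = 2 * d - q + 2" and f: "f = 2 * (d - q + 1)" and t: "inj_on t {1..n}"
	and Dl: "Dl = alexander_dual n (cyclic_boundary_complex n f t)"
shows "simplicial_complex_on n Dl" "buchsbaum TYPE('k::field) Dl"
	"linear_resolution n (sr_ideal n Dl :: 'k mpoly set) q"
	"sr_dim TYPE('k) n Dl = enat d" "sr_codim TYPE('k) n Dl = enat (d - q + 2)"
	"minimal_multiplicity TYPE('k) n Dl q"
	"has_local_cohomology_dim n (sr_ideal n Dl :: 'k mpoly set) (q - 1) 1"
proof -
define m where "m = d - q + 1"
have m: "1 <= m" "2 * m + 2 <= n" using q n_eq by (auto simp: m_def)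
obtain pos where pos: "bij_betw pos {1..n} {..<n}"
	and faces: "!!W. W : cyclic_boundary_complex n (2 * m) t <->
		W <: {1..n} & ~ (\<exists>R\<subseteq>W. card R = Suc m & cyc_stable n (pos ` R))"
	using cyclic_boundary_complex_iff[OF t m] by (elim exE conjE) blast
interpret cyclic_dual n m "{1..n}" pos by unfold_locales (use pos m in simp_all)
have Dl_dual: "Dl = dual"
	unfolding Dl f m_def[symmetric] alexander_dual_def dual_def faces stable_def by blast
have e: "n - Suc m = d" "n - 2 * m = q" "Suc m = d - q + 2" using q n_eq by (auto simp: m_def)
note r = dual_ring[OF refl, unfolded e(1,2), unfolded e(3)]
show "simplicial_complex_on n Dl" "buchsbaum TYPE('k::field) Dl"
	"linear_resolution n (sr_ideal n Dl :: 'k mpoly set) q"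
	"sr_dim TYPE('k) n Dl = enat d" "sr_codim TYPE('k) n Dl = enat (d - q + 2)"
	"minimal_multiplicity TYPE('k) n Dl q"
	"has_local_cohomology_dim n (sr_ideal n Dl :: 'k mpoly set) (q - 1) 1"
	unfolding Dl_dual by (rule r)+
qed

theorem mainTheorem9:
  shows "(\<forall>(q::nat) (d::nat) (n::nat) (f::nat) (t :: nat \<Rightarrow> real) \<Delta>.
            2 \<le> q \<and> q \<le> d \<and> n = 2 * d - q + 2 \<and> f = 2 * (d - q + 1) \<and>
            inj_on t {1..n} \<and> \<Delta> = alexander_dual n (cyclic_boundary_complex n f t) \<longrightarrow>
              simplicial_complex_on n \<Delta> \<and>
              sr_dim TYPE('k::field) n \<Delta> = enat d \<and>
              buchsbaum TYPE('k) \<Delta> \<and>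
              minimal_multiplicity TYPE('k) n \<Delta> q)
       \<and>
         (\<forall>(c::nat) (d::nat) (q::nat) (h::nat).
            1 \<le> c \<and> 2 \<le> q \<and> q \<le> d \<and> h_bound c d q = 1 \<longrightarrow>
              ((\<exists>n \<Delta>'. simplicial_complex_on n \<Delta>' \<and>
                        buchsbaum TYPE('k) \<Delta>' \<and>
                        linear_resolution n (sr_ideal n \<Delta>' :: 'k mpoly set) q \<and>
                        sr_dim TYPE('k) n \<Delta>' = enat d \<and>
                        sr_codim TYPE('k) n \<Delta>' = enat c \<and>
                        has_local_cohomology_dim n (sr_ideal n \<Delta>' :: 'k mpoly set) (q - 1) h)
               \<longleftrightarrow> 0 \<le> real h \<and> real h \<le> h_bound c d q))"
proof (intro conjI allI impI)
fix q d n f :: nat and t :: "nat => real" and Dl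
assume a: "2 <= q & q <= d & n = 2 * d - q + 2 & f = 2 * (d - q + 1) &
	inj_on t {1..n} & Dl = alexander_dual n (cyclic_boundary_complex n f t)"
have r: "2 <= q" "q <= d" "n = 2 * d - q + 2" "f = 2 * (d - q + 1)" "inj_on t {1..n}"
	"Dl = alexander_dual n (cyclic_boundary_complex n f t)" using a by blast+
show "simplicial_complex_on n Dl" "sr_dim TYPE('k) n Dl = enat d" "buchsbaum TYPE('k) Dl"
	"minimal_multiplicity TYPE('k) n Dl q"
	by (rule cyclic_polytope_dual[OF r])+
next
fix c d q h :: nat
assume a: "1 <= c & 2 <= q & q <= d & h_bound c d q = 1"
hence c: "1 <= c" and q: "2 <= q" "q <= d" and hb: "h_bound c d q = 1" by blast+
\<comment> \<open>This identifies \<open>c\<close> with the codimension \<open>d - q + 2\<close> of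
  the cyclic dual and makes the homology bound equal to one.\<close>
have cd: "c + q - 2 = d" by (rule h_bound_eq_1_imp[OF q hb])
let ?P = "%n Dl'. simplicial_complex_on n Dl' & buchsbaum TYPE('k) Dl' &
	linear_resolution n (sr_ideal n Dl' :: 'k mpoly set) q &
	sr_dim TYPE('k) n Dl' = enat d & sr_codim TYPE('k) n Dl' = enat c &
	has_local_cohomology_dim n (sr_ideal n Dl' :: 'k mpoly set) (q - 1) h"
show "(EX n Dl'. ?P n Dl') <-> 0 <= real h & real h <= h_bound c d q"
proof
	assume "EX n Dl'. ?P n Dl'"
	then obtain n Dl' where "?P n Dl'" by (elim exE)
	hence "h <= 1" by (elim conjE) (rule local_cohomology_dim_le_1[OF q c cd])
	thus "0 <= real h & real h <= h_bound c d q" unfolding hb by simp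
next
	assume "0 <= real h & real h <= h_bound c d q"
	\<comment> \<open>Only two values are left to be realized: the join of a skeleton with a simplex is
	  acyclic, and the cyclic dual has one-dimensional cohomology.\<close>
	hence "h = 0 \<or> h = 1" unfolding hb by auto
	thus "EX n Dl'. ?P n Dl'"
	proof
		assume h: "h = 0"
		interpret sj: skeleton_join c d q by unfold_locales (use c q in simp_all)
		interpret lb: linear_buchsbaum "TYPE('k)" "{1..c + d}" sj.cx d q by (rule sj.linear_buchsbaum_cx)
		have pure: "ALL F:sj.cx. EX G:sj.cx. F <: G & card G = d" using sj.pure_cx by blast
		note r = lb.stanley_reisner_ring[OF refl refl pure sj.nonface_cx]
		have "has_local_cohomology_dim (c + d) (sr_ideal (c + d) sj.cx :: 'k mpoly set) (q - 1) h"
			using lb.local_cohomology_dim_iff[OF refl sj.acyclic_cx] h by simp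
		hence "?P (c + d) sj.cx" using r(1-5) by blast
		thus ?thesis by (rule exI[of "%Dl'. ?P (c + d) Dl'", THEN exI[of "%n. EX Dl'. ?P n Dl'"]])
	next
		assume h: "h = 1"
		define n where "n = 2 * d - q + 2"
		\<comment> \<open>Any injective choice of parameters on the moment curve would do; the labels
		  themselves are taken.\<close>
		define Dl where "Dl = alexander_dual n (cyclic_boundary_complex n (2 * (d - q + 1)) real)"
		have t: "inj_on real {1..n}" by (simp add: inj_on_def)
		note r = cyclic_polytope_dual[OF q n_def refl t Dl_def]
		have "d - q + 2 = c" using cd q by linarith
		hence "?P n Dl" using r h by simp
		thus ?thesis by (rule exI[of "%Dl'. ?P n Dl'", THEN exI[of "%n. EX Dl'. ?P n Dl'"]])
	qed
qed
qed

end
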